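(* Let $\mathcal C$ be a triangulated category endowed with a weight structure $w$ whose heart $\underline{Hw}$ is Karoubian; let $M\in\mathrm{Obj}\,\mathcal C$ and $m\in\mathbb Z$. 1. For a complex $C\in\mathrm{Obj}\,K(\underline{Hw})$ there exists a choice of $w_{\le m}M$ such that $t(w_{\le m}M)\cong C$ (in $K(\underline{Hw})$) if and only if $C$ is a choice of $w^{st}_{\le m}(t(M))$ (this condition does not depend on the choice of $t(M)$). 2. Assume that $N'=w_{\le m+1}M$ (a choice, with its morphism $N'\to M$). Then for any $m$-$w^{st}$-decomposition triangle $$C\xrightarrow{e}t(N')\xrightarrow{f}D\xrightarrow{g}C[1]$$ in $K(\underline{Hw})$, where $t(N')$ comes from a weight Postnikov tower $Po_{N'}$ for $N'$, there exist morphisms of weight Postnikov towers $Po_{N'}\to Po_{\tilde D}\to Po_{N[1]}$ satisfying the following conditions: the corresponding weight complex morphisms $(f_{K(\underline{Hw})},g_{K(\underline{Hw})})$ form a couple $K(\underline{Hw})$-isomorphic to $(f,g)$ (with the first component of this isomorphism being just $\mathrm{id}_{t(N')}$), and the underlying $\mathcal C$-morphisms $N'\to\tilde D\to N[1]$ extend to a $\mathcal C$-distinguished triangle $N\to N'\to\tilde D\to N[1]$ such that the composed morphism $N\to N'\to M$ gives an $m$-weight decomposition of $M$. 3. Let $\mathcal B$ be a full additive subcategory of $\underline{Hw}$. Then the full subcategory $\mathcal C^{\mathcal B}$ of $\mathcal C$ consisting of those $N\in\mathrm{Obj}\,\mathcal C$ such that $t(N)$ is $K(\underline{Hw})$-isomorphic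 to an object of $K(\mathcal B)$ is triangulated. Moreover, $w$ restricts to $\mathcal C^{\mathcal B}$, and the heart of this restriction equals $\mathrm{Kar}_{\mathcal C}\mathcal B\cong\mathrm{Kar}(\mathcal B)$.
   Context: A weight structure $w$ on a triangulated category $\mathcal C$ (homological convention) is a pair of classes $\mathcal C_{w\le 0},\mathcal C_{w\ge 0}\subset \mathrm{Obj}\,\mathcal C$ such that: (i) both are closed under retracts in $\mathcal C$; (ii) $\mathcal C_{w\le 0}\subset\mathcal C_{w\le 0}[1]$ and $\mathcal C_{w\ge 0}[1]\subset\mathcal C_{w\ge 0}$; (iii) $\mathcal C(X,Y)=0$ for all $X\in\mathcal C_{w\le 0}$, $Y\in\mathcal C_{w\ge 0}[1]$; (iv) every $M\in\mathrm{Obj}\,\mathcal C$ fits in a distinguished triangle $LM\to M\to RM\to LM[1]$ with $LM\in\mathcal C_{w\le 0}$, $RM\in\mathcal C_{w\ge 0}[1]$. Notation: $\mathcal C_{w\ge i}=\mathcal C_{w\ge 0}[i]$, $\mathcal C_{w\le i}=\mathcal C_{w\le 0}[i]$; the heart $\underline{Hw}$ is the full subcategory with object class $\mathcal C_{w=0}=\mathcal C_{w\ge 0}\cap\mathcal C_{w\le 0}$. $w$ restricts to a full triangulated subcategory $\mathcal D$ if $(\mathcal C_{w\le 0}\cap\mathrm{Obj}\,\mathcal D,\mathcal C_{w\ge 0}\cap\mathrm{Obj}\,\mathcal D)$ is a weight structure on $\mathcal D$. An $m$-weight decomposition of $M$ is a distinguished triangle $w_{\le m}M\to M\to w_{\ge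 m+1}M\to w_{\le m}M[1]$ with $w_{\le m}M\in\mathcal C_{w\le m}$, $w_{\ge m+1}M\in\mathcal C_{w\ge m+1}$; $w_{\le m}M$ denotes any possible choice. Weight Postnikov towers. For $M$ choose $i$-weight decompositions with maps $h_i:w_{\le i}M\to M$ for all $i\in\mathbb Z$; there are unique $j_i:w_{\le i}M\to w_{\le i+1}M$ with $h_{i+1}\circ j_i=h_i$. Complete them to distinguished triangles $w_{\le i-1}M\xrightarrow{j_{i-1}}w_{\le i}M\xrightarrow{c_i}M_i\xrightarrow{e_{i-1}}w_{\le i-1}M[1]$; this datum is a weight Postnikov tower $Po_M$ for $M$. Put $M^p=M_{-p}[p]\in\mathcal C_{w=0}$, $d^i=c_{-i-1}[i+1]\circ e_{-i-1}[i]:M^i\to M^{i+1}$; the complex $t(M)=(M^i,d^i)$ over $\underline{Hw}$ is the corresponding choice of a weight complex of $M$; any two choices are homotopy equivalent. A morphism of towers over $g:M\to M'$ consists of $g$ and $g_{\le i}:w_{\le i}M\to w_{\le i}M'$, $g_i:M_i\to M'_i$ compatible with all $h_i,j_i,c_i,e_i$; it induces the morphism of weight complexes $(g_{-i}[i])_i$, regarded in $K(\underline{Hw})$. For an additive $\mathcal B$, $w^{st}$ is the weight structure on the homotopy category $K(\mathcal B)$ of cohomological complexes with $K(\mathcal B)_{w^{st}\le 0}$ (resp. $K(\mathcal B)_{w^{st}\ge 0}$) the class of complexes homotopy equivalent to ones concentrated in degrees $\ge 0$ (resp. $\le 0$); $w^{st}_{\le m}$ and $m$-$w^{st}$-decompositions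 are with respect to it. $\mathrm{Kar}(\mathcal B)$ is the Karoubi envelope (idempotent completion) of $\mathcal B$; $\mathrm{Kar}_{\mathcal C}\mathcal B$ is the full subcategory of $\mathcal C$ of all retracts of finite direct sums of objects of $\mathcal B$. A category is Karoubian if all idempotents split. *)

theory Defs
  imports "HOL-Algebra.FiniteProduct"
begin

section \<open>Categories\<close>

record ('o, 'a) cat =
  Obj :: "'o set"
  Hom :: "'o \<Rightarrow> 'o \<Rightarrow> 'a set"
  idm :: "'o \<Rightarrow> 'a"
  cmp :: "'a \<Rightarrow> 'a \<Rightarrow> 'a"  (infixl "\<cdot>\<index>" 70)

text \<open>Composition takes no object arguments, so an arrow has to determine its source and target;
  hence the disjointness axiom.\<close>

locale category =
  fixes C :: "('o, 'a, 'z) cat_scheme" (structure)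
  assumes Hom_disjoint:
      "\<lbrakk>X \<in> Obj C; Y \<in> Obj C; X' \<in> Obj C; Y' \<in> Obj C; f \<in> Hom C X Y; f \<in> Hom C X' Y'\<rbrakk>
        \<Longrightarrow> X = X' \<and> Y = Y'"
    and idm_closed: "X \<in> Obj C \<Longrightarrow> idm C X \<in> Hom C X X"
    and cmp_closed:
      "\<lbrakk>X \<in> Obj C; Y \<in> Obj C; Z \<in> Obj C; f \<in> Hom C X Y; g \<in> Hom C Y Z\<rbrakk> \<Longrightarrow> g \<cdot> f \<in> Hom C X Z"
    and cmp_idm: "\<lbrakk>X \<in> Obj C; Y \<in> Obj C; f \<in> Hom C X Y\<rbrakk> \<Longrightarrow> f \<cdot> idm C X = f"
    and idm_cmp: "\<lbrakk>X \<in> Obj C; Y \<in> Obj C; f \<in> Hom C X Y\<rbrakk> \<Longrightarrow> idm C Y \<cdot> f = f"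
    and cmp_assoc:
      "\<lbrakk>X \<in> Obj C; Y \<in> Obj C; Z \<in> Obj C; V \<in> Obj C;
        f \<in> Hom C X Y; g \<in> Hom C Y Z; h \<in> Hom C Z V\<rbrakk> \<Longrightarrow> (h \<cdot> g) \<cdot> f = h \<cdot> (g \<cdot> f)"

definition iso_arrow :: "('o, 'a, 'z) cat_scheme \<Rightarrow> 'o \<Rightarrow> 'o \<Rightarrow> 'a \<Rightarrow> bool" where
  "iso_arrow C X Y f \<longleftrightarrow> X \<in> Obj C \<and> Y \<in> Obj C \<and> f \<in> Hom C X Y \<and>
     (\<exists>g\<in>Hom C Y X. g \<cdot>\<^bsub>C\<^esub> f = idm C X \<and> f \<cdot>\<^bsub>C\<^esub> g = idm C Y)"

definition isomorphic :: "('o, 'a, 'z) cat_scheme \<Rightarrow> 'o \<Rightarrow> 'o \<Rightarrow> bool" where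
  "isomorphic C X Y \<longleftrightarrow> (\<exists>f. iso_arrow C X Y f)"

definition retract_of :: "('o, 'a, 'z) cat_scheme \<Rightarrow> 'o \<Rightarrow> 'o \<Rightarrow> bool" where
  "retract_of C X Y \<longleftrightarrow> X \<in> Obj C \<and> Y \<in> Obj C \<and>
     (\<exists>s\<in>Hom C X Y. \<exists>r\<in>Hom C Y X. r \<cdot>\<^bsub>C\<^esub> s = idm C X)"

definition zero_object :: "('o, 'a, 'z) cat_scheme \<Rightarrow> 'o \<Rightarrow> bool" where
  "zero_object C Z \<longleftrightarrow> Z \<in> Obj C \<and>
     (\<forall>X\<in>Obj C. (\<exists>!f. f \<in> Hom C Z X) \<and> (\<exists>!f. f \<in> Hom C X Z))"

definition karoubian :: "('o, 'a, 'z) cat_scheme \<Rightarrow> bool" where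
  "karoubian C \<longleftrightarrow> (\<forall>X\<in>Obj C. \<forall>p\<in>Hom C X X. p \<cdot>\<^bsub>C\<^esub> p = p \<longrightarrow>
     (\<exists>Y\<in>Obj C. \<exists>r\<in>Hom C X Y. \<exists>s\<in>Hom C Y X. r \<cdot>\<^bsub>C\<^esub> s = idm C Y \<and> s \<cdot>\<^bsub>C\<^esub> r = p))"

definition full_sub :: "('o, 'a, 'z) cat_scheme \<Rightarrow> 'o set \<Rightarrow> ('o, 'a, 'z) cat_scheme" where
  "full_sub C D = C\<lparr>Obj := D\<rparr>"

definition is_functor ::
  "('o, 'a, 'z) cat_scheme \<Rightarrow> ('p, 'b, 'y) cat_scheme \<Rightarrow> ('o \<Rightarrow> 'p) \<Rightarrow> ('a \<Rightarrow> 'b) \<Rightarrow> bool" where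
  "is_functor A B FO FA \<longleftrightarrow>
     (\<forall>X\<in>Obj A. FO X \<in> Obj B \<and> FA (idm A X) = idm B (FO X)) \<and>
     (\<forall>X\<in>Obj A. \<forall>Y\<in>Obj A. \<forall>f\<in>Hom A X Y. FA f \<in> Hom B (FO X) (FO Y)) \<and>
     (\<forall>X\<in>Obj A. \<forall>Y\<in>Obj A. \<forall>Z\<in>Obj A. \<forall>f\<in>Hom A X Y. \<forall>g\<in>Hom A Y Z.
        FA (g \<cdot>\<^bsub>A\<^esub> f) = FA g \<cdot>\<^bsub>B\<^esub> FA f)"

definition natural_iso ::
  "('o, 'a, 'z) cat_scheme \<Rightarrow> ('p, 'b, 'y) cat_scheme \<Rightarrow> ('o \<Rightarrow> 'p) \<Rightarrow> ('a \<Rightarrow> 'b)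
    \<Rightarrow> ('o \<Rightarrow> 'p) \<Rightarrow> ('a \<Rightarrow> 'b) \<Rightarrow> ('o \<Rightarrow> 'b) \<Rightarrow> bool" where
  "natural_iso A B FO FA GO GA \<eta> \<longleftrightarrow>
     (\<forall>X\<in>Obj A. iso_arrow B (FO X) (GO X) (\<eta> X)) \<and>
     (\<forall>X\<in>Obj A. \<forall>Y\<in>Obj A. \<forall>f\<in>Hom A X Y. \<eta> Y \<cdot>\<^bsub>B\<^esub> FA f = GA f \<cdot>\<^bsub>B\<^esub> \<eta> X)"

definition equivalent_cats ::
  "('o, 'a, 'z) cat_scheme \<Rightarrow> ('p, 'b, 'y) cat_scheme \<Rightarrow> bool" where
  "equivalent_cats A B \<longleftrightarrow>
     (\<exists>FO FA GO GA \<eta> \<epsilon>. is_functor A B FO FA \<and> is_functor B A GO GA \<and>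
        natural_iso A A (\<lambda>X. X) (\<lambda>f. f) (GO \<circ> FO) (GA \<circ> FA) \<eta> \<and>
        natural_iso B B (FO \<circ> GO) (FA \<circ> GA) (\<lambda>X. X) (\<lambda>f. f) \<epsilon>)"

definition Kar :: "('o, 'a, 'z) cat_scheme
    \<Rightarrow> ('o \<times> 'a, ('o \<times> 'a) \<times> ('o \<times> 'a) \<times> 'a) cat" where
  "Kar B =
    \<lparr>Obj = {(X, p). X \<in> Obj B \<and> p \<in> Hom B X X \<and> p \<cdot>\<^bsub>B\<^esub> p = p},
     Hom = (\<lambda>(X, p) (Y, q). {((X, p), (Y, q), f) | f. f \<in> Hom B X Y \<and> q \<cdot>\<^bsub>B\<^esub> (f \<cdot>\<^bsub>B\<^esub> p) = f}),
     idm = (\<lambda>(X, p). ((X, p), (X, p), p)),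
     cmp = (\<lambda>(_, R, g) (P, _, f). (P, R, g \<cdot>\<^bsub>B\<^esub> f))\<rparr>"


section \<open>Additive categories\<close>

record ('o, 'a) addcat = "('o, 'a) cat" +
  madd :: "'a \<Rightarrow> 'a \<Rightarrow> 'a"
  mzero :: "'o \<Rightarrow> 'o \<Rightarrow> 'a"

definition hom_group :: "('o, 'a, 'z) addcat_scheme \<Rightarrow> 'o \<Rightarrow> 'o \<Rightarrow> 'a monoid" where
  "hom_group C X Y = \<lparr>carrier = Hom C X Y, mult = madd C, one = mzero C X Y\<rparr>"

definition mneg :: "('o, 'a, 'z) addcat_scheme \<Rightarrow> 'o \<Rightarrow> 'o \<Rightarrow> 'a \<Rightarrow> 'a" where
  "mneg C X Y f = inv\<^bsub>hom_group C X Y\<^esub> f"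

definition biproduct :: "('o, 'a, 'z) addcat_scheme \<Rightarrow> 'o \<Rightarrow> 'o \<Rightarrow> 'o
    \<Rightarrow> 'a \<Rightarrow> 'a \<Rightarrow> 'a \<Rightarrow> 'a \<Rightarrow> bool" where
  "biproduct C X Y S i1 i2 p1 p2 \<longleftrightarrow>
     X \<in> Obj C \<and> Y \<in> Obj C \<and> S \<in> Obj C \<and>
     i1 \<in> Hom C X S \<and> i2 \<in> Hom C Y S \<and> p1 \<in> Hom C S X \<and> p2 \<in> Hom C S Y \<and>
     p1 \<cdot>\<^bsub>C\<^esub> i1 = idm C X \<and> p2 \<cdot>\<^bsub>C\<^esub> i2 = idm C Y \<and>
     p2 \<cdot>\<^bsub>C\<^esub> i1 = mzero C X Y \<and> p1 \<cdot>\<^bsub>C\<^esub> i2 = mzero C Y X \<and>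
     madd C (i1 \<cdot>\<^bsub>C\<^esub> p1) (i2 \<cdot>\<^bsub>C\<^esub> p2) = idm C S"

locale additive_category = category C
  for C :: "('o, 'a, 'z) addcat_scheme" (structure) +
  assumes hom_comm_group: "\<lbrakk>X \<in> Obj C; Y \<in> Obj C\<rbrakk> \<Longrightarrow> comm_group (hom_group C X Y)"
    and cmp_madd_left:
      "\<lbrakk>X \<in> Obj C; Y \<in> Obj C; Z \<in> Obj C; f \<in> Hom C X Y; g \<in> Hom C Y Z; g' \<in> Hom C Y Z\<rbrakk>
        \<Longrightarrow> madd C g g' \<cdot> f = madd C (g \<cdot> f) (g' \<cdot> f)"
    and cmp_madd_right:
      "\<lbrakk>X \<in> Obj C; Y \<in> Obj C; Z \<in> Obj C; f \<in> Hom C X Y; f' \<in> Hom C X Y; g \<in> Hom C Y Z\<rbrakk>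
        \<Longrightarrow> g \<cdot> madd C f f' = madd C (g \<cdot> f) (g \<cdot> f')"
    and ex_zero_object: "\<exists>Z. zero_object C Z"
    and ex_biproduct:
      "\<lbrakk>X \<in> Obj C; Y \<in> Obj C\<rbrakk> \<Longrightarrow> \<exists>S i1 i2 p1 p2. biproduct C X Y S i1 i2 p1 p2"

definition finite_direct_sum :: "('o, 'a, 'z) addcat_scheme \<Rightarrow> 'o set \<Rightarrow> 'o \<Rightarrow> bool" where
  "finite_direct_sum C B S \<longleftrightarrow> S \<in> Obj C \<and>
     (\<exists>(I :: nat set) Y \<iota> \<pi>. finite I \<and>
        (\<forall>i\<in>I. Y i \<in> B \<and> \<iota> i \<in> Hom C (Y i) S \<and> \<pi> i \<in> Hom C S (Y i)) \<and>
        (\<forall>i\<in>I. \<forall>j\<in>I. \<pi> i \<cdot>\<^bsub>C\<^esub> \<iota> j = (if i = j then idm C (Y i) else mzero C (Y j) (Y i))) \<and>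
        finprod (hom_group C S S) (\<lambda>i. \<iota> i \<cdot>\<^bsub>C\<^esub> \<pi> i) I = idm C S)"

definition Kar_in_obj :: "('o, 'a, 'z) addcat_scheme \<Rightarrow> 'o set \<Rightarrow> 'o set" where
  "Kar_in_obj C B = {X \<in> Obj C. \<exists>S. finite_direct_sum C B S \<and> retract_of C X S}"


section \<open>Triangulated categories\<close>

text \<open>The translation is a strict automorphism; it is recorded through all its integer powers,
  so that \<open>shO C n X\<close> is $X[n]$ and \<open>shA C n f\<close> is $f[n]$.
  \<open>dist C X Y Z f g h\<close> says that $X \to Y \to Z \to X[1]$ is distinguished.\<close>

record ('o, 'a) tricat = "('o, 'a) addcat" +
  shO :: "int \<Rightarrow> 'o \<Rightarrow> 'o"
  shA :: "int \<Rightarrow> 'a \<Rightarrow> 'a"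
  dist :: "'o \<Rightarrow> 'o \<Rightarrow> 'o \<Rightarrow> 'a \<Rightarrow> 'a \<Rightarrow> 'a \<Rightarrow> bool"

locale triangulated_category = additive_category C
  for C :: "('o, 'a, 'z) tricat_scheme" (structure) +
  assumes shO_closed: "X \<in> Obj C \<Longrightarrow> shO C n X \<in> Obj C"
    and shO_0: "X \<in> Obj C \<Longrightarrow> shO C 0 X = X"
    and shO_add: "X \<in> Obj C \<Longrightarrow> shO C k (shO C n X) = shO C (k + n) X"
    and shA_closed:
      "\<lbrakk>X \<in> Obj C; Y \<in> Obj C; f \<in> Hom C X Y\<rbrakk> \<Longrightarrow> shA C n f \<in> Hom C (shO C n X) (shO C n Y)"
    and shA_0: "\<lbrakk>X \<in> Obj C; Y \<in> Obj C; f \<in> Hom C X Y\<rbrakk> \<Longrightarrow> shA C 0 f = f"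
    and shA_add:
      "\<lbrakk>X \<in> Obj C; Y \<in> Obj C; f \<in> Hom C X Y\<rbrakk> \<Longrightarrow> shA C k (shA C n f) = shA C (k + n) f"
    and shA_idm: "X \<in> Obj C \<Longrightarrow> shA C n (idm C X) = idm C (shO C n X)"
    and shA_cmp:
      "\<lbrakk>X \<in> Obj C; Y \<in> Obj C; Z \<in> Obj C; f \<in> Hom C X Y; g \<in> Hom C Y Z\<rbrakk>
        \<Longrightarrow> shA C n (g \<cdot> f) = shA C n g \<cdot> shA C n f"
    and shA_madd:
      "\<lbrakk>X \<in> Obj C; Y \<in> Obj C; f \<in> Hom C X Y; g \<in> Hom C X Y\<rbrakk>
        \<Longrightarrow> shA C n (madd C f g) = madd C (shA C n f) (shA C n g)"
    and dist_typed:
      "dist C X Y Z f g h \<Longrightarrow> X \<in> Obj C \<and> Y \<in> Obj C \<and> Z \<in> Obj C \<and>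
         f \<in> Hom C X Y \<and> g \<in> Hom C Y Z \<and> h \<in> Hom C Z (shO C 1 X)"
    and dist_iso:
      "\<lbrakk>dist C X Y Z f g h; iso_arrow C X X' a; iso_arrow C Y Y' b; iso_arrow C Z Z' c;
        f' \<in> Hom C X' Y'; g' \<in> Hom C Y' Z'; h' \<in> Hom C Z' (shO C 1 X');
        f' \<cdot> a = b \<cdot> f; g' \<cdot> b = c \<cdot> g; h' \<cdot> c = shA C 1 a \<cdot> h\<rbrakk> \<Longrightarrow> dist C X' Y' Z' f' g' h'"
    and dist_idm:
      "\<lbrakk>X \<in> Obj C; zero_object C Z\<rbrakk>
        \<Longrightarrow> dist C X X Z (idm C X) (mzero C X Z) (mzero C Z (shO C 1 X))"
    and dist_ex:
      "\<lbrakk>X \<in> Obj C; Y \<in> Obj C; f \<in> Hom C X Y\<rbrakk> \<Longrightarrow> \<exists>Z g h. dist C X Y Z f g h"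
    and dist_rotate:
      "dist C X Y Z f g h
        \<Longrightarrow> dist C Y Z (shO C 1 X) g h (mneg C (shO C 1 X) (shO C 1 Y) (shA C 1 f))"
    and dist_rotate_back:
      "\<lbrakk>X \<in> Obj C; Y \<in> Obj C; Z \<in> Obj C;
        f \<in> Hom C X Y; g \<in> Hom C Y Z; h \<in> Hom C Z (shO C 1 X);
        dist C Y Z (shO C 1 X) g h (mneg C (shO C 1 X) (shO C 1 Y) (shA C 1 f))\<rbrakk>
        \<Longrightarrow> dist C X Y Z f g h"
    and dist_mor:
      "\<lbrakk>dist C X Y Z f g h; dist C X' Y' Z' f' g' h'; a \<in> Hom C X X'; b \<in> Hom C Y Y';
        f' \<cdot> a = b \<cdot> f\<rbrakk>
        \<Longrightarrow> \<exists>c\<in>Hom C Z Z'. g' \<cdot> b = c \<cdot> g \<and> h' \<cdot> c = shA C 1 a \<cdot> h"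
    and octahedron:
      "\<lbrakk>dist C X Y Z' f a a'; dist C Y Z X' g b b'; dist C X Z Y' (g \<cdot> f) c c'\<rbrakk>
        \<Longrightarrow> \<exists>u v. dist C Z' Y' X' u v (shA C 1 a \<cdot> b') \<and>
              u \<cdot> a = c \<cdot> g \<and> c' \<cdot> u = a' \<and> v \<cdot> c = b \<and> b' \<cdot> v = shA C 1 f \<cdot> c'"

definition full_trisub :: "('o, 'a) tricat \<Rightarrow> 'o set \<Rightarrow> ('o, 'a) tricat" where
  "full_trisub C D = (full_sub C D)\<lparr>dist :=
     (\<lambda>X Y Z f g h. X \<in> D \<and> Y \<in> D \<and> Z \<in> D \<and> dist C X Y Z f g h)\<rparr>"


section \<open>The homotopy category of complexes\<close>

record ('o, 'a) cplx =
  cob :: "int \<Rightarrow> 'o"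
  cdf :: "int \<Rightarrow> 'a"

definition complexes :: "('o, 'a, 'z) addcat_scheme \<Rightarrow> ('o, 'a) cplx set" where
  "complexes B = {X. \<forall>n. cob X n \<in> Obj B \<and> cdf X n \<in> Hom B (cob X n) (cob X (n + 1)) \<and>
     cdf X (n + 1) \<cdot>\<^bsub>B\<^esub> cdf X n = mzero B (cob X n) (cob X (n + 1 + 1))}"

definition chain_maps ::
  "('o, 'a, 'z) addcat_scheme \<Rightarrow> ('o, 'a) cplx \<Rightarrow> ('o, 'a) cplx \<Rightarrow> (int \<Rightarrow> 'a) set" where
  "chain_maps B X Y = {f. \<forall>n. f n \<in> Hom B (cob X n) (cob Y n) \<and>
     cdf Y n \<cdot>\<^bsub>B\<^esub> f n = f (n + 1) \<cdot>\<^bsub>B\<^esub> cdf X n}"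

definition homotopic :: "('o, 'a, 'z) addcat_scheme \<Rightarrow> ('o, 'a) cplx \<Rightarrow> ('o, 'a) cplx
    \<Rightarrow> (int \<Rightarrow> 'a) \<Rightarrow> (int \<Rightarrow> 'a) \<Rightarrow> bool" where
  "homotopic B X Y f g \<longleftrightarrow>
     (\<exists>s. \<forall>n. s n \<in> Hom B (cob X n) (cob Y (n - 1)) \<and>
        f n = madd B (g n) (madd B (cdf Y (n - 1) \<cdot>\<^bsub>B\<^esub> s n) (s (n + 1) \<cdot>\<^bsub>B\<^esub> cdf X n)))"

definition hclass :: "('o, 'a, 'z) addcat_scheme \<Rightarrow> ('o, 'a) cplx \<Rightarrow> ('o, 'a) cplx
    \<Rightarrow> (int \<Rightarrow> 'a) \<Rightarrow> (int \<Rightarrow> 'a) set" where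
  "hclass B X Y f = {f' \<in> chain_maps B X Y. homotopic B X Y f' f}"

type_synonym ('o, 'a) karr = "('o, 'a) cplx \<times> ('o, 'a) cplx \<times> (int \<Rightarrow> 'a) set"

definition kmor :: "('o, 'a, 'z) addcat_scheme \<Rightarrow> ('o, 'a) cplx \<Rightarrow> ('o, 'a) cplx
    \<Rightarrow> (int \<Rightarrow> 'a) \<Rightarrow> ('o, 'a) karr" where
  "kmor B X Y f = (X, Y, hclass B X Y f)"

definition Kadd :: "('o, 'a, 'z) addcat_scheme \<Rightarrow> (('o, 'a) cplx, ('o, 'a) karr) addcat" where
  "Kadd B =
    \<lparr>Obj = complexes B,
     Hom = (\<lambda>X Y. kmor B X Y ` chain_maps B X Y),
     idm = (\<lambda>X. kmor B X X (\<lambda>n. idm B (cob X n))),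
     cmp = (\<lambda>(_, Z, \<gamma>) (X, _, \<phi>). (X, Z, \<Union>g\<in>\<gamma>. \<Union>f\<in>\<phi>. hclass B X Z (\<lambda>n. g n \<cdot>\<^bsub>B\<^esub> f n))),
     madd = (\<lambda>(X, Y, \<phi>) (_, _, \<gamma>). (X, Y, \<Union>f\<in>\<phi>. \<Union>g\<in>\<gamma>. hclass B X Y (\<lambda>n. madd B (f n) (g n)))),
     mzero = (\<lambda>X Y. kmor B X Y (\<lambda>n. mzero B (cob X n) (cob Y n)))\<rparr>"

definition cshift :: "('o, 'a, 'z) addcat_scheme \<Rightarrow> int \<Rightarrow> ('o, 'a) cplx \<Rightarrow> ('o, 'a) cplx" where
  "cshift B k X =
    \<lparr>cob = (\<lambda>n. cob X (n + k)),
     cdf = (\<lambda>n. if even k then cdf X (n + k)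
                else mneg B (cob X (n + k)) (cob X (n + k + 1)) (cdf X (n + k)))\<rparr>"

definition kshift :: "('o, 'a, 'z) addcat_scheme \<Rightarrow> int \<Rightarrow> ('o, 'a) karr \<Rightarrow> ('o, 'a) karr" where
  "kshift B k = (\<lambda>(X, Y, \<phi>). (cshift B k X, cshift B k Y, (\<lambda>f n. f (n + k)) ` \<phi>))"

text \<open>The cone of $f : X \to Y$ is $X[1] \oplus Y$ in each degree, with differential
  $(x, y) \mapsto (d_{X[1]} x, f x + d_Y y)$. No biproducts are chosen in the base category,
  so a cone is a complex together with a splitting in every degree.\<close>

definition is_cone :: "('o, 'a, 'z) addcat_scheme \<Rightarrow> ('o, 'a) cplx \<Rightarrow> ('o, 'a) cplx \<Rightarrow> (int \<Rightarrow> 'a)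
    \<Rightarrow> ('o, 'a) cplx \<Rightarrow> (int \<Rightarrow> 'a) \<Rightarrow> (int \<Rightarrow> 'a) \<Rightarrow> (int \<Rightarrow> 'a) \<Rightarrow> (int \<Rightarrow> 'a) \<Rightarrow> bool" where
  "is_cone B X Y f Z i1 i2 p1 p2 \<longleftrightarrow> Z \<in> complexes B \<and>
     (\<forall>n. biproduct B (cob X (n + 1)) (cob Y n) (cob Z n) (i1 n) (i2 n) (p1 n) (p2 n) \<and>
        cdf Z n =
          madd B (i1 (n + 1) \<cdot>\<^bsub>B\<^esub> (cdf (cshift B 1 X) n \<cdot>\<^bsub>B\<^esub> p1 n))
            (madd B (i2 (n + 1) \<cdot>\<^bsub>B\<^esub> (f (n + 1) \<cdot>\<^bsub>B\<^esub> p1 n))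
              (i2 (n + 1) \<cdot>\<^bsub>B\<^esub> (cdf Y n \<cdot>\<^bsub>B\<^esub> p2 n))))"

definition kdist :: "('o, 'a, 'z) addcat_scheme
    \<Rightarrow> ('o, 'a) cplx \<Rightarrow> ('o, 'a) cplx \<Rightarrow> ('o, 'a) cplx
    \<Rightarrow> ('o, 'a) karr \<Rightarrow> ('o, 'a) karr \<Rightarrow> ('o, 'a) karr \<Rightarrow> bool" where
  "kdist B X Y Z f g h \<longleftrightarrow>
     X \<in> complexes B \<and> Y \<in> complexes B \<and> Z \<in> complexes B \<and>
     f \<in> Hom (Kadd B) X Y \<and> g \<in> Hom (Kadd B) Y Z \<and> h \<in> Hom (Kadd B) Z (cshift B 1 X) \<and>
     (\<exists>X0 Y0 Z0 f0 i1 i2 p1 p2 a b c.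
        X0 \<in> complexes B \<and> Y0 \<in> complexes B \<and> f0 \<in> chain_maps B X0 Y0 \<and>
        is_cone B X0 Y0 f0 Z0 i1 i2 p1 p2 \<and>
        iso_arrow (Kadd B) X0 X a \<and> iso_arrow (Kadd B) Y0 Y b \<and> iso_arrow (Kadd B) Z0 Z c \<and>
        f \<cdot>\<^bsub>Kadd B\<^esub> a = b \<cdot>\<^bsub>Kadd B\<^esub> kmor B X0 Y0 f0 \<and>
        g \<cdot>\<^bsub>Kadd B\<^esub> b = c \<cdot>\<^bsub>Kadd B\<^esub> kmor B Y0 Z0 i2 \<and>
        h \<cdot>\<^bsub>Kadd B\<^esub> c = kshift B 1 a \<cdot>\<^bsub>Kadd B\<^esub> kmor B Z0 (cshift B 1 X0) p1)"

definition Kcat :: "('o, 'a, 'z) addcat_scheme \<Rightarrow> (('o, 'a) cplx, ('o, 'a) karr) tricat" where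
  "Kcat B = addcat.extend (Kadd B) \<lparr>shO = cshift B, shA = kshift B, dist = kdist B\<rparr>"


lemma Kcat_simps [simp]:
  "Obj (Kcat B) = complexes B"
  "Hom (Kcat B) X Y = kmor B X Y ` chain_maps B X Y"
  "idm (Kcat B) = idm (Kadd B)"
  "cmp (Kcat B) = cmp (Kadd B)"
  "madd (Kcat B) = madd (Kadd B)"
  "mzero (Kcat B) = mzero (Kadd B)"
  "shO (Kcat B) = cshift B"
  "shA (Kcat B) = kshift B"
  "dist (Kcat B) = kdist B"
  by (simp_all add: Kcat_def Kadd_def addcat.defs)


section \<open>Weight structures\<close>

record 'o weights =
  wle0 :: "'o set"
  wge0 :: "'o set"

locale weight_structure = triangulated_category C
  for C :: "('o, 'a, 'z) tricat_scheme" (structure) and w :: "'o weights" +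
  assumes wle0_Obj: "wle0 w \<subseteq> Obj C"
    and wge0_Obj: "wge0 w \<subseteq> Obj C"
    and wle0_retract: "\<lbrakk>X \<in> wle0 w; retract_of C Y X\<rbrakk> \<Longrightarrow> Y \<in> wle0 w"
    and wge0_retract: "\<lbrakk>X \<in> wge0 w; retract_of C Y X\<rbrakk> \<Longrightarrow> Y \<in> wge0 w"
    and wle0_shift: "wle0 w \<subseteq> shO C 1 ` wle0 w"
    and wge0_shift: "shO C 1 ` wge0 w \<subseteq> wge0 w"
    and orthogonal: "\<lbrakk>X \<in> wle0 w; Y \<in> shO C 1 ` wge0 w\<rbrakk> \<Longrightarrow> Hom C X Y = {mzero C X Y}"
    and decomposition:
      "N \<in> Obj C \<Longrightarrow> \<exists>L R h g k. dist C L N R h g k \<and> L \<in> wle0 w \<and> R \<in> shO C 1 ` wge0 w"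

definition wle :: "('o, 'a, 'z) tricat_scheme \<Rightarrow> 'o weights \<Rightarrow> int \<Rightarrow> 'o set" where
  "wle C w i = shO C i ` wle0 w"

definition wge :: "('o, 'a, 'z) tricat_scheme \<Rightarrow> 'o weights \<Rightarrow> int \<Rightarrow> 'o set" where
  "wge C w i = shO C i ` wge0 w"

definition heart :: "('o, 'a, 'z) tricat_scheme \<Rightarrow> 'o weights \<Rightarrow> ('o, 'a, 'z) tricat_scheme" where
  "heart C w = full_sub C (wge0 w \<inter> wle0 w)"

definition restrict_weights :: "'o weights \<Rightarrow> 'o set \<Rightarrow> 'o weights" where
  "restrict_weights w D = \<lparr>wle0 = wle0 w \<inter> D, wge0 = wge0 w \<inter> D\<rparr>"

definition weight_decomposition :: "('o, 'a, 'z) tricat_scheme \<Rightarrow> 'o weights \<Rightarrow> int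
    \<Rightarrow> 'o \<Rightarrow> 'o \<Rightarrow> 'o \<Rightarrow> 'a \<Rightarrow> 'a \<Rightarrow> 'a \<Rightarrow> bool" where
  "weight_decomposition C w m L M R h g k \<longleftrightarrow>
     dist C L M R h g k \<and> L \<in> wle C w m \<and> R \<in> wge C w (m + 1)"

text \<open>\<open>h : L \<rightarrow> M\<close> is the first arrow of an \<open>m\<close>-weight decomposition of \<open>M\<close>.\<close>

definition gives_decomposition ::
  "('o, 'a, 'z) tricat_scheme \<Rightarrow> 'o weights \<Rightarrow> int \<Rightarrow> 'o \<Rightarrow> 'o \<Rightarrow> 'a \<Rightarrow> bool" where
  "gives_decomposition C w m L M h \<longleftrightarrow> (\<exists>R g k. weight_decomposition C w m L M R h g k)"

definition truncation_choice ::
  "('o, 'a, 'z) tricat_scheme \<Rightarrow> 'o weights \<Rightarrow> int \<Rightarrow> 'o \<Rightarrow> 'o \<Rightarrow> bool" where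
  "truncation_choice C w m M L \<longleftrightarrow> (\<exists>h. gives_decomposition C w m L M h)"

definition w_st :: "('o, 'a, 'z) addcat_scheme \<Rightarrow> ('o, 'a) cplx weights" where
  "w_st B =
    \<lparr>wle0 = {X \<in> Obj (Kcat B). \<exists>Y. isomorphic (Kcat B) X Y \<and> (\<forall>n<0. zero_object B (cob Y n))},
     wge0 = {X \<in> Obj (Kcat B). \<exists>Y. isomorphic (Kcat B) X Y \<and> (\<forall>n>0. zero_object B (cob Y n))}\<rparr>"


section \<open>Weight Postnikov towers and weight complexes\<close>

text \<open>\<open>tw_ob P i\<close> is $w_{\le i}M$ and \<open>tw_gr P i\<close> is $M_i$. The arrow fields are indexed as
  $h_i : w_{\le i}M \to M$, $j_i : w_{\le i}M \to w_{\le i+1}M$, $c_i : w_{\le i}M \to M_i$ and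
  $e_i : M_{i+1} \to w_{\le i}M[1]$.\<close>

record ('o, 'a) tower =
  tw_ob :: "int \<Rightarrow> 'o"
  tw_gr :: "int \<Rightarrow> 'o"
  tw_h :: "int \<Rightarrow> 'a"
  tw_j :: "int \<Rightarrow> 'a"
  tw_c :: "int \<Rightarrow> 'a"
  tw_e :: "int \<Rightarrow> 'a"

definition is_tower ::
  "('o, 'a, 'z) tricat_scheme \<Rightarrow> 'o weights \<Rightarrow> 'o \<Rightarrow> ('o, 'a) tower \<Rightarrow> bool" where
  "is_tower C w M P \<longleftrightarrow>
     (\<forall>i. gives_decomposition C w i (tw_ob P i) M (tw_h P i) \<and>
        tw_j P i \<in> Hom C (tw_ob P i) (tw_ob P (i + 1)) \<and>
        tw_h P (i + 1) \<cdot>\<^bsub>C\<^esub> tw_j P i = tw_h P i \<and>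
        dist C (tw_ob P (i - 1)) (tw_ob P i) (tw_gr P i) (tw_j P (i - 1)) (tw_c P i) (tw_e P (i - 1)))"

definition is_tower_mor :: "('o, 'a, 'z) tricat_scheme
    \<Rightarrow> 'o \<Rightarrow> ('o, 'a) tower \<Rightarrow> 'o \<Rightarrow> ('o, 'a) tower
    \<Rightarrow> 'a \<Rightarrow> (int \<Rightarrow> 'a) \<Rightarrow> (int \<Rightarrow> 'a) \<Rightarrow> bool" where
  "is_tower_mor C M P M' P' g gle ggr \<longleftrightarrow> g \<in> Hom C M M' \<and>
     (\<forall>i. gle i \<in> Hom C (tw_ob P i) (tw_ob P' i) \<and>
        ggr i \<in> Hom C (tw_gr P i) (tw_gr P' i) \<and>
        tw_h P' i \<cdot>\<^bsub>C\<^esub> gle i = g \<cdot>\<^bsub>C\<^esub> tw_h P i \<and>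
        tw_j P' i \<cdot>\<^bsub>C\<^esub> gle i = gle (i + 1) \<cdot>\<^bsub>C\<^esub> tw_j P i \<and>
        tw_c P' i \<cdot>\<^bsub>C\<^esub> gle i = ggr i \<cdot>\<^bsub>C\<^esub> tw_c P i \<and>
        tw_e P' i \<cdot>\<^bsub>C\<^esub> ggr (i + 1) = shA C 1 (gle i) \<cdot>\<^bsub>C\<^esub> tw_e P i)"

definition tower_complex ::
  "('o, 'a, 'z) tricat_scheme \<Rightarrow> ('o, 'a) tower \<Rightarrow> ('o, 'a) cplx" where
  "tower_complex C P =
    \<lparr>cob = (\<lambda>i. shO C i (tw_gr P (- i))),
     cdf = (\<lambda>i. shA C (i + 1) (tw_c P (- i - 1)) \<cdot>\<^bsub>C\<^esub> shA C i (tw_e P (- i - 1)))\<rparr>"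

definition tower_complex_mor :: "('o, 'a, 'z) tricat_scheme \<Rightarrow> 'o weights
    \<Rightarrow> ('o, 'a) tower \<Rightarrow> ('o, 'a) tower \<Rightarrow> (int \<Rightarrow> 'a) \<Rightarrow> ('o, 'a) karr" where
  "tower_complex_mor C w P P' ggr =
     kmor (heart C w) (tower_complex C P) (tower_complex C P') (\<lambda>i. shA C i (ggr (- i)))"

definition is_weight_complex ::
  "('o, 'a, 'z) tricat_scheme \<Rightarrow> 'o weights \<Rightarrow> 'o \<Rightarrow> ('o, 'a) cplx \<Rightarrow> bool" where
  "is_weight_complex C w M T \<longleftrightarrow> (\<exists>P. is_tower C w M P \<and> T = tower_complex C P)"

text \<open>Objects of $\mathcal C^{\mathcal B}$, where \<open>B\<close> is the object class of $\mathcal B$.\<close>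

definition weight_complex_sub :: "('o, 'a, 'z) tricat_scheme \<Rightarrow> 'o weights \<Rightarrow> 'o set \<Rightarrow> 'o set" where
  "weight_complex_sub C w B =
     {N \<in> Obj C. \<exists>T. is_weight_complex C w N T \<and>
        (\<exists>X\<in>Obj (Kcat (full_sub (heart C w) B)). isomorphic (Kcat (heart C w)) T X)}"

end

theory Submission
  imports Defs
begin

text \<open>Over the identity morphism of \<open>M\<close>, a tower morphism has graded components \<open>1 + d s + t d\<close> with unrelated
  \<open>s\<close> and \<open>t\<close>; the square of the error is null-homotopic, so weight complexes are unique in \<open>K(Hw)\<close>.
  For towers that are constant from some index on, the cones of the lifts \<open>w\<^bsub>\<le>i-1\<^esub>A \<rightarrow> w\<^bsub>\<le>i\<^esub>A'\<close>
  of \<open>A \<rightarrow> A'\<close> form a tower of the cone \<open>A''\<close>, whose weight complex is a cone of those of \<open>A\<close> and \<open>A'\<close>.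

  Let \<open>N' = w\<^bsub>\<le>m+1\<^esub>M\<close>. In an \<open>m\<close>-decomposition \<open>C \<rightarrow> t(N') \<rightarrow> D\<close>, the complex \<open>D\<close> can be
  represented by one that has a chain endomorphism homotopic to the identity and zero above degree \<open>-m-1\<close>,
  while \<open>D\<close> vanishes below that degree. Its lowest component is an idempotent; splitting it in the Karoubian
  heart replaces \<open>D\<close> by a single object. The map \<open>t(N') \<rightarrow> D\<close> is then realized by a map from \<open>N'\<close> to a
  shift of this object, and its cocone is the required truncation \<open>N\<close>.

  Eilenberg's swindle turns complexes over \<open>Kar B\<close> into complexes over \<open>B\<close>. Combined with the realization of
  stupid truncations, this identifies the objects of \<open>C\<^sup>B\<close> as those with a tower whose graded pieces lie in
  \<open>Kar B\<close>, a property that passes to cones and truncations.\<close>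

section \<open>Arrows and biproducts\<close>

text \<open>Weight complexes are not functorial in K(Hw): the graded components of a tower morphism
  come from completing squares of triangles and are fixed only up to d s + t d with independent s
  and t. Hence the weight complex of a cone in C is the cone of a chain map whose homotopy class is
  not under control in general. The realization of truncations avoids this by removing one degree at
  a time. The complex t(w_{<=m+1} M) starts in degree -m-1, so the quotient of an m-decomposition
  is, up to splitting an idempotent, a single object in that degree. For a target in one degree the
  term d s vanishes and t d is an honest homotopy; a chain map is then determined in K(Hw) by its
  composite with the tower arrow \<open>tw_c\<close>, and this pins down the map occurring in the
  cone. No boundedness is assumed. The arrows from a cone tower to its object are composed downward
  from an index where everything is constant, so cones of towers are formed only for truncated
  objects, and general objects of C^B are treated weight by weight.\<close>

context category begin

definition is_arr :: "'a \<Rightarrow> bool" where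
  "is_arr f \<longleftrightarrow> (\<exists>X\<in>Obj C. \<exists>Y\<in>Obj C. f \<in> Hom C X Y)"
definition src :: "'a \<Rightarrow> 'o" where
  "src f = (THE X. X \<in> Obj C \<and> (\<exists>Y\<in>Obj C. f \<in> Hom C X Y))"
definition tgt :: "'a \<Rightarrow> 'o" where
  "tgt f = (THE Y. Y \<in> Obj C \<and> (\<exists>X\<in>Obj C. f \<in> Hom C X Y))"
definition ar :: "'a \<Rightarrow> 'o \<Rightarrow> 'o \<Rightarrow> bool" where
  "ar f X Y \<longleftrightarrow> X \<in> Obj C \<and> Y \<in> Obj C \<and> f \<in> Hom C X Y"

lemma src_eq: "ar f X Y \<Longrightarrow> src f = X"
  unfolding src_def ar_def by (rule the_equality) (use Hom_disjoint in blast)+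

lemma tgt_eq: "ar f X Y \<Longrightarrow> tgt f = Y"
  unfolding tgt_def ar_def by (rule the_equality) (use Hom_disjoint in blast)+

lemma is_arrI: "ar f X Y \<Longrightarrow> is_arr f"
  unfolding is_arr_def ar_def by blast

lemma is_arr_ar: "is_arr f \<longleftrightarrow> ar f (src f) (tgt f)"
  using src_eq tgt_eq unfolding is_arr_def ar_def by metis

text \<open>Source and target are functions of the arrow, so this turns typing hypotheses into rewrite
  rules whose side conditions contain no variables beyond the arrows themselves.\<close>

lemma ar_iff: "ar f X Y \<longleftrightarrow> is_arr f \<and> src f = X \<and> tgt f = Y \<and> X \<in> Obj C \<and> Y \<in> Obj C"
  using src_eq tgt_eq is_arrI is_arr_ar ar_def by metis

lemma Hom_ar: "X \<in> Obj C \<Longrightarrow> Y \<in> Obj C \<Longrightarrow> f \<in> Hom C X Y \<longleftrightarrow> ar f X Y"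
  by (simp add: ar_def)

lemma src_Obj [simp]: "is_arr f \<Longrightarrow> src f \<in> Obj C"
  and tgt_Obj [simp]: "is_arr f \<Longrightarrow> tgt f \<in> Obj C"
  using is_arr_ar ar_def by auto

lemma ar_cmp: "ar f X Y \<Longrightarrow> ar g Y Z \<Longrightarrow> ar (g \<cdot> f) X Z"
  using cmp_closed unfolding ar_def by blast

lemma cmp_arr [simp]:
  assumes "is_arr f" "is_arr g" "tgt f = src g"
  shows "is_arr (g \<cdot> f)" "src (g \<cdot> f) = src f" "tgt (g \<cdot> f) = tgt g"
proof -
  have "ar (g \<cdot> f) (src f) (tgt g)"
    using ar_cmp[of f "src f" "tgt f" g "tgt g"] assms is_arr_ar by metis
  then show "is_arr (g \<cdot> f)" "src (g \<cdot> f) = src f" "tgt (g \<cdot> f) = tgt g"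
    using is_arrI src_eq tgt_eq by blast+
qed

lemma assoc [simp]:
  assumes "is_arr f" "is_arr g" "is_arr h" "tgt f = src g" "tgt g = src h"
  shows "(h \<cdot> g) \<cdot> f = h \<cdot> (g \<cdot> f)"
  using assms cmp_assoc unfolding is_arr_ar ar_def by metis

text \<open>Since \<open>assoc\<close> nests composites to the right, an equation
  \<open>g \<cdot> f = k\<close> no longer matches inside a longer composite; its image under
  \<open>THEN ra\<close> does.\<close>

lemma ra:
  assumes "g \<cdot> f = k" "is_arr f" "is_arr g" "tgt f = src g" "is_arr x" "tgt x = src f"
  shows "g \<cdot> (f \<cdot> x) = k \<cdot> x"
  using assms assoc by metis

lemma ar_idm: "X \<in> Obj C \<Longrightarrow> ar (idm C X) X X"
  using idm_closed by (simp add: ar_def)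

lemma idm_arr [simp]:
  assumes "X \<in> Obj C" shows "is_arr (idm C X)" "src (idm C X) = X" "tgt (idm C X) = X"
  using ar_idm[OF assms] is_arrI src_eq tgt_eq by blast+

lemma cmp_id [simp]: "is_arr f \<Longrightarrow> src f = X \<Longrightarrow> f \<cdot> idm C X = f"
  using cmp_idm is_arr_ar ar_def by metis

lemma id_cmp [simp]: "is_arr f \<Longrightarrow> tgt f = Y \<Longrightarrow> idm C Y \<cdot> f = f"
  using idm_cmp is_arr_ar ar_def by metis

lemma iso_arrow_ar: "iso_arrow C X Y f \<longleftrightarrow>
    ar f X Y \<and> (\<exists>g. ar g Y X \<and> g \<cdot> f = idm C X \<and> f \<cdot> g = idm C Y)"
  unfolding iso_arrow_def ar_def by blast

lemma iso_arrowD: "iso_arrow C X Y f \<Longrightarrow> ar f X Y"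
  by (simp add: iso_arrow_ar)

lemma iso_arrowE:
  assumes "iso_arrow C X Y f"
  obtains g where "ar f X Y" "ar g Y X" "g \<cdot> f = idm C X" "f \<cdot> g = idm C Y" "iso_arrow C Y X g"
  using assms unfolding iso_arrow_ar by blast

lemma iso_arrow_idm: "X \<in> Obj C \<Longrightarrow> iso_arrow C X X (idm C X)"
  unfolding iso_arrow_ar ar_iff by (intro conjI exI[of _ "idm C X"]) auto

lemma iso_arrow_cmp:
  assumes "iso_arrow C X Y f" "iso_arrow C Y Z g" shows "iso_arrow C X Z (g \<cdot> f)"
proof -
  obtain f' where f: "ar f X Y" "ar f' Y X" "f' \<cdot> f = idm C X" "f \<cdot> f' = idm C Y"
    using assms(1) by (rule iso_arrowE)
  obtain g' where g: "ar g Y Z" "ar g' Z Y" "g' \<cdot> g = idm C Y" "g \<cdot> g' = idm C Z"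
    using assms(2) by (rule iso_arrowE)
  have "ar (g \<cdot> f) X Z" "ar (f' \<cdot> g') Z X" using f g ar_cmp by blast+
  moreover have "(f' \<cdot> g') \<cdot> (g \<cdot> f) = idm C X"
    using f(1,2) g(1,2) by (simp add: ar_iff g(3)[THEN ra] f(3))
  moreover have "(g \<cdot> f) \<cdot> (f' \<cdot> g') = idm C Z"
    using f(1,2) g(1,2) by (simp add: ar_iff f(4)[THEN ra] g(4))
  ultimately show ?thesis unfolding iso_arrow_ar by blast
qed

lemma iso_of_left_right_inverse:
  assumes "ar f X Y" "ar g Y X" "ar h Y X" "g \<cdot> f = idm C X" "f \<cdot> h = idm C Y"
  shows "iso_arrow C X Y f"
proof -
  have "g = g \<cdot> (f \<cdot> h)" using assms(1,2,3) by (simp add: assms(5) ar_iff)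
  also have "\<dots> = h" using assms(1,2,3) by (simp add: assms(4)[THEN ra] ar_iff)
  finally show ?thesis using assms unfolding iso_arrow_ar by blast
qed

text \<open>Used where only automorphisms are under control: the comparison maps of cones and of
  towers are not mutually inverse, but their composites are invertible.\<close>

lemma iso_of_iso_composites:
  assumes "ar f X Y" "ar g Y X" "iso_arrow C X X (g \<cdot> f)" "iso_arrow C Y Y (f \<cdot> g)"
  shows "iso_arrow C X Y f"
proof -
  obtain h where h: "ar h X X" "h \<cdot> (g \<cdot> f) = idm C X"
    using assms(3) by (rule iso_arrowE)
  obtain k where k: "ar k Y Y" "(f \<cdot> g) \<cdot> k = idm C Y"
    using assms(4) by (rule iso_arrowE)
  show ?thesis
  proof (rule iso_of_left_right_inverse)
    show "ar f X Y" by fact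
    show "ar (h \<cdot> g) Y X" "ar (g \<cdot> k) Y X" using assms h k ar_cmp by blast+
    show "(h \<cdot> g) \<cdot> f = idm C X" "f \<cdot> (g \<cdot> k) = idm C Y"
      using assms(1,2) h k by (simp_all add: ar_iff)
  qed
qed

lemma isomorphic_refl: "X \<in> Obj C \<Longrightarrow> isomorphic C X X"
  unfolding isomorphic_def using iso_arrow_idm by blast

lemma isomorphic_sym: "isomorphic C X Y \<Longrightarrow> isomorphic C Y X"
  unfolding isomorphic_def using iso_arrowE by metis

lemma isomorphic_trans: "isomorphic C X Y \<Longrightarrow> isomorphic C Y Z \<Longrightarrow> isomorphic C X Z"
  unfolding isomorphic_def using iso_arrow_cmp by blast

lemma retract_of_ar: "retract_of C X Y \<longleftrightarrow> (\<exists>s r. ar s X Y \<and> ar r Y X \<and> r \<cdot> s = idm C X)"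
  unfolding retract_of_def ar_def by blast

lemma retract_trans:
  assumes "retract_of C X Y" "retract_of C Y Z" shows "retract_of C X Z"
proof -
  obtain s r where 1: "ar s X Y" "ar r Y X" "r \<cdot> s = idm C X"
    using assms(1) unfolding retract_of_ar by blast
  obtain s' r' where 2: "ar s' Y Z" "ar r' Z Y" "r' \<cdot> s' = idm C Y"
    using assms(2) unfolding retract_of_ar by blast
  have "ar (s' \<cdot> s) X Z" "ar (r \<cdot> r') Z X" using 1 2 ar_cmp by blast+
  moreover have "(r \<cdot> r') \<cdot> (s' \<cdot> s) = idm C X"
    using 1(1,2) 2(1,2) by (simp add: ar_iff 2(3)[THEN ra] 1(3))
  ultimately show ?thesis unfolding retract_of_ar by blast
qed

lemma isomorphic_retract: "isomorphic C X Y \<Longrightarrow> retract_of C X Y"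
  unfolding isomorphic_def iso_arrow_ar retract_of_ar by blast

end

section \<open>Calculus of arrows in an additive category\<close>

context additive_category begin

abbreviation add :: "'a \<Rightarrow> 'a \<Rightarrow> 'a" (infixl "\<boxplus>" 65) where "f \<boxplus> g \<equiv> madd C f g"
abbreviation zr :: "'o \<Rightarrow> 'o \<Rightarrow> 'a" where "zr X Y \<equiv> mzero C X Y"

text \<open>\<open>mneg\<close> takes both objects as arguments; reading them off the arrow lets
  signs be moved by rewriting alone.\<close>

definition neg :: "'a \<Rightarrow> 'a" where "neg f = mneg C (src f) (tgt f) f"

lemma hom_group_simps [simp]:
  "carrier (hom_group C X Y) = Hom C X Y" "mult (hom_group C X Y) = madd C"
  "one (hom_group C X Y) = mzero C X Y"
  by (simp_all add: hom_group_def)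

lemma ar_madd: assumes "ar f X Y" "ar g X Y" shows "ar (f \<boxplus> g) X Y"
proof -
  interpret G: comm_group "hom_group C X Y" using assms hom_comm_group by (simp add: ar_def)
  show ?thesis using assms G.m_closed by (simp add: ar_def)
qed

lemma madd_arr [simp]:
  assumes "is_arr f" "is_arr g" "src f = src g" "tgt f = tgt g"
  shows "is_arr (f \<boxplus> g)" "src (f \<boxplus> g) = src g" "tgt (f \<boxplus> g) = tgt g"
  using ar_madd[of f "src f" "tgt f" g] assms is_arr_ar is_arrI src_eq tgt_eq by metis+

lemma ar_zr: assumes "X \<in> Obj C" "Y \<in> Obj C" shows "ar (zr X Y) X Y"
proof -
  interpret G: comm_group "hom_group C X Y" using assms hom_comm_group by (simp add: ar_def)
  show ?thesis using assms G.one_closed by (simp add: ar_def)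
qed

lemma zr_arr [simp]:
  assumes "X \<in> Obj C" "Y \<in> Obj C"
  shows "is_arr (zr X Y)" "src (zr X Y) = X" "tgt (zr X Y) = Y"
  using ar_zr[OF assms] is_arrI src_eq tgt_eq by metis+

lemma ar_mneg: assumes "ar f X Y" shows "ar (mneg C X Y f) X Y"
proof -
  interpret G: comm_group "hom_group C X Y" using assms hom_comm_group by (simp add: ar_def)
  show ?thesis using assms G.inv_closed by (simp add: ar_def mneg_def)
qed

lemma mneg_neg [simp]: "is_arr f \<Longrightarrow> src f = X \<Longrightarrow> tgt f = Y \<Longrightarrow> mneg C X Y f = neg f"
  by (simp add: neg_def)

lemma neg_arr [simp]:
  assumes "is_arr f"
  shows "is_arr (neg f)" "src (neg f) = src f" "tgt (neg f) = tgt f"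
  using ar_mneg[of f "src f" "tgt f"] assms is_arr_ar is_arrI src_eq tgt_eq neg_def by metis+

lemma madd_comm:
  assumes "is_arr f" "is_arr g" "src f = src g" "tgt f = tgt g" shows "f \<boxplus> g = g \<boxplus> f"
proof -
  interpret G: comm_group "hom_group C (src f) (tgt f)" using assms hom_comm_group by simp
  have "f \<in> carrier (hom_group C (src f) (tgt f))" "g \<in> carrier (hom_group C (src f) (tgt f))"
    using assms by (simp_all add: Hom_ar ar_iff)
  from G.m_comm[OF this] show ?thesis by simp
qed

lemma madd_assoc:
  assumes "is_arr f" "is_arr g" "is_arr h" "src f = src g" "tgt f = tgt g" "src g = src h" "tgt g = tgt h"
  shows "(f \<boxplus> g) \<boxplus> h = f \<boxplus> (g \<boxplus> h)"
proof -
  interpret G: comm_group "hom_group C (src f) (tgt f)" using assms hom_comm_group by simp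
  have "f \<in> carrier (hom_group C (src f) (tgt f))" "g \<in> carrier (hom_group C (src f) (tgt f))"
    "h \<in> carrier (hom_group C (src f) (tgt f))" using assms by (simp_all add: Hom_ar ar_iff)
  from G.m_assoc[OF this] show ?thesis by simp
qed

lemma madd_lcomm:
  assumes "is_arr f" "is_arr g" "is_arr h" "src f = src g" "tgt f = tgt g" "src g = src h" "tgt g = tgt h"
  shows "f \<boxplus> (g \<boxplus> h) = g \<boxplus> (f \<boxplus> h)"
  using madd_assoc[of f g h] madd_assoc[of g f h] madd_comm[of f g] assms by simp

lemmas madd_ac = madd_assoc madd_comm madd_lcomm

lemma madd_zr [simp]:
  assumes "is_arr f" "src f = X" "tgt f = Y" shows "f \<boxplus> zr X Y = f" "zr X Y \<boxplus> f = f"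
proof -
  interpret G: comm_group "hom_group C X Y" using assms hom_comm_group by auto
  show "f \<boxplus> zr X Y = f" "zr X Y \<boxplus> f = f"
    using assms is_arr_ar ar_def G.r_one G.l_one by (metis hom_group_simps)+
qed

lemma madd_neg [simp]:
  assumes "is_arr f" shows "f \<boxplus> neg f = zr (src f) (tgt f)" "neg f \<boxplus> f = zr (src f) (tgt f)"
proof -
  interpret G: comm_group "hom_group C (src f) (tgt f)" using assms hom_comm_group by auto
  have "f \<in> carrier (hom_group C (src f) (tgt f))" using assms by (simp add: Hom_ar ar_iff)
  from G.r_inv[OF this] G.l_inv[OF this]
  show "f \<boxplus> neg f = zr (src f) (tgt f)" "neg f \<boxplus> f = zr (src f) (tgt f)"
    by (simp_all add: neg_def mneg_def)
qed

lemma madd_neg_cancel [simp]: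
  assumes "is_arr f" "is_arr g" "src f = src g" "tgt f = tgt g"
  shows "f \<boxplus> (neg f \<boxplus> g) = g" "neg f \<boxplus> (f \<boxplus> g) = g"
  using madd_assoc[of f "neg f" g] madd_assoc[of "neg f" f g] assms by simp_all

lemma madd_left_cancel:
  assumes "f \<boxplus> g = f \<boxplus> h" "is_arr f" "is_arr g" "is_arr h"
    "src f = src g" "tgt f = tgt g" "src f = src h" "tgt f = tgt h"
  shows "g = h"
proof -
  have "g = neg f \<boxplus> (f \<boxplus> g)" "h = neg f \<boxplus> (f \<boxplus> h)" using assms(2-) by simp_all
  then show ?thesis using assms(1) by metis
qed

lemma neg_unique:
  assumes "f \<boxplus> g = zr (src f) (tgt f)" "is_arr f" "is_arr g" "src f = src g" "tgt f = tgt g"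
  shows "g = neg f"
  using assms by (intro madd_left_cancel[of f g "neg f"]) simp_all

lemma eq_of_diff:
  assumes "f \<boxplus> neg g = zr (src g) (tgt g)" "is_arr f" "is_arr g" "src f = src g" "tgt f = tgt g"
  shows "f = g"
proof -
  have "f = f \<boxplus> (neg g \<boxplus> g)" using assms(2-) by simp
  also have "\<dots> = (f \<boxplus> neg g) \<boxplus> g" using assms(2-) by (simp add: madd_assoc del: madd_neg)
  finally show ?thesis using assms by simp
qed

lemma neg_neg [simp]: "is_arr f \<Longrightarrow> neg (neg f) = f"
  using neg_unique[of "neg f" f] by simp

lemma cmp_madd [simp]:
  assumes "is_arr f" "is_arr f'" "is_arr g" "src f = src f'" "tgt f = tgt f'"
  shows "tgt f = src g \<Longrightarrow> g \<cdot> (f \<boxplus> f') = g \<cdot> f \<boxplus> g \<cdot> f'"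
    "tgt g = src f \<Longrightarrow> (f \<boxplus> f') \<cdot> g = f \<cdot> g \<boxplus> f' \<cdot> g"
  using assms cmp_madd_right[of "src f" "tgt f" "tgt g" f f' g]
    cmp_madd_left[of "src g" "tgt g" "tgt f" g f f'] by (simp_all add: Hom_ar ar_iff)

lemma zr_of_madd_self:
  assumes "h \<boxplus> h = h" "is_arr h" shows "h = zr (src h) (tgt h)"
proof (rule madd_left_cancel)
  show "h \<boxplus> h = h \<boxplus> zr (src h) (tgt h)" using assms by (simp only: assms(1)) simp
qed (use assms(2) in simp_all)

lemma cmp_zr [simp]:
  assumes "is_arr g" "X \<in> Obj C"
  shows "src g = Y \<Longrightarrow> g \<cdot> zr X Y = zr X (tgt g)" "tgt g = Y \<Longrightarrow> zr Y X \<cdot> g = zr (src g) X"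
proof -
  assume Y: "src g = Y"
  have Y': "Y \<in> Obj C" using assms Y by auto
  have "g \<cdot> (zr X Y \<boxplus> zr X Y) = g \<cdot> zr X Y \<boxplus> g \<cdot> zr X Y"
    using assms Y Y' by (intro cmp_madd) simp_all
  moreover have "zr X Y \<boxplus> zr X Y = zr X Y" using assms Y' by simp
  ultimately have "g \<cdot> zr X Y \<boxplus> g \<cdot> zr X Y = g \<cdot> zr X Y" by simp
  from zr_of_madd_self[OF this] show "g \<cdot> zr X Y = zr X (tgt g)" using assms Y Y' by simp
next
  assume Y: "tgt g = Y"
  have Y': "Y \<in> Obj C" using assms Y by auto
  have "(zr Y X \<boxplus> zr Y X) \<cdot> g = zr Y X \<cdot> g \<boxplus> zr Y X \<cdot> g"
    using assms Y Y' by (intro cmp_madd) simp_all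
  moreover have "zr Y X \<boxplus> zr Y X = zr Y X" using assms Y' by simp
  ultimately have "zr Y X \<cdot> g \<boxplus> zr Y X \<cdot> g = zr Y X \<cdot> g" by simp
  from zr_of_madd_self[OF this] show "zr Y X \<cdot> g = zr (src g) X" using assms Y Y' by simp
qed

lemma neg_zr [simp]: "X \<in> Obj C \<Longrightarrow> Y \<in> Obj C \<Longrightarrow> neg (zr X Y) = zr X Y"
  using neg_unique[of "zr X Y" "zr X Y"] by simp

lemma neg_madd [simp]:
  assumes "is_arr f" "is_arr g" "src f = src g" "tgt f = tgt g"
  shows "neg (f \<boxplus> g) = neg f \<boxplus> neg g"
proof -
  have "(f \<boxplus> g) \<boxplus> (neg f \<boxplus> neg g) = f \<boxplus> (neg f \<boxplus> (g \<boxplus> neg g))"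
    using assms by (simp add: madd_assoc madd_lcomm[of g] del: madd_neg madd_neg_cancel)
  also have "\<dots> = zr (src f) (tgt f)" using assms by simp
  finally show ?thesis using assms by (intro neg_unique[symmetric]) simp_all
qed

lemma neg_cmp [simp]:
  assumes "is_arr f" "is_arr g" "tgt f = src g"
  shows "neg g \<cdot> f = neg (g \<cdot> f)" "g \<cdot> neg f = neg (g \<cdot> f)"
proof -
  have "g \<cdot> f \<boxplus> neg g \<cdot> f = zr (src f) (tgt g)"
    using assms cmp_madd(2)[of g "neg g" f] by simp
  then show "neg g \<cdot> f = neg (g \<cdot> f)" using assms by (intro neg_unique) simp_all
  have "g \<cdot> f \<boxplus> g \<cdot> neg f = zr (src f) (tgt g)"
    using assms cmp_madd(1)[of f "neg f" g] by simp
  then show "g \<cdot> neg f = neg (g \<cdot> f)" using assms by (intro neg_unique) simp_all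
qed

lemma neg_eq_iff: "is_arr f \<Longrightarrow> is_arr g \<Longrightarrow> neg f = neg g \<longleftrightarrow> f = g"
  using neg_neg by metis

lemma neg_eq_zr: "is_arr f \<Longrightarrow> src f = X \<Longrightarrow> tgt f = Y \<Longrightarrow> neg f = zr X Y \<longleftrightarrow> f = zr X Y"
  using neg_neg neg_zr src_Obj tgt_Obj by metis

section \<open>Zero objects and biproducts\<close>

lemma zero_object_idm: "zero_object C Z \<longleftrightarrow> Z \<in> Obj C \<and> idm C Z = zr Z Z"
proof
  assume "zero_object C Z"
  then show "Z \<in> Obj C \<and> idm C Z = zr Z Z"
    unfolding zero_object_def using idm_closed ar_zr ar_def by metis
next
  assume Z: "Z \<in> Obj C \<and> idm C Z = zr Z Z"
  have "f = zr Z X" if "ar f Z X" for f X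
  proof -
    have "f = f \<cdot> idm C Z" using that by (simp add: ar_iff)
    then show ?thesis using that Z by (simp add: ar_iff)
  qed
  moreover have "f = zr X Z" if "ar f X Z" for f X
  proof -
    have "f = idm C Z \<cdot> f" using that by (simp add: ar_iff)
    then show ?thesis using that Z by (simp add: ar_iff)
  qed
  ultimately show "zero_object C Z"
    unfolding zero_object_def ar_def[symmetric] using Z ar_zr by (auto simp: Hom_ar intro!: ex1I)
qed

lemma zero_object_Obj: "zero_object C Z \<Longrightarrow> Z \<in> Obj C"
  by (simp add: zero_object_def)

lemma to_zero: "zero_object C Z \<Longrightarrow> ar f X Z \<Longrightarrow> f = zr X Z"
  using id_cmp[of f Z] by (simp add: ar_iff zero_object_idm)

lemma from_zero: "zero_object C Z \<Longrightarrow> ar f Z X \<Longrightarrow> f = zr Z X"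
  using cmp_id[of f Z] by (simp add: ar_iff zero_object_idm)

lemma zero_objects_iso:
  assumes "zero_object C Z" "zero_object C Z'" shows "iso_arrow C Z Z' (zr Z Z')"
  using assms unfolding zero_object_idm iso_arrow_ar
  by (intro conjI exI[of _ "zr Z' Z"]) (auto simp: ar_iff)

lemma biproduct_ar: "biproduct C X Y S i1 i2 p1 p2 \<longleftrightarrow>
    ar i1 X S \<and> ar i2 Y S \<and> ar p1 S X \<and> ar p2 S Y \<and>
    p1 \<cdot> i1 = idm C X \<and> p2 \<cdot> i2 = idm C Y \<and> p2 \<cdot> i1 = zr X Y \<and> p1 \<cdot> i2 = zr Y X \<and>
    i1 \<cdot> p1 \<boxplus> i2 \<cdot> p2 = idm C S"
  unfolding biproduct_def ar_def by blast

lemma biproduct_zero_objects: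
  assumes "zero_object C X" "zero_object C Y" "zero_object C S"
  shows "biproduct C X Y S (zr X S) (zr Y S) (zr S X) (zr S Y)"
  using assms unfolding biproduct_ar zero_object_idm by (auto simp: ar_iff)

lemma biproduct_zero_left:
  assumes "zero_object C X" "Y \<in> Obj C"
  shows "biproduct C X Y Y (zr X Y) (idm C Y) (zr Y X) (idm C Y)"
  using assms unfolding biproduct_ar zero_object_idm by (auto simp: ar_iff)

lemma biproduct_zero_right:
  assumes "zero_object C Y" "X \<in> Obj C"
  shows "biproduct C X Y X (idm C X) (zr Y X) (idm C X) (zr X Y)"
  using assms unfolding biproduct_ar zero_object_idm by (auto simp: ar_iff)

lemma biproduct_is_zero:
  assumes "biproduct C X Y S i1 i2 p1 p2" "zero_object C X" "zero_object C Y"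
  shows "zero_object C S"
proof -
  have "i1 = zr X S" "i2 = zr Y S" using assms from_zero unfolding biproduct_ar by blast+
  then have "i1 \<cdot> p1 \<boxplus> i2 \<cdot> p2 = zr S S" using assms(1) unfolding biproduct_ar by (simp add: ar_iff)
  then show ?thesis using assms(1) unfolding biproduct_ar zero_object_idm by (simp add: ar_iff)
qed

lemma biproduct_neg:
  "biproduct C X Y S i1 i2 p1 p2 \<Longrightarrow> biproduct C X Y S (neg i1) i2 (neg p1) p2"
  unfolding biproduct_ar by (auto simp: ar_iff)

lemma biproduct_ext_from:
  assumes "biproduct C X Y S i1 i2 p1 p2" "is_arr f" "is_arr g" "src f = S" "src g = S"
    "tgt f = tgt g" "f \<cdot> i1 = g \<cdot> i1" "f \<cdot> i2 = g \<cdot> i2"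
  shows "f = g"
proof -
  have t: "ar i1 X S" "ar i2 Y S" "ar p1 S X" "ar p2 S Y" and e: "i1 \<cdot> p1 \<boxplus> i2 \<cdot> p2 = idm C S"
    using assms(1) unfolding biproduct_ar by blast+
  have "f = f \<cdot> (i1 \<cdot> p1 \<boxplus> i2 \<cdot> p2)" "g = g \<cdot> (i1 \<cdot> p1 \<boxplus> i2 \<cdot> p2)" using e t assms(2-5) by (simp_all del: cmp_madd add: ar_iff)
  moreover have "f \<cdot> (i1 \<cdot> p1 \<boxplus> i2 \<cdot> p2) = (f \<cdot> i1) \<cdot> p1 \<boxplus> (f \<cdot> i2) \<cdot> p2"
    "g \<cdot> (i1 \<cdot> p1 \<boxplus> i2 \<cdot> p2) = (g \<cdot> i1) \<cdot> p1 \<boxplus> (g \<cdot> i2) \<cdot> p2"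
    using t assms(2-6) by (simp_all add: ar_iff)
  ultimately show ?thesis using assms(7,8) by metis
qed

lemma biproduct_ext_to:
  assumes "biproduct C X Y S i1 i2 p1 p2" "is_arr f" "is_arr g" "tgt f = S" "tgt g = S"
    "src f = src g" "p1 \<cdot> f = p1 \<cdot> g" "p2 \<cdot> f = p2 \<cdot> g"
  shows "f = g"
proof -
  have t: "ar i1 X S" "ar i2 Y S" "ar p1 S X" "ar p2 S Y" and e: "i1 \<cdot> p1 \<boxplus> i2 \<cdot> p2 = idm C S"
    using assms(1) unfolding biproduct_ar by blast+
  have "f = (i1 \<cdot> p1 \<boxplus> i2 \<cdot> p2) \<cdot> f" "g = (i1 \<cdot> p1 \<boxplus> i2 \<cdot> p2) \<cdot> g" using e t assms(2-5) by (simp_all del: cmp_madd add: ar_iff)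
  moreover have "(i1 \<cdot> p1 \<boxplus> i2 \<cdot> p2) \<cdot> f = i1 \<cdot> (p1 \<cdot> f) \<boxplus> i2 \<cdot> (p2 \<cdot> f)"
    "(i1 \<cdot> p1 \<boxplus> i2 \<cdot> p2) \<cdot> g = i1 \<cdot> (p1 \<cdot> g) \<boxplus> i2 \<cdot> (p2 \<cdot> g)"
    using t assms(2-6) by (simp_all add: ar_iff)
  ultimately show ?thesis using assms(7,8) by metis
qed

end

section \<open>The homotopy category\<close>

declare Kcat_simps [simp del]

context additive_category begin

text \<open>Bundling a chain map with the membership of its two complexes makes a single fact supply
  all typing information.\<close>

definition cm :: "('o, 'a) cplx \<Rightarrow> ('o, 'a) cplx \<Rightarrow> (int \<Rightarrow> 'a) \<Rightarrow> bool" where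
  "cm X Y f \<longleftrightarrow> X \<in> complexes C \<and> Y \<in> complexes C \<and> f \<in> chain_maps C X Y"

lemma complexes_ar: "X \<in> complexes C \<longleftrightarrow> (\<forall>n. ar (cdf X n) (cob X n) (cob X (n + 1)) \<and>
    cdf X (n + 1) \<cdot> cdf X n = zr (cob X n) (cob X (n + 1 + 1)))"
  unfolding complexes_def ar_def by blast

text \<open>The upper degree is a separate variable \<open>m\<close>, so that d d = 0 still applies
  after simplification has changed the arithmetic form of \<open>n + 1\<close>.\<close>

lemma cplxD:
  assumes "X \<in> complexes C"
  shows "is_arr (cdf X n)" "src (cdf X n) = cob X n" "tgt (cdf X n) = cob X (n + 1)"
    "cob X n \<in> Obj C" "m = n + 1 \<Longrightarrow> cdf X m \<cdot> cdf X n = zr (cob X n) (cob X (m + 1))"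
  using assms unfolding complexes_ar ar_iff by blast+

lemma cm_ar: "cm X Y f \<longleftrightarrow> X \<in> complexes C \<and> Y \<in> complexes C \<and>
    (\<forall>n. ar (f n) (cob X n) (cob Y n) \<and> cdf Y n \<cdot> f n = f (n + 1) \<cdot> cdf X n)"
  unfolding cm_def chain_maps_def using cplxD(4) by (auto simp: ar_def)

lemma cmD:
  assumes "cm X Y f"
  shows "is_arr (f n)" "src (f n) = cob X n" "tgt (f n) = cob Y n"
    "cdf Y n \<cdot> f n = f (n + 1) \<cdot> cdf X n"
  using assms unfolding cm_ar ar_iff by blast+

lemma cm_cplx: "cm X Y f \<Longrightarrow> X \<in> complexes C" "cm X Y f \<Longrightarrow> Y \<in> complexes C"
  by (auto simp: cm_def)

lemma cm_id: "X \<in> complexes C \<Longrightarrow> cm X X (\<lambda>n. idm C (cob X n))"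
  unfolding cm_ar ar_iff by (simp add: cplxD)

lemma cm_cmp: assumes "cm X Y f" "cm Y Z g" shows "cm X Z (\<lambda>n. g n \<cdot> f n)"
proof -
  note [simp] = cmD[OF assms(1)] cmD[OF assms(2)] cplxD[OF cm_cplx(1)[OF assms(1)]]
    cplxD[OF cm_cplx(2)[OF assms(1)]] cplxD[OF cm_cplx(2)[OF assms(2)]]
    cmD(4)[OF assms(1), THEN ra] cmD(4)[OF assms(2), THEN ra]
  show ?thesis unfolding cm_ar ar_iff using cm_cplx assms by (auto)
qed

lemma homotopicI:
  assumes "\<And>n. ar (s n) (cob X n) (cob Y (n - 1))"
    "\<And>n. f n = g n \<boxplus> (cdf Y (n - 1) \<cdot> s n \<boxplus> s (n + 1) \<cdot> cdf X n)"
  shows "homotopic C X Y f g"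
  unfolding homotopic_def using assms by (auto simp: ar_def intro!: exI[of _ s])

lemma homotopicE:
  assumes "homotopic C X Y f g" "X \<in> complexes C" "Y \<in> complexes C"
  obtains s where "\<forall>n. is_arr (s n) \<and> src (s n) = cob X n \<and> tgt (s n) = cob Y (n - 1)"
    "\<forall>n. f n = g n \<boxplus> (cdf Y (n - 1) \<cdot> s n \<boxplus> s (n + 1) \<cdot> cdf X n)"
proof -
  obtain s where s: "\<And>n. s n \<in> Hom C (cob X n) (cob Y (n - 1))"
    "\<And>n. f n = g n \<boxplus> (cdf Y (n - 1) \<cdot> s n \<boxplus> s (n + 1) \<cdot> cdf X n)"
    using assms(1) unfolding homotopic_def by blast
  have "\<And>n. ar (s n) (cob X n) (cob Y (n - 1))"
    using s(1) cplxD(4)[OF assms(2)] cplxD(4)[OF assms(3)] by (simp add: ar_def)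
  then show thesis using s(2) that unfolding ar_iff by blast
qed

lemma homotopic_refl: assumes "cm X Y f" shows "homotopic C X Y f f"
proof -
  note [simp] = cmD[OF assms] cplxD[OF cm_cplx(1)[OF assms]] cplxD[OF cm_cplx(2)[OF assms]]
  show ?thesis by (rule homotopicI[where s = "\<lambda>n. zr (cob X n) (cob Y (n - 1))"]) (auto simp: ar_iff)
qed

lemma homotopic_sym:
  assumes "cm X Y g" "homotopic C X Y f g" shows "homotopic C X Y g f"
proof -
  note [simp] = cmD[OF assms(1)] cplxD[OF cm_cplx(1)[OF assms(1)]] cplxD[OF cm_cplx(2)[OF assms(1)]]
  obtain s where s[rule_format, simp]: "\<forall>n. is_arr (s n) \<and> src (s n) = cob X n \<and> tgt (s n) = cob Y (n - 1)"
    and f[rule_format]: "\<forall>n. f n = g n \<boxplus> (cdf Y (n - 1) \<cdot> s n \<boxplus> s (n + 1) \<cdot> cdf X n)"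
    using assms(2) cm_cplx[OF assms(1)] by (rule homotopicE)
  show ?thesis
  proof (rule homotopicI[where s = "\<lambda>n. neg (s n)"])
    show "g n = f n \<boxplus> (cdf Y (n - 1) \<cdot> neg (s n) \<boxplus> neg (s (n + 1)) \<cdot> cdf X n)" for n
    proof -
      define k where "k = cdf Y (n - 1) \<cdot> s n \<boxplus> s (n + 1) \<cdot> cdf X n"
      have k: "is_arr k" "src k = cob X n" "tgt k = cob Y n" by (simp_all add: k_def)
      have "cdf Y (n - 1) \<cdot> neg (s n) \<boxplus> neg (s (n + 1)) \<cdot> cdf X n = neg k"
        by (simp add: k_def)
      moreover have "f n = g n \<boxplus> k" by (simp add: f k_def)
      moreover have "(g n \<boxplus> k) \<boxplus> neg k = g n" using k by (simp add: madd_assoc)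
      ultimately show ?thesis by simp
    qed
  qed (simp add: ar_iff)
qed

lemma homotopic_trans:
  assumes "cm X Y h" "homotopic C X Y f g" "homotopic C X Y g h" shows "homotopic C X Y f h"
proof -
  note [simp] = cmD[OF assms(1)] cplxD[OF cm_cplx(1)[OF assms(1)]] cplxD[OF cm_cplx(2)[OF assms(1)]]
  obtain s where s[rule_format, simp]: "\<forall>n. is_arr (s n) \<and> src (s n) = cob X n \<and> tgt (s n) = cob Y (n - 1)"
    and f[rule_format]: "\<forall>n. f n = g n \<boxplus> (cdf Y (n - 1) \<cdot> s n \<boxplus> s (n + 1) \<cdot> cdf X n)"
    using assms(2) cm_cplx[OF assms(1)] by (rule homotopicE)
  obtain t where t[rule_format, simp]: "\<forall>n. is_arr (t n) \<and> src (t n) = cob X n \<and> tgt (t n) = cob Y (n - 1)"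
    and g[rule_format]: "\<forall>n. g n = h n \<boxplus> (cdf Y (n - 1) \<cdot> t n \<boxplus> t (n + 1) \<cdot> cdf X n)"
    using assms(3) cm_cplx[OF assms(1)] by (rule homotopicE)
  show ?thesis
    by (rule homotopicI[where s = "\<lambda>n. s n \<boxplus> t n"]) (simp_all add: ar_iff f g madd_ac)
qed

lemma homotopic_cmp_left:
  assumes "cm Y Z g" "cm X Y f'" "homotopic C X Y f f'"
  shows "homotopic C X Z (\<lambda>n. g n \<cdot> f n) (\<lambda>n. g n \<cdot> f' n)"
proof -
  note [simp] = cmD[OF assms(1)] cmD[OF assms(2)] cplxD[OF cm_cplx(1)[OF assms(1)]]
    cplxD[OF cm_cplx(2)[OF assms(1)]] cplxD[OF cm_cplx(1)[OF assms(2)]] cmD(4)[OF assms(1), THEN ra]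
  obtain s where s[rule_format, simp]: "\<forall>n. is_arr (s n) \<and> src (s n) = cob X n \<and> tgt (s n) = cob Y (n - 1)"
    and f[rule_format]: "\<forall>n. f n = f' n \<boxplus> (cdf Y (n - 1) \<cdot> s n \<boxplus> s (n + 1) \<cdot> cdf X n)"
    using assms(3) cm_cplx[OF assms(2)] by (rule homotopicE)
  show ?thesis
    by (rule homotopicI[where s = "\<lambda>n. g (n - 1) \<cdot> s n"]) (simp_all add: ar_iff f)
qed

lemma homotopic_cmp_right:
  assumes "cm X Y f" "cm Y Z g'" "homotopic C Y Z g g'"
  shows "homotopic C X Z (\<lambda>n. g n \<cdot> f n) (\<lambda>n. g' n \<cdot> f n)"
proof -
  note [simp] = cmD[OF assms(1)] cmD[OF assms(2)] cplxD[OF cm_cplx(1)[OF assms(1)]]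
    cplxD[OF cm_cplx(1)[OF assms(2)]] cplxD[OF cm_cplx(2)[OF assms(2)]] cmD(4)[OF assms(1), THEN ra]
  obtain s where s[rule_format, simp]: "\<forall>n. is_arr (s n) \<and> src (s n) = cob Y n \<and> tgt (s n) = cob Z (n - 1)"
    and f[rule_format]: "\<forall>n. g n = g' n \<boxplus> (cdf Z (n - 1) \<cdot> s n \<boxplus> s (n + 1) \<cdot> cdf Y n)"
    using assms(3) cm_cplx[OF assms(2)] by (rule homotopicE)
  show ?thesis
    by (rule homotopicI[where s = "\<lambda>n. s n \<cdot> f n"]) (simp_all add: ar_iff f)
qed

lemma homotopic_cmp:
  assumes "cm X Y f" "cm X Y f'" "cm Y Z g" "cm Y Z g'" "homotopic C X Y f f'" "homotopic C Y Z g g'"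
  shows "homotopic C X Z (\<lambda>n. g n \<cdot> f n) (\<lambda>n. g' n \<cdot> f' n)"
  using homotopic_trans[OF cm_cmp[OF assms(2,4)] homotopic_cmp_left[OF assms(3,2,5)]
    homotopic_cmp_right[OF assms(2,4,6)]] .

lemma kmor_eq_iff:
  assumes "cm X Y f" "cm X Y g" shows "kmor C X Y f = kmor C X Y g \<longleftrightarrow> homotopic C X Y f g"
proof
  assume "kmor C X Y f = kmor C X Y g"
  moreover have "f \<in> hclass C X Y f" using assms(1) homotopic_refl by (simp add: hclass_def cm_def)
  ultimately show "homotopic C X Y f g" by (simp add: kmor_def hclass_def)
next
  assume h: "homotopic C X Y f g"
  have "hclass C X Y f = hclass C X Y g"
    unfolding hclass_def using homotopic_trans[OF assms(2) _ h]
      homotopic_trans[OF assms(1) _ homotopic_sym[OF assms(2) h]] by blast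
  then show "kmor C X Y f = kmor C X Y g" by (simp add: kmor_def)
qed

text \<open>The union over all representatives in the definition of composition collapses because
  homotopic representatives give the same class.\<close>

lemma kmor_cmp:
  assumes "cm X Y f" "cm Y Z g"
  shows "kmor C Y Z g \<cdot>\<^bsub>Kcat C\<^esub> kmor C X Y f = kmor C X Z (\<lambda>n. g n \<cdot> f n)"
proof -
  have "hclass C X Z (\<lambda>n. g' n \<cdot> f' n) = hclass C X Z (\<lambda>n. g n \<cdot> f n)"
    if "g' \<in> hclass C Y Z g" "f' \<in> hclass C X Y f" for f' g'
  proof -
    have *: "cm X Y f'" "cm Y Z g'" "homotopic C X Y f' f" "homotopic C Y Z g' g"
      using that assms by (simp_all add: hclass_def cm_def)
    have "kmor C X Z (\<lambda>n. g' n \<cdot> f' n) = kmor C X Z (\<lambda>n. g n \<cdot> f n)"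
      using kmor_eq_iff[OF cm_cmp[OF *(1,2)] cm_cmp[OF assms]]
        homotopic_cmp[OF *(1) assms(1) *(2) assms(2) *(3,4)] by simp
    then show ?thesis by (simp add: kmor_def)
  qed
  moreover have "f \<in> hclass C X Y f" "g \<in> hclass C Y Z g"
    using assms homotopic_refl by (simp_all add: hclass_def cm_def)
  ultimately have "(\<Union>g'\<in>hclass C Y Z g. \<Union>f'\<in>hclass C X Y f. hclass C X Z (\<lambda>n. g' n \<cdot> f' n)) =
      hclass C X Z (\<lambda>n. g n \<cdot> f n)" by blast
  then show ?thesis by (simp add: Kcat_simps Kadd_def kmor_def)
qed

lemma K_idm: "idm (Kcat C) X = kmor C X X (\<lambda>n. idm C (cob X n))"
  by (simp add: Kcat_simps Kadd_def)

lemma K_Obj [simp]: "Obj (Kcat C) = complexes C"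
  by (simp add: Kcat_simps)

lemma K_Hom_iff:
  "X \<in> complexes C \<Longrightarrow> Y \<in> complexes C \<Longrightarrow>
    \<phi> \<in> Hom (Kcat C) X Y \<longleftrightarrow> (\<exists>f. cm X Y f \<and> \<phi> = kmor C X Y f)"
  by (auto simp: Kcat_simps cm_def)

lemma K_category: "category (Kcat C)"
proof
  fix X Y X' Y' f
  assume "f \<in> Hom (Kcat C) X Y" "f \<in> Hom (Kcat C) X' Y'"
  then show "X = X' \<and> Y = Y'" by (auto simp: Kcat_simps kmor_def)
next
  fix X assume "X \<in> Obj (Kcat C)"
  then show "idm (Kcat C) X \<in> Hom (Kcat C) X X" using cm_id by (auto simp: K_Hom_iff K_idm)
next
  fix X Y Z f g
  assume *: "X \<in> Obj (Kcat C)" "Y \<in> Obj (Kcat C)" "Z \<in> Obj (Kcat C)"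
    "f \<in> Hom (Kcat C) X Y" "g \<in> Hom (Kcat C) Y Z"
  then obtain a b where "cm X Y a" "f = kmor C X Y a" "cm Y Z b" "g = kmor C Y Z b"
    by (auto simp: K_Hom_iff)
  then show "g \<cdot>\<^bsub>Kcat C\<^esub> f \<in> Hom (Kcat C) X Z"
    using * kmor_cmp cm_cmp by (simp add: K_Hom_iff) blast
next
  fix X Y f
  assume *: "X \<in> Obj (Kcat C)" "Y \<in> Obj (Kcat C)" "f \<in> Hom (Kcat C) X Y"
  then obtain a where a: "cm X Y a" "f = kmor C X Y a" by (auto simp: K_Hom_iff)
  have "(\<lambda>n. a n \<cdot> idm C (cob X n)) = a" "(\<lambda>n. idm C (cob Y n) \<cdot> a n) = a" using cmD[OF a(1)] by auto
  then show "f \<cdot>\<^bsub>Kcat C\<^esub> idm (Kcat C) X = f" "idm (Kcat C) Y \<cdot>\<^bsub>Kcat C\<^esub> f = f"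
    using a kmor_cmp cm_id cm_cplx by (simp_all add: K_idm)
next
  fix X Y Z V f g h
  assume *: "X \<in> Obj (Kcat C)" "Y \<in> Obj (Kcat C)" "Z \<in> Obj (Kcat C)" "V \<in> Obj (Kcat C)"
    "f \<in> Hom (Kcat C) X Y" "g \<in> Hom (Kcat C) Y Z" "h \<in> Hom (Kcat C) Z V"
  then obtain a b c where a: "cm X Y a" "f = kmor C X Y a" "cm Y Z b" "g = kmor C Y Z b"
      "cm Z V c" "h = kmor C Z V c"
    by (auto simp: K_Hom_iff)
  have "(\<lambda>n. (c n \<cdot> b n) \<cdot> a n) = (\<lambda>n. c n \<cdot> (b n \<cdot> a n))" using cmD[OF a(1)] cmD[OF a(3)] cmD[OF a(5)] by auto
  then show "h \<cdot>\<^bsub>Kcat C\<^esub> g \<cdot>\<^bsub>Kcat C\<^esub> f = h \<cdot>\<^bsub>Kcat C\<^esub> (g \<cdot>\<^bsub>Kcat C\<^esub> f)"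
    using a cm_cmp[OF a(1,3)] cm_cmp[OF a(3,5)] by (simp add: kmor_cmp)
qed

end

sublocale additive_category \<subseteq> K: category "Kcat C"
  by (rule K_category)

context additive_category begin

lemma K_ar_iff: "K.ar \<phi> X Y \<longleftrightarrow> (\<exists>f. cm X Y f \<and> \<phi> = kmor C X Y f)"
  unfolding K.ar_def using K_Hom_iff cm_cplx by (metis K_Obj)

lemma K_ar_kmor: "cm X Y f \<Longrightarrow> K.ar (kmor C X Y f) X Y"
  using K_ar_iff by blast

section \<open>Homotopy equivalences as the isomorphisms of K\<close>

definition heq where
  "heq X Y f g \<longleftrightarrow> cm X Y f \<and> cm Y X g \<and>
     homotopic C X X (\<lambda>n. g n \<cdot> f n) (\<lambda>n. idm C (cob X n)) \<and>
     homotopic C Y Y (\<lambda>n. f n \<cdot> g n) (\<lambda>n. idm C (cob Y n))"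

lemma heq_iso: assumes "heq X Y f g" shows "iso_arrow (Kcat C) X Y (kmor C X Y f)"
proof -
  note h = assms[unfolded heq_def]
  have c: "X \<in> complexes C" "Y \<in> complexes C" using h cm_cplx by blast+
  have "kmor C Y X g \<cdot>\<^bsub>Kcat C\<^esub> kmor C X Y f = idm (Kcat C) X"
    using h by (simp add: kmor_cmp K_idm kmor_eq_iff[OF cm_cmp[of X Y f X g] cm_id[OF c(1)]])
  moreover have "kmor C X Y f \<cdot>\<^bsub>Kcat C\<^esub> kmor C Y X g = idm (Kcat C) Y"
    using h by (simp add: kmor_cmp K_idm kmor_eq_iff[OF cm_cmp[of Y X g Y f] cm_id[OF c(2)]])
  ultimately show ?thesis using h K_ar_kmor unfolding K.iso_arrow_ar by blast
qed

lemma iso_heqE: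
  assumes "iso_arrow (Kcat C) X Y \<phi>"
  obtains f g where "heq X Y f g" "\<phi> = kmor C X Y f"
proof -
  obtain \<gamma> where 1: "K.ar \<phi> X Y" "K.ar \<gamma> Y X" "\<gamma> \<cdot>\<^bsub>Kcat C\<^esub> \<phi> = idm (Kcat C) X"
    "\<phi> \<cdot>\<^bsub>Kcat C\<^esub> \<gamma> = idm (Kcat C) Y"
    using assms by (rule K.iso_arrowE)
  then obtain f g where 2: "cm X Y f" "\<phi> = kmor C X Y f" "cm Y X g" "\<gamma> = kmor C Y X g"
    unfolding K_ar_iff by blast
  have c: "X \<in> complexes C" "Y \<in> complexes C" using 2 cm_cplx by blast+
  have "homotopic C X X (\<lambda>n. g n \<cdot> f n) (\<lambda>n. idm C (cob X n))"
     "homotopic C Y Y (\<lambda>n. f n \<cdot> g n) (\<lambda>n. idm C (cob Y n))"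
    using 1(3,4) 2 by (simp_all add: kmor_cmp K_idm kmor_eq_iff[OF cm_cmp[of X Y f X g] cm_id[OF c(1)]]
        kmor_eq_iff[OF cm_cmp[of Y X g Y f] cm_id[OF c(2)]])
  then show thesis using that 2 unfolding heq_def by blast
qed

text \<open>The boundary of an arbitrary degree -1 family is a chain map; this is how a class is
  moved to a more convenient representative.\<close>

lemma cm_cong_homotopic:
  assumes "cm X Y f" "\<And>n. ar (s n) (cob X n) (cob Y (n - 1))"
  shows "cm X Y (\<lambda>n. f n \<boxplus> (cdf Y (n - 1) \<cdot> s n \<boxplus> s (n + 1) \<cdot> cdf X n))"
proof -
  note [simp] = cmD[OF assms(1)] cplxD[OF cm_cplx(1)[OF assms(1)]] cplxD[OF cm_cplx(2)[OF assms(1)]]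
    cplxD(5)[OF cm_cplx(1)[OF assms(1)], THEN ra] cplxD(5)[OF cm_cplx(2)[OF assms(1)], THEN ra]
    assms(2)[unfolded ar_iff]
  have [simp]: "2 + n - 1 = n + 1" for n :: int by simp
  show ?thesis unfolding cm_ar ar_iff using cm_cplx[OF assms(1)] by simp
qed

section \<open>Shifts of complexes and the weight classes of \<open>w_st\<close>\<close>

lemma cshift_cob [simp]: "cob (cshift C k X) n = cob X (n + k)"
  by (simp add: cshift_def)

lemma cshift_cdf: "X \<in> complexes C \<Longrightarrow>
    cdf (cshift C k X) n = (if even k then cdf X (n + k) else neg (cdf X (n + k)))"
  by (simp add: cshift_def cplxD algebra_simps)

lemma cshift_complex [simp]:
  assumes "X \<in> complexes C" shows "cshift C k X \<in> complexes C"
proof -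
  note [simp] = cplxD[OF assms] cshift_cdf[OF assms]
  have *: "n + 1 + k = n + k + 1" for n by simp
  show ?thesis unfolding complexes_ar ar_iff cshift_cob
    by (simp add: * add.assoc neg_eq_zr) (simp add: add.left_commute add.commute)
qed

lemma cshift_0: "X \<in> complexes C \<Longrightarrow> cshift C 0 X = X"
  by (rule cplx.equality) (auto simp: cshift_cdf fun_eq_iff)

lemma cshift_add: assumes "X \<in> complexes C" shows "cshift C k (cshift C l X) = cshift C (k + l) X"
  by (rule cplx.equality) (auto simp: cshift_cdf assms fun_eq_iff add.assoc cplxD[OF assms])

lemma cm_shift: assumes "cm X Y f" shows "cm (cshift C k X) (cshift C k Y) (\<lambda>n. f (n + k))"
proof -
  note [simp] = cmD[OF assms(1)] cplxD[OF cm_cplx(1)[OF assms(1)]] cplxD[OF cm_cplx(2)[OF assms(1)]]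
   cm_cplx[OF assms] cshift_cdf
  have *: "n + 1 + k = n + k + 1" for n by simp
  show ?thesis unfolding cm_ar ar_iff by (simp add: * )
qed

lemma homotopic_shift:
  assumes "cm X Y g" "homotopic C X Y f g"
  shows "homotopic C (cshift C k X) (cshift C k Y) (\<lambda>n. f (n + k)) (\<lambda>n. g (n + k))"
proof -
  note [simp] = cmD[OF assms(1)] cplxD[OF cm_cplx(1)[OF assms(1)]] cplxD[OF cm_cplx(2)[OF assms(1)]]
   cm_cplx[OF assms(1)] cshift_cdf
  obtain s where s[rule_format, simp]: "\<forall>n. is_arr (s n) \<and> src (s n) = cob X n \<and> tgt (s n) = cob Y (n - 1)"
    and f[rule_format]: "\<forall>n. f n = g n \<boxplus> (cdf Y (n - 1) \<cdot> s n \<boxplus> s (n + 1) \<cdot> cdf X n)"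
    using assms(2) cm_cplx[OF assms(1)] by (rule homotopicE)
  have *: "n + 1 + k = n + k + 1" "n - 1 + k = n + k - 1" for n by simp_all
  \<comment> \<open>An odd shift negates the differentials, so the homotopy has to change sign as
    well.\<close>
  show ?thesis
    by (rule homotopicI[where s = "\<lambda>n. if even k then s (n + k) else neg (s (n + k))"])
      (simp_all add: ar_iff f * )
qed

lemma kshift_kmor:
  assumes "cm X Y f"
  shows "kshift C k (kmor C X Y f) = kmor C (cshift C k X) (cshift C k Y) (\<lambda>n. f (n + k))"
proof -
  have c: "X \<in> complexes C" "Y \<in> complexes C" using assms cm_cplx by blast+
  have "(\<lambda>f n. f (n + k)) ` hclass C X Y f = hclass C (cshift C k X) (cshift C k Y) (\<lambda>n. f (n + k))"
  proof
    show "(\<lambda>f n. f (n + k)) ` hclass C X Y f \<subseteq> hclass C (cshift C k X) (cshift C k Y) (\<lambda>n. f (n + k))"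
      unfolding hclass_def using cm_shift homotopic_shift[OF assms] c by (auto simp: cm_def)
    show "hclass C (cshift C k X) (cshift C k Y) (\<lambda>n. f (n + k)) \<subseteq> (\<lambda>f n. f (n + k)) ` hclass C X Y f"
    proof
      fix g assume g: "g \<in> hclass C (cshift C k X) (cshift C k Y) (\<lambda>n. f (n + k))"
      have g1: "cm (cshift C k X) (cshift C k Y) g"
        "homotopic C (cshift C k X) (cshift C k Y) g (\<lambda>n. f (n + k))"
        using g c by (auto simp: hclass_def cm_def)
      \<comment> \<open>Every representative of the shifted class is itself a shift: moving it back
        by \<open>- k\<close> restores the original complexes exactly.\<close>
      have "cm X Y (\<lambda>n. g (n - k))" using cm_shift[OF g1(1), of "- k"] by (simp add: cshift_add c cshift_0)
      moreover have "homotopic C X Y (\<lambda>n. g (n - k)) f"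
        using homotopic_shift[OF cm_shift[OF assms] g1(2), of "- k"] by (simp add: cshift_add c cshift_0)
      ultimately have "(\<lambda>n. g (n - k)) \<in> hclass C X Y f" by (simp add: hclass_def cm_def)
      then show "g \<in> (\<lambda>f n. f (n + k)) ` hclass C X Y f"
        by (intro image_eqI[where x = "\<lambda>n. g (n - k)"]) simp_all
    qed
  qed
  then show ?thesis by (simp add: kshift_def kmor_def)
qed

lemma kshift_iso:
  assumes "iso_arrow (Kcat C) X Y \<phi>"
  shows "iso_arrow (Kcat C) (cshift C k X) (cshift C k Y) (kshift C k \<phi>)"
proof -
  obtain f g where fg: "heq X Y f g" "\<phi> = kmor C X Y f" using assms by (rule iso_heqE)
  note h = fg(1)[unfolded heq_def]
  have "heq (cshift C k X) (cshift C k Y) (\<lambda>n. f (n + k)) (\<lambda>n. g (n + k))"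
    unfolding heq_def using h cm_shift
      homotopic_shift[OF cm_id, of X "\<lambda>n. g n \<cdot> f n" k] homotopic_shift[OF cm_id, of Y "\<lambda>n. f n \<cdot> g n" k]
      cm_cplx by auto
  from heq_iso[OF this] show ?thesis using kshift_kmor h fg(2) by simp
qed

lemma isomorphic_cshift:
  "isomorphic (Kcat C) X Y \<Longrightarrow> isomorphic (Kcat C) (cshift C k X) (cshift C k Y)"
  unfolding isomorphic_def using kshift_iso by blast

text \<open>The term of \<open>cshift C m Y\<close> in degree \<open>n\<close> is
  \<open>cob Y (n + m)\<close>, so shifting by \<open>m\<close> moves the cohomological bound from 0
  to \<open>- m\<close>.\<close>

lemma wle_w_st: "wle (Kcat C) (w_st C) m =
    {X \<in> complexes C. \<exists>Y. isomorphic (Kcat C) X Y \<and> (\<forall>n < - m. zero_object C (cob Y n))}" (is "?L = ?R")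
proof
  show "?L \<subseteq> ?R"
  proof
    fix X assume "X \<in> ?L"
    then obtain X' Y where X: "X = cshift C m X'" "X' \<in> complexes C" "isomorphic (Kcat C) X' Y"
      "\<forall>n<0. zero_object C (cob Y n)" by (auto simp: wle_def w_st_def Kcat_simps(7))
    from X(3) have "isomorphic (Kcat C) X (cshift C m Y)" unfolding X(1) by (rule isomorphic_cshift)
    then show "X \<in> ?R" using X by (auto intro!: exI[of _ "cshift C m Y"])
  qed
  show "?R \<subseteq> ?L"
  proof
    fix X assume "X \<in> ?R"
    then obtain Y where Y: "X \<in> complexes C" "isomorphic (Kcat C) X Y" "\<forall>n < - m. zero_object C (cob Y n)" by blast
    have "isomorphic (Kcat C) (cshift C (-m) X) (cshift C (-m) Y)" using Y(2) by (rule isomorphic_cshift)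
    moreover have "X = cshift C m (cshift C (-m) X)" using Y(1) by (simp add: cshift_add cshift_0)
    ultimately show "X \<in> ?L" unfolding wle_def w_st_def Kcat_simps(7) using Y
      by (auto intro!: rev_image_eqI[of "cshift C (-m) X"] exI[of _ "cshift C (-m) Y"])
  qed
qed

lemma wge_w_st: "wge (Kcat C) (w_st C) m =
    {X \<in> complexes C. \<exists>Y. isomorphic (Kcat C) X Y \<and> (\<forall>n > - m. zero_object C (cob Y n))}" (is "?L = ?R")
proof
  show "?L \<subseteq> ?R"
  proof
    fix X assume "X \<in> ?L"
    then obtain X' Y where X: "X = cshift C m X'" "X' \<in> complexes C" "isomorphic (Kcat C) X' Y"
      "\<forall>n>0. zero_object C (cob Y n)" by (auto simp: wge_def w_st_def Kcat_simps(7))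
    from X(3) have "isomorphic (Kcat C) X (cshift C m Y)" unfolding X(1) by (rule isomorphic_cshift)
    then show "X \<in> ?R" using X by (auto intro!: exI[of _ "cshift C m Y"])
  qed
  show "?R \<subseteq> ?L"
  proof
    fix X assume "X \<in> ?R"
    then obtain Y where Y: "X \<in> complexes C" "isomorphic (Kcat C) X Y" "\<forall>n > - m. zero_object C (cob Y n)" by blast
    have "isomorphic (Kcat C) (cshift C (-m) X) (cshift C (-m) Y)" using Y(2) by (rule isomorphic_cshift)
    moreover have "X = cshift C m (cshift C (-m) X)" using Y(1) by (simp add: cshift_add cshift_0)
    ultimately show "X \<in> ?L" unfolding wge_def w_st_def Kcat_simps(7) using Y
      by (auto intro!: rev_image_eqI[of "cshift C (-m) X"] exI[of _ "cshift C (-m) Y"])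
  qed
qed

end

section \<open>Cones of chain maps\<close>

context additive_category begin

text \<open>Sorting summands with \<open>madd_ac\<close> need not place a term next to its negative;
  these rules cancel the pair across the terms in between.\<close>

lemma madd_cancel_apart2:
  assumes "is_arr f" "is_arr g" "src f = src g" "tgt f = tgt g"
  shows "f \<boxplus> (g \<boxplus> neg f) = g" "neg f \<boxplus> (g \<boxplus> f) = g"
  using assms by (simp_all add: madd_lcomm[of f g] madd_lcomm[of "neg f" g])

lemma madd_cancel_apart3:
  assumes "is_arr f" "is_arr g" "is_arr h" "src f = src g" "tgt f = tgt g" "src g = src h" "tgt g = tgt h"
  shows "f \<boxplus> (g \<boxplus> (neg f \<boxplus> h)) = g \<boxplus> h" "neg f \<boxplus> (g \<boxplus> (f \<boxplus> h)) = g \<boxplus> h"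
    "f \<boxplus> (g \<boxplus> (h \<boxplus> neg f)) = g \<boxplus> h" "neg f \<boxplus> (g \<boxplus> (h \<boxplus> f)) = g \<boxplus> h"
  using assms by (simp_all add: madd_lcomm[of f g] madd_lcomm[of "neg f" g] madd_cancel_apart2)

lemma madd_cancel_apart4:
  assumes "is_arr f" "is_arr g" "is_arr h" "is_arr k" "src f = src g" "tgt f = tgt g"
    "src g = src h" "tgt g = tgt h" "src h = src k" "tgt h = tgt k"
  shows "f \<boxplus> (g \<boxplus> (h \<boxplus> (neg f \<boxplus> k))) = g \<boxplus> (h \<boxplus> k)"
    "neg f \<boxplus> (g \<boxplus> (h \<boxplus> (f \<boxplus> k))) = g \<boxplus> (h \<boxplus> k)"
  using assms by (simp_all add: madd_lcomm[of f g] madd_lcomm[of "neg f" g] madd_cancel_apart3)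

lemmas madd_cancel_apart = madd_cancel_apart2 madd_cancel_apart3 madd_cancel_apart4

lemma coneD:
  assumes "is_cone C X Y f Z i1 i2 p1 p2" "cm X Y f"
  shows "Z \<in> complexes C"
    and "biproduct C (cob X (n + 1)) (cob Y n) (cob Z n) (i1 n) (i2 n) (p1 n) (p2 n)"
    and "is_arr (i1 n)" "src (i1 n) = cob X (n + 1)" "tgt (i1 n) = cob Z n"
    and "is_arr (i2 n)" "src (i2 n) = cob Y n" "tgt (i2 n) = cob Z n"
    and "is_arr (p1 n)" "src (p1 n) = cob Z n" "tgt (p1 n) = cob X (n + 1)"
    and "is_arr (p2 n)" "src (p2 n) = cob Z n" "tgt (p2 n) = cob Y n"
    and "p1 n \<cdot> i1 n = idm C (cob X (n + 1))" "p2 n \<cdot> i2 n = idm C (cob Y n)"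
    and "p2 n \<cdot> i1 n = zr (cob X (n + 1)) (cob Y n)" "p1 n \<cdot> i2 n = zr (cob Y n) (cob X (n + 1))"
    and "i1 n \<cdot> p1 n \<boxplus> i2 n \<cdot> p2 n = idm C (cob Z n)"
    and "cdf Z n \<cdot> i1 n = neg (i1 (n + 1) \<cdot> cdf X (n + 1)) \<boxplus> i2 (n + 1) \<cdot> f (n + 1)"
    and "cdf Z n \<cdot> i2 n = i2 (n + 1) \<cdot> cdf Y n"
    and "m = n + 1 \<Longrightarrow> p1 m \<cdot> cdf Z n = neg (cdf X m \<cdot> p1 n)"
    and "m = n + 1 \<Longrightarrow> p2 m \<cdot> cdf Z n = f m \<cdot> p1 n \<boxplus> cdf Y n \<cdot> p2 n"
proof -
  have Z: "Z \<in> complexes C" and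
    b: "\<And>n. biproduct C (cob X (n + 1)) (cob Y n) (cob Z n) (i1 n) (i2 n) (p1 n) (p2 n)" and
    d: "\<And>n. cdf Z n = i1 (n + 1) \<cdot> (cdf (cshift C 1 X) n \<cdot> p1 n) \<boxplus>
       (i2 (n + 1) \<cdot> (f (n + 1) \<cdot> p1 n) \<boxplus> i2 (n + 1) \<cdot> (cdf Y n \<cdot> p2 n))"
    using assms(1) unfolding is_cone_def by blast+
  show "Z \<in> complexes C" by fact
  show "biproduct C (cob X (n + 1)) (cob Y n) (cob Z n) (i1 n) (i2 n) (p1 n) (p2 n)" by (rule b)
  note b' [simp] = b[unfolded biproduct_ar ar_iff]
  show "is_arr (i1 n)" "src (i1 n) = cob X (n + 1)" "tgt (i1 n) = cob Z n"
     "is_arr (i2 n)" "src (i2 n) = cob Y n" "tgt (i2 n) = cob Z n"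
     "is_arr (p1 n)" "src (p1 n) = cob Z n" "tgt (p1 n) = cob X (n + 1)"
     "is_arr (p2 n)" "src (p2 n) = cob Z n" "tgt (p2 n) = cob Y n"
     "p1 n \<cdot> i1 n = idm C (cob X (n + 1))" "p2 n \<cdot> i2 n = idm C (cob Y n)"
     "p2 n \<cdot> i1 n = zr (cob X (n + 1)) (cob Y n)" "p1 n \<cdot> i2 n = zr (cob Y n) (cob X (n + 1))"
     "i1 n \<cdot> p1 n \<boxplus> i2 n \<cdot> p2 n = idm C (cob Z n)"
    by simp_all
  have e: "\<And>n. p1 n \<cdot> i1 n = idm C (cob X (n + 1))" "\<And>n. p2 n \<cdot> i2 n = idm C (cob Y n)"
     "\<And>n. p2 n \<cdot> i1 n = zr (cob X (n + 1)) (cob Y n)" "\<And>n. p1 n \<cdot> i2 n = zr (cob Y n) (cob X (n + 1))"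
    by simp_all
  note [simp] = e[THEN ra] cmD[OF assms(2)] cplxD[OF cm_cplx(1)[OF assms(2)]]
    cplxD[OF cm_cplx(2)[OF assms(2)]] cshift_cdf[OF cm_cplx(1)[OF assms(2)]]
  show "cdf Z n \<cdot> i1 n = neg (i1 (n + 1) \<cdot> cdf X (n + 1)) \<boxplus> i2 (n + 1) \<cdot> f (n + 1)"
    "cdf Z n \<cdot> i2 n = i2 (n + 1) \<cdot> cdf Y n"
    by (simp_all add: d)
  show "m = n + 1 \<Longrightarrow> p1 m \<cdot> cdf Z n = neg (cdf X m \<cdot> p1 n)"
    "m = n + 1 \<Longrightarrow> p2 m \<cdot> cdf Z n = f m \<cdot> p1 n \<boxplus> cdf Y n \<cdot> p2 n"
    by (simp_all add: d)
qed

lemma cone_cm: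
  assumes "is_cone C X Y f Z i1 i2 p1 p2" "cm X Y f"
  shows "cm Y Z i2" "cm Z (cshift C 1 X) p1"
proof -
  note [simp] = coneD[OF assms] cplxD[OF cm_cplx(1)[OF assms(2)]] cm_cplx[OF assms(2)]
    cplxD[OF cm_cplx(2)[OF assms(2)]] cplxD[OF coneD(1)[OF assms]] cshift_cdf[OF cm_cplx(1)[OF assms(2)]]
  show "cm Y Z i2" "cm Z (cshift C 1 X) p1" unfolding cm_ar ar_iff by simp_all
qed

text \<open>The connecting chain map is the off-diagonal part of the differential.\<close>

lemma cone_of_split:
  assumes "X \<in> complexes C" "Y \<in> complexes C" "Z \<in> complexes C"
    and b: "\<And>n. biproduct C (cob X (n + 1)) (cob Y n) (cob Z n) (i1 n) (i2 n) (p1 n) (p2 n)"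
    and d2: "\<And>n. cdf Z n \<cdot> i2 n = i2 (n + 1) \<cdot> cdf Y n"
    and d1: "\<And>n. p1 (n + 1) \<cdot> cdf Z n = neg (cdf X (n + 1) \<cdot> p1 n)"
  shows "cm X Y (\<lambda>n. p2 n \<cdot> (cdf Z (n - 1) \<cdot> i1 (n - 1)))"
    and "is_cone C X Y (\<lambda>n. p2 n \<cdot> (cdf Z (n - 1) \<cdot> i1 (n - 1))) Z i1 i2 p1 p2"
proof -
  note b' = b[unfolded biproduct_ar ar_iff]
  have t[simp]: "is_arr (i1 n)" "src (i1 n) = cob X (n + 1)" "tgt (i1 n) = cob Z n"
     "is_arr (i2 n)" "src (i2 n) = cob Y n" "tgt (i2 n) = cob Z n"
     "is_arr (p1 n)" "src (p1 n) = cob Z n" "tgt (p1 n) = cob X (n + 1)"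
     "is_arr (p2 n)" "src (p2 n) = cob Z n" "tgt (p2 n) = cob Y n" for n
    using b' by simp_all
  have e: "p1 n \<cdot> i1 n = idm C (cob X (n + 1))" "p2 n \<cdot> i2 n = idm C (cob Y n)"
     "p2 n \<cdot> i1 n = zr (cob X (n + 1)) (cob Y n)" "p1 n \<cdot> i2 n = zr (cob Y n) (cob X (n + 1))"
     "i1 n \<cdot> p1 n \<boxplus> i2 n \<cdot> p2 n = idm C (cob Z n)" for n
    using b' by simp_all
  note [simp] = e e(1-4)[THEN ra] cplxD[OF assms(1)] cplxD[OF assms(2)] cplxD[OF assms(3)]
    cshift_cdf[OF assms(1)]
  define f where "f = (\<lambda>n. p2 n \<cdot> (cdf Z (n - 1) \<cdot> i1 (n - 1)))"
  have tf[simp]: "is_arr (f n)" "src (f n) = cob X n" "tgt (f n) = cob Y n" for n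
    by (simp_all add: f_def)
  have di1: "cdf Z n \<cdot> i1 n = neg (i1 (n + 1) \<cdot> cdf X (n + 1)) \<boxplus> i2 (n + 1) \<cdot> f (n + 1)" for n
    by (rule biproduct_ext_to[OF b[of "n + 1"]]) (simp_all add: f_def d1 d1[THEN ra])
  have di1': "cdf Z m \<cdot> i1 n = neg (i1 (n + 1) \<cdot> cdf X (n + 1)) \<boxplus> i2 (n + 1) \<cdot> f (n + 1)" if "m = n" for m n
    using di1 that by simp
  show "cm X Y f" unfolding cm_ar ar_iff
  proof (intro conjI allI assms)
    fix n
    \<comment> \<open>The component of d d = 0 from the X summand to the Y summand says precisely
      that the off-diagonal part is a chain map.\<close>
    have "zr (cob X n) (cob Y (n + 1)) = p2 (n + 1) \<cdot> (cdf Z n \<cdot> (cdf Z (n - 1) \<cdot> i1 (n - 1)))"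
      by (simp add: cplxD(5)[OF assms(3), THEN ra] del: assoc)
    also have "\<dots> = neg (f (n + 1) \<cdot> cdf X n) \<boxplus> cdf Y n \<cdot> f n"
      by (simp add: di1' di1'[THEN ra] d2[THEN ra])
    finally show "cdf Y n \<cdot> f n = f (n + 1) \<cdot> cdf X n"
      using neg_unique[of "neg (f (n + 1) \<cdot> cdf X n)" "cdf Y n \<cdot> f n"] by simp
  qed simp_all
  have "cdf Z n = i1 (n + 1) \<cdot> (cdf (cshift C 1 X) n \<cdot> p1 n) \<boxplus>
       (i2 (n + 1) \<cdot> (f (n + 1) \<cdot> p1 n) \<boxplus> i2 (n + 1) \<cdot> (cdf Y n \<cdot> p2 n))" for n
    by (rule biproduct_ext_from[OF b[of n]]) (simp_all add: di1 d2)
  then show "is_cone C X Y f Z i1 i2 p1 p2" unfolding is_cone_def using b assms(3) by blast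
qed

lemma cone_exists:
  assumes "cm X Y f" shows "\<exists>Z i1 i2 p1 p2. is_cone C X Y f Z i1 i2 p1 p2"
proof -
  note [simp] = cmD[OF assms] cplxD[OF cm_cplx(1)[OF assms]] cplxD[OF cm_cplx(2)[OF assms]]
    cshift_cdf[OF cm_cplx(1)[OF assms]] cmD(4)[OF assms, THEN ra]
    cplxD(5)[OF cm_cplx(1)[OF assms], THEN ra] cplxD(5)[OF cm_cplx(2)[OF assms], THEN ra]
  \<comment> \<open>The object and the four arrows of a biproduct belong together, so they are
    chosen as one tuple in each degree.\<close>
  have "\<forall>n. \<exists>t. case t of (S, i1, i2, p1, p2) \<Rightarrow> biproduct C (cob X (n + 1)) (cob Y n) S i1 i2 p1 p2"
  proof
    fix n
    obtain S i1 i2 p1 p2 where "biproduct C (cob X (n + 1)) (cob Y n) S i1 i2 p1 p2"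
      using ex_biproduct[of "cob X (n + 1)" "cob Y n"] by auto
    then show "\<exists>t. case t of (S, i1, i2, p1, p2) \<Rightarrow> biproduct C (cob X (n + 1)) (cob Y n) S i1 i2 p1 p2"
      by (intro exI[of _ "(S, i1, i2, p1, p2)"]) simp
  qed
  from choice[OF this] obtain t where t: "\<forall>n. case t n of (S, i1, i2, p1, p2) \<Rightarrow>
      biproduct C (cob X (n + 1)) (cob Y n) S i1 i2 p1 p2" ..
  define S i1 i2 p1 p2 where defs: "S = (\<lambda>n. fst (t n))" "i1 = (\<lambda>n. fst (snd (t n)))"
    "i2 = (\<lambda>n. fst (snd (snd (t n))))" "p1 = (\<lambda>n. fst (snd (snd (snd (t n)))))"
    "p2 = (\<lambda>n. snd (snd (snd (snd (t n)))))"
  have b: "biproduct C (cob X (n + 1)) (cob Y n) (S n) (i1 n) (i2 n) (p1 n) (p2 n)" for n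
    using t[rule_format, of n] by (simp add: defs case_prod_beta)
  note [simp] = b[unfolded biproduct_ar ar_iff]
  have e: "p1 n \<cdot> i1 n = idm C (cob X (n + 1))" "p2 n \<cdot> i2 n = idm C (cob Y n)"
     "p2 n \<cdot> i1 n = zr (cob X (n + 1)) (cob Y n)" "p1 n \<cdot> i2 n = zr (cob Y n) (cob X (n + 1))" for n
    by simp_all
  note [simp] = e[THEN ra]
  define Z where "Z = \<lparr>cob = S, cdf = (\<lambda>n. i1 (n + 1) \<cdot> (cdf (cshift C 1 X) n \<cdot> p1 n) \<boxplus>
       (i2 (n + 1) \<cdot> (f (n + 1) \<cdot> p1 n) \<boxplus> i2 (n + 1) \<cdot> (cdf Y n \<cdot> p2 n)))\<rparr>"
  have "Z \<in> complexes C" unfolding complexes_ar ar_iff Z_def by simp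
  then have "is_cone C X Y f Z i1 i2 p1 p2"
    using b unfolding is_cone_def Z_def by simp
  then show ?thesis by blast
qed

lemma cm_inverse:
  assumes "cm X Y f" "\<And>n. ar (g n) (cob Y n) (cob X n)" "\<And>n. g n \<cdot> f n = idm C (cob X n)"
    "\<And>n. f n \<cdot> g n = idm C (cob Y n)"
  shows "heq X Y f g"
proof -
  note [simp] = cmD[OF assms(1)] cplxD[OF cm_cplx(1)[OF assms(1)]] cplxD[OF cm_cplx(2)[OF assms(1)]]
    assms(2)[unfolded ar_iff]
  have "cm Y X g" unfolding cm_ar ar_iff
  proof (intro conjI allI)
    fix n
    have "cdf X n \<cdot> g n = g (n + 1) \<cdot> (f (n + 1) \<cdot> (cdf X n \<cdot> g n))"
      by (simp add: assms(3)[THEN ra])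
    also have "\<dots> = g (n + 1) \<cdot> ((cdf Y n \<cdot> f n) \<cdot> g n)" by (subst cmD(4)[OF assms(1)]) simp
    also have "\<dots> = g (n + 1) \<cdot> (cdf Y n \<cdot> (f n \<cdot> g n))"
      by (simp del: cmD(4)[OF assms(1)])
    also have "\<dots> = g (n + 1) \<cdot> cdf Y n" by (subst assms(4)) simp
    finally show "cdf X n \<cdot> g n = g (n + 1) \<cdot> cdf Y n" .
  qed (simp_all add: cm_cplx[OF assms(1)])
  then show ?thesis unfolding heq_def using assms(1) cm_cplx[OF assms(1)]
    by (simp add: assms(3,4) homotopic_refl cm_id)
qed

text \<open>In block form \<open>q\<close> is triangular. The homotopies from the diagonal entries
  to identities assemble into a homotopy on the cone, which makes \<open>q\<close> unitriangular,
  hence strictly invertible.\<close>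

lemma cone_endo_iso:
  assumes "cm X Y f" "is_cone C X Y f Z i1 i2 p1 p2" "cm Z Z q"
    and "homotopic C X X a (\<lambda>n. idm C (cob X n))" "homotopic C Y Y b (\<lambda>n. idm C (cob Y n))"
    and s: "\<And>n. is_arr (s n)" "\<And>n. src (s n) = cob X (n + 1)" "\<And>n. tgt (s n) = cob Y n"
    and q1: "\<And>n. p1 n \<cdot> q n = a (n + 1) \<cdot> p1 n"
    and q2: "\<And>n. p2 n \<cdot> q n = b n \<cdot> p2 n \<boxplus> s n \<cdot> p1 n"
  shows "iso_arrow (Kcat C) Z Z (kmor C Z Z q)"
proof -
  note cX = cm_cplx(1)[OF assms(1)] and cY = cm_cplx(2)[OF assms(1)]
  note D = coneD[OF assms(2,1)]
  note [simp] = cmD[OF assms(1)] cmD[OF assms(3)] cplxD[OF cX] cplxD[OF cY] cplxD[OF D(1)] s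
    D(3-18) D(15-18,20-23)[THEN ra] D(22,23) q1[THEN ra] q2[THEN ra] q1 q2
  obtain x where x[rule_format, simp]: "\<forall>n. is_arr (x n) \<and> src (x n) = cob X n \<and> tgt (x n) = cob X (n - 1)"
    and a[rule_format]: "\<forall>n. a n = idm C (cob X n) \<boxplus> (cdf X (n - 1) \<cdot> x n \<boxplus> x (n + 1) \<cdot> cdf X n)"
    using assms(4) cX cX by (rule homotopicE)
  obtain y where y[rule_format, simp]: "\<forall>n. is_arr (y n) \<and> src (y n) = cob Y n \<and> tgt (y n) = cob Y (n - 1)"
    and b[rule_format]: "\<forall>n. b n = idm C (cob Y n) \<boxplus> (cdf Y (n - 1) \<cdot> y n \<boxplus> y (n + 1) \<cdot> cdf Y n)"
    using assms(5) cY cY by (rule homotopicE)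
  have [simp]: "2 + n - 1 = n + 1" for n :: int by simp
  \<comment> \<open>The shifted summand carries the differential -d of X, so \<open>x\<close> enters
    with a plus and \<open>y\<close> with a minus to cancel both diagonal errors.\<close>
  define S where "S = (\<lambda>n. i1 (n - 1) \<cdot> (x (n + 1) \<cdot> p1 n) \<boxplus> neg (i2 (n - 1) \<cdot> (y n \<cdot> p2 n)))"
  have S[simp]: "is_arr (S n)" "src (S n) = cob Z n" "tgt (S n) = cob Z (n - 1)" for n
    by (simp_all add: S_def)
  have pS: "p1 m \<cdot> S n = x (n + 1) \<cdot> p1 n" "p2 m \<cdot> S n = neg (y n \<cdot> p2 n)" if "m = n - 1" for m n
    using that by (simp_all add: S_def)
  define q' where "q' = (\<lambda>n. q n \<boxplus> (cdf Z (n - 1) \<cdot> S n \<boxplus> S (n + 1) \<cdot> cdf Z n))"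
  have cq': "cm Z Z q'" unfolding q'_def by (rule cm_cong_homotopic[OF assms(3)]) (simp add: ar_iff D(1))
  have tq'[simp]: "is_arr (q' n)" "src (q' n) = cob Z n" "tgt (q' n) = cob Z n" for n
    using cmD[OF cq'] by auto
  have hq: "homotopic C Z Z q' q"
    by (rule homotopicI[where s = S]) (simp_all add: ar_iff q'_def)
  \<comment> \<open>The off-diagonal entry after the correction by \<open>S\<close>; besides
    \<open>s\<close> it contains the contributions of the connecting map \<open>f\<close> composed
    with \<open>x\<close> and \<open>y\<close>.\<close>
  define u where "u = (\<lambda>n. s n \<boxplus> (f n \<cdot> x (n + 1) \<boxplus> neg (y (n + 1) \<cdot> f (n + 1))))"
  have u[simp]: "is_arr (u n)" "src (u n) = cob X (n + 1)" "tgt (u n) = cob Y n" for n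
    by (simp_all add: u_def)
  have q1': "p1 n \<cdot> q' n = p1 n" for n
    by (simp add: q'_def a pS pS[THEN ra] madd_ac madd_cancel_apart)
  have q2': "p2 n \<cdot> q' n = p2 n \<boxplus> u n \<cdot> p1 n" for n
    by (simp add: q'_def b pS pS[THEN ra] u_def madd_ac madd_cancel_apart)
  \<comment> \<open>The square of \<open>i2 u p1\<close> is zero because \<open>p1 i2\<close> is
    zero, so subtracting it from the identity inverts the unitriangular map.\<close>
  define r where "r = (\<lambda>n. idm C (cob Z n) \<boxplus> neg (i2 n \<cdot> (u n \<cdot> p1 n)))"
  have r[simp]: "is_arr (r n)" "src (r n) = cob Z n" "tgt (r n) = cob Z n" for n
    by (simp_all add: r_def)
  have r1: "p1 n \<cdot> r n = p1 n" and r2: "p2 n \<cdot> r n = p2 n \<boxplus> neg (u n \<cdot> p1 n)" for n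
    by (simp_all add: r_def)
  have "heq Z Z q' r"
  proof (rule cm_inverse[OF cq'])
    show "r n \<cdot> q' n = idm C (cob Z n)" for n
      by (rule biproduct_ext_to[OF D(2)[of n]])
        (simp_all add: q1' q2' r1 r2 q1'[THEN ra] q2'[THEN ra] r1[THEN ra] r2[THEN ra] madd_assoc)
    show "q' n \<cdot> r n = idm C (cob Z n)" for n
      by (rule biproduct_ext_to[OF D(2)[of n]])
        (simp_all add: q1' q2' r1 r2 q1'[THEN ra] q2'[THEN ra] r1[THEN ra] r2[THEN ra] madd_assoc)
  qed (simp add: ar_iff)
  then have "iso_arrow (Kcat C) Z Z (kmor C Z Z q')" by (rule heq_iso)
  moreover have "kmor C Z Z q' = kmor C Z Z q" using kmor_eq_iff[OF cq' assms(3)] hq by simp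
  ultimately show ?thesis by simp
qed

text \<open>The homotopy witnessing that the square commutes becomes the off-diagonal entry of the
  induced map of cones.\<close>

lemma cone_map:
  assumes "cm X Y f" "is_cone C X Y f Z i1 i2 p1 p2" "cm X' Y' f'" "is_cone C X' Y' f' Z' j1 j2 r1 r2"
    and "cm X X' a" "cm Y Y' b"
    and "homotopic C X Y' (\<lambda>n. b n \<cdot> f n) (\<lambda>n. f' n \<cdot> a n)"
  obtains c s where "cm Z Z' c" "\<forall>n. is_arr (s n) \<and> src (s n) = cob X (n + 1) \<and> tgt (s n) = cob Y' n"
    "\<forall>n. r1 n \<cdot> c n = a (n + 1) \<cdot> p1 n" "\<forall>n. r2 n \<cdot> c n = b n \<cdot> p2 n \<boxplus> s n \<cdot> p1 n"
    "\<forall>n. c n \<cdot> i2 n = j2 n \<cdot> b n"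
proof -
  note cX = cm_cplx(1)[OF assms(1)] and cY = cm_cplx(2)[OF assms(1)]
  note cX' = cm_cplx(1)[OF assms(3)] and cY' = cm_cplx(2)[OF assms(3)]
  note D = coneD[OF assms(2,1)] and D' = coneD[OF assms(4,3)]
  note [simp] = cmD[OF assms(1)] cmD[OF assms(3)] cmD[OF assms(5)] cmD[OF assms(6)]
    cplxD[OF cX] cplxD[OF cY] cplxD[OF cX'] cplxD[OF cY'] cplxD[OF D(1)] cplxD[OF D'(1)]
    D(3-18) D(15-18,20-23)[THEN ra] D(22,23) D'(3-18) D'(15-18,20-23)[THEN ra] D'(22,23)
    cmD(4)[OF assms(5), THEN ra] cmD(4)[OF assms(6), THEN ra]
  obtain s where s[rule_format, simp]: "\<forall>n. is_arr (s n) \<and> src (s n) = cob X n \<and> tgt (s n) = cob Y' (n - 1)"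
    and h[rule_format]: "\<forall>n. b n \<cdot> f n = f' n \<cdot> a n \<boxplus> (cdf Y' (n - 1) \<cdot> s n \<boxplus> s (n + 1) \<cdot> cdf X n)"
    using assms(7) cX cY' by (rule homotopicE)
  have [simp]: "2 + n - 1 = n + 1" for n :: int by simp
  define c where "c = (\<lambda>n. j1 n \<cdot> (a (n + 1) \<cdot> p1 n) \<boxplus> j2 n \<cdot> (b n \<cdot> p2 n \<boxplus> s (n + 1) \<cdot> p1 n))"
  have c[simp]: "is_arr (c n)" "src (c n) = cob Z n" "tgt (c n) = cob Z' n" for n
    by (simp_all add: c_def)
  have c1: "r1 n \<cdot> c n = a (n + 1) \<cdot> p1 n" and c2: "r2 n \<cdot> c n = b n \<cdot> p2 n \<boxplus> s (n + 1) \<cdot> p1 n"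
    and ci: "c n \<cdot> i2 n = j2 n \<cdot> b n" for n
    by (simp_all add: c_def)
  have "cm Z Z' c" unfolding cm_ar ar_iff
  proof (intro conjI allI D(1) D'(1))
    show "cdf Z' n \<cdot> c n = c (n + 1) \<cdot> cdf Z n" for n
      by (rule biproduct_ext_to[OF D'(2)[of "n + 1"]])
        (simp_all add: c1 c2 c1[THEN ra] c2[THEN ra] h[THEN ra] madd_ac madd_cancel_apart)
  qed simp_all
  then show thesis by (rule that[where s = "\<lambda>n. s (n + 1)"]) (auto simp: c1 c2 ci)
qed

text \<open>The composites of the two induced maps are triangular with diagonal homotopic to the identity.\<close>

lemma cone_iso:
  assumes "cm X Y f" "is_cone C X Y f Z i1 i2 p1 p2" "cm X' Y' f'" "is_cone C X' Y' f' Z' j1 j2 r1 r2"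
    and "iso_arrow (Kcat C) X X' \<alpha>" "iso_arrow (Kcat C) Y Y' \<beta>"
    and "\<beta> \<cdot>\<^bsub>Kcat C\<^esub> kmor C X Y f = kmor C X' Y' f' \<cdot>\<^bsub>Kcat C\<^esub> \<alpha>"
  obtains \<gamma> where "iso_arrow (Kcat C) Z Z' \<gamma>"
    "\<gamma> \<cdot>\<^bsub>Kcat C\<^esub> kmor C Y Z i2 = kmor C Y' Z' j2 \<cdot>\<^bsub>Kcat C\<^esub> \<beta>"
    "kmor C Z' (cshift C 1 X') r1 \<cdot>\<^bsub>Kcat C\<^esub> \<gamma> = kshift C 1 \<alpha> \<cdot>\<^bsub>Kcat C\<^esub> kmor C Z (cshift C 1 X) p1"
proof -
  obtain a a' where a: "heq X X' a a'" "\<alpha> = kmor C X X' a" using assms(5) by (rule iso_heqE)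
  obtain b b' where b: "heq Y Y' b b'" "\<beta> = kmor C Y Y' b" using assms(6) by (rule iso_heqE)
  note a1 = a(1)[unfolded heq_def] and b1 = b(1)[unfolded heq_def]
  have ca: "cm X X' a" "cm X' X a'" and cb: "cm Y Y' b" "cm Y' Y b'" using a1 b1 by blast+
  note D = coneD[OF assms(2,1)] and D' = coneD[OF assms(4,3)]
  have h: "homotopic C X Y' (\<lambda>n. b n \<cdot> f n) (\<lambda>n. f' n \<cdot> a n)"
    using assms(7) unfolding a(2) b(2) kmor_cmp[OF assms(1) cb(1)] kmor_cmp[OF ca(1) assms(3)]
    by (simp add: kmor_eq_iff[OF cm_cmp[OF assms(1) cb(1)] cm_cmp[OF ca(1) assms(3)]])
  note t = cmD(1-3)[OF assms(1)] cmD(1-3)[OF assms(3)] cmD(1-3)[OF ca(1)] cmD(1-3)[OF ca(2)]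
    cmD(1-3)[OF cb(1)] cmD(1-3)[OF cb(2)]
  \<comment> \<open>The square of the inverses commutes up to homotopy along f a' ~ b' b f a' ~ b'
    f' a a' ~ b' f'.\<close>
  have "homotopic C X' Y (\<lambda>n. f n \<cdot> a' n) (\<lambda>n. b' n \<cdot> f' n)"
  proof -
    have 1: "homotopic C X' Y (\<lambda>n. b' n \<cdot> (b n \<cdot> (f n \<cdot> a' n))) (\<lambda>n. f n \<cdot> a' n)"
      using homotopic_cmp_right[OF cm_cmp[OF ca(2) assms(1)] cm_id[OF cm_cplx(1)[OF cb(1)]], of "\<lambda>n. b' n \<cdot> b n"]
        b1 by (simp add: t)
    have 2: "homotopic C X' Y (\<lambda>n. b' n \<cdot> (b n \<cdot> (f n \<cdot> a' n))) (\<lambda>n. b' n \<cdot> (f' n \<cdot> (a n \<cdot> a' n)))"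
      using homotopic_cmp_left[OF cb(2) cm_cmp[OF ca(2) cm_cmp[OF ca(1) assms(3)]]
        homotopic_cmp_right[OF ca(2) cm_cmp[OF ca(1) assms(3)] h]] by (simp add: t)
    have 3: "homotopic C X' Y (\<lambda>n. b' n \<cdot> (f' n \<cdot> (a n \<cdot> a' n))) (\<lambda>n. b' n \<cdot> f' n)"
      using homotopic_cmp_left[OF cm_cmp[OF assms(3) cb(2)] cm_id[OF cm_cplx(2)[OF ca(1)]], of "\<lambda>n. a n \<cdot> a' n"]
        a1 by (simp add: t)
    have 4: "cm X' Y (\<lambda>n. f n \<cdot> a' n)" "cm X' Y (\<lambda>n. b' n \<cdot> f' n)"
      using cm_cmp ca cb assms by blast+
    show ?thesis
      using homotopic_trans[OF 4(2) homotopic_sym[OF 4(1) 1] homotopic_trans[OF 4(2) 2 3]] .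
  qed
  from homotopic_sym[OF cm_cmp[OF assms(3) cb(2)] this]
  have h': "homotopic C X' Y (\<lambda>n. b' n \<cdot> f' n) (\<lambda>n. f n \<cdot> a' n)" .
  obtain c s where c: "cm Z Z' c" and s[rule_format]: "\<forall>n. is_arr (s n) \<and> src (s n) = cob X (n + 1) \<and> tgt (s n) = cob Y' n"
    and c1[rule_format]: "\<forall>n. r1 n \<cdot> c n = a (n + 1) \<cdot> p1 n" and c2[rule_format]: "\<forall>n. r2 n \<cdot> c n = b n \<cdot> p2 n \<boxplus> s n \<cdot> p1 n"
    and ci[rule_format]: "\<forall>n. c n \<cdot> i2 n = j2 n \<cdot> b n"
    using assms(1-4) ca(1) cb(1) h by (rule cone_map)
  obtain c' s' where c': "cm Z' Z c'" and s'[rule_format]: "\<forall>n. is_arr (s' n) \<and> src (s' n) = cob X' (n + 1) \<and> tgt (s' n) = cob Y n"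
    and c1'[rule_format]: "\<forall>n. p1 n \<cdot> c' n = a' (n + 1) \<cdot> r1 n" and c2'[rule_format]: "\<forall>n. p2 n \<cdot> c' n = b' n \<cdot> r2 n \<boxplus> s' n \<cdot> r1 n"
    and ci'[rule_format]: "\<forall>n. c' n \<cdot> j2 n = i2 n \<cdot> b' n"
    using assms(3,4,1,2) ca(2) cb(2) h' by (rule cone_map)
  note t2 = t cmD(1-3)[OF c] cmD(1-3)[OF c'] s s' D(3-14) D'(3-14)
  \<comment> \<open>Matrix multiplication: the diagonal of the composite is \<open>a' a\<close> and
    \<open>b' b\<close>, and its off-diagonal entry is the given \<open>s\<close>.\<close>
  have i1: "iso_arrow (Kcat C) Z Z (kmor C Z Z (\<lambda>n. c' n \<cdot> c n))"
    by (rule cone_endo_iso[OF assms(1,2) cm_cmp[OF c c'], where a = "\<lambda>n. a' n \<cdot> a n" and b = "\<lambda>n. b' n \<cdot> b n"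
          and s = "\<lambda>n. b' n \<cdot> s n \<boxplus> s' n \<cdot> a (n + 1)"])
      (use a1 b1 in \<open>simp_all add: t2 c1' c1'[THEN ra] c2'[THEN ra] c1 c2 madd_assoc\<close>)
  have i2: "iso_arrow (Kcat C) Z' Z' (kmor C Z' Z' (\<lambda>n. c n \<cdot> c' n))"
    by (rule cone_endo_iso[OF assms(3,4) cm_cmp[OF c' c], where a = "\<lambda>n. a n \<cdot> a' n" and b = "\<lambda>n. b n \<cdot> b' n"
          and s = "\<lambda>n. b n \<cdot> s' n \<boxplus> s n \<cdot> a' (n + 1)"])
      (use a1 b1 in \<open>simp_all add: t2 c1[THEN ra] c2[THEN ra] c1' c2' madd_assoc\<close>)
  have "iso_arrow (Kcat C) Z Z' (kmor C Z Z' c)"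
    by (rule K.iso_of_iso_composites[of _ _ _ "kmor C Z' Z c'"])
      (use i1 i2 c c' in \<open>simp_all add: K_ar_kmor kmor_cmp\<close>)
  moreover have "kmor C Z Z' c \<cdot>\<^bsub>Kcat C\<^esub> kmor C Y Z i2 = kmor C Y' Z' j2 \<cdot>\<^bsub>Kcat C\<^esub> \<beta>"
    using c cone_cm(1)[OF assms(2,1)] cone_cm(1)[OF assms(4,3)] cb by (simp add: b(2) kmor_cmp ci)
  moreover have "kmor C Z' (cshift C 1 X') r1 \<cdot>\<^bsub>Kcat C\<^esub> kmor C Z Z' c =
      kshift C 1 \<alpha> \<cdot>\<^bsub>Kcat C\<^esub> kmor C Z (cshift C 1 X) p1"
    using c cone_cm(2)[OF assms(2,1)] cone_cm(2)[OF assms(4,3)] ca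
    by (simp add: a(2) kmor_cmp c1 kshift_kmor kmor_cmp[OF _ cm_shift])
  ultimately show thesis by (rule that)
qed

text \<open>In each degree \<open>W\<close> is Y[1] + X[1] + Y with the two copies of Y joined by
  the identity; contracting them leaves X[1].\<close>

lemma cone_rotate:
  assumes "cm X Y f" "is_cone C X Y f Z i1 i2 p1 p2" "is_cone C Y Z i2 W j1 j2 r1 r2"
  shows "iso_arrow (Kcat C) W (cshift C 1 X) (kmor C W (cshift C 1 X) (\<lambda>n. p1 n \<cdot> r2 n))"
    and "kmor C W (cshift C 1 X) (\<lambda>n. p1 n \<cdot> r2 n) \<cdot>\<^bsub>Kcat C\<^esub> kmor C Z W j2 = kmor C Z (cshift C 1 X) p1"
proof -
  note cX = cm_cplx(1)[OF assms(1)] and cY = cm_cplx(2)[OF assms(1)]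
  note D = coneD[OF assms(2,1)] and D' = coneD[OF assms(3) cone_cm(1)[OF assms(2,1)]]
  note [simp] = cmD[OF assms(1)] cplxD[OF cX] cplxD[OF cY] cplxD[OF D(1)] cplxD[OF D'(1)]
    D(3-18) D(15-18,20-23)[THEN ra] D(20-23) D'(3-18) D'(15-18,20-23)[THEN ra] D'(20-23)
    cmD(4)[OF assms(1), THEN ra] cshift_cdf[OF cX]
  define q where "q = (\<lambda>n. p1 n \<cdot> r2 n)"
  \<comment> \<open>The inclusion of X[1] through \<open>Z\<close> is not a chain map, since the
    differential of \<open>Z\<close> also sends X[1] to Y by \<open>f\<close>. The component -f in
    Y[1] compensates.\<close>
  define u where "u = (\<lambda>n. j2 n \<cdot> i1 n \<boxplus> neg (j1 n \<cdot> f (n + 1)))"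
  have tq[simp]: "is_arr (q n)" "src (q n) = cob W n" "tgt (q n) = cob X (n + 1)" for n
    by (simp_all add: q_def)
  have tu[simp]: "is_arr (u n)" "tgt (u n) = cob W n" "src (u n) = cob X (n + 1)" for n
    by (simp_all add: u_def)
  have q: "cm W (cshift C 1 X) q"
    unfolding cm_ar ar_iff by (simp add: q_def D'(1) cX)
  have u: "cm (cshift C 1 X) W u"
    unfolding cm_ar ar_iff by (simp add: u_def D'(1) cX madd_ac madd_cancel_apart)
  have qu: "q n \<cdot> u n = idm C (cob X (n + 1))" for n
    by (simp add: q_def u_def)
  have uq: "homotopic C W W (\<lambda>n. u n \<cdot> q n) (\<lambda>n. idm C (cob W n))"
  proof (rule homotopicI[where s = "\<lambda>n. neg (j1 (n - 1) \<cdot> (p2 n \<cdot> r2 n))"])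
    show "u n \<cdot> q n = idm C (cob W n) \<boxplus> (cdf W (n - 1) \<cdot> neg (j1 (n - 1) \<cdot> (p2 n \<cdot> r2 n)) \<boxplus>
          neg (j1 (n + 1 - 1) \<cdot> (p2 (n + 1) \<cdot> r2 (n + 1))) \<cdot> cdf W n)" (is "?l = ?r") for n
    proof (rule biproduct_ext_to[OF D'(2)[of n]])
      show "r1 n \<cdot> ?l = r1 n \<cdot> ?r" by (simp add: u_def q_def madd_ac madd_cancel_apart)
      have "r2 n \<cdot> ?r = r2 n \<boxplus> neg (i2 n \<cdot> (p2 n \<cdot> r2 n))" by simp
      moreover have "r2 n \<cdot> ?l = i1 n \<cdot> (p1 n \<cdot> r2 n)" by (simp add: u_def q_def)
      moreover have "r2 n = i1 n \<cdot> (p1 n \<cdot> r2 n) \<boxplus> i2 n \<cdot> (p2 n \<cdot> r2 n)"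
        using arg_cong[OF D(19)[of n], of "\<lambda>x. x \<cdot> r2 n"] by simp
      then have "r2 n \<boxplus> neg (i2 n \<cdot> (p2 n \<cdot> r2 n)) =
          (i1 n \<cdot> (p1 n \<cdot> r2 n) \<boxplus> i2 n \<cdot> (p2 n \<cdot> r2 n)) \<boxplus> neg (i2 n \<cdot> (p2 n \<cdot> r2 n))" by simp
      then have "r2 n \<boxplus> neg (i2 n \<cdot> (p2 n \<cdot> r2 n)) = i1 n \<cdot> (p1 n \<cdot> r2 n)"
        by (simp add: madd_assoc)
      ultimately show "r2 n \<cdot> ?l = r2 n \<cdot> ?r" by simp
    qed simp_all
  qed (simp add: ar_iff)
  have "heq W (cshift C 1 X) q u"
    unfolding heq_def using q u uq cX by (simp add: qu homotopic_refl cm_id[of "cshift C 1 X", simplified])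
  then show "iso_arrow (Kcat C) W (cshift C 1 X) (kmor C W (cshift C 1 X) (\<lambda>n. p1 n \<cdot> r2 n))"
    unfolding q_def[symmetric] by (rule heq_iso)
  have "(\<lambda>n. q n \<cdot> j2 n) = p1" by (simp add: q_def)
  then show "kmor C W (cshift C 1 X) (\<lambda>n. p1 n \<cdot> r2 n) \<cdot>\<^bsub>Kcat C\<^esub> kmor C Z W j2 = kmor C Z (cshift C 1 X) p1"
    unfolding q_def[symmetric]
    by (simp add: kmor_cmp[OF cone_cm(1)[OF assms(3) cone_cm(1)[OF assms(2,1)]] q])
qed

text \<open>The homotopies \<open>s\<close> and \<open>t\<close> may differ, but the square of \<open>f - 1\<close> is null-homotopic.\<close>

lemma weakly_homotopic_id_iso:
  assumes "cm T T f" "\<And>n. ar (s n) (cob T n) (cob T (n - 1))" "\<And>n. ar (t n) (cob T n) (cob T (n - 1))"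
    and f: "\<And>n. f n = idm C (cob T n) \<boxplus> (cdf T (n - 1) \<cdot> s n \<boxplus> t (n + 1) \<cdot> cdf T n)"
  shows "iso_arrow (Kcat C) T T (kmor C T T f)"
proof -
  note cT = cm_cplx(1)[OF assms(1)]
  note [simp] = cplxD[OF cT] assms(2)[unfolded ar_iff] assms(3)[unfolded ar_iff]
    cplxD(5)[OF cT, THEN ra]
  define x where "x = (\<lambda>n. cdf T (n - 1) \<cdot> s n \<boxplus> t (n + 1) \<cdot> cdf T n)"
  have x[simp]: "is_arr (x n)" "src (x n) = cob T n" "tgt (x n) = cob T n" for n
    by (simp_all add: x_def)
  have fx: "f n = idm C (cob T n) \<boxplus> x n" for n by (simp add: f x_def)
  have [simp]: "2 + n - 1 = n + 1" for n :: int by simp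
  have dx: "cdf T n \<cdot> x n = x (n + 1) \<cdot> cdf T n" for n
  proof -
    have "cdf T n \<boxplus> cdf T n \<cdot> x n = cdf T n \<boxplus> x (n + 1) \<cdot> cdf T n"
      using cmD(4)[OF assms(1), of n] by (simp add: fx)
    then show ?thesis by (rule madd_left_cancel) simp_all
  qed
  \<comment> \<open>That \<open>x\<close> = d s + t d commutes with d gives d s d = d t d, the only
    relation between \<open>s\<close> and \<open>t\<close>.\<close>
  have st: "cdf T n \<cdot> (s (n + 1) \<cdot> cdf T n) = cdf T n \<cdot> (t (n + 1) \<cdot> cdf T n)" for n
    using dx[of n] by (simp add: x_def)
  \<comment> \<open>Expanding, x x = d s d s + d s t d + t d t d. Replacing d s d by d t d in the
    first term, and the reverse in the last, gives d h + h d.\<close>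
  define h where "h = (\<lambda>n. t n \<cdot> (cdf T (n - 1) \<cdot> s n) \<boxplus> s n \<cdot> (t (n + 1) \<cdot> cdf T n))"
  have h[simp]: "is_arr (h n)" "src (h n) = cob T n" "tgt (h n) = cob T (n - 1)" for n
    by (simp_all add: h_def)
  have xx: "x n \<cdot> x n = cdf T (n - 1) \<cdot> h n \<boxplus> h (n + 1) \<cdot> cdf T n" for n
  proof -
    have "cdf T (n - 1) \<cdot> (s n \<cdot> (cdf T (n - 1) \<cdot> s n)) = cdf T (n - 1) \<cdot> (t n \<cdot> (cdf T (n - 1) \<cdot> s n))"
      using arg_cong[OF st[of "n - 1"], of "\<lambda>z. z \<cdot> s n"] by simp
    moreover have "t (n + 1) \<cdot> (cdf T n \<cdot> (s (n + 1) \<cdot> cdf T n)) = t (n + 1) \<cdot> (cdf T n \<cdot> (t (n + 1) \<cdot> cdf T n))"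
      by (simp add: st)
    ultimately show ?thesis by (simp add: x_def h_def madd_ac)
  qed
  \<comment> \<open>As x x is null-homotopic, 1 - x inverts 1 + x up to homotopy.\<close>
  define g where "g = (\<lambda>n. idm C (cob T n) \<boxplus> neg (x n))"
  have g[simp]: "is_arr (g n)" "src (g n) = cob T n" "tgt (g n) = cob T n" for n
    by (simp_all add: g_def)
  have cg: "cm T T g" unfolding cm_ar ar_iff using cT by (simp add: g_def dx)
  have "g n \<cdot> f n = idm C (cob T n) \<boxplus> neg (x n \<cdot> x n)" "f n \<cdot> g n = idm C (cob T n) \<boxplus> neg (x n \<cdot> x n)" for n
    by (simp_all add: g_def fx madd_assoc)
  then have "homotopic C T T (\<lambda>n. g n \<cdot> f n) (\<lambda>n. idm C (cob T n))"
    "homotopic C T T (\<lambda>n. f n \<cdot> g n) (\<lambda>n. idm C (cob T n))"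
    by (auto intro!: homotopicI[where s = "\<lambda>n. neg (h n)"] simp: ar_iff xx)
  then have "heq T T f g" unfolding heq_def using assms(1) cg by simp
  then show ?thesis by (rule heq_iso)
qed

end

section \<open>Distinguished triangles and truncations of complexes\<close>

context category begin

lemma cong_iso:
  assumes "iso_arrow C X Y f" shows "is_arr f" "src f = X" "tgt f = Y" "X \<in> Obj C" "Y \<in> Obj C"
  using iso_arrowD[OF assms] by (auto simp: ar_iff)

end

context additive_category begin

lemma eq_to_zero:
  "zero_object C (tgt f) \<Longrightarrow> is_arr f \<Longrightarrow> is_arr g \<Longrightarrow> src f = src g \<Longrightarrow> tgt f = tgt g \<Longrightarrow> f = g"
  using to_zero[of "tgt f" f "src f"] to_zero[of "tgt f" g "src f"] by (simp add: ar_iff)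

lemma eq_from_zero:
  "zero_object C (src f) \<Longrightarrow> is_arr f \<Longrightarrow> is_arr g \<Longrightarrow> src f = src g \<Longrightarrow> tgt f = tgt g \<Longrightarrow> f = g"
  using from_zero[of "src f" f "tgt f"] from_zero[of "src f" g "tgt f"] by (simp add: ar_iff)

lemma kshift_cmp:
  assumes "K.ar \<phi> X Y" "K.ar \<psi> Y Z"
  shows "kshift C k (\<psi> \<cdot>\<^bsub>Kcat C\<^esub> \<phi>) = kshift C k \<psi> \<cdot>\<^bsub>Kcat C\<^esub> kshift C k \<phi>"
proof -
  obtain f g where "cm X Y f" "\<phi> = kmor C X Y f" "cm Y Z g" "\<psi> = kmor C Y Z g"
    using assms unfolding K_ar_iff by blast
  then show ?thesis by (simp add: kmor_cmp kshift_kmor cm_cmp kmor_cmp[OF cm_shift cm_shift])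
qed

lemma Kadd_K:
  "Hom (Kadd C) = Hom (Kcat C)" "cmp (Kadd C) = cmp (Kcat C)" "iso_arrow (Kadd C) = iso_arrow (Kcat C)"
  by (auto simp: Kcat_simps Kadd_def iso_arrow_def fun_eq_iff)

lemma kdist_K: "kdist C X Y Z f g h \<longleftrightarrow>
    K.ar f X Y \<and> K.ar g Y Z \<and> K.ar h Z (cshift C 1 X) \<and>
    (\<exists>X0 Y0 Z0 f0 i1 i2 p1 p2 a b c. cm X0 Y0 f0 \<and> is_cone C X0 Y0 f0 Z0 i1 i2 p1 p2 \<and>
       iso_arrow (Kcat C) X0 X a \<and> iso_arrow (Kcat C) Y0 Y b \<and> iso_arrow (Kcat C) Z0 Z c \<and>
       f \<cdot>\<^bsub>Kcat C\<^esub> a = b \<cdot>\<^bsub>Kcat C\<^esub> kmor C X0 Y0 f0 \<and>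
       g \<cdot>\<^bsub>Kcat C\<^esub> b = c \<cdot>\<^bsub>Kcat C\<^esub> kmor C Y0 Z0 i2 \<and>
       h \<cdot>\<^bsub>Kcat C\<^esub> c = kshift C 1 a \<cdot>\<^bsub>Kcat C\<^esub> kmor C Z0 (cshift C 1 X0) p1)"
  unfolding kdist_def Kadd_K K.ar_def K_Obj cm_def using cshift_complex by blast

lemma kdistI:
  assumes "K.ar f X Y" "K.ar g Y Z" "K.ar h Z (cshift C 1 X)" "cm X0 Y0 f0"
    "is_cone C X0 Y0 f0 Z0 i1 i2 p1 p2"
    "iso_arrow (Kcat C) X0 X a" "iso_arrow (Kcat C) Y0 Y b" "iso_arrow (Kcat C) Z0 Z c"
    "f \<cdot>\<^bsub>Kcat C\<^esub> a = b \<cdot>\<^bsub>Kcat C\<^esub> kmor C X0 Y0 f0"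
    "g \<cdot>\<^bsub>Kcat C\<^esub> b = c \<cdot>\<^bsub>Kcat C\<^esub> kmor C Y0 Z0 i2"
    "h \<cdot>\<^bsub>Kcat C\<^esub> c = kshift C 1 a \<cdot>\<^bsub>Kcat C\<^esub> kmor C Z0 (cshift C 1 X0) p1"
  shows "kdist C X Y Z f g h"
  unfolding kdist_K using assms by blast

lemma kdist_cone:
  assumes "cm X Y f" "is_cone C X Y f Z i1 i2 p1 p2"
  shows "kdist C X Y Z (kmor C X Y f) (kmor C Y Z i2) (kmor C Z (cshift C 1 X) p1)"
proof -
  note c = cone_cm[OF assms(2,1)] and X = cm_cplx[OF assms(1)] and Z = coneD(1)[OF assms(2,1)]
  note t = K_ar_kmor[OF assms(1)] K_ar_kmor[OF c(1)] K_ar_kmor[OF c(2)]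
  note i = K.iso_arrow_idm[of X] K.iso_arrow_idm[of Y] K.iso_arrow_idm[of Z]
  have s: "kshift C 1 (idm (Kcat C) X) = idm (Kcat C) (cshift C 1 X)"
    using X by (simp add: K_idm kshift_kmor cm_id)
  show ?thesis
    by (rule kdistI[OF t assms i]) (use t X Z s in \<open>simp_all add: K.ar_iff\<close>)
qed

text \<open>A distinguished triangle of K comes with some cone behind it. Here that cone is moved to
  prescribed isomorphic copies of the first two vertices, so that its terms become known.\<close>

lemma kdist_normal:
  assumes "kdist C X Y Z f g h" "iso_arrow (Kcat C) X X1 \<xi>" "iso_arrow (Kcat C) Y Y1 \<eta>"
  obtains f1 Z1 i1 i2 p1 p2 \<gamma> where "cm X1 Y1 f1" "is_cone C X1 Y1 f1 Z1 i1 i2 p1 p2"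
    "iso_arrow (Kcat C) Z Z1 \<gamma>" "\<gamma> \<cdot>\<^bsub>Kcat C\<^esub> g = kmor C Y1 Z1 i2 \<cdot>\<^bsub>Kcat C\<^esub> \<eta>"
    "kmor C Z1 (cshift C 1 X1) p1 \<cdot>\<^bsub>Kcat C\<^esub> \<gamma> = kshift C 1 \<xi> \<cdot>\<^bsub>Kcat C\<^esub> h"
proof -
  obtain X0 Y0 Z0 f0 i1 i2 p1 p2 a b c where 0: "cm X0 Y0 f0" "is_cone C X0 Y0 f0 Z0 i1 i2 p1 p2"
       "iso_arrow (Kcat C) X0 X a" "iso_arrow (Kcat C) Y0 Y b" "iso_arrow (Kcat C) Z0 Z c"
       "f \<cdot>\<^bsub>Kcat C\<^esub> a = b \<cdot>\<^bsub>Kcat C\<^esub> kmor C X0 Y0 f0"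
       "g \<cdot>\<^bsub>Kcat C\<^esub> b = c \<cdot>\<^bsub>Kcat C\<^esub> kmor C Y0 Z0 i2"
       "h \<cdot>\<^bsub>Kcat C\<^esub> c = kshift C 1 a \<cdot>\<^bsub>Kcat C\<^esub> kmor C Z0 (cshift C 1 X0) p1"
    and t: "K.ar f X Y" "K.ar g Y Z" "K.ar h Z (cshift C 1 X)"
    using assms(1) unfolding kdist_K by blast
  obtain \<xi>' where \<xi>': "K.ar \<xi>' X1 X" "\<xi>' \<cdot>\<^bsub>Kcat C\<^esub> \<xi> = idm (Kcat C) X"
    using assms(2) by (rule K.iso_arrowE)
  obtain a' where a': "K.ar a' X X0" "a' \<cdot>\<^bsub>Kcat C\<^esub> a = idm (Kcat C) X0" "a \<cdot>\<^bsub>Kcat C\<^esub> a' = idm (Kcat C) X"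
    using 0(3) by (rule K.iso_arrowE)
  obtain b' where b': "K.ar b' Y Y0" "b \<cdot>\<^bsub>Kcat C\<^esub> b' = idm (Kcat C) Y"
    using 0(4) by (rule K.iso_arrowE)
  obtain c' where c': "K.ar c' Z Z0" "c' \<cdot>\<^bsub>Kcat C\<^esub> c = idm (Kcat C) Z0" "c \<cdot>\<^bsub>Kcat C\<^esub> c' = idm (Kcat C) Z"
      "iso_arrow (Kcat C) Z Z0 c'"
    using 0(5) by (rule K.iso_arrowE)
  note k = cone_cm[OF 0(2,1)]
  note [simp] = t[unfolded K.ar_iff] K.cong_iso[OF assms(2)] K.cong_iso[OF assms(3)]
    K.cong_iso[OF 0(3)] K.cong_iso[OF 0(4)] K.cong_iso[OF 0(5)]
    \<xi>'(1)[unfolded K.ar_iff] a'(1)[unfolded K.ar_iff] b'(1)[unfolded K.ar_iff] c'(1)[unfolded K.ar_iff]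
    K_ar_kmor[OF 0(1), unfolded K.ar_iff] K_ar_kmor[OF k(1), unfolded K.ar_iff] K_ar_kmor[OF k(2), unfolded K.ar_iff]
    K.cong_iso[OF kshift_iso[OF assms(2), of 1]] K.cong_iso[OF kshift_iso[OF 0(3), of 1]]
  have [simp]: "X1 \<in> complexes C" "Y1 \<in> complexes C"
    using K.cong_iso(5)[OF assms(2)] K.cong_iso(5)[OF assms(3)] by simp_all
  have "K.ar (\<eta> \<cdot>\<^bsub>Kcat C\<^esub> (f \<cdot>\<^bsub>Kcat C\<^esub> \<xi>')) X1 Y1" by (simp add: K.ar_iff)
  then obtain f1 where f1: "cm X1 Y1 f1" "kmor C X1 Y1 f1 = \<eta> \<cdot>\<^bsub>Kcat C\<^esub> (f \<cdot>\<^bsub>Kcat C\<^esub> \<xi>')"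
    unfolding K_ar_iff by auto
  obtain Z1 j1 j2 r1 r2 where Z1: "is_cone C X1 Y1 f1 Z1 j1 j2 r1 r2" using cone_exists[OF f1(1)] by blast
  note k1 = cone_cm[OF Z1 f1(1)]
  note [simp] = K_ar_kmor[OF k1(1), unfolded K.ar_iff] K_ar_kmor[OF k1(2), unfolded K.ar_iff]
  have "(\<eta> \<cdot>\<^bsub>Kcat C\<^esub> b) \<cdot>\<^bsub>Kcat C\<^esub> kmor C X0 Y0 f0 = kmor C X1 Y1 f1 \<cdot>\<^bsub>Kcat C\<^esub> (\<xi> \<cdot>\<^bsub>Kcat C\<^esub> a)"
    by (simp add: f1(2) \<xi>'(2)[THEN K.ra] 0(6))
  from cone_iso[OF 0(1,2) f1(1) Z1 K.iso_arrow_cmp[OF 0(3) assms(2)] K.iso_arrow_cmp[OF 0(4) assms(3)] this]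
  obtain \<gamma> where g: "iso_arrow (Kcat C) Z0 Z1 \<gamma>"
    "\<gamma> \<cdot>\<^bsub>Kcat C\<^esub> kmor C Y0 Z0 i2 = kmor C Y1 Z1 j2 \<cdot>\<^bsub>Kcat C\<^esub> (\<eta> \<cdot>\<^bsub>Kcat C\<^esub> b)"
    "kmor C Z1 (cshift C 1 X1) r1 \<cdot>\<^bsub>Kcat C\<^esub> \<gamma> =
      kshift C 1 (\<xi> \<cdot>\<^bsub>Kcat C\<^esub> a) \<cdot>\<^bsub>Kcat C\<^esub> kmor C Z0 (cshift C 1 X0) p1" .
  note [simp] = K.cong_iso[OF g(1)]
  have s: "kshift C 1 (\<xi> \<cdot>\<^bsub>Kcat C\<^esub> a) = kshift C 1 \<xi> \<cdot>\<^bsub>Kcat C\<^esub> kshift C 1 a"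
    using kshift_cmp K.iso_arrowD assms(2) 0(3) by blast
  have c'g: "c' \<cdot>\<^bsub>Kcat C\<^esub> g = kmor C Y0 Z0 i2 \<cdot>\<^bsub>Kcat C\<^esub> b'"
  proof -
    have "c' \<cdot>\<^bsub>Kcat C\<^esub> g = c' \<cdot>\<^bsub>Kcat C\<^esub> (g \<cdot>\<^bsub>Kcat C\<^esub> (b \<cdot>\<^bsub>Kcat C\<^esub> b'))" by (simp add: b'(2))
    also have "\<dots> = kmor C Y0 Z0 i2 \<cdot>\<^bsub>Kcat C\<^esub> b'" by (simp add: 0(7)[THEN K.ra] c'(2)[THEN K.ra])
    finally show ?thesis .
  qed
  have hc: "kshift C 1 a \<cdot>\<^bsub>Kcat C\<^esub> (kmor C Z0 (cshift C 1 X0) p1 \<cdot>\<^bsub>Kcat C\<^esub> c') = h"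
    using 0(8)[THEN K.ra, of c'] by (simp add: c'(3))
  show thesis
  proof (rule that[OF f1(1) Z1 K.iso_arrow_cmp[OF c'(4) g(1)]])
    show "(\<gamma> \<cdot>\<^bsub>Kcat C\<^esub> c') \<cdot>\<^bsub>Kcat C\<^esub> g = kmor C Y1 Z1 j2 \<cdot>\<^bsub>Kcat C\<^esub> \<eta>"
      by (simp add: c'g g(2)[THEN K.ra] b'(2))
    show "kmor C Z1 (cshift C 1 X1) r1 \<cdot>\<^bsub>Kcat C\<^esub> (\<gamma> \<cdot>\<^bsub>Kcat C\<^esub> c') = kshift C 1 \<xi> \<cdot>\<^bsub>Kcat C\<^esub> h"
      by (simp add: g(3)[THEN K.ra] s hc)
  qed
qed

lemma truncation_choice_K: "truncation_choice (Kcat C) (w_st C) m T X \<longleftrightarrow>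
    (\<exists>h R g k. kdist C X T R h g k \<and> (\<exists>Y. isomorphic (Kcat C) X Y \<and> (\<forall>n < - m. zero_object C (cob Y n))) \<and>
       (\<exists>Y. isomorphic (Kcat C) R Y \<and> (\<forall>n \<ge> - m. zero_object C (cob Y n))))"
proof -
  have "kdist C X T R h g k \<Longrightarrow> X \<in> complexes C \<and> R \<in> complexes C" for R h g k
    by (simp add: kdist_def)
  moreover have "(\<forall>n > - (m + 1). P n) = (\<forall>n \<ge> - m. P n)" for P by force
  ultimately show ?thesis
    unfolding truncation_choice_def gives_decomposition_def weight_decomposition_def wle_w_st wge_w_st
      Kcat_simps(9) by (auto; blast)
qed

text \<open>This gives the independence of the chosen weight complex in the first claim.\<close>

lemma truncation_choice_iso:
  assumes "truncation_choice (Kcat C) (w_st C) m T X" "isomorphic (Kcat C) X X'" "isomorphic (Kcat C) T T'"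
  shows "truncation_choice (Kcat C) (w_st C) m T' X'"
proof -
  obtain h R g k Y Y' where 1: "kdist C X T R h g k" "isomorphic (Kcat C) X Y"
      "\<forall>n < - m. zero_object C (cob Y n)" "isomorphic (Kcat C) R Y'" "\<forall>n \<ge> - m. zero_object C (cob Y' n)"
    using assms(1) unfolding truncation_choice_K by blast
  obtain a b where ab: "iso_arrow (Kcat C) X X' a" "iso_arrow (Kcat C) T T' b"
    using assms(2,3) unfolding isomorphic_def by blast
  obtain f1 Z1 i1 i2 p1 p2 \<gamma> where 2: "cm X' T' f1" "is_cone C X' T' f1 Z1 i1 i2 p1 p2"
    "iso_arrow (Kcat C) R Z1 \<gamma>"
    using 1(1) ab by (rule kdist_normal)
  have "isomorphic (Kcat C) X' Y" "isomorphic (Kcat C) Z1 Y'"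
    using K.isomorphic_trans[OF K.isomorphic_sym[OF assms(2)] 1(2)]
      K.isomorphic_trans[OF K.isomorphic_sym 1(4)] 2(3) unfolding isomorphic_def by blast+
  then show ?thesis
    unfolding truncation_choice_K using kdist_cone[OF 2(1,2)] 1(3,5) by blast
qed

section \<open>Stupid truncations\<close>

definition zob :: 'o where "zob = (SOME Z. zero_object C Z)"

lemma zob [simp]: "zero_object C zob" "zob \<in> Obj C"
proof -
  show "zero_object C zob" unfolding zob_def using ex_zero_object by (rule someI_ex)
  then show "zob \<in> Obj C" by (rule zero_object_Obj)
qed

definition trunc_ge :: "int \<Rightarrow> ('o, 'a) cplx \<Rightarrow> ('o, 'a) cplx" where
  "trunc_ge k T = \<lparr>cob = (\<lambda>n. if k \<le> n then cob T n else zob),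
     cdf = (\<lambda>n. if k \<le> n then cdf T n else zr zob (if k \<le> n + 1 then cob T (n + 1) else zob))\<rparr>"

definition trunc_lt :: "int \<Rightarrow> ('o, 'a) cplx \<Rightarrow> ('o, 'a) cplx" where
  "trunc_lt k T = \<lparr>cob = (\<lambda>n. if n < k then cob T n else zob),
     cdf = (\<lambda>n. if n + 1 < k then cdf T n else zr (if n < k then cob T n else zob) zob)\<rparr>"

lemma trunc_ge_complex: assumes "T \<in> complexes C" shows "trunc_ge k T \<in> complexes C"
  unfolding complexes_ar ar_iff trunc_ge_def by (auto simp: cplxD[OF assms])

lemma trunc_lt_complex: assumes "T \<in> complexes C" shows "trunc_lt k T \<in> complexes C"
  unfolding complexes_ar ar_iff trunc_lt_def by (auto simp: cplxD[OF assms])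

text \<open>In each degree \<open>T\<close> is the sum of \<open>X\<close> and a quotient
  \<open>R\<close>, so it is a cone of a map R[-1] -> X. Rotating that triangle gives X -> T ->
  R.\<close>

lemma stupid_truncation:
  assumes "T \<in> complexes C" "X \<in> complexes C" "\<And>n. k \<le> n \<Longrightarrow> cob X n = cob T n"
    "\<And>n. k \<le> n \<Longrightarrow> cdf X n = cdf T n" "\<And>n. n < k \<Longrightarrow> zero_object C (cob X n)"
  shows "truncation_choice (Kcat C) (w_st C) (- k) T X"
proof -
  define R where "R = trunc_lt k T"
  have R: "R \<in> complexes C" unfolding R_def using assms(1) by (rule trunc_lt_complex)
  have Rlt: "n < k \<Longrightarrow> cob R n = cob T n" "n + 1 < k \<Longrightarrow> cdf R n = cdf T n" and Rge: "\<not> n < k \<Longrightarrow> cob R n = zob" for n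
    by (auto simp: R_def trunc_lt_def)
  note [simp] = cplxD[OF assms(1)] cplxD[OF assms(2)] cplxD[OF R]
  define i1 where "i1 = (\<lambda>n. if n < k then idm C (cob T n) else zr (cob R n) (cob T n))"
  define i2 where "i2 = (\<lambda>n. if n < k then zr (cob X n) (cob T n) else idm C (cob T n))"
  define p1 where "p1 = (\<lambda>n. if n < k then idm C (cob T n) else zr (cob T n) (cob R n))"
  define p2 where "p2 = (\<lambda>n. if n < k then zr (cob T n) (cob X n) else idm C (cob T n))"
  \<comment> \<open>A cone contains its first complex shifted by one, so R[-1] contributes exactly
    \<open>R\<close>.\<close>
  let ?R = "cshift C (- 1) R"
  have b: "biproduct C (cob ?R (n + 1)) (cob X n) (cob T n) (i1 n) (i2 n) (p1 n) (p2 n)" for n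
  proof (cases "n < k")
    case True
    then show ?thesis using biproduct_zero_right[of "cob X n" "cob T n"] assms(5)
      by (simp add: i1_def i2_def p1_def p2_def Rlt)
  next
    case False
    then show ?thesis using biproduct_zero_left[of zob "cob T n"] assms(3)
      by (simp add: i1_def i2_def p1_def p2_def Rge)
  qed
  have d2: "cdf T n \<cdot> i2 n = i2 (n + 1) \<cdot> cdf X n" for n
  proof (cases "n < k")
    case True
    show ?thesis
      by (rule eq_from_zero) (use True assms(3,5) in \<open>auto simp: i2_def\<close>)
  qed (use assms(3,4) in \<open>simp add: i2_def\<close>)
  have d1: "p1 (n + 1) \<cdot> cdf T n = neg (cdf ?R (n + 1) \<cdot> p1 n)" for n
  proof (cases "n + 1 < k")
    case False
    show ?thesis
      by (rule eq_to_zero) (use False Rlt Rge in \<open>auto simp: p1_def cshift_cdf R\<close>)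
  qed (use Rlt Rge in \<open>simp add: p1_def cshift_cdf R\<close>)
  let ?f = "\<lambda>n. p2 n \<cdot> (cdf T (n - 1) \<cdot> i1 (n - 1))"
  have f: "cm ?R X ?f" and c: "is_cone C ?R X ?f T i1 i2 p1 p2"
    using cone_of_split[OF cshift_complex[OF R] assms(2,1) b d2 d1] by blast+
  obtain W j1 j2 r1 r2 where W: "is_cone C X T i2 W j1 j2 r1 r2"
    using cone_exists[OF cone_cm(1)[OF c f]] by blast
  have "isomorphic (Kcat C) W (cshift C 1 ?R)"
    using cone_rotate(1)[OF f c W] unfolding isomorphic_def by blast
  then have "isomorphic (Kcat C) W R" by (simp add: cshift_add cshift_0 R)
  moreover have "isomorphic (Kcat C) X X" using assms(2) by (simp add: K.isomorphic_refl)
  moreover have "\<forall>n < - (- k). zero_object C (cob X n)" "\<forall>n \<ge> - (- k). zero_object C (cob R n)"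
    using assms(5) Rge by simp_all
  ultimately show ?thesis
    unfolding truncation_choice_K using kdist_cone[OF cone_cm(1)[OF c f] W] by blast
qed

text \<open>Below \<open>k\<close> there is nothing for the homotopy to hit, so \<open>p k\<close> =
  1 + s d; since \<open>p (k + 1)\<close> is zero, the chain map condition gives d (p k) =
  0.\<close>

lemma concentrated_idempotent:
  assumes "cm Z Z p" "homotopic C Z Z p (\<lambda>n. idm C (cob Z n))"
    "\<And>n. n < k \<Longrightarrow> zero_object C (cob Z n)" "\<And>n. k < n \<Longrightarrow> p n = zr (cob Z n) (cob Z n)"
  shows "p k \<cdot> p k = p k" "cdf Z k \<cdot> p k = zr (cob Z k) (cob Z (k + 1))"
proof -
  note cZ = cm_cplx(1)[OF assms(1)]
  note [simp] = cmD[OF assms(1)] cplxD[OF cZ]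
  obtain s where s[rule_format, simp]: "\<forall>n. is_arr (s n) \<and> src (s n) = cob Z n \<and> tgt (s n) = cob Z (n - 1)"
    and h[rule_format]: "\<forall>n. p n = idm C (cob Z n) \<boxplus> (cdf Z (n - 1) \<cdot> s n \<boxplus> s (n + 1) \<cdot> cdf Z n)"
    using assms(2) cZ cZ by (rule homotopicE)
  show d: "cdf Z k \<cdot> p k = zr (cob Z k) (cob Z (k + 1))"
    by (simp add: assms(4))
  have "s k = zr (cob Z k) (cob Z (k - 1))"
    by (rule eq_to_zero) (simp_all add: assms(3))
  then have p: "p k = idm C (cob Z k) \<boxplus> s (k + 1) \<cdot> cdf Z k" by (simp add: h)
  have "p k \<cdot> p k = (idm C (cob Z k) \<boxplus> s (k + 1) \<cdot> cdf Z k) \<cdot> p k" by (simp only: p[symmetric])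
  also have "\<dots> = p k" using d by (simp del: cmD(4)[OF assms(1)])
  finally show "p k \<cdot> p k = p k" .
qed

text \<open>Splitting the idempotent \<open>p k\<close> strips off the contractible part:
  \<open>s r\<close> is \<open>p\<close> itself, which is homotopic to the identity, and
  \<open>r s\<close> is the identity strictly.\<close>

lemma concentrated_heq:
  assumes "cm Z Z p" "homotopic C Z Z p (\<lambda>n. idm C (cob Z n))"
    "\<And>n. n < k \<Longrightarrow> zero_object C (cob Z n)" "\<And>n. k < n \<Longrightarrow> p n = zr (cob Z n) (cob Z n)"
    and E: "E \<in> complexes C" "\<And>n. n \<noteq> k \<Longrightarrow> zero_object C (cob E n)"
    and "ar r (cob Z k) (cob E k)" "ar s (cob E k) (cob Z k)" "r \<cdot> s = idm C (cob E k)" "s \<cdot> r = p k"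
  shows "heq Z E (\<lambda>n. if n = k then r else zr (cob Z n) (cob E n)) (\<lambda>n. if n = k then s else zr (cob E n) (cob Z n))"
    (is "heq Z E ?r ?s")
proof -
  note cZ = cm_cplx(1)[OF assms(1)]
  note [simp] = cmD(1-3)[OF assms(1)] cplxD[OF cZ] cplxD[OF E(1)] assms(7)[unfolded ar_iff] assms(8)[unfolded ar_iff]
  have rs: "is_arr (?r n)" "src (?r n) = cob Z n" "tgt (?r n) = cob E n"
    "is_arr (?s n)" "src (?s n) = cob E n" "tgt (?s n) = cob Z n" for n by auto
  have r: "cm Z E ?r" unfolding cm_ar ar_iff
  proof (intro conjI allI cZ E(1))
    show "cdf E n \<cdot> ?r n = ?r (n + 1) \<cdot> cdf Z n" for n
    proof (cases "n = k - 1")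
      case True
      show ?thesis by (rule eq_from_zero) (use True assms(3)[of n] in auto)
    next
      case False
      show ?thesis by (rule eq_to_zero) (use False E(2)[of "n + 1"] in auto)
    qed
  qed (use rs in auto)
  \<comment> \<open>The arrow \<open>s\<close> lands in the image of the idempotent, on which the
    differential vanishes.\<close>
  have ds: "cdf Z k \<cdot> s = zr (cob E k) (cob Z (k + 1))"
  proof -
    have "cdf Z k \<cdot> s = (cdf Z k \<cdot> p k) \<cdot> s" by (simp add: assms(10)[symmetric] assms(9))
    then show ?thesis using concentrated_idempotent(2)[OF assms(1-4)] by simp
  qed
  have s: "cm E Z ?s" unfolding cm_ar ar_iff
  proof (intro conjI allI cZ E(1))
    show "cdf Z n \<cdot> ?s n = ?s (n + 1) \<cdot> cdf E n" for n
    proof (cases "n = k")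
      case False
      show ?thesis by (rule eq_from_zero) (use False E(2)[of n] in auto)
    qed (simp add: ds)
  qed (use rs in auto)
  have 1: "?r n \<cdot> ?s n = idm C (cob E n)" for n
  proof (cases "n = k")
    case False
    show ?thesis by (rule eq_from_zero) (use False E(2)[of n] in auto)
  qed (simp add: assms(9))
  have 2: "?s n \<cdot> ?r n = p n" for n
  proof (cases "n < k")
    case True
    show ?thesis by (rule eq_from_zero) (use True assms(3)[of n] in auto)
  qed (use assms(4)[of n] assms(10) in auto)
  show ?thesis unfolding heq_def
    using r s assms(2) unfolding 1 2 by (simp add: homotopic_refl cm_id E(1))
qed

text \<open>Both neighbours of degree \<open>k\<close> in \<open>E\<close> are zero, so a homotopy
  to the identity is an equality there.\<close>

lemma retract_of_concentrated:
  assumes "isomorphic (Kcat C) E W" "\<And>n. n \<noteq> k \<Longrightarrow> zero_object C (cob E n)"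
  shows "retract_of C (cob E k) (cob W k)"
proof -
  obtain f g where h: "heq E W f g" using assms(1) unfolding isomorphic_def using iso_heqE by metis
  then have fg: "cm E W f" "cm W E g" "homotopic C E E (\<lambda>n. g n \<cdot> f n) (\<lambda>n. idm C (cob E n))"
    by (auto simp: heq_def)
  note cE = cm_cplx(1)[OF fg(1)]
  note [simp] = cmD[OF fg(1)] cmD[OF fg(2)] cplxD[OF cE]
  obtain s where s[rule_format, simp]: "\<forall>n. is_arr (s n) \<and> src (s n) = cob E n \<and> tgt (s n) = cob E (n - 1)"
    and h[rule_format]: "\<forall>n. g n \<cdot> f n = idm C (cob E n) \<boxplus> (cdf E (n - 1) \<cdot> s n \<boxplus> s (n + 1) \<cdot> cdf E n)"
    using fg(3) cE cE by (rule homotopicE)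
  have "s k = zr (cob E k) (cob E (k - 1))" "s (k + 1) = zr (cob E (k + 1)) (cob E k)"
    by (rule eq_to_zero eq_from_zero, simp_all add: assms(2))+
  then have "g k \<cdot> f k = idm C (cob E k)" by (simp add: h)
  moreover have "ar (f k) (cob E k) (cob W k)" "ar (g k) (cob W k) (cob E k)"
    using cplxD(4)[OF cm_cplx(2)[OF fg(1)]] by (simp_all add: ar_iff)
  ultimately show ?thesis unfolding retract_of_ar by blast
qed

text \<open>In degree \<open>k\<close> the identity of \<open>T\<close> is homotopic to a map
  through the zero object \<open>cob X k\<close>. As \<open>cob T (k - 1)\<close> is zero too, the
  homotopy reduces to s d = -1.\<close>

lemma split_lowest_differential:
  assumes "isomorphic (Kcat C) T X" "zero_object C (cob X k)" "zero_object C (cob T (k - 1))"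
  obtains s where "ar s (cob T (k + 1)) (cob T k)" "s \<cdot> cdf T k = idm C (cob T k)"
proof -
  obtain f g where h: "heq T X f g" using assms(1) unfolding isomorphic_def using iso_heqE by metis
  then have fg: "cm T X f" "cm X T g" "homotopic C T T (\<lambda>n. g n \<cdot> f n) (\<lambda>n. idm C (cob T n))"
    by (auto simp: heq_def)
  note cT = cm_cplx(1)[OF fg(1)]
  note [simp] = cmD[OF fg(1)] cmD[OF fg(2)] cplxD[OF cT] cplxD[OF cm_cplx(2)[OF fg(1)]]
  obtain s where s[rule_format, simp]: "\<forall>n. is_arr (s n) \<and> src (s n) = cob T n \<and> tgt (s n) = cob T (n - 1)"
    and h[rule_format]: "\<forall>n. g n \<cdot> f n = idm C (cob T n) \<boxplus> (cdf T (n - 1) \<cdot> s n \<boxplus> s (n + 1) \<cdot> cdf T n)"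
    using fg(3) cT cT by (rule homotopicE)
  have "s k = zr (cob T k) (cob T (k - 1))"
    by (rule eq_to_zero) (simp_all add: assms(3))
  moreover have "f k = zr (cob T k) (cob X k)"
    by (rule eq_to_zero) (simp_all add: assms(2))
  ultimately have 1: "idm C (cob T k) \<boxplus> s (k + 1) \<cdot> cdf T k = zr (cob T k) (cob T k)"
    using h[of k] by simp
  have "s (k + 1) \<cdot> cdf T k = neg (idm C (cob T k))"
    by (rule neg_unique) (use 1 in simp_all)
  then have "neg (s (k + 1)) \<cdot> cdf T k = idm C (cob T k)" by simp
  then show thesis by (intro that[of "neg (s (k + 1))"]) (simp_all add: ar_iff)
qed

lemma full_sub_simps [simp]:
  "Obj (full_sub C B) = B" "Hom (full_sub C B) = Hom C" "idm (full_sub C B) = idm C"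
  "cmp (full_sub C B) = cmp C" "madd (full_sub C B) = madd C" "mzero (full_sub C B) = mzero C"
  by (simp_all add: full_sub_def)

lemma complexes_full_sub:
  "B \<subseteq> Obj C \<Longrightarrow> X \<in> complexes (full_sub C B) \<longleftrightarrow> X \<in> complexes C \<and> (\<forall>n. cob X n \<in> B)"
  unfolding complexes_def by auto

text \<open>Adding contractible complexes $A^n = A^n$ in degrees $n - 1$ and $n$ turns \<open>T\<close> into a complex
  with terms \<open>S n\<close>.\<close>

lemma isomorphic_of_complements:
  assumes "T \<in> complexes C"
    and A: "\<And>n. ar (iT n) (cob T n) (S n)" "\<And>n. ar (pT n) (S n) (cob T n)"
      "\<And>n. ar (iA n) (A n) (S n)" "\<And>n. ar (pA n) (S n) (A n)"
      "\<And>n. ar (iB n) (A (n + 1)) (S n)" "\<And>n. ar (pB n) (S n) (A (n + 1))"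
    and e: "\<And>n. pT n \<cdot> iT n = idm C (cob T n)" "\<And>n. pA n \<cdot> iA n = idm C (A n)"
      "\<And>n. pB n \<cdot> iB n = idm C (A (n + 1))"
      "\<And>n. pT n \<cdot> iA n = zr (A n) (cob T n)" "\<And>n. pT n \<cdot> iB n = zr (A (n + 1)) (cob T n)"
      "\<And>n. pA n \<cdot> iT n = zr (cob T n) (A n)" "\<And>n. pA n \<cdot> iB n = zr (A (n + 1)) (A n)"
      "\<And>n. pB n \<cdot> iT n = zr (cob T n) (A (n + 1))" "\<And>n. pB n \<cdot> iA n = zr (A n) (A (n + 1))"
    and 1: "\<And>n. iT n \<cdot> pT n \<boxplus> (iA n \<cdot> pA n \<boxplus> iB n \<cdot> pB n) = idm C (S n)"
  shows "\<exists>X\<in>complexes C. cob X = S \<and> isomorphic (Kcat C) T X"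
proof -
  note [simp] = cplxD[OF assms(1)] A[unfolded ar_iff] e e[THEN ra] cplxD(5)[OF assms(1), THEN ra]
  have [simp]: "A n \<in> Obj C" "S n \<in> Obj C" for n using A(3)[of n] by (auto simp: ar_def)
  \<comment> \<open>The last summand of \<open>S n\<close> is a copy of \<open>A (n + 1)\<close> and
    is mapped identically onto the middle summand of the next degree.\<close>
  define X where "X = \<lparr>cob = S, cdf = (\<lambda>n. iT (n + 1) \<cdot> (cdf T n \<cdot> pT n) \<boxplus> iA (n + 1) \<cdot> pB n)\<rparr>"
  have X: "X \<in> complexes C" unfolding complexes_ar ar_iff X_def by simp
  have Xs: "cob X n = S n" "cdf X n = iT (n + 1) \<cdot> (cdf T n \<cdot> pT n) \<boxplus> iA (n + 1) \<cdot> pB n" for n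
    by (simp_all add: X_def)
  have i: "cm T X iT" and p: "cm X T pT"
    unfolding cm_ar ar_iff using X assms(1) by (simp_all add: Xs)
  have "homotopic C X X (\<lambda>n. iT n \<cdot> pT n) (\<lambda>n. idm C (cob X n))"
  \<comment> \<open>The contraction of the added pairs: the middle summand \<open>A n\<close> in
    degree \<open>n\<close> returns to its copy in degree \<open>n - 1\<close>.\<close>
  proof (rule homotopicI[where s = "\<lambda>n. neg (iB (n - 1) \<cdot> pA n)"])
    show "ar (neg (iB (n - 1) \<cdot> pA n)) (cob X n) (cob X (n - 1))" for n by (simp add: ar_iff Xs)
    have m: "pB (n - 1) \<cdot> iB (n - 1) = idm C (A n)" for n using e(3)[of "n - 1"] by simp
    have [simp]: "tgt (pB (n - 1)) = A n" "src (iB (n - 1)) = A n" for n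
      using A(5,6)[of "n - 1"] by (simp_all add: ar_iff)
    show "iT n \<cdot> pT n = idm C (cob X n) \<boxplus> (cdf X (n - 1) \<cdot> neg (iB (n - 1) \<cdot> pA n) \<boxplus>
        neg (iB (n + 1 - 1) \<cdot> pA (n + 1)) \<cdot> cdf X n)" (is "_ = ?r") for n
    proof -
      have "?r = idm C (S n) \<boxplus> (neg (iA n \<cdot> pA n) \<boxplus> neg (iB n \<cdot> pB n))"
        by (simp add: Xs m m[THEN ra])
      also have "\<dots> = iT n \<cdot> pT n"
        by (subst 1[of n, symmetric]) (simp add: madd_ac madd_cancel_apart)
      finally show ?thesis by simp
    qed
  qed
  moreover have "homotopic C T T (\<lambda>n. pT n \<cdot> iT n) (\<lambda>n. idm C (cob T n))"
    by (simp add: homotopic_refl cm_id assms(1))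
  ultimately have "heq T X iT pT" unfolding heq_def using i p by simp
  then show ?thesis using heq_iso X unfolding isomorphic_def
    by (intro bexI[of _ X] conjI exI[of _ "kmor C T X iT"]) (auto simp: X_def)
qed

end

section \<open>Triangulated categories\<close>

context triangulated_category begin

lemma shO_Obj [simp]: "X \<in> Obj C \<Longrightarrow> shO C n X \<in> Obj C"
  by (rule shO_closed)

declare shO_0 [simp] shO_add [simp] shA_idm [simp]

lemma ar_shA: "ar f X Y \<Longrightarrow> ar (shA C n f) (shO C n X) (shO C n Y)"
  using shA_closed shO_closed by (simp add: ar_def)

lemma shA_arr [simp]:
  assumes "is_arr f"
  shows "is_arr (shA C n f)" "src (shA C n f) = shO C n (src f)" "tgt (shA C n f) = shO C n (tgt f)"
  using ar_shA[of f "src f" "tgt f" n] assms is_arr_ar is_arrI src_eq tgt_eq by metis+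

lemma shA_simps [simp]:
  "is_arr f \<Longrightarrow> shA C 0 f = f" "is_arr f \<Longrightarrow> shA C k (shA C n f) = shA C (k + n) f"
  using shA_0[of "src f" "tgt f" f] shA_add[of "src f" "tgt f" f] by (simp_all add: Hom_ar ar_iff)

lemma shA_cmp' [simp]:
  assumes "is_arr f" "is_arr g" "tgt f = src g"
  shows "shA C n (g \<cdot> f) = shA C n g \<cdot> shA C n f"
  using shA_cmp[of "src f" "tgt f" "tgt g" f g] assms by (simp add: Hom_ar ar_iff)

lemma shA_madd' [simp]:
  assumes "is_arr f" "is_arr g" "src f = src g" "tgt f = tgt g"
  shows "shA C n (f \<boxplus> g) = shA C n f \<boxplus> shA C n g"
  using shA_madd[of "src f" "tgt f" f g] assms by (simp add: Hom_ar ar_iff)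

lemma shA_zr [simp]:
  assumes "X \<in> Obj C" "Y \<in> Obj C" shows "shA C n (zr X Y) = zr (shO C n X) (shO C n Y)"
proof -
  have "shA C n (zr X Y) \<boxplus> shA C n (zr X Y) = shA C n (zr X Y \<boxplus> zr X Y)"
    using assms by (intro shA_madd'[symmetric]) auto
  also have "zr X Y \<boxplus> zr X Y = zr X Y" using assms by simp
  finally show ?thesis using zr_of_madd_self[of "shA C n (zr X Y)"] assms by simp
qed

lemma shA_neg [simp]:
  assumes "is_arr f" shows "shA C n (neg f) = neg (shA C n f)"
proof (rule neg_unique)
  have "shA C n f \<boxplus> shA C n (neg f) = shA C n (f \<boxplus> neg f)"
    using assms by (intro shA_madd'[symmetric]) auto
  then show "shA C n f \<boxplus> shA C n (neg f) = zr (src (shA C n f)) (tgt (shA C n f))"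
    using assms by simp
qed (use assms in simp_all)

lemma shA_inj:
  assumes "shA C n f = shA C n g" "is_arr f" "is_arr g" shows "f = g"
  using arg_cong[OF assms(1), of "shA C (- n)"] assms(2,3) by simp

lemma shA_eq_zr_iff:
  assumes "is_arr f" "X \<in> Obj C" "Y \<in> Obj C"
  shows "shA C n f = zr (shO C n X) (shO C n Y) \<longleftrightarrow> f = zr X Y"
  using shA_inj[of n f "zr X Y"] assms by auto

lemma zero_object_shO: assumes "zero_object C Z" shows "zero_object C (shO C n Z)"
  using assms shA_idm[of Z n] unfolding zero_object_idm by auto

lemma iso_arrow_shA: assumes "iso_arrow C X Y f" shows "iso_arrow C (shO C n X) (shO C n Y) (shA C n f)"
proof -
  obtain g where g: "ar f X Y" "ar g Y X" "g \<cdot> f = idm C X" "f \<cdot> g = idm C Y"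
    using assms by (rule iso_arrowE)
  have "shA C n g \<cdot> shA C n f = idm C (shO C n X)" "shA C n f \<cdot> shA C n g = idm C (shO C n Y)"
    using arg_cong[OF g(3), of "shA C n"] arg_cong[OF g(4), of "shA C n"] g(1,2) by (simp_all add: ar_iff)
  then show ?thesis unfolding iso_arrow_ar using ar_shA g by blast
qed

lemma distD:
  assumes "dist C X Y Z f g h"
  shows "ar f X Y" "ar g Y Z" "ar h Z (shO C 1 X)"
  using dist_typed[OF assms] unfolding ar_def by auto

lemma dist_rot:
  assumes "dist C X Y Z f g h" shows "dist C Y Z (shO C 1 X) g h (neg (shA C 1 f))"
  using dist_rotate[OF assms] distD[OF assms] by (simp add: ar_iff)

lemma dist_unrot:
  assumes "dist C X Y Z f g h" shows "dist C (shO C (-1) Z) X Y (neg (shA C (-1) h)) f g"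
proof -
  note [simp] = distD[OF assms, unfolded ar_iff]
  show ?thesis
    by (rule dist_rotate_back) (use assms in \<open>simp_all add: Hom_ar ar_iff\<close>)
qed

text \<open>The automorphism -1 of the middle vertex absorbs both signs.\<close>

lemma dist_signs:
  assumes "dist C X Y Z (neg f) (neg g) h" "is_arr f" "is_arr g"
  shows "dist C X Y Z f g h"
proof -
  note D = distD[OF assms(1), unfolded ar_iff]
  have [simp]: "src f = X" "tgt f = Y" "src g = Y" "tgt g = Z" "X \<in> Obj C" "Y \<in> Obj C" "Z \<in> Obj C"
     "is_arr h" "src h = Z" "tgt h = shO C 1 X" using D assms by simp_all
  have "iso_arrow C Y Y (neg (idm C Y))"
    unfolding iso_arrow_ar by (intro conjI exI[of _ "neg (idm C Y)"]) (simp_all add: ar_iff)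
  then show ?thesis
    using assms by (intro dist_iso[OF assms(1) iso_arrow_idm _ iso_arrow_idm, of _ "neg (idm C Y)"])
      (simp_all add: Hom_ar ar_iff)
qed

text \<open>Three rotations negate all three arrows; \<open>dist_signs\<close> removes two of the
  signs and the third stays on the connecting arrow.\<close>

lemma dist_shift_1:
  assumes "dist C X Y Z f g h"
  shows "dist C (shO C 1 X) (shO C 1 Y) (shO C 1 Z) (shA C 1 f) (shA C 1 g) (neg (shA C 1 h))"
  using dist_signs[OF dist_rot[OF dist_rot[OF dist_rot[OF assms]]]] distD[OF assms]
  by (simp add: ar_iff)

lemma dist_shift_minus_1:
  assumes "dist C X Y Z f g h"
  shows "dist C (shO C (-1) X) (shO C (-1) Y) (shO C (-1) Z) (shA C (-1) f) (shA C (-1) g) (neg (shA C (-1) h))"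
  using dist_signs[of _ _ _ "shA C (-1) f" "shA C (-1) g" "neg (shA C (-1) h)"]
    dist_unrot[OF dist_unrot[OF dist_unrot[OF assms]]] distD[OF assms]
  by (simp add: ar_iff)

lemma dist_shift:
  assumes "dist C X Y Z f g h"
  shows "dist C (shO C k X) (shO C k Y) (shO C k Z) (shA C k f) (shA C k g)
    (if even k then shA C k h else neg (shA C k h))"
proof -
  note [simp] = distD[OF assms, unfolded ar_iff]
  show ?thesis
  proof (induction k rule: int_induct[where k = 0])
    case base
    then show ?case using assms by simp
  next
    case (step1 i)
    show ?case using dist_shift_1[OF step1(2)] by (auto simp: add.commute split: if_splits)
  next
    case (step2 i)
    show ?case using dist_shift_minus_1[OF step2(2)] by (auto simp: add.commute split: if_splits)
  qed
qed

section \<open>Lifting and extending arrows along distinguished triangles\<close>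

lemma dist_cmp_zero:
  assumes "dist C X Y Z f g h"
  shows "g \<cdot> f = zr X Z" "h \<cdot> g = zr Y (shO C 1 X)" "shA C 1 f \<cdot> h = zr Z (shO C 1 Y)"
proof -
  have 1: "g \<cdot> f = zr X Z" if d: "dist C X Y Z f g h" for X Y Z f g h
  proof -
    note D[simp] = distD[OF d, unfolded ar_iff]
    \<comment> \<open>Completing the square from the trivial triangle X -> X -> 0 factors
      \<open>g \<cdot> f\<close> through a zero object.\<close>
    obtain c where c: "c \<in> Hom C zob Z" "g \<cdot> f = c \<cdot> mzero C X zob"
      using dist_mor[OF dist_idm[OF _ zob(1)] d, of X "idm C X" f] by (auto simp: Hom_ar ar_iff)
    then show ?thesis by (simp add: Hom_ar ar_iff)
  qed
  note D[simp] = distD[OF assms, unfolded ar_iff]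
  show "g \<cdot> f = zr X Z" "h \<cdot> g = zr Y (shO C 1 X)" using 1 assms dist_rot by blast+
  have "neg (shA C 1 f) \<cdot> h = zr Z (shO C 1 Y)" using 1 dist_rot[OF dist_rot[OF assms]] by blast
  then show "shA C 1 f \<cdot> h = zr Z (shO C 1 Y)" by (simp add: neg_eq_zr)
qed

lemma dist_zero_first: assumes "W \<in> Obj C" shows "dist C (shO C (-1) zob) W W (zr (shO C (-1) zob) W) (idm C W) (zr W zob)"
  using dist_unrot[OF dist_idm[OF assms zob(1)]] assms by simp

text \<open>Completing a square from the rotated trivial triangle W -> 0 -> W[1] yields an arrow
  W[1] -> X[1]. Both rotations carry the same sign, which cancels, and the arrow is shifted
  back.\<close>

lemma dist_lift:
  assumes "dist C X Y Z f g h" "ar x W Y" "g \<cdot> x = zr W Z"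
  obtains y where "ar y W X" "f \<cdot> y = x"
proof -
  note D[simp] = distD[OF assms(1), unfolded ar_iff] assms(2)[unfolded ar_iff]
  obtain c where c: "c \<in> Hom C (shO C 1 W) (shO C 1 X)"
     "neg (shA C 1 f) \<cdot> c = shA C 1 x \<cdot> neg (shA C 1 (idm C W))"
    using dist_mor[OF dist_rot[OF dist_idm[OF _ zob(1)]] dist_rot[OF assms(1)], of W x "zr zob Z"] assms(3)
    by (auto simp: Hom_ar ar_iff)
  then have [simp]: "is_arr c" "src c = shO C 1 W" "tgt c = shO C 1 X" by (simp_all add: Hom_ar ar_iff)
  have "neg (shA C 1 f \<cdot> c) = neg (shA C 1 x)" using c(2) by simp
  then have "shA C 1 f \<cdot> c = shA C 1 x" by (simp add: neg_eq_iff)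
  from arg_cong[OF this, of "shA C (-1)"] have "f \<cdot> shA C (-1) c = x" by simp
  then show thesis by (intro that[of "shA C (-1) c"]) (simp_all add: ar_iff)
qed

lemma dist_extend:
  assumes "dist C X Y Z f g h" "ar x Y W" "x \<cdot> f = zr X W"
  obtains z where "ar z Z W" "z \<cdot> g = x"
proof -
  note D[simp] = distD[OF assms(1), unfolded ar_iff] assms(2)[unfolded ar_iff]
  obtain c where c: "c \<in> Hom C Z W" "idm C W \<cdot> x = c \<cdot> g"
    using dist_mor[OF assms(1) dist_zero_first, of W "zr X (shO C (-1) zob)" x] assms(3)
    by (auto simp: Hom_ar ar_iff)
  then show thesis by (intro that[of c]) (simp_all add: Hom_ar)
qed

lemma dist_lift2:
  assumes "dist C X Y Z f g h" "ar x W Z" "h \<cdot> x = zr W (shO C 1 X)"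
  obtains y where "ar y W Y" "g \<cdot> y = x"
  using dist_lift[OF dist_rot[OF assms(1)] assms(2,3)] by blast

lemma dist_extend2:
  assumes "dist C X Y Z f g h" "ar x Z W" "x \<cdot> g = zr Y W"
  obtains z where "ar z (shO C 1 X) W" "z \<cdot> h = x"
  using dist_extend[OF dist_rot[OF assms(1)] assms(2,3)] by blast

lemma dist_lift0:
  assumes "dist C X Y Z f g h" "ar x W X" "f \<cdot> x = zr W Y"
  obtains y where "ar y W (shO C (-1) Z)" "shA C (-1) h \<cdot> y = x"
proof -
  note [simp] = distD[OF assms(1), unfolded ar_iff] assms(2)[unfolded ar_iff]
  obtain y where "ar y W (shO C (-1) Z)" "neg (shA C (-1) h) \<cdot> y = x"
    using dist_lift[OF dist_unrot[OF assms(1)] assms(2,3)] .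
  then show thesis by (intro that[of "neg y"]) (simp_all add: ar_iff)
qed

lemma dist_mono:
  assumes "dist C X Y Z f g h" "zero_object C Z" "ar x W X" "f \<cdot> x = zr W Y"
  shows "x = zr W X"
proof -
  note [simp] = distD[OF assms(1), unfolded ar_iff] assms(3)[unfolded ar_iff]
  obtain y where y: "ar y W (shO C (-1) Z)" "shA C (-1) h \<cdot> y = x"
    using dist_lift0[OF assms(1,3,4)] .
  have "y = zr W (shO C (-1) Z)" using to_zero[OF zero_object_shO[OF assms(2)] y(1)] .
  then show ?thesis using y by (simp flip: y(2))
qed

text \<open>Both \<open>g\<close> and \<open>h\<close> vanish; the identity of \<open>Z\<close>
  composed with \<open>g\<close> is then zero, so it factors through \<open>h\<close> and is
  zero.\<close>

lemma dist_zero_of_iso: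
  assumes "dist C X Y Z f g h" "iso_arrow C X Y f" shows "zero_object C Z"
proof -
  obtain k where k: "ar k Y X" "k \<cdot> f = idm C X" "f \<cdot> k = idm C Y"
    using assms(2) by (rule iso_arrowE)
  note [simp] = distD[OF assms(1), unfolded ar_iff] k(1)[unfolded ar_iff]
  have "(g \<cdot> f) \<cdot> k = zr Y Z" using dist_cmp_zero(1)[OF assms(1)] by simp
  then have g: "g = zr Y Z" by (simp add: k(3))
  have k1: "shA C 1 k \<cdot> shA C 1 f = idm C (shO C 1 X)" using arg_cong[OF k(2), of "shA C 1"] by simp
  have "shA C 1 k \<cdot> (shA C 1 f \<cdot> h) = zr Z (shO C 1 X)" using dist_cmp_zero(3)[OF assms(1)] by simp
  then have h: "h = zr Z (shO C 1 X)" by (simp add: k1[THEN ra])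
  have "idm C Z \<cdot> g = zr Y Z" by (simp add: g)
  then obtain t where t: "ar t (shO C 1 X) Z" "t \<cdot> h = idm C Z"
    using dist_extend2[OF assms(1) ar_idm] by auto
  then show ?thesis by (simp add: zero_object_idm h ar_iff)
qed

lemma dist_zero_third:
  assumes "dist C X Y Z f g h" "zero_object C X" "zero_object C Y" shows "zero_object C Z"
proof -
  have "f = zr X Y" using assms from_zero distD(1) by blast
  then show ?thesis using dist_zero_of_iso[OF assms(1)] zero_objects_iso[OF assms(2,3)] by simp
qed

text \<open>The vanishing connecting arrow makes \<open>v\<close> split and \<open>u\<close> monic;
  \<open>p\<close> is then the factorization of 1 - s v through \<open>u\<close>.\<close>

lemma dist_split:
  assumes "dist C X Y Z u v (zr Z (shO C 1 X))"
  obtains s p where "biproduct C Z X Y s u v p"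
proof -
  note [simp] = distD[OF assms, unfolded ar_iff]
  obtain s where s: "ar s Z Y" "v \<cdot> s = idm C Z"
    using dist_lift2[OF assms ar_idm] by auto
  note [simp] = s(1)[unfolded ar_iff]
  have vu: "v \<cdot> u = zr X Z" using dist_cmp_zero(1)[OF assms] .
  have "v \<cdot> (idm C Y \<boxplus> neg (s \<cdot> v)) = zr Y Z" by (simp add: s(2)[THEN ra])
  then obtain p where p: "ar p Y X" "u \<cdot> p = idm C Y \<boxplus> neg (s \<cdot> v)"
    using dist_lift[OF assms, of "idm C Y \<boxplus> neg (s \<cdot> v)" Y] by (auto simp: ar_iff)
  note [simp] = p(1)[unfolded ar_iff]
  have mono: "x = zr W X" if x: "ar x W X" "u \<cdot> x = zr W Y" for x W
  proof -
    note [simp] = x(1)[unfolded ar_iff]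
    obtain y where "ar y W (shO C (-1) Z)" "shA C (-1) (zr Z (shO C 1 X)) \<cdot> y = x"
      using dist_lift0[OF assms x] .
    then show ?thesis by (auto simp: ar_iff)
  qed
  have "u \<cdot> (p \<cdot> u \<boxplus> neg (idm C X)) = zr X Y" by (simp add: p(2)[THEN ra] vu)
  then have "p \<cdot> u \<boxplus> neg (idm C X) = zr X X" by (intro mono) (simp_all add: ar_iff)
  then have pu: "p \<cdot> u = idm C X" using eq_of_diff[of "p \<cdot> u" "idm C X"] by simp
  have "u \<cdot> (p \<cdot> s) = zr Z Y" by (simp add: p(2)[THEN ra] s(2))
  then have ps: "p \<cdot> s = zr Z X" by (intro mono) (simp_all add: ar_iff)
  have "s \<cdot> v \<boxplus> u \<cdot> p = idm C Y" by (simp add: p(2) madd_ac madd_cancel_apart)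
  then show thesis using s(2) vu pu ps
    by (intro that[of s p]) (simp add: biproduct_ar ar_iff)
qed

text \<open>Its purpose is to find biproducts in a class known to be closed under shifts and
  cones.\<close>

lemma cone_of_zero:
  assumes "dist C X Y Z (zr X Y) g h"
  obtains s p where "biproduct C (shO C 1 X) Y Z s g h p"
proof -
  have "dist C Y Z (shO C 1 X) g h (zr (shO C 1 X) (shO C 1 Y))"
    using dist_rot[OF assms] distD[OF assms] by (simp add: ar_iff)
  then show thesis by (rule dist_split) (rule that)
qed

lemma octahedron_obtain:
  assumes "dist C X Y Z' f a a'" "dist C Y Z X' g b b'" "dist C X Z Y' (g \<cdot> f) c c'"
  obtains u v where "dist C Z' Y' X' u v (shA C 1 a \<cdot> b')" "u \<cdot> a = c \<cdot> g" "c' \<cdot> u = a'"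
    "v \<cdot> c = b" "b' \<cdot> v = shA C 1 f \<cdot> c'"
  using octahedron[OF assms] by blast

text \<open>A \<open>3 \<times> 3\<close> lemma, obtained from three octahedra on the cone \<open>V\<close> of \<open>X1 \<rightarrow> Y2\<close>.\<close>

lemma cone_of_filtered_morphism:
  assumes X: "dist C X1 X2 GX j c e" and Y: "dist C Y1 Y2 GY j' c' e'"
    and Z1: "dist C X1 Y1 Z1 \<gamma>1 \<alpha>1 \<beta>1" and Z2: "dist C X2 Y2 Z2 \<gamma>2 \<alpha>2 \<beta>2"
    and sq: "\<gamma>2 \<cdot> j = j' \<cdot> \<gamma>1"
  obtains jz G cz ez u v k where "dist C Z1 Z2 G jz cz ez" "dist C GY G (shO C 1 GX) u v k"
    "jz \<cdot> \<alpha>1 = \<alpha>2 \<cdot> j'" "cz \<cdot> \<alpha>2 = u \<cdot> c'" "ez \<cdot> u = shA C 1 \<alpha>1 \<cdot> e'"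
    "v \<cdot> cz = shA C 1 c \<cdot> \<beta>2" "shA C 1 \<beta>1 \<cdot> ez = neg (shA C 1 e \<cdot> v)"
    "zero_object C GY \<longrightarrow> (\<forall>s g. ar s (shO C 1 GX) G \<and> v \<cdot> s = idm C (shO C 1 GX) \<and>
       ar g X2 Y1 \<and> j' \<cdot> g = \<gamma>2 \<longrightarrow> ez \<cdot> (s \<cdot> shA C 1 c) = neg (shA C 1 (\<alpha>1 \<cdot> g)))"
proof -
  note [simp] = distD[OF X, unfolded ar_iff] distD[OF Y, unfolded ar_iff] distD[OF Z1, unfolded ar_iff]
    distD[OF Z2, unfolded ar_iff]
  \<comment> \<open>\<open>V\<close> is the cone of the diagonal of the square. The two
    factorizations of the diagonal exhibit it as an extension of \<open>GY\<close> by
    \<open>Z1\<close> and of \<open>Z2\<close> by \<open>GX\<close>.\<close>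
  obtain V aV bV where V: "dist C X1 Y2 V (j' \<cdot> \<gamma>1) aV bV"
    using dist_ex[of X1 Y2 "j' \<cdot> \<gamma>1"] by (auto simp: Hom_ar ar_iff)
  note [simp] = distD[OF V, unfolded ar_iff]
  obtain u1 v1 where o1: "dist C Z1 V GY u1 v1 (shA C 1 \<alpha>1 \<cdot> e')" "u1 \<cdot> \<alpha>1 = aV \<cdot> j'" "bV \<cdot> u1 = \<beta>1"
    "v1 \<cdot> aV = c'" "e' \<cdot> v1 = shA C 1 \<gamma>1 \<cdot> bV"
    using octahedron_obtain[OF Z1 Y V] .
  have V': "dist C X1 Y2 V (\<gamma>2 \<cdot> j) aV bV" using V sq by simp
  obtain u2 v2 where o2: "dist C GX V Z2 u2 v2 (shA C 1 c \<cdot> \<beta>2)" "u2 \<cdot> c = aV \<cdot> \<gamma>2" "bV \<cdot> u2 = e"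
    "v2 \<cdot> aV = \<alpha>2" "\<beta>2 \<cdot> v2 = shA C 1 j \<cdot> bV"
    using octahedron_obtain[OF X Z2 V'] .
  note [simp] = distD[OF o1(1), unfolded ar_iff] distD[OF o2(1), unfolded ar_iff]
  \<comment> \<open>The third octahedron belongs to the composite Z1 -> V -> Z2, whose factors have
    cones \<open>GY\<close> and GX[1].\<close>
  obtain G cz ez where G: "dist C Z1 Z2 G (v2 \<cdot> u1) cz ez"
    using dist_ex[of Z1 Z2 "v2 \<cdot> u1"] by (auto simp: Hom_ar ar_iff)
  obtain u v where o3: "dist C GY G (shO C 1 GX) u v (shA C 1 v1 \<cdot> neg (shA C 1 u2))" "u \<cdot> v1 = cz \<cdot> v2"
    "ez \<cdot> u = shA C 1 \<alpha>1 \<cdot> e'" "v \<cdot> cz = shA C 1 c \<cdot> \<beta>2" "neg (shA C 1 u2) \<cdot> v = shA C 1 u1 \<cdot> ez"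
    using octahedron_obtain[OF o1(1) dist_rot[OF o2(1)] G] .
  note [simp] = distD[OF G, unfolded ar_iff] distD[OF o3(1), unfolded ar_iff]
  have r: "shA C 1 bV \<cdot> shA C 1 u1 = shA C 1 \<beta>1" "shA C 1 bV \<cdot> shA C 1 u2 = shA C 1 e"
    "shA C 1 u2 \<cdot> shA C 1 c = shA C 1 aV \<cdot> shA C 1 \<gamma>2" "shA C 1 u1 \<cdot> shA C 1 \<alpha>1 = shA C 1 aV \<cdot> shA C 1 j'"
    using arg_cong[OF o1(3), of "shA C 1"] arg_cong[OF o2(3), of "shA C 1"] arg_cong[OF o2(2), of "shA C 1"]
      arg_cong[OF o1(2), of "shA C 1"] by simp_all
  show thesis
  proof (rule that[OF G o3(1) _ _ o3(3,4)])
    show "(v2 \<cdot> u1) \<cdot> \<alpha>1 = \<alpha>2 \<cdot> j'" by (simp add: o1(2) o2(4)[THEN ra])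
    show "cz \<cdot> \<alpha>2 = u \<cdot> c'"
    proof -
      have "cz \<cdot> \<alpha>2 = (cz \<cdot> v2) \<cdot> aV" by (simp add: o2(4))
      also have "\<dots> = u \<cdot> c'" unfolding o3(2)[symmetric] by (simp add: o1(4))
      finally show ?thesis .
    qed
    show "shA C 1 \<beta>1 \<cdot> ez = neg (shA C 1 e \<cdot> v)"
    proof -
      have "shA C 1 \<beta>1 \<cdot> ez = shA C 1 bV \<cdot> (shA C 1 u1 \<cdot> ez)" by (simp add: r(1)[THEN ra])
      also have "\<dots> = neg (shA C 1 e \<cdot> v)" unfolding o3(5)[symmetric] by (simp add: r(2)[THEN ra])
      finally show ?thesis .
    qed
    show "zero_object C GY \<longrightarrow> (\<forall>s g. ar s (shO C 1 GX) G \<and> v \<cdot> s = idm C (shO C 1 GX) \<and>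
       ar g X2 Y1 \<and> j' \<cdot> g = \<gamma>2 \<longrightarrow> ez \<cdot> (s \<cdot> shA C 1 c) = neg (shA C 1 (\<alpha>1 \<cdot> g)))"
    proof (intro impI allI)
      fix s g
      assume zG: "zero_object C GY"
      assume "ar s (shO C 1 GX) G \<and> v \<cdot> s = idm C (shO C 1 GX) \<and> ar g X2 Y1 \<and> j' \<cdot> g = \<gamma>2"
      then have s: "ar s (shO C 1 GX) G" "v \<cdot> s = idm C (shO C 1 GX)" "ar g X2 Y1" "j' \<cdot> g = \<gamma>2" by auto
      note [simp] = s(1)[unfolded ar_iff] s(3)[unfolded ar_iff]
      have jg: "shA C 1 j' \<cdot> shA C 1 g = shA C 1 \<gamma>2" using arg_cong[OF s(4), of "shA C 1"] by simp
      \<comment> \<open>When \<open>GY\<close> is zero, the shift of \<open>u1\<close> is monic, so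
        the connecting arrow on the summand GX[1] can be compared with \<open>g\<close> after
        composing into V[1].\<close>
      let ?x = "ez \<cdot> (s \<cdot> shA C 1 c) \<boxplus> shA C 1 (\<alpha>1 \<cdot> g)"
      have "shA C 1 u1 \<cdot> (ez \<cdot> (s \<cdot> shA C 1 c)) = (shA C 1 u1 \<cdot> ez) \<cdot> (s \<cdot> shA C 1 c)" by simp
      also have "\<dots> = neg (shA C 1 u2 \<cdot> shA C 1 c)" unfolding o3(5)[symmetric]
        by (simp add: s(2)[THEN ra])
      also have "\<dots> = neg (shA C 1 aV \<cdot> shA C 1 \<gamma>2)" by (simp add: r(3))
      finally have "shA C 1 u1 \<cdot> ?x = zr (shO C 1 X2) (shO C 1 V)"
        by (simp add: r(4)[THEN ra] jg)
      then have "?x = zr (shO C 1 X2) (shO C 1 Z1)"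
        by (intro dist_mono[OF dist_shift_1[OF o1(1)] zero_object_shO[OF zG]]) (simp_all add: ar_iff)
      then have "?x = zr (src (shA C 1 (\<alpha>1 \<cdot> g))) (tgt (shA C 1 (\<alpha>1 \<cdot> g)))" by simp
      then have "shA C 1 (\<alpha>1 \<cdot> g) \<boxplus> ez \<cdot> (s \<cdot> shA C 1 c) = zr (src (shA C 1 (\<alpha>1 \<cdot> g))) (tgt (shA C 1 (\<alpha>1 \<cdot> g)))"
        by (subst madd_comm) simp_all
      then show "ez \<cdot> (s \<cdot> shA C 1 c) = neg (shA C 1 (\<alpha>1 \<cdot> g))"
        by (rule neg_unique) simp_all
    qed
  qed
qed

end

section \<open>Weights\<close>

context additive_category begin

lemma full_subcategory_additive:
  fixes D :: "('o, 'a, 'y) addcat_scheme"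
  assumes O: "Obj D \<subseteq> Obj C"
    and eqs: "Hom D = Hom C" "idm D = idm C" "cmp D = cmp C" "madd D = madd C" "mzero D = mzero C"
    and Z: "Z \<in> Obj D" "zero_object C Z"
    and b: "\<And>X Y. X \<in> Obj D \<Longrightarrow> Y \<in> Obj D \<Longrightarrow>
      \<exists>S i1 i2 p1 p2. S \<in> Obj D \<and> biproduct C X Y S i1 i2 p1 p2"
  shows "additive_category D"
proof (intro additive_category.intro additive_category_axioms.intro category.intro)
  have [simp]: "hom_group D = hom_group C" by (simp add: hom_group_def fun_eq_iff eqs)
  have O': "X \<in> Obj D \<Longrightarrow> X \<in> Obj C" for X using O by blast
  note [simp] = eqs
  show "\<exists>Z. zero_object D Z" using Z O' by (intro exI[of _ Z]) (auto simp: zero_object_def)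
  show "\<exists>S i1 i2 p1 p2. biproduct D X Y S i1 i2 p1 p2" if XY: "X \<in> Obj D" "Y \<in> Obj D" for X Y
  proof -
    obtain S i1 i2 p1 p2 where "S \<in> Obj D" "biproduct C X Y S i1 i2 p1 p2" using b[of X Y] XY by blast
    then have "biproduct D X Y S i1 i2 p1 p2" using XY by (simp add: biproduct_def)
    then show ?thesis by blast
  qed
next
  have O': "X \<in> Obj D \<Longrightarrow> X \<in> Obj C" for X using O by blast
  note [simp] = eqs
  fix X Y X' Y' f
  assume "X \<in> Obj D" "Y \<in> Obj D" "X' \<in> Obj D" "Y' \<in> Obj D"
    "f \<in> Hom D X Y" "f \<in> Hom D X' Y'"
  then show "X = X' \<and> Y = Y'" using Hom_disjoint[OF O' O' O' O'] by simp
next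
  have O': "X \<in> Obj D \<Longrightarrow> X \<in> Obj C" for X using O by blast
  note [simp] = eqs
  fix X assume "X \<in> Obj D"
  then show "idm D X \<in> Hom D X X" using idm_closed[OF O'] by simp
next
  have O': "X \<in> Obj D \<Longrightarrow> X \<in> Obj C" for X using O by blast
  note [simp] = eqs
  fix X Y Z f g
  assume "X \<in> Obj D" "Y \<in> Obj D" "Z \<in> Obj D"
    "f \<in> Hom D X Y" "g \<in> Hom D Y Z"
  then show "g \<cdot>\<^bsub>D\<^esub> f \<in> Hom D X Z"
    using cmp_closed[OF O' O' O'] by simp
next
  have O': "X \<in> Obj D \<Longrightarrow> X \<in> Obj C" for X using O by blast
  note [simp] = eqs
  fix X Y f assume "X \<in> Obj D" "Y \<in> Obj D" "f \<in> Hom D X Y"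
  then show "f \<cdot>\<^bsub>D\<^esub> idm D X = f" "idm D Y \<cdot>\<^bsub>D\<^esub> f = f"
    using cmp_idm[OF O' O'] idm_cmp[OF O' O'] by simp_all
next
  have O': "X \<in> Obj D \<Longrightarrow> X \<in> Obj C" for X using O by blast
  note [simp] = eqs
  fix X Y Z V f g h
  assume "X \<in> Obj D" "Y \<in> Obj D" "Z \<in> Obj D" "V \<in> Obj D"
    "f \<in> Hom D X Y" "g \<in> Hom D Y Z" "h \<in> Hom D Z V"
  then show "h \<cdot>\<^bsub>D\<^esub> g \<cdot>\<^bsub>D\<^esub> f = h \<cdot>\<^bsub>D\<^esub> (g \<cdot>\<^bsub>D\<^esub> f)"
    using cmp_assoc[OF O' O' O' O'] by simp
next
  have O': "X \<in> Obj D \<Longrightarrow> X \<in> Obj C" for X using O by blast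
  note [simp] = eqs
  fix X Y assume "X \<in> Obj D" "Y \<in> Obj D"
  then show "comm_group (hom_group D X Y)"
    using hom_comm_group[of X Y] O' by (simp add: hom_group_def)
next
  have O': "X \<in> Obj D \<Longrightarrow> X \<in> Obj C" for X using O by blast
  note [simp] = eqs
  fix X Y Z f g g'
  assume "X \<in> Obj D" "Y \<in> Obj D" "Z \<in> Obj D"
    "f \<in> Hom D X Y" "g \<in> Hom D Y Z" "g' \<in> Hom D Y Z"
  then show "madd D g g' \<cdot>\<^bsub>D\<^esub> f =
      madd D (g \<cdot>\<^bsub>D\<^esub> f) (g' \<cdot>\<^bsub>D\<^esub> f)"
    using cmp_madd_left[OF O' O' O'] by simp
next
  have O': "X \<in> Obj D \<Longrightarrow> X \<in> Obj C" for X using O by blast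
  note [simp] = eqs
  fix X Y Z f f' g
  assume "X \<in> Obj D" "Y \<in> Obj D" "Z \<in> Obj D"
    "f \<in> Hom D X Y" "f' \<in> Hom D X Y" "g \<in> Hom D Y Z"
  then show "g \<cdot>\<^bsub>D\<^esub> madd D f f' =
      madd D (g \<cdot>\<^bsub>D\<^esub> f) (g \<cdot>\<^bsub>D\<^esub> f')"
    using cmp_madd_right[OF O' O' O'] by simp
qed

end

context weight_structure begin

lemma wle_iff: "X \<in> wle C w i \<longleftrightarrow> X \<in> Obj C \<and> shO C (- i) X \<in> wle0 w"
proof
  assume "X \<in> wle C w i"
  then obtain Y where "Y \<in> wle0 w" "X = shO C i Y" by (auto simp: wle_def)
  then show "X \<in> Obj C \<and> shO C (- i) X \<in> wle0 w" using wle0_Obj by (auto simp: subset_iff)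
next
  assume "X \<in> Obj C \<and> shO C (- i) X \<in> wle0 w"
  then show "X \<in> wle C w i" unfolding wle_def by (intro image_eqI[of _ _ "shO C (- i) X"]) auto
qed

lemma wge_iff: "X \<in> wge C w i \<longleftrightarrow> X \<in> Obj C \<and> shO C (- i) X \<in> wge0 w"
proof
  assume "X \<in> wge C w i"
  then obtain Y where "Y \<in> wge0 w" "X = shO C i Y" by (auto simp: wge_def)
  then show "X \<in> Obj C \<and> shO C (- i) X \<in> wge0 w" using wge0_Obj by (auto simp: subset_iff)
next
  assume "X \<in> Obj C \<and> shO C (- i) X \<in> wge0 w"
  then show "X \<in> wge C w i" unfolding wge_def by (intro image_eqI[of _ _ "shO C (- i) X"]) auto
qed

lemma wle_Obj: "X \<in> wle C w i \<Longrightarrow> X \<in> Obj C" and wge_Obj: "X \<in> wge C w i \<Longrightarrow> X \<in> Obj C"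
  by (auto simp: wle_iff wge_iff)

lemma wle_0 [simp]: "wle C w 0 = wle0 w" and wge_0 [simp]: "wge C w 0 = wge0 w"
  using wle0_Obj wge0_Obj by (auto simp: wle_iff wge_iff)

lemma shO_wle [simp]: "X \<in> Obj C \<Longrightarrow> shO C k X \<in> wle C w i \<longleftrightarrow> X \<in> wle C w (i - k)"
  and shO_wge [simp]: "X \<in> Obj C \<Longrightarrow> shO C k X \<in> wge C w i \<longleftrightarrow> X \<in> wge C w (i - k)"
  by (auto simp: wle_iff wge_iff)

lemma wle_Suc: assumes "X \<in> wle C w i" shows "X \<in> wle C w (i + 1)"
proof -
  have "shO C (- i) X \<in> wle0 w" using assms by (simp add: wle_iff)
  then obtain Y where Y: "Y \<in> wle0 w" "shO C (- i) X = shO C 1 Y" using wle0_shift by blast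
  then have "shO C (-1) (shO C (- i) X) = Y" using wle0_Obj by (auto simp: subset_iff)
  moreover have "shO C (-1) (shO C (- i) X) = shO C (- (i + 1)) X"
    using assms by (simp add: wle_iff algebra_simps)
  ultimately show ?thesis using Y(1) assms by (simp add: wle_iff)
qed

lemma wge_Suc: assumes "X \<in> wge C w (i + 1)" shows "X \<in> wge C w i"
proof -
  have 1: "shO C (- (i + 1)) X \<in> wge0 w" "X \<in> Obj C" using assms by (auto simp: wge_iff)
  have "shO C 1 (shO C (- (i + 1)) X) \<in> wge0 w" using 1(1) wge0_shift by blast
  then show ?thesis using 1(2) by (simp add: wge_iff)
qed

lemma wle_mono: assumes "X \<in> wle C w i" "i \<le> j" shows "X \<in> wle C w j"
  using assms(2,1) by (induction j rule: int_ge_induct) (auto intro: wle_Suc)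

lemma wge_mono: assumes "X \<in> wge C w j" "i \<le> j" shows "X \<in> wge C w i"
proof -
  have "X \<in> wge C w j \<Longrightarrow> X \<in> wge C w i"
    using assms(2) by (induction j rule: int_ge_induct) (auto intro: wge_Suc)
  then show ?thesis using assms(1) .
qed

lemma weight_orth:
  assumes "ar f X Y" "X \<in> wle C w i" "Y \<in> wge C w j" "i < j"
  shows "f = zr X Y"
proof -
  note [simp] = assms(1)[unfolded ar_iff]
  have Y: "Y \<in> wge C w (i + 1)" using wge_mono[OF assms(3), of "i + 1"] assms(4) by simp
  have 1: "shO C (- i) X \<in> wle0 w" using assms(2) by (simp add: wle_iff)
  have "shO C (- (i + 1)) Y \<in> wge0 w" using Y by (simp add: wge_iff)
  then have "shO C 1 (shO C (- (i + 1)) Y) \<in> shO C 1 ` wge0 w" by blast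
  then have 2: "shO C (- i) Y \<in> shO C 1 ` wge0 w" by simp
  have "shA C (- i) f \<in> Hom C (shO C (- i) X) (shO C (- i) Y)" by (simp add: Hom_ar ar_iff)
  then have "shA C (- i) f = zr (shO C (- i) X) (shO C (- i) Y)" using orthogonal[OF 1 2] by simp
  then show ?thesis by (simp add: shA_eq_zr_iff)
qed

lemma decomposition_exists:
  assumes "X \<in> Obj C" shows "\<exists>L R h g k. weight_decomposition C w i L X R h g k"
proof -
  obtain L R h g k where d: "dist C L (shO C (- i) X) R h g k" "L \<in> wle0 w" "R \<in> shO C 1 ` wge0 w"
    using decomposition[of "shO C (- i) X"] assms by auto
  have R: "R \<in> wge C w 1" using d(3) by (simp add: wge_def)
  have "L \<in> Obj C" "R \<in> Obj C" using distD[OF d(1)] by (auto simp: ar_def)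
  then have "weight_decomposition C w i (shO C i L) X (shO C i R) (shA C i h) (shA C i g)
      (if even i then shA C i k else neg (shA C i k))"
    using dist_shift[OF d(1), of i] assms R d(2) unfolding weight_decomposition_def by simp
  then show ?thesis by blast
qed

lemma shO_retract: assumes "retract_of C X Y" shows "retract_of C (shO C k X) (shO C k Y)"
proof -
  obtain s r where 1: "ar s X Y" "ar r Y X" "r \<cdot> s = idm C X" using assms unfolding retract_of_ar by blast
  have "shA C k r \<cdot> shA C k s = idm C (shO C k X)"
    using arg_cong[OF 1(3), of "shA C k"] 1(1,2) by (simp add: ar_iff)
  then show ?thesis unfolding retract_of_ar using ar_shA 1 by blast
qed

lemma wle_retract: "X \<in> wle C w i \<Longrightarrow> retract_of C Y X \<Longrightarrow> Y \<in> wle C w i"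
  and wge_retract: "X \<in> wge C w i \<Longrightarrow> retract_of C Y X \<Longrightarrow> Y \<in> wge C w i"
  using wle0_retract[of "shO C (- i) X" "shO C (- i) Y"] wge0_retract[of "shO C (- i) X" "shO C (- i) Y"]
    shO_retract[of Y X "- i"] unfolding wle_iff wge_iff
  by (simp_all add: retract_of_def[of C Y X])

text \<open>The quotient map of a decomposition vanishes, so the identity lifts and \<open>X\<close>
  is a retract of its own truncation. Closure properties of the weight classes can thus be tested on
  arrows.\<close>

lemma wle_orthI:
  assumes "X \<in> Obj C" "\<And>R f. R \<in> wge C w (i + 1) \<Longrightarrow> ar f X R \<Longrightarrow> f = zr X R"
  shows "X \<in> wle C w i"
proof -
  obtain L R h g k where d: "dist C L X R h g k" "L \<in> wle C w i" "R \<in> wge C w (i + 1)"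
    using decomposition_exists[OF assms(1)] unfolding weight_decomposition_def by blast
  note [simp] = distD[OF d(1), unfolded ar_iff]
  have "g \<cdot> idm C X = zr X R" using assms(2)[OF d(3) distD(2)[OF d(1)]] by simp
  then obtain y where "ar y X L" "h \<cdot> y = idm C X"
    using dist_lift[OF d(1) ar_idm[OF assms(1)]] by blast
  then have "retract_of C X L" unfolding retract_of_ar using distD(1)[OF d(1)] by blast
  then show ?thesis using wle_retract d(2) by blast
qed

lemma wge_orthI:
  assumes "Y \<in> Obj C" "\<And>L f. L \<in> wle C w (i - 1) \<Longrightarrow> ar f L Y \<Longrightarrow> f = zr L Y"
  shows "Y \<in> wge C w i"
proof -
  obtain L R h g k where d: "dist C L Y R h g k" "L \<in> wle C w (i - 1)" "R \<in> wge C w i"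
    using decomposition_exists[OF assms(1), of "i - 1"] unfolding weight_decomposition_def by auto
  note [simp] = distD[OF d(1), unfolded ar_iff]
  have "idm C Y \<cdot> h = zr L Y" using assms(2)[OF d(2) distD(1)[OF d(1)]] by simp
  then obtain y where "ar y R Y" "y \<cdot> g = idm C Y"
    using dist_extend[OF d(1) ar_idm[OF assms(1)]] by blast
  then have "retract_of C Y R" unfolding retract_of_ar using distD(2)[OF d(1)] by blast
  then show ?thesis using wge_retract d(3) by blast
qed

lemma wle_extension:
  assumes "dist C X Y Z f g h" "X \<in> wle C w i" "Z \<in> wle C w i" shows "Y \<in> wle C w i"
proof (rule wle_orthI)
  note [simp] = distD[OF assms(1), unfolded ar_iff]
  show "Y \<in> Obj C" by simp
  fix R x assume R: "R \<in> wge C w (i + 1)" and x: "ar x Y R"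
  note [simp] = x[unfolded ar_iff]
  have "ar (x \<cdot> f) X R" by (simp add: ar_iff)
  then have "x \<cdot> f = zr X R" using weight_orth[OF _ assms(2) R] by simp
  then obtain z where z: "ar z Z R" "z \<cdot> g = x" using dist_extend[OF assms(1) x] by blast
  then have "z = zr Z R" using weight_orth[OF z(1) assms(3) R] by simp
  then show "x = zr Y R" by (simp flip: z(2))
qed

lemma wge_extension:
  assumes "dist C X Y Z f g h" "X \<in> wge C w i" "Z \<in> wge C w i" shows "Y \<in> wge C w i"
proof (rule wge_orthI)
  note [simp] = distD[OF assms(1), unfolded ar_iff]
  show "Y \<in> Obj C" by simp
  fix L x assume L: "L \<in> wle C w (i - 1)" and x: "ar x L Y"
  note [simp] = x[unfolded ar_iff]
  have "ar (g \<cdot> x) L Z" by (simp add: ar_iff)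
  then have "g \<cdot> x = zr L Z" using weight_orth[OF _ L assms(3)] by simp
  then obtain y where y: "ar y L X" "f \<cdot> y = x" using dist_lift[OF assms(1) x] by blast
  then have "y = zr L X" using weight_orth[OF y(1) L assms(2)] by simp
  then show "x = zr L Y" by (simp flip: y(2))
qed

lemma wle_cone:
  assumes "dist C X Y Z f g h" "X \<in> wle C w (i - 1)" "Y \<in> wle C w i" shows "Z \<in> wle C w i"
  using wle_extension[OF dist_rot[OF assms(1)], of i] assms(2,3) wle_Obj by simp

lemma zero_wle: "zero_object C Z \<Longrightarrow> Z \<in> wle C w i"
  and zero_wge: "zero_object C Z \<Longrightarrow> Z \<in> wge C w i"
  using from_zero to_zero by (auto intro!: wle_orthI wge_orthI zero_object_Obj)

lemma biproduct_wle:
  assumes "biproduct C X Y S i1 i2 p1 p2" "X \<in> wle C w i" "Y \<in> wle C w i" shows "S \<in> wle C w i"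
proof (rule wle_orthI)
  note [simp] = assms(1)[unfolded biproduct_ar ar_iff]
  show "S \<in> Obj C" by simp
  fix R x assume R: "R \<in> wge C w (i + 1)" and x: "ar x S R"
  note [simp] = x[unfolded ar_iff]
  have "ar (x \<cdot> i1) X R" "ar (x \<cdot> i2) Y R" by (simp_all add: ar_iff)
  then have "x \<cdot> i1 = zr X R" "x \<cdot> i2 = zr Y R" using weight_orth[OF _ _ R] assms(2,3) by simp_all
  then show "x = zr S R" using biproduct_ext_from[OF assms(1), of x "zr S R"] R wge_Obj by simp
qed

lemma biproduct_wge:
  assumes "biproduct C X Y S i1 i2 p1 p2" "X \<in> wge C w i" "Y \<in> wge C w i" shows "S \<in> wge C w i"
proof (rule wge_orthI)
  note [simp] = assms(1)[unfolded biproduct_ar ar_iff]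
  show "S \<in> Obj C" by simp
  fix L x assume L: "L \<in> wle C w (i - 1)" and x: "ar x L S"
  note [simp] = x[unfolded ar_iff]
  have "ar (p1 \<cdot> x) L X" "ar (p2 \<cdot> x) L Y" by (simp_all add: ar_iff)
  then have "p1 \<cdot> x = zr L X" "p2 \<cdot> x = zr L Y" using weight_orth[OF _ L] assms(2,3) by simp_all
  then show "x = zr L S" using biproduct_ext_to[OF assms(1), of x "zr L S"] L wle_Obj by simp
qed

section \<open>The heart as an additive category\<close>

lemma heart_simps [simp]:
  "Hom (heart C w) = Hom C" "idm (heart C w) = idm C"
  "cmp (heart C w) = cmp C" "madd (heart C w) = madd C" "mzero (heart C w) = mzero C"
  "hom_group (heart C w) = hom_group C" "mneg (heart C w) = mneg C"
  by (simp_all add: heart_def hom_group_def mneg_def fun_eq_iff full_sub_def)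

lemma heart_Obj: "Obj (heart C w) = wge C w 0 \<inter> wle C w 0"
  by (simp add: heart_def)

lemma heart_Obj_C: "X \<in> Obj (heart C w) \<Longrightarrow> X \<in> Obj C"
  using wle_Obj[of X 0] by (simp add: heart_Obj)

lemma heart_zero_object: "zero_object (heart C w) Z \<longleftrightarrow> zero_object C Z"
proof
  assume "zero_object (heart C w) Z"
  then have Z: "Z \<in> Obj (heart C w)" "\<exists>!f. f \<in> Hom C Z Z" by (auto simp: zero_object_def)
  then have "idm C Z = zr Z Z" using ar_idm[of Z] ar_zr[of Z Z] heart_Obj_C by (auto simp: Hom_ar)
  then show "zero_object C Z" using Z heart_Obj_C by (simp add: zero_object_idm)
next
  assume Z: "zero_object C Z"
  then have "Z \<in> Obj (heart C w)" using zero_wle[of Z 0] zero_wge[of Z 0] by (simp add: heart_Obj)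
  then show "zero_object (heart C w) Z" using Z heart_Obj_C by (auto simp: zero_object_def)
qed

lemma heart_biproduct: "biproduct (heart C w) X Y S i1 i2 p1 p2 \<longleftrightarrow>
    biproduct C X Y S i1 i2 p1 p2 \<and> X \<in> Obj (heart C w) \<and> Y \<in> Obj (heart C w)"
proof
  assume "biproduct (heart C w) X Y S i1 i2 p1 p2"
  then show "biproduct C X Y S i1 i2 p1 p2 \<and> X \<in> Obj (heart C w) \<and> Y \<in> Obj (heart C w)"
    using heart_Obj_C[of X] heart_Obj_C[of Y] heart_Obj_C[of S] by (simp add: biproduct_def)
next
  assume b: "biproduct C X Y S i1 i2 p1 p2 \<and> X \<in> Obj (heart C w) \<and> Y \<in> Obj (heart C w)"
  then have "S \<in> Obj (heart C w)"
    using biproduct_wle[of X Y S i1 i2 p1 p2 0] biproduct_wge[of X Y S i1 i2 p1 p2 0]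
    by (simp add: heart_Obj)
  then show "biproduct (heart C w) X Y S i1 i2 p1 p2" using b by (simp add: biproduct_def)
qed

lemma heart_additive: "additive_category (heart C w)"
proof (rule full_subcategory_additive[of _ zob])
  show "Obj (heart C w) \<subseteq> Obj C" using heart_Obj_C by blast
  show "zob \<in> Obj (heart C w)" using zero_wle[OF zob(1), of 0] zero_wge[OF zob(1), of 0] by (simp add: heart_Obj)
  fix X Y assume "X \<in> Obj (heart C w)" "Y \<in> Obj (heart C w)"
  then show "\<exists>S i1 i2 p1 p2. S \<in> Obj (heart C w) \<and> biproduct C X Y S i1 i2 p1 p2"
    using ex_biproduct[of X Y] heart_Obj_C heart_biproduct unfolding biproduct_def[of "heart C w"] by metis
qed simp_all

end

sublocale weight_structure \<subseteq> H: additive_category "heart C w"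
  by (rule heart_additive)

context weight_structure begin

lemma H_ar: "H.ar f X Y \<longleftrightarrow> ar f X Y \<and> X \<in> Obj (heart C w) \<and> Y \<in> Obj (heart C w)"
  using heart_Obj_C by (auto simp: ar_def H.ar_def)

text \<open>\<open>H.neg\<close> reads source and target inside the heart. They agree with those in
  \<open>C\<close>, so the signs in shifted complexes over the heart can be computed in
  \<open>C\<close>.\<close>

lemma H_neg: assumes "H.ar f X Y" shows "H.neg f = neg f"
proof -
  have "H.src f = X" "H.tgt f = Y" using assms H.src_eq H.tgt_eq by blast+
  moreover have "src f = X" "tgt f = Y" using assms src_eq tgt_eq H_ar by blast+
  ultimately show ?thesis by (simp add: H.neg_def neg_def)
qed

lemma H_complexes: "X \<in> complexes (heart C w) \<longleftrightarrow>
    (\<forall>n. cob X n \<in> Obj (heart C w) \<and> ar (cdf X n) (cob X n) (cob X (n + 1)) \<and>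
      cdf X (n + 1) \<cdot> cdf X n = zr (cob X n) (cob X (n + 1 + 1)))"
  unfolding H.complexes_ar H_ar by auto

lemma H_cm: "H.cm X Y f \<longleftrightarrow> X \<in> complexes (heart C w) \<and> Y \<in> complexes (heart C w) \<and>
    (\<forall>n. ar (f n) (cob X n) (cob Y n) \<and> cdf Y n \<cdot> f n = f (n + 1) \<cdot> cdf X n)"
  unfolding H.cm_ar H_ar using H.cplxD(4) by auto

lemma H_cplxD:
  assumes "X \<in> complexes (heart C w)"
  shows "cob X n \<in> Obj (heart C w)" "cob X n \<in> Obj C" "is_arr (cdf X n)" "src (cdf X n) = cob X n"
    "tgt (cdf X n) = cob X (n + 1)" "m = n + 1 \<Longrightarrow> cdf X m \<cdot> cdf X n = zr (cob X n) (cob X (m + 1))"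
  using assms heart_Obj_C unfolding H_complexes ar_iff by blast+

lemma H_cmD:
  assumes "H.cm X Y f"
  shows "is_arr (f n)" "src (f n) = cob X n" "tgt (f n) = cob Y n"
    "cdf Y n \<cdot> f n = f (n + 1) \<cdot> cdf X n"
  using assms unfolding H_cm ar_iff by blast+

lemma H_homotopicI:
  assumes "X \<in> complexes (heart C w)" "Y \<in> complexes (heart C w)" "\<And>n. ar (s n) (cob X n) (cob Y (n - 1))"
    "\<And>n. f n = g n \<boxplus> (cdf Y (n - 1) \<cdot> s n \<boxplus> s (n + 1) \<cdot> cdf X n)"
  shows "homotopic (heart C w) X Y f g"
  by (rule H.homotopicI[where s = s]) (use assms H_cplxD(1) in \<open>simp_all add: H_ar\<close>)

end

section \<open>Weight Postnikov towers\<close>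

lemma int_norms:
  fixes n :: int
  shows "- 1 - n = - n - 1" "- 2 - n = - n - 2" "2 + n = n + 2" "1 + n = n + 1" "- (n + 1) = - n - 1" "- (n + 2) = - n - 2"
  by simp_all

context weight_structure begin

lemma gives_decompositionE:
  assumes "gives_decomposition C w i L M h"
  obtains R g k where "dist C L M R h g k" "L \<in> wle C w i" "R \<in> wge C w (i + 1)"
  using assms unfolding gives_decomposition_def weight_decomposition_def by blast

lemma gives_decompositionI:
  "dist C L M R h g k \<Longrightarrow> L \<in> wle C w i \<Longrightarrow> R \<in> wge C w (i + 1) \<Longrightarrow> gives_decomposition C w i L M h"
  unfolding gives_decomposition_def weight_decomposition_def by blast

lemma gives_decompositionD:
  assumes "gives_decomposition C w i L M h"
  shows "ar h L M" "L \<in> wle C w i" "M \<in> Obj C" "L \<in> Obj C"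
  using assms distD[of L M] by (auto elim!: gives_decompositionE simp: ar_def)

lemma gives_decomposition_ex: "M \<in> Obj C \<Longrightarrow> \<exists>L h. gives_decomposition C w i L M h"
  using decomposition_exists unfolding gives_decomposition_def by blast

lemma gives_decomposition_id:
  assumes "M \<in> wle C w k" "k \<le> i" shows "gives_decomposition C w i M M (idm C M)"
  using gives_decompositionI[OF dist_idm[OF wle_Obj[OF assms(1)] zob(1)]] wle_mono[OF assms] zero_wge[OF zob(1)]
  by blast

text \<open>The obstruction is an arrow from \<open>A\<close> to the quotient, which has weight at
  least \<open>i + 1\<close>; the case \<open>k = i\<close> is therefore still allowed.\<close>

lemma decomposition_lift:
  assumes "gives_decomposition C w i L M h" "ar x A M" "A \<in> wle C w k" "k \<le> i"
  obtains y where "ar y A L" "h \<cdot> y = x"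
proof -
  obtain R g k' where d: "dist C L M R h g k'" "R \<in> wge C w (i + 1)"
    using assms(1) by (rule gives_decompositionE)
  note [simp] = distD[OF d(1), unfolded ar_iff] assms(2)[unfolded ar_iff]
  have "ar (g \<cdot> x) A R" by (simp add: ar_iff)
  then have "g \<cdot> x = zr A R" using weight_orth[OF _ assms(3) d(2)] assms(4) by simp
  then show thesis using dist_lift[OF d(1) assms(2)] that by blast
qed

text \<open>What \<open>h\<close> kills comes from the quotient shifted by -1, of weight at least
  \<open>i\<close>. Uniqueness of lifts thus needs the strict bound \<open>k < i\<close>.\<close>

lemma decomposition_mono:
  assumes "gives_decomposition C w i L M h" "ar y A L" "A \<in> wle C w k" "k < i" "h \<cdot> y = zr A M"
  shows "y = zr A L"
proof -
  obtain R g k' where d: "dist C L M R h g k'" "R \<in> wge C w (i + 1)"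
    using assms(1) by (rule gives_decompositionE)
  note [simp] = distD[OF d(1), unfolded ar_iff] assms(2)[unfolded ar_iff]
  obtain z where z: "ar z A (shO C (-1) R)" "shA C (-1) k' \<cdot> z = y"
    using dist_lift0[OF d(1) assms(2,5)] .
  have "shO C (-1) R \<in> wge C w i" using d(2) by simp
  then have "z = zr A (shO C (-1) R)" using weight_orth[OF z(1) assms(3) _ assms(4)] by blast
  then show ?thesis by (simp flip: z(2))
qed

lemma decomposition_unique:
  assumes "gives_decomposition C w i L M h" "ar y A L" "ar y' A L" "A \<in> wle C w k" "k < i" "h \<cdot> y = h \<cdot> y'"
  shows "y = y'"
proof -
  note [simp] = gives_decompositionD(1)[OF assms(1), unfolded ar_iff] assms(2,3)[unfolded ar_iff]
  have "y \<boxplus> neg y' = zr A L"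
    by (rule decomposition_mono[OF assms(1) _ assms(4,5)]) (simp_all add: ar_iff assms(6))
  then show ?thesis using eq_of_diff[of y y'] by simp
qed

lemma towerD:
  assumes "is_tower C w M P"
  shows "M \<in> Obj C" "gives_decomposition C w i (tw_ob P i) M (tw_h P i)"
    "is_arr (tw_h P i)" "src (tw_h P i) = tw_ob P i" "tgt (tw_h P i) = M"
    "is_arr (tw_j P i)" "src (tw_j P i) = tw_ob P i" "tgt (tw_j P i) = tw_ob P (i + 1)"
    "is_arr (tw_c P i)" "src (tw_c P i) = tw_ob P i" "tgt (tw_c P i) = tw_gr P i"
    "is_arr (tw_e P i)" "src (tw_e P i) = tw_gr P (i + 1)" "tgt (tw_e P i) = shO C 1 (tw_ob P i)"
    "tw_ob P i \<in> Obj C" "tw_gr P i \<in> Obj C"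
    "tw_h P (i + 1) \<cdot> tw_j P i = tw_h P i"
    "dist C (tw_ob P (i - 1)) (tw_ob P i) (tw_gr P i) (tw_j P (i - 1)) (tw_c P i) (tw_e P (i - 1))"
    "tw_ob P i \<in> wle C w i" "tw_gr P i \<in> wle C w i" "tw_gr P i \<in> wge C w i"
proof -
  have P: "gives_decomposition C w i (tw_ob P i) M (tw_h P i)"
      "tw_h P (i + 1) \<cdot> tw_j P i = tw_h P i"
      "dist C (tw_ob P (i - 1)) (tw_ob P i) (tw_gr P i) (tw_j P (i - 1)) (tw_c P i) (tw_e P (i - 1))" for i
    using assms unfolding is_tower_def by blast+
  show "M \<in> Obj C" "gives_decomposition C w i (tw_ob P i) M (tw_h P i)"
    "tw_h P (i + 1) \<cdot> tw_j P i = tw_h P i"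
    "dist C (tw_ob P (i - 1)) (tw_ob P i) (tw_gr P i) (tw_j P (i - 1)) (tw_c P i) (tw_e P (i - 1))"
    "tw_ob P i \<in> wle C w i"
    using P gives_decompositionD by blast+
  show "is_arr (tw_h P i)" "src (tw_h P i) = tw_ob P i" "tgt (tw_h P i) = M"
    "tw_ob P i \<in> Obj C" using gives_decompositionD(1)[OF P(1)[of i]] by (auto simp: ar_iff)
  show "is_arr (tw_j P i)" "src (tw_j P i) = tw_ob P i" "tgt (tw_j P i) = tw_ob P (i + 1)"
    "is_arr (tw_e P i)" "src (tw_e P i) = tw_gr P (i + 1)" "tgt (tw_e P i) = shO C 1 (tw_ob P i)"
    using distD[OF P(3)[of "i + 1"]] by (simp_all add: ar_iff)
  show "is_arr (tw_c P i)" "src (tw_c P i) = tw_ob P i" "tgt (tw_c P i) = tw_gr P i" "tw_gr P i \<in> Obj C"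
    using distD[OF P(3)[of i]] by (simp_all add: ar_iff)
  show "tw_gr P i \<in> wle C w i"
    using wle_cone[OF P(3)[of i]] gives_decompositionD(2)[OF P(1)] by blast
  obtain R g k where 1: "dist C (tw_ob P i) M R (tw_h P i) g k" "R \<in> wge C w (i + 1)"
    using P(1)[of i] by (rule gives_decompositionE)
  obtain R' g' k' where 2: "dist C (tw_ob P (i - 1)) M R' (tw_h P i \<cdot> tw_j P (i - 1)) g' k'" "R' \<in> wge C w i"
    using P(1)[of "i - 1"] P(2)[of "i - 1"] by (auto elim!: gives_decompositionE)
  \<comment> \<open>The octahedron on w_{<=i-1} M -> w_{<=i} M -> M makes the graded piece an
    extension of \<open>R'\<close> by R[-1], both of weight at least \<open>i\<close>.\<close>
  obtain u v k'' where o: "dist C (tw_gr P i) R' R u v k''"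
    using octahedron_obtain[OF P(3)[of i] 1(1) 2(1)] .
  have "shO C (-1) R \<in> wge C w i" using 1 distD[OF 1(1)] by (simp add: ar_iff)
  then show "tw_gr P i \<in> wge C w i"
    using wge_extension[OF dist_unrot[OF o]] 2(2) by blast
qed

lemma tower_cmp:
  assumes "is_tower C w M P"
  shows "m = i + 1 \<Longrightarrow> tw_c P m \<cdot> tw_j P i = zr (tw_ob P i) (tw_gr P m)"
    "m = i + 1 \<Longrightarrow> tw_e P i \<cdot> tw_c P m = zr (tw_ob P m) (shO C 1 (tw_ob P i))"
  using dist_cmp_zero[OF towerD(18)[OF assms, of "i + 1"]] by simp_all

section \<open>Existence of towers with prescribed truncations\<close>

lemma tower_exists:
  assumes "\<And>i. gives_decomposition C w i (L i) M (h i)"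
  obtains P where "is_tower C w M P" "tw_ob P = L" "tw_h P = h"
proof -
  note D = gives_decompositionD[OF assms]
  have "\<forall>i. \<exists>j. ar j (L i) (L (i + 1)) \<and> h (i + 1) \<cdot> j = h i"
    using decomposition_lift[OF assms D(1) D(2)] by (metis zle_add1_eq_le less_add_one order_less_imp_le)
  from choice[OF this] obtain j where j: "\<And>i. ar (j i) (L i) (L (i + 1))" "\<And>i. h (i + 1) \<cdot> j i = h i" by blast
  have "\<forall>i. \<exists>t. case t of (G, c, e) \<Rightarrow> dist C (L (i - 1)) (L i) G (j (i - 1)) c e"
  proof
    fix i
    obtain G c e where "dist C (L (i - 1)) (L i) G (j (i - 1)) c e"
      using dist_ex[of "L (i - 1)" "L i" "j (i - 1)"] j(1)[of "i - 1"] by (auto simp: Hom_ar ar_iff)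
    then show "\<exists>t. case t of (G, c, e) \<Rightarrow> dist C (L (i - 1)) (L i) G (j (i - 1)) c e"
      by (intro exI[of _ "(G, c, e)"]) simp
  qed
  from choice[OF this] obtain t where t: "\<forall>i. case t i of (G, c, e) \<Rightarrow> dist C (L (i - 1)) (L i) G (j (i - 1)) c e" ..
  define P where "P = \<lparr>tw_ob = L, tw_gr = (\<lambda>i. fst (t i)), tw_h = h, tw_j = j,
    tw_c = (\<lambda>i. fst (snd (t i))), tw_e = (\<lambda>i. snd (snd (t (i + 1))))\<rparr>"
  have "is_tower C w M P"
    unfolding is_tower_def P_def using assms j t by (auto simp: case_prod_beta ar_def)
  then show thesis by (rule that) (simp_all add: P_def)
qed

lemma tower_of_constant:
  assumes "is_tower C w M P" "\<And>i. k \<le> i \<Longrightarrow> tw_ob P i = M \<and> tw_h P i = idm C M"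
  shows "k \<le> i \<Longrightarrow> tw_j P i = idm C M" "k < i \<Longrightarrow> zero_object C (tw_gr P i)"
proof -
  note [simp] = towerD(1,3-17)[OF assms(1)]
  have j: "tw_j P i = idm C M" if "k \<le> i" for i
  proof -
    have "tgt (tw_j P i) = M" "tw_h P (i + 1) = idm C M" "tw_h P i = idm C M"
      using that assms(2)[of i] assms(2)[of "i + 1"] towerD(8)[OF assms(1), of i] by auto
    then show ?thesis using towerD(17)[OF assms(1), of i] id_cmp[OF towerD(6)[OF assms(1), of i]] by metis
  qed
  then show "k \<le> i \<Longrightarrow> tw_j P i = idm C M" .
  assume i: "k < i"
  show "zero_object C (tw_gr P i)"
    using dist_zero_of_iso[OF towerD(18)[OF assms(1), of i]] j[of "i - 1"] assms(2)[of i] assms(2)[of "i - 1"] i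
      iso_arrow_idm[of M] by simp
qed

lemma bounded_tower_exists:
  assumes "M \<in> wle C w k"
  obtains P where "is_tower C w M P" "\<forall>i\<ge>k. tw_ob P i = M \<and> tw_h P i = idm C M"
proof -
  have "\<forall>i. \<exists>t. case t of (L, h) \<Rightarrow> gives_decomposition C w i L M h \<and> (k \<le> i \<longrightarrow> L = M \<and> h = idm C M)"
  proof
    fix i
    show "\<exists>t. case t of (L, h) \<Rightarrow> gives_decomposition C w i L M h \<and> (k \<le> i \<longrightarrow> L = M \<and> h = idm C M)"
    proof (cases "k \<le> i")
      case True
      then show ?thesis using gives_decomposition_id[OF assms True] by (intro exI[of _ "(M, idm C M)"]) simp
    next
      case False
      then show ?thesis using gives_decomposition_ex[OF wle_Obj[OF assms], of i] by auto
    qed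
  qed
  from choice[OF this] obtain t where t: "\<forall>i. case t i of (L, h) \<Rightarrow> gives_decomposition C w i L M h \<and>
     (k \<le> i \<longrightarrow> L = M \<and> h = idm C M)" ..
  then have "\<And>i. gives_decomposition C w i (fst (t i)) M (snd (t i))" by (simp add: case_prod_beta)
  then obtain P where "is_tower C w M P" "tw_ob P = (\<lambda>i. fst (t i))" "tw_h P = (\<lambda>i. snd (t i))"
    by (rule tower_exists)
  then show thesis using t by (intro that[of P]) (auto simp: case_prod_beta)
qed

lemma tower_exists_with:
  assumes "gives_decomposition C w m L M h"
  obtains P where "is_tower C w M P" "tw_ob P m = L" "tw_h P m = h"
proof -
  have M: "M \<in> Obj C" using gives_decompositionD[OF assms] by blast
  have "\<forall>i. \<exists>t. case t of (L', h') \<Rightarrow> gives_decomposition C w i L' M h' \<and> (i = m \<longrightarrow> L' = L \<and> h' = h)"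
  proof
    fix i
    show "\<exists>t. case t of (L', h') \<Rightarrow> gives_decomposition C w i L' M h' \<and> (i = m \<longrightarrow> L' = L \<and> h' = h)"
    proof (cases "i = m")
      case True
      then show ?thesis using assms by (intro exI[of _ "(L, h)"]) simp
    next
      case False
      then show ?thesis using gives_decomposition_ex[OF M, of i] by auto
    qed
  qed
  from choice[OF this] obtain t where t: "\<forall>i. case t i of (L', h') \<Rightarrow> gives_decomposition C w i L' M h' \<and>
     (i = m \<longrightarrow> L' = L \<and> h' = h)" ..
  then have "\<And>i. gives_decomposition C w i (fst (t i)) M (snd (t i))" by (simp add: case_prod_beta)
  then obtain P where "is_tower C w M P" "tw_ob P = (\<lambda>i. fst (t i))" "tw_h P = (\<lambda>i. snd (t i))"
    by (rule tower_exists)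
  then show thesis using t by (intro that[of P]) (auto simp: case_prod_beta)
qed

section \<open>Morphisms of towers\<close>

lemma tower_morD:
  assumes "is_tower_mor C M P M' P' g gle ggr" "is_tower C w M P" "is_tower C w M' P'"
  shows "ar g M M'" "is_arr (gle i)" "src (gle i) = tw_ob P i" "tgt (gle i) = tw_ob P' i"
    "is_arr (ggr i)" "src (ggr i) = tw_gr P i" "tgt (ggr i) = tw_gr P' i"
    "tw_h P' i \<cdot> gle i = g \<cdot> tw_h P i" "tw_j P' i \<cdot> gle i = gle (i + 1) \<cdot> tw_j P i"
    "tw_c P' i \<cdot> gle i = ggr i \<cdot> tw_c P i" "m = i + 1 \<Longrightarrow> tw_e P' i \<cdot> ggr m = shA C 1 (gle i) \<cdot> tw_e P i"
proof -
  note [simp] = towerD(1,15,16)[OF assms(2)] towerD(1,15,16)[OF assms(3)]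
  show "ar g M M'" "is_arr (gle i)" "src (gle i) = tw_ob P i" "tgt (gle i) = tw_ob P' i"
    "is_arr (ggr i)" "src (ggr i) = tw_gr P i" "tgt (ggr i) = tw_gr P' i"
    "tw_h P' i \<cdot> gle i = g \<cdot> tw_h P i" "tw_j P' i \<cdot> gle i = gle (i + 1) \<cdot> tw_j P i"
    "tw_c P' i \<cdot> gle i = ggr i \<cdot> tw_c P i" "m = i + 1 \<Longrightarrow> tw_e P' i \<cdot> ggr m = shA C 1 (gle i) \<cdot> tw_e P i"
    using assms(1) unfolding is_tower_mor_def by (simp_all add: Hom_ar ar_iff)
qed

lemma tower_morI:
  assumes "ar g M M'" "\<And>i. ar (gle i) (tw_ob P i) (tw_ob P' i)" "\<And>i. ar (ggr i) (tw_gr P i) (tw_gr P' i)"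
    "\<And>i. tw_h P' i \<cdot> gle i = g \<cdot> tw_h P i" "\<And>i. tw_j P' i \<cdot> gle i = gle (i + 1) \<cdot> tw_j P i"
    "\<And>i. tw_c P' i \<cdot> gle i = ggr i \<cdot> tw_c P i" "\<And>i. tw_e P' i \<cdot> ggr (i + 1) = shA C 1 (gle i) \<cdot> tw_e P i"
  shows "is_tower_mor C M P M' P' g gle ggr"
  unfolding is_tower_mor_def using assms by (auto simp: ar_def)

text \<open>Compatibility with \<open>tw_j\<close> is automatic: both composites go from weight at
  most \<open>i\<close> to the truncation at \<open>i + 1\<close>, where lifts are unique.\<close>

lemma tower_mor_lift:
  assumes "is_tower C w M P" "is_tower C w M' P'" "ar g M M'"
  obtains gle where "\<forall>i. ar (gle i) (tw_ob P i) (tw_ob P' i)" "\<forall>i. tw_h P' i \<cdot> gle i = g \<cdot> tw_h P i"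
    "\<forall>i. tw_j P' i \<cdot> gle i = gle (i + 1) \<cdot> tw_j P i"
proof -
  note [simp] = towerD(1,3-17)[OF assms(1)] towerD(1,3-17)[OF assms(2)] assms(3)[unfolded ar_iff]
  have "\<exists>y. ar y (tw_ob P i) (tw_ob P' i) \<and> tw_h P' i \<cdot> y = g \<cdot> tw_h P i" for i
  proof -
    have "ar (g \<cdot> tw_h P i) (tw_ob P i) M'" by (simp add: ar_iff)
    then show ?thesis using decomposition_lift[OF towerD(2)[OF assms(2)] _ towerD(19)[OF assms(1)]] by (metis order_refl)
  qed
  then obtain gle where l: "\<And>i. ar (gle i) (tw_ob P i) (tw_ob P' i)" "\<And>i. tw_h P' i \<cdot> gle i = g \<cdot> tw_h P i"
    by metis
  note [simp] = l(1)[unfolded ar_iff]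
  have "tw_j P' i \<cdot> gle i = gle (i + 1) \<cdot> tw_j P i" for i
    by (rule decomposition_unique[OF towerD(2)[OF assms(2), of "i + 1"] _ _ towerD(19)[OF assms(1), of i]])
      (simp_all add: ar_iff towerD(17)[OF assms(2), THEN ra] l(2)[THEN ra] l(2))
  then show thesis using l that by blast
qed

text \<open>The graded components come from completing morphisms of triangles, so they are not
  unique. This is the source of the weak homotopies.\<close>

lemma tower_mor_exists:
  assumes "is_tower C w M P" "is_tower C w M' P'" "ar g M M'"
  obtains gle ggr where "is_tower_mor C M P M' P' g gle ggr"
proof -
  obtain gle where l[rule_format]: "\<forall>i. ar (gle i) (tw_ob P i) (tw_ob P' i)" "\<forall>i. tw_h P' i \<cdot> gle i = g \<cdot> tw_h P i"
    "\<forall>i. tw_j P' i \<cdot> gle i = gle (i + 1) \<cdot> tw_j P i"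
    using tower_mor_lift[OF assms] .
  have "\<exists>x. ar x (tw_gr P i) (tw_gr P' i) \<and> tw_c P' i \<cdot> gle i = x \<cdot> tw_c P i \<and>
      tw_e P' (i - 1) \<cdot> x = shA C 1 (gle (i - 1)) \<cdot> tw_e P (i - 1)" for i
    using dist_mor[OF towerD(18)[OF assms(1), of i] towerD(18)[OF assms(2), of i], of "gle (i - 1)" "gle i"]
      l(1)[of i] l(1)[of "i - 1"] l(3)[of "i - 1"] towerD(16)[OF assms(1), of i] towerD(16)[OF assms(2), of i]
    by (auto simp: ar_def)
  then obtain ggr where r: "\<And>i. ar (ggr i) (tw_gr P i) (tw_gr P' i)" "\<And>i. tw_c P' i \<cdot> gle i = ggr i \<cdot> tw_c P i"
      "\<And>i. tw_e P' (i - 1) \<cdot> ggr i = shA C 1 (gle (i - 1)) \<cdot> tw_e P (i - 1)"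
    by metis
  have "tw_e P' i \<cdot> ggr (i + 1) = shA C 1 (gle i) \<cdot> tw_e P i" for i using r(3)[of "i + 1"] by simp
  then show thesis using that tower_morI[OF assms(3) l(1) r(1) l(2,3) r(2)] by blast
qed

lemma tower_mor_cmp:
  assumes "is_tower_mor C M P M' P' g gle ggr" "is_tower_mor C M' P' M'' P'' g' gle' ggr'"
    "is_tower C w M P" "is_tower C w M' P'" "is_tower C w M'' P''"
  shows "is_tower_mor C M P M'' P'' (g' \<cdot> g) (\<lambda>i. gle' i \<cdot> gle i) (\<lambda>i. ggr' i \<cdot> ggr i)"
proof -
  note D = tower_morD[OF assms(1,3,4)] and D' = tower_morD[OF assms(2,4,5)]
  note [simp] = towerD(1,3-17)[OF assms(3)] towerD(1,3-17)[OF assms(4)] towerD(1,3-17)[OF assms(5)]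
    D(1)[unfolded ar_iff] D'(1)[unfolded ar_iff] D(2-11) D'(2-11) D'(8-11)[THEN ra] D(8-11)[THEN ra]
  show ?thesis by (rule tower_morI) (simp_all add: ar_iff)
qed

section \<open>Weight complexes of towers and their uniqueness\<close>

lemma tower_complex_simps [simp]:
  "cob (tower_complex C P) n = shO C n (tw_gr P (- n))"
  "cdf (tower_complex C P) n = shA C (n + 1) (tw_c P (- n - 1)) \<cdot> shA C n (tw_e P (- n - 1))"
  by (simp_all add: tower_complex_def)

lemma tower_gr_heart:
  assumes "is_tower C w M P" shows "shO C n (tw_gr P (- n)) \<in> Obj (heart C w)"
  using towerD(16,20,21)[OF assms, of "- n"] shO_wle[of _ n 0] shO_wge[of _ n 0]
  by (simp add: heart_Obj del: wle_0 wge_0)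

lemma tower_complex_complex:
  assumes "is_tower C w M P" shows "tower_complex C P \<in> complexes (heart C w)"
proof -
  note [simp] = towerD(1,3-17)[OF assms]
  note [simp] = int_norms
  have *: "shA C (n + 1) (tw_e P (- n - 2)) \<cdot> shA C (n + 1) (tw_c P (- n - 1)) =
      zr (shO C (n + 1) (tw_ob P (- n - 1))) (shO C (n + 2) (tw_ob P (- n - 2)))" for n
    using arg_cong[OF tower_cmp(2)[OF assms, of "- n - 1" "- n - 2"], of "shA C (n + 1)"] by simp
  show ?thesis unfolding H_complexes
  proof (intro allI conjI)
    fix n
    show "cob (tower_complex C P) n \<in> Obj (heart C w)" using tower_gr_heart[OF assms] by simp
    show "ar (cdf (tower_complex C P) n) (cob (tower_complex C P) n) (cob (tower_complex C P) (n + 1))"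
      by (simp add: ar_iff)
    show "cdf (tower_complex C P) (n + 1) \<cdot> cdf (tower_complex C P) n =
        zr (cob (tower_complex C P) n) (cob (tower_complex C P) (n + 1 + 1))"
      by (simp add: *[THEN ra])
  qed
qed

lemma tower_mor_cm:
  assumes "is_tower_mor C M P M' P' g gle ggr" "is_tower C w M P" "is_tower C w M' P'"
  shows "H.cm (tower_complex C P) (tower_complex C P') (\<lambda>i. shA C i (ggr (- i)))"
proof -
  note D = tower_morD[OF assms]
  note [simp] = towerD(1,3-17)[OF assms(2)] towerD(1,3-17)[OF assms(3)] D(2-7)
  have [simp]: "- (n + 1) = - n - 1" for n :: int by simp
  have 1: "shA C (n + 1) (tw_c P' (- n - 1)) \<cdot> shA C (n + 1) (gle (- n - 1)) =
      shA C (n + 1) (ggr (- n - 1)) \<cdot> shA C (n + 1) (tw_c P (- n - 1))" for n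
    using arg_cong[OF D(10)[of "- n - 1"], of "shA C (n + 1)"] by simp
  have 2: "shA C n (tw_e P' (- n - 1)) \<cdot> shA C n (ggr (- n)) =
      shA C (n + 1) (gle (- n - 1)) \<cdot> shA C n (tw_e P (- n - 1))" for n
    using arg_cong[OF D(11)[of "- n" "- n - 1"], of "shA C n"] by simp
  show ?thesis unfolding H_cm
    using tower_complex_complex assms(2,3) by (simp add: ar_iff 1[THEN ra] 2)
qed

lemma tower_mor_K_ar:
  assumes "is_tower_mor C M P M' P' g gle ggr" "is_tower C w M P" "is_tower C w M' P'"
  shows "H.K.ar (tower_complex_mor C w P P' ggr) (tower_complex C P) (tower_complex C P')"
  unfolding tower_complex_mor_def using H.K_ar_kmor[OF tower_mor_cm[OF assms]] .

lemma tower_mor_K_cmp: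
  assumes "is_tower_mor C M P M' P' g gle ggr" "is_tower_mor C M' P' M'' P'' g' gle' ggr'"
    "is_tower C w M P" "is_tower C w M' P'" "is_tower C w M'' P''"
  shows "tower_complex_mor C w P' P'' ggr' \<cdot>\<^bsub>Kcat (heart C w)\<^esub> tower_complex_mor C w P P' ggr =
    tower_complex_mor C w P P'' (\<lambda>i. ggr' i \<cdot> ggr i)"
proof -
  note [simp] = tower_morD(5-7)[OF assms(1,3,4)] tower_morD(5-7)[OF assms(2,4,5)]
  show ?thesis unfolding tower_complex_mor_def
    using H.kmor_cmp[OF tower_mor_cm[OF assms(1,3,4)] tower_mor_cm[OF assms(2,4,5)]] by simp
qed

text \<open>Vanishing on w_{<=i} M, the arrow factors through w_{<=i-1} M [1]. There it kills
  w_{<=i-2} M [1], which has weight at most \<open>i - 1\<close>, and so descends to the next graded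
  piece; the result is t d.\<close>

lemma tower_gr_factor:
  assumes "is_tower C w M P" "ar x (tw_gr P i) G" "G \<in> wge C w i" "x \<cdot> tw_c P i = zr (tw_ob P i) G"
  obtains t where "ar t (shO C 1 (tw_gr P (i - 1))) G"
    "x = t \<cdot> (shA C 1 (tw_c P (i - 1)) \<cdot> tw_e P (i - 1))"
proof -
  note [simp] = towerD(1,3-17)[OF assms(1)] assms(2)[unfolded ar_iff]
  obtain y where y: "ar y (shO C 1 (tw_ob P (i - 1))) G" "y \<cdot> tw_e P (i - 1) = x"
    using dist_extend2[OF towerD(18)[OF assms(1)] assms(2,4)] .
  note [simp] = y(1)[unfolded ar_iff]
  have "shO C 1 (tw_ob P (i - 2)) \<in> wle C w (i - 1)" using towerD(19)[OF assms(1), of "i - 2"] by simp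
  from weight_orth[OF _ this assms(3)]
  have "y \<cdot> shA C 1 (tw_j P (i - 2)) = zr (shO C 1 (tw_ob P (i - 2))) G"
    by (simp add: ar_iff)
  then obtain t where t: "ar t (shO C 1 (tw_gr P (i - 1))) G" "t \<cdot> shA C 1 (tw_c P (i - 1)) = y"
    using dist_extend[OF dist_shift_1[OF towerD(18)[OF assms(1), of "i - 1"]], of y G] y(1) by auto
  note [simp] = t(1)[unfolded ar_iff]
  show thesis using that[OF t(1)] by (simp add: t(2)[THEN ra] y(2))
qed

text \<open>In the weight complex this reads \<open>f = d s + t d\<close>, with \<open>s\<close> and \<open>t\<close> unrelated.\<close>

lemma tower_mor_over_zero:
  assumes P: "is_tower C w M P" and P': "is_tower C w M' P'"
    and "ar y (tw_ob P i) (tw_ob P' i)" "tw_h P' i \<cdot> y = zr (tw_ob P i) M'"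
    and "ar f (tw_gr P i) (tw_gr P' i)" "f \<cdot> tw_c P i = tw_c P' i \<cdot> y"
  obtains z t where "ar z (tw_gr P i) (shO C (-1) (tw_gr P' (i + 1)))" "ar t (shO C 1 (tw_gr P (i - 1))) (tw_gr P' i)"
    "f = tw_c P' i \<cdot> (shA C (-1) (tw_e P' i) \<cdot> z) \<boxplus> t \<cdot> (shA C 1 (tw_c P (i - 1)) \<cdot> tw_e P (i - 1))"
proof -
  note [simp] = towerD(1,3-17)[OF P] towerD(1,3-17)[OF P'] assms(3)[unfolded ar_iff] assms(5)[unfolded ar_iff]
  \<comment> \<open>One step up the tower, lifts from weight at most \<open>i\<close> are unique, so
    \<open>y\<close> dies there and comes from the graded piece of index \<open>i + 1\<close>
    shifted by -1.\<close>
  have "tw_j P' i \<cdot> y = zr (tw_ob P i) (tw_ob P' (i + 1))"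
    by (rule decomposition_mono[OF towerD(2)[OF P', of "i + 1"] _ towerD(19)[OF P, of i]])
      (simp_all add: ar_iff towerD(17)[OF P', THEN ra] assms(4))
  then obtain y1 where y1: "ar y1 (tw_ob P i) (shO C (-1) (tw_gr P' (i + 1)))" "shA C (-1) (tw_e P' i) \<cdot> y1 = y"
    using dist_lift0[OF towerD(18)[OF P', of "i + 1"], of y "tw_ob P i"] assms(3) by auto
  note [simp] = y1(1)[unfolded ar_iff]
  \<comment> \<open>That shifted piece has weight at least \<open>i\<close>, so \<open>y1\<close>
    vanishes on w_{<=i-1} M and extends over the graded piece of index \<open>i\<close>.\<close>
  have "ar (y1 \<cdot> tw_j P (i - 1)) (tw_ob P (i - 1)) (shO C (-1) (tw_gr P' (i + 1)))" by (simp add: ar_iff)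
  moreover have "shO C (-1) (tw_gr P' (i + 1)) \<in> wge C w i" using towerD(21)[OF P', of "i + 1"] by simp
  ultimately have "y1 \<cdot> tw_j P (i - 1) = zr (tw_ob P (i - 1)) (shO C (-1) (tw_gr P' (i + 1)))"
    using weight_orth[OF _ towerD(19)[OF P, of "i - 1"]] by simp
  then obtain z where z: "ar z (tw_gr P i) (shO C (-1) (tw_gr P' (i + 1)))" "z \<cdot> tw_c P i = y1"
    using dist_extend[OF towerD(18)[OF P, of i] y1(1)] by blast
  note [simp] = z(1)[unfolded ar_iff]
  let ?x = "f \<boxplus> neg (tw_c P' i \<cdot> (shA C (-1) (tw_e P' i) \<cdot> z))"
  have "?x \<cdot> tw_c P i = zr (tw_ob P i) (tw_gr P' i)"
    by (simp add: z(2) y1(2) assms(6))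
  then obtain t where t: "ar t (shO C 1 (tw_gr P (i - 1))) (tw_gr P' i)"
    "?x = t \<cdot> (shA C 1 (tw_c P (i - 1)) \<cdot> tw_e P (i - 1))"
    using tower_gr_factor[OF P, of ?x i "tw_gr P' i"] towerD(21)[OF P', of i] by (auto simp: ar_iff)
  have "f = tw_c P' i \<cdot> (shA C (-1) (tw_e P' i) \<cdot> z) \<boxplus> ?x"
    by (simp add: madd_ac madd_cancel_apart)
  then show thesis using that[OF z(1) t(1)] t(2) by simp
qed

text \<open>The difference from the identity lies over the zero morphism of \<open>M\<close>, so at
  each index its graded component has the form d s + t d.\<close>

lemma tower_endo_iso:
  assumes P: "is_tower C w M P" and m: "is_tower_mor C M P M P (idm C M) gle ggr"
  shows "iso_arrow (Kcat (heart C w)) (tower_complex C P) (tower_complex C P) (tower_complex_mor C w P P ggr)"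
proof -
  note D = tower_morD[OF m P P]
  note [simp] = towerD(1,3-17)[OF P] D(2-7)
  have "\<exists>z t. ar z (tw_gr P i) (shO C (-1) (tw_gr P (i + 1))) \<and> ar t (shO C 1 (tw_gr P (i - 1))) (tw_gr P i) \<and>
    ggr i \<boxplus> neg (idm C (tw_gr P i)) = tw_c P i \<cdot> (shA C (-1) (tw_e P i) \<cdot> z) \<boxplus>
      t \<cdot> (shA C 1 (tw_c P (i - 1)) \<cdot> tw_e P (i - 1))" for i
    by (rule tower_mor_over_zero[OF P P, of "gle i \<boxplus> neg (idm C (tw_ob P i))" i "ggr i \<boxplus> neg (idm C (tw_gr P i))"])
      (auto simp: ar_iff D(8-10))
  then obtain z t where zt: "\<And>i. ar (z i) (tw_gr P i) (shO C (-1) (tw_gr P (i + 1)))"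
    "\<And>i. ar (t i) (shO C 1 (tw_gr P (i - 1))) (tw_gr P i)"
    "\<And>i. ggr i \<boxplus> neg (idm C (tw_gr P i)) = tw_c P i \<cdot> (shA C (-1) (tw_e P i) \<cdot> z i) \<boxplus>
      t i \<cdot> (shA C 1 (tw_c P (i - 1)) \<cdot> tw_e P (i - 1))"
    by metis
  note [simp] = zt(1,2)[unfolded ar_iff]
  let ?T = "tower_complex C P"
  have T: "?T \<in> complexes (heart C w)" using tower_complex_complex[OF P] .
  show ?thesis unfolding tower_complex_mor_def
  \<comment> \<open>Tower index \<open>i\<close> is degree \<open>- i\<close>. The arrow
    \<open>t i\<close> starts at the piece of index \<open>i - 1\<close>, in degree
    \<open>- i + 1\<close>, whence the offset for \<open>t\<close>.\<close>
  proof (rule H.weakly_homotopic_id_iso[where s = "\<lambda>n. shA C n (z (- n))" and t = "\<lambda>n. shA C (n - 1) (t (- n + 1))"])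
    show "H.cm ?T ?T (\<lambda>i. shA C i (ggr (- i)))" using tower_mor_cm[OF m P P] .
    have [simp]: "- n + 1 - 1 = - n" "- (n - 1) = - n + 1" for n :: int by simp_all
    show "H.ar (shA C n (z (- n))) (cob ?T n) (cob ?T (n - 1))" for n
      using tower_gr_heart[OF P, of n] tower_gr_heart[OF P, of "n - 1"] by (simp add: H_ar ar_iff)
    show "H.ar (shA C (n - 1) (t (- n + 1))) (cob ?T n) (cob ?T (n - 1))" for n
      using tower_gr_heart[OF P, of n] tower_gr_heart[OF P, of "n - 1"] by (simp add: H_ar ar_iff)
    fix n
    have "ggr (- n) = idm C (tw_gr P (- n)) \<boxplus> (ggr (- n) \<boxplus> neg (idm C (tw_gr P (- n))))"
      by (simp add: madd_ac madd_cancel_apart)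
    then have "shA C n (ggr (- n)) = shA C n (idm C (tw_gr P (- n)) \<boxplus> (tw_c P (- n) \<cdot> (shA C (-1) (tw_e P (- n)) \<cdot> z (- n)) \<boxplus>
      t (- n) \<cdot> (shA C 1 (tw_c P (- n - 1)) \<cdot> tw_e P (- n - 1))))"
      unfolding zt(3) by simp
    also have "\<dots> = idm C (cob ?T n) \<boxplus> (cdf ?T (n - 1) \<cdot> shA C n (z (- n)) \<boxplus>
        shA C (n + 1 - 1) (t (- (n + 1) + 1)) \<cdot> cdf ?T n)"
      by (simp add: add.commute)
    finally show "shA C n (ggr (- n)) = madd (heart C w) (idm (heart C w) (cob ?T n))
       (madd (heart C w) (cdf ?T (n - 1) \<cdot>\<^bsub>heart C w\<^esub> shA C n (z (- n)))
        (shA C (n + 1 - 1) (t (- (n + 1) + 1)) \<cdot>\<^bsub>heart C w\<^esub> cdf ?T n))"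
      by simp
  qed
qed

lemma tower_iso:
  assumes P: "is_tower C w M P" and P': "is_tower C w M P'" and m: "is_tower_mor C M P M P' (idm C M) gle ggr"
  shows "iso_arrow (Kcat (heart C w)) (tower_complex C P) (tower_complex C P') (tower_complex_mor C w P P' ggr)"
proof -
  obtain gle' ggr' where m': "is_tower_mor C M P' M P (idm C M) gle' ggr'"
    using tower_mor_exists[OF P' P ar_idm[OF towerD(1)[OF P]]] .
  have M: "idm C M \<cdot> idm C M = idm C M" using towerD(1)[OF P] by simp
  show ?thesis
  proof (rule H.K.iso_of_iso_composites)
    show "H.K.ar (tower_complex_mor C w P P' ggr) (tower_complex C P) (tower_complex C P')"
      "H.K.ar (tower_complex_mor C w P' P ggr') (tower_complex C P') (tower_complex C P)"
      using tower_mor_K_ar m m' P P' by blast+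
    show "iso_arrow (Kcat (heart C w)) (tower_complex C P) (tower_complex C P)
       (tower_complex_mor C w P' P ggr' \<cdot>\<^bsub>Kcat (heart C w)\<^esub> tower_complex_mor C w P P' ggr)"
      using tower_endo_iso[OF P] tower_mor_cmp[OF m m' P P' P] by (simp add: tower_mor_K_cmp[OF m m' P P' P] M)
    show "iso_arrow (Kcat (heart C w)) (tower_complex C P') (tower_complex C P')
       (tower_complex_mor C w P P' ggr \<cdot>\<^bsub>Kcat (heart C w)\<^esub> tower_complex_mor C w P' P ggr')"
      using tower_endo_iso[OF P'] tower_mor_cmp[OF m' m P' P P'] by (simp add: tower_mor_K_cmp[OF m' m P' P P'] M)
  qed
qed

lemma tower_complex_unique:
  assumes P: "is_tower C w M P" and P': "is_tower C w M P'"
  shows "isomorphic (Kcat (heart C w)) (tower_complex C P) (tower_complex C P')"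
  using tower_mor_exists[OF P P' ar_idm[OF towerD(1)[OF P]]] tower_iso[OF P P'] unfolding isomorphic_def by metis

text \<open>Shifting a triangle by \<open>k\<close> multiplies its connecting arrow by (-1)^k.
  Carried by \<open>tw_e\<close>, this is exactly the sign in \<open>cshift\<close>, so the two
  complexes are equal and not merely isomorphic.\<close>

lemma shifted_tower:
  assumes P: "is_tower C w M P"
  obtains Q where "is_tower C w (shO C k M) Q" "tower_complex C Q = cshift (heart C w) k (tower_complex C P)"
proof -
  note [simp] = towerD(1,3-17)[OF P]
  define \<sigma> where "\<sigma> = (\<lambda>x. if even k then x else neg x)"
  have \<sigma>[simp]: "is_arr (\<sigma> x)" "src (\<sigma> x) = src x" "tgt (\<sigma> x) = tgt x" if "is_arr x" for x
    using that by (simp_all add: \<sigma>_def)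
  have \<sigma>_simps: "y \<cdot> \<sigma> x = \<sigma> (y \<cdot> x)" "shA C n (\<sigma> x) = \<sigma> (shA C n x)"
    if "is_arr x" "is_arr y" "tgt x = src y" for x y n
    using that by (simp_all add: \<sigma>_def)
  define Q where "Q = \<lparr>tw_ob = (\<lambda>i. shO C k (tw_ob P (i - k))), tw_gr = (\<lambda>i. shO C k (tw_gr P (i - k))),
    tw_h = (\<lambda>i. shA C k (tw_h P (i - k))), tw_j = (\<lambda>i. shA C k (tw_j P (i - k))),
    tw_c = (\<lambda>i. shA C k (tw_c P (i - k))), tw_e = (\<lambda>i. \<sigma> (shA C k (tw_e P (i - k))))\<rparr>"
  have e: "i + 1 - k = i - k + 1" "i - 1 - k = i - k - 1" for i by simp_all
  have "is_tower C w (shO C k M) Q" unfolding is_tower_def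
  proof (intro allI conjI)
    fix i
    obtain R g e where R: "dist C (tw_ob P (i - k)) M R (tw_h P (i - k)) g e" "R \<in> wge C w (i - k + 1)"
      using towerD(2)[OF P, of "i - k"] by (rule gives_decompositionE)
    have [simp]: "R \<in> Obj C" using wge_Obj[OF R(2)] .
    show "gives_decomposition C w i (tw_ob Q i) (shO C k M) (tw_h Q i)"
      using gives_decompositionI[OF dist_shift[OF R(1), of k]] R(2) towerD(19)[OF P, of "i - k"]
      by (simp add: Q_def e)
    show "tw_j Q i \<in> Hom C (tw_ob Q i) (tw_ob Q (i + 1))" by (simp add: Q_def Hom_ar ar_iff e)
    show "tw_h Q (i + 1) \<cdot> tw_j Q i = tw_h Q i"
      by (simp add: Q_def e flip: shA_cmp')
    show "dist C (tw_ob Q (i - 1)) (tw_ob Q i) (tw_gr Q i) (tw_j Q (i - 1)) (tw_c Q i) (tw_e Q (i - 1))"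
      using dist_shift[OF towerD(18)[OF P, of "i - k"], of k] by (cases "even k") (simp_all add: Q_def e \<sigma>_def)
  qed
  moreover have "tower_complex C Q = cshift (heart C w) k (tower_complex C P)"
  proof (rule cplx.equality)
    have e2: "- n - 1 - k = - n - k - 1" "n + 1 + k = n + k + 1" for n :: int by simp_all
    show "cob (tower_complex C Q) = cob (cshift (heart C w) k (tower_complex C P))"
      by (rule ext) (simp add: Q_def)
    have d: "(if even k then x else H.neg x) = \<sigma> x" if "x = cdf (tower_complex C P) n" for x n
      using H_neg[of x "cob (tower_complex C P) n" "cob (tower_complex C P) (n + 1)"]
        H.cplxD(1-4)[OF tower_complex_complex[OF P]] that by (simp add: H.ar_iff \<sigma>_def del: tower_complex_simps)
    show "cdf (tower_complex C Q) = cdf (cshift (heart C w) k (tower_complex C P))"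
    proof (rule ext)
      fix n
      have "cdf (tower_complex C Q) n = shA C (n + k + 1) (tw_c P (- n - k - 1)) \<cdot> \<sigma> (shA C (n + k) (tw_e P (- n - k - 1)))"
        by (simp add: Q_def e2 \<sigma>_def)
      also have "\<dots> = \<sigma> (cdf (tower_complex C P) (n + k))"
        by (simp add: \<sigma>_simps)
      also have "\<dots> = cdf (cshift (heart C w) k (tower_complex C P)) n"
        unfolding H.cshift_cdf[OF tower_complex_complex[OF P]] by (rule d[OF refl, symmetric])
      finally show "cdf (tower_complex C Q) n = cdf (cshift (heart C w) k (tower_complex C P)) n" .
    qed
  qed simp
  ultimately show thesis by (rule that)
qed

text \<open>Below \<open>k\<close> the tower is kept and from \<open>k\<close> on it is constant, so
  its weight complex is the part of the old one in degrees at least \<open>- k\<close>, padded by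
  zeros.\<close>

lemma truncated_tower:
  assumes P: "is_tower C w M P"
  obtains Q where "is_tower C w (tw_ob P k) Q"
    "\<forall>i\<ge>k. tw_ob Q i = tw_ob P k \<and> tw_h Q i = idm C (tw_ob P k)"
    "\<forall>i\<le>k. tw_gr Q i = tw_gr P i" "\<forall>i>k. zero_object C (tw_gr Q i)"
    "\<forall>n\<ge>- k. cdf (tower_complex C Q) n = cdf (tower_complex C P) n"
proof -
  note [simp] = towerD(1,3-17)[OF P]
  have "\<exists>y. ar y (tw_ob P i) (tw_ob P k) \<and> tw_h P k \<cdot> y = tw_h P i \<and> (i = k \<longrightarrow> y = idm C (tw_ob P k))" if "i \<le> k" for i
  proof (cases "i = k")
    case True
    then show ?thesis by (intro exI[of _ "idm C (tw_ob P k)"]) (simp add: ar_iff)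
  next
    case False
    have "ar (tw_h P i) (tw_ob P i) M" by (simp add: ar_iff)
    from decomposition_lift[OF towerD(2)[OF P] this towerD(19)[OF P] that] False show ?thesis by blast
  qed
  then obtain l where l: "\<And>i. i \<le> k \<Longrightarrow> ar (l i) (tw_ob P i) (tw_ob P k)" "\<And>i. i \<le> k \<Longrightarrow> tw_h P k \<cdot> l i = tw_h P i"
     "l k = idm C (tw_ob P k)" by (metis order_refl)
  note lk = l(1)[unfolded ar_iff]
  have lj: "l (i + 1) \<cdot> tw_j P i = l i" if "i < k" for i
    by (rule decomposition_unique[OF towerD(2)[OF P, of k] _ _ towerD(19)[OF P, of i]])
      (use that lk[of i] lk[of "i + 1"] l(2)[of "i + 1"] l(2)[of i] in \<open>simp_all add: ar_iff l(2)[THEN ra]\<close>)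
  define Q where "Q = \<lparr>tw_ob = (\<lambda>i. if i < k then tw_ob P i else tw_ob P k),
    tw_gr = (\<lambda>i. if i \<le> k then tw_gr P i else zob),
    tw_h = (\<lambda>i. if i < k then l i else idm C (tw_ob P k)),
    tw_j = (\<lambda>i. if i < k then tw_j P i else idm C (tw_ob P k)),
    tw_c = (\<lambda>i. if i \<le> k then tw_c P i else zr (tw_ob P k) zob),
    tw_e = (\<lambda>i. if i < k then tw_e P i else zr zob (shO C 1 (tw_ob P k)))\<rparr>"
  have "is_tower C w (tw_ob P k) Q" unfolding is_tower_def
  proof (intro allI conjI)
    fix i
    show "gives_decomposition C w i (tw_ob Q i) (tw_ob P k) (tw_h Q i)"
    proof (cases "i < k")
      case True
      obtain R g e where R: "dist C (tw_ob P k) M R (tw_h P k) g e" "R \<in> wge C w (k + 1)"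
        using towerD(2)[OF P, of k] by (rule gives_decompositionE)
      obtain R' g' e' where R': "dist C (tw_ob P i) M R' (tw_h P i) g' e'" "R' \<in> wge C w (i + 1)"
        using towerD(2)[OF P, of i] by (rule gives_decompositionE)
      obtain Z a a' where Z: "dist C (tw_ob P i) (tw_ob P k) Z (l i) a a'"
        using dist_ex[of "tw_ob P i" "tw_ob P k" "l i"] l(1)[of i] True by (auto simp: ar_def)
      \<comment> \<open>The cone of w_{<=i} M -> w_{<=k} M is an extension of \<open>R'\<close> by
        R[-1]; by \<open>i < k\<close> the latter also has weight at least
        \<open>i + 1\<close>.\<close>
      obtain u v x where o: "dist C Z R' R u v x"
        using octahedron_obtain[OF Z R(1), of R' g' e'] R'(1) l(2)[of i] True by (metis order_less_imp_le)
      have "shO C (-1) R \<in> wge C w (i + 1)" using wge_mono[OF R(2), of "i + 2"] True wge_Obj[OF R(2)] by (simp add: int_norms)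
      then have "Z \<in> wge C w (i + 1)" using wge_extension[OF dist_unrot[OF o]] R'(2) by blast
      then show ?thesis using gives_decompositionI[OF Z] towerD(19)[OF P, of i] True by (simp add: Q_def)
    next
      case False
      then show ?thesis using gives_decomposition_id[OF towerD(19)[OF P, of k]] by (simp add: Q_def)
    qed
    show "tw_j Q i \<in> Hom C (tw_ob Q i) (tw_ob Q (i + 1))"
      using ar_idm[of "tw_ob P k"] by (cases "i + 1 = k") (auto simp: Q_def Hom_ar ar_iff)
    show "tw_h Q (i + 1) \<cdot> tw_j Q i = tw_h Q i"
      using lj[of i] l(3) lk[of i] by (cases "i + 1 = k") (auto simp: Q_def)
    show "dist C (tw_ob Q (i - 1)) (tw_ob Q i) (tw_gr Q i) (tw_j Q (i - 1)) (tw_c Q i) (tw_e Q (i - 1))"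
    proof (cases "i \<le> k")
      case True
      then show ?thesis using towerD(18)[OF P, of i] by (cases "i = k") (auto simp: Q_def)
    next
      case False
      then show ?thesis using dist_idm[OF towerD(15)[OF P, of k] zob(1)] by (auto simp: Q_def)
    qed
  qed
  then show thesis by (rule that) (auto simp: Q_def)
qed

end

section \<open>Towers of cones\<close>

context triangulated_category begin

lemma biproduct_shA:
  assumes "biproduct C X Y S i1 i2 p1 p2"
  shows "biproduct C (shO C n X) (shO C n Y) (shO C n S) (shA C n i1) (shA C n i2) (shA C n p1) (shA C n p2)"
proof -
  note b = assms[unfolded biproduct_ar]
  note [simp] = b[unfolded ar_iff]
  have "shA C n p1 \<cdot> shA C n i1 = idm C (shO C n X)" "shA C n p2 \<cdot> shA C n i2 = idm C (shO C n Y)"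
    "shA C n p2 \<cdot> shA C n i1 = zr (shO C n X) (shO C n Y)" "shA C n p1 \<cdot> shA C n i2 = zr (shO C n Y) (shO C n X)"
    "shA C n i1 \<cdot> shA C n p1 \<boxplus> shA C n i2 \<cdot> shA C n p2 = idm C (shO C n S)"
    by (simp_all add: shA_cmp'[symmetric] shA_madd'[symmetric] del: shA_cmp' shA_madd')
  then show ?thesis unfolding biproduct_ar ar_iff by simp
qed

end

context weight_structure begin

text \<open>The source is filtered one step lower than the target because the cone shifts it by one.
  The graded piece of the cone is an extension of two pure pieces, and it splits because the
  classifying arrow goes from weight at most \<open>i\<close> to weight at least
  \<open>i + 1\<close>.\<close>

lemma tower_cone_step:
  assumes P: "is_tower C w A P" and P': "is_tower C w A' P'"
    and Z1: "dist C (tw_ob P (i - 2)) (tw_ob P' (i - 1)) Z1 \<gamma>1 \<alpha>1 \<beta>1"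
    and Z2: "dist C (tw_ob P (i - 1)) (tw_ob P' i) Z2 \<gamma>2 \<alpha>2 \<beta>2"
    and sq: "\<gamma>2 \<cdot> tw_j P (i - 2) = tw_j P' (i - 1) \<cdot> \<gamma>1"
  obtains jz G cz ez u v s p where "dist C Z1 Z2 G jz cz ez"
    "biproduct C (shO C 1 (tw_gr P (i - 1))) (tw_gr P' i) G s u v p"
    "jz \<cdot> \<alpha>1 = \<alpha>2 \<cdot> tw_j P' (i - 1)" "cz \<cdot> \<alpha>2 = u \<cdot> tw_c P' i" "ez \<cdot> u = shA C 1 \<alpha>1 \<cdot> tw_e P' (i - 1)"
    "v \<cdot> cz = neg (shA C 1 (tw_c P (i - 1)) \<cdot> \<beta>2)" "shA C 1 \<beta>1 \<cdot> ez = shA C 1 (tw_e P (i - 2)) \<cdot> v"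
    "zero_object C (tw_gr P' i) \<longrightarrow> (\<forall>g. ar g (tw_ob P (i - 1)) (tw_ob P' (i - 1)) \<and> tw_j P' (i - 1) \<cdot> g = \<gamma>2 \<longrightarrow>
       ez \<cdot> (s \<cdot> shA C 1 (tw_c P (i - 1))) = shA C 1 (\<alpha>1 \<cdot> g))"
proof -
  note [simp] = towerD(1,3-17)[OF P] towerD(1,3-17)[OF P'] distD[OF Z1, unfolded ar_iff] distD[OF Z2, unfolded ar_iff]
  have X: "dist C (tw_ob P (i - 2)) (tw_ob P (i - 1)) (tw_gr P (i - 1)) (tw_j P (i - 2)) (tw_c P (i - 1)) (tw_e P (i - 2))"
    using towerD(18)[OF P, of "i - 1"] by simp
  obtain jz G cz ez u v k where 1: "dist C Z1 Z2 G jz cz ez" "dist C (tw_gr P' i) G (shO C 1 (tw_gr P (i - 1))) u v k"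
    "jz \<cdot> \<alpha>1 = \<alpha>2 \<cdot> tw_j P' (i - 1)" "cz \<cdot> \<alpha>2 = u \<cdot> tw_c P' i" "ez \<cdot> u = shA C 1 \<alpha>1 \<cdot> tw_e P' (i - 1)"
    "v \<cdot> cz = shA C 1 (tw_c P (i - 1)) \<cdot> \<beta>2" "shA C 1 \<beta>1 \<cdot> ez = neg (shA C 1 (tw_e P (i - 2)) \<cdot> v)"
    "zero_object C (tw_gr P' i) \<longrightarrow> (\<forall>s g. ar s (shO C 1 (tw_gr P (i - 1))) G \<and> v \<cdot> s = idm C (shO C 1 (tw_gr P (i - 1))) \<and>
       ar g (tw_ob P (i - 1)) (tw_ob P' (i - 1)) \<and> tw_j P' (i - 1) \<cdot> g = \<gamma>2 \<longrightarrow>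
       ez \<cdot> (s \<cdot> shA C 1 (tw_c P (i - 1))) = neg (shA C 1 (\<alpha>1 \<cdot> g)))"
    using cone_of_filtered_morphism[OF X towerD(18)[OF P', of i] Z1 Z2 sq] .
  note [simp] = distD[OF 1(1), unfolded ar_iff] distD[OF 1(2), unfolded ar_iff]
  have w1: "shO C 1 (tw_gr P (i - 1)) \<in> wle C w i" using towerD(20)[OF P, of "i - 1"] by simp
  have w2: "shO C 1 (tw_gr P' i) \<in> wge C w (i + 1)" using towerD(21)[OF P', of i] by simp
  have k: "k = zr (shO C 1 (tw_gr P (i - 1))) (shO C 1 (tw_gr P' i))"
    using weight_orth[OF distD(3)[OF 1(2)] w1 w2] by simp
  obtain s p where b: "biproduct C (shO C 1 (tw_gr P (i - 1))) (tw_gr P' i) G s u v p"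
    using dist_split[OF 1(2)[unfolded k]] .
  note b' = b[unfolded biproduct_ar]
  note [simp] = b'[unfolded ar_iff]
  show thesis
  \<comment> \<open>Negating \<open>s\<close> and \<open>v\<close> turns the connecting arrow of the
    last clause from -g into \<open>g\<close>.\<close>
  proof (rule that[OF 1(1) biproduct_neg[OF b] 1(3,4,5)])
    show "neg v \<cdot> cz = neg (shA C 1 (tw_c P (i - 1)) \<cdot> \<beta>2)" by (simp add: 1(6))
    show "shA C 1 \<beta>1 \<cdot> ez = shA C 1 (tw_e P (i - 2)) \<cdot> neg v" by (simp add: 1(7))
    show "zero_object C (tw_gr P' i) \<longrightarrow> (\<forall>g. ar g (tw_ob P (i - 1)) (tw_ob P' (i - 1)) \<and> tw_j P' (i - 1) \<cdot> g = \<gamma>2 \<longrightarrow>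
       ez \<cdot> (neg s \<cdot> shA C 1 (tw_c P (i - 1))) = shA C 1 (\<alpha>1 \<cdot> g))"
    proof (intro impI allI, elim conjE)
      fix g assume "zero_object C (tw_gr P' i)" and g: "ar g (tw_ob P (i - 1)) (tw_ob P' (i - 1))" "tw_j P' (i - 1) \<cdot> g = \<gamma>2"
      then have "ez \<cdot> (s \<cdot> shA C 1 (tw_c P (i - 1))) = neg (shA C 1 (\<alpha>1 \<cdot> g))" using 1(8) b' by blast
      then show "ez \<cdot> (neg s \<cdot> shA C 1 (tw_c P (i - 1))) = shA C 1 (\<alpha>1 \<cdot> g)" using g(1) by (simp add: ar_iff)
    qed
  qed
qed

text \<open>For towers that are eventually constant, the cone of the unique lift
  \<open>w_{\<le>i-1}A \<rightarrow> w_{\<le>i}A'\<close> can be taken as \<open>w_{\<le>i}A''\<close>: the maps to \<open>A''\<close> are the composites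
  up to the index from which on everything is constant.\<close>

lemma tower_cone:
  assumes d: "dist C A A' A'' u v q" and P: "is_tower C w A P" and P': "is_tower C w A' P'"
    and cP: "\<forall>i\<ge>k. tw_ob P i = A \<and> tw_h P i = idm C A"
    and cP': "\<forall>i\<ge>k. tw_ob P' i = A' \<and> tw_h P' i = idm C A'"
  obtains P'' gle ggr f i1 p1 p2 where "is_tower C w A'' P''"
    "is_tower_mor C A' P' A'' P'' v gle ggr"
    "\<forall>i\<ge>k+1. tw_ob P'' i = A'' \<and> tw_h P'' i = idm C A''"
    "H.cm (tower_complex C P) (tower_complex C P') f"
    "is_cone (heart C w) (tower_complex C P) (tower_complex C P') f (tower_complex C P'')
       i1 (\<lambda>n. shA C n (ggr (- n))) p1 p2"
    "\<forall>n g. zero_object C (tw_gr P' (- n + 1)) \<and> ar g (tw_ob P (- n)) (tw_ob P' (- n)) \<and>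
       tw_h P' (- n) \<cdot> g = u \<cdot> tw_h P (- n) \<longrightarrow> f n \<cdot> shA C n (tw_c P (- n)) = shA C n (tw_c P' (- n) \<cdot> g)"
proof -
  note [simp] = towerD(1,3-17)[OF P] towerD(1,3-17)[OF P'] distD[OF d, unfolded ar_iff]
  \<comment> \<open>Lifting from index \<open>i - 1\<close> to index \<open>i\<close> places the
    cone in weight at most \<open>i\<close> and makes the lift unique.\<close>
  have "\<forall>i. \<exists>\<gamma>. ar \<gamma> (tw_ob P (i - 1)) (tw_ob P' i) \<and> tw_h P' i \<cdot> \<gamma> = u \<cdot> tw_h P (i - 1)"
  proof
    fix i
    have "ar (u \<cdot> tw_h P (i - 1)) (tw_ob P (i - 1)) A'" by (simp add: ar_iff)
    from decomposition_lift[OF towerD(2)[OF P', of i] this towerD(19)[OF P]]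
    show "\<exists>\<gamma>. ar \<gamma> (tw_ob P (i - 1)) (tw_ob P' i) \<and> tw_h P' i \<cdot> \<gamma> = u \<cdot> tw_h P (i - 1)" by force
  qed
  from choice[OF this] obtain \<gamma> where g: "\<And>i. ar (\<gamma> i) (tw_ob P (i - 1)) (tw_ob P' i)"
    and hg: "\<And>i. tw_h P' i \<cdot> \<gamma> i = u \<cdot> tw_h P (i - 1)" by blast
  note [simp] = g[unfolded ar_iff]
  have gu: "\<gamma> i = u" if "k + 1 \<le> i" for i
  proof -
    have *: "tw_h P' i = idm C A'" "tw_h P (i - 1) = idm C A" "tw_ob P' i = A'" using cP cP' that by auto
    have "tgt (\<gamma> i) = A'" using g[of i] *(3) by (simp add: ar_iff)
    then show ?thesis using hg[of i] unfolding *(1,2) by simp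
  qed
  have sq: "\<gamma> i \<cdot> tw_j P (i - 2) = tw_j P' (i - 1) \<cdot> \<gamma> (i - 1)" for i
  proof (rule decomposition_unique[OF towerD(2)[OF P', of i] _ _ towerD(19)[OF P, of "i - 2"]])
    have [simp]: "tw_h P (i - 1) \<cdot> tw_j P (i - 2) = tw_h P (i - 2)" "tw_h P' i \<cdot> tw_j P' (i - 1) = tw_h P' (i - 1)"
      using towerD(17)[OF P, of "i - 2"] towerD(17)[OF P', of "i - 1"] by simp_all
    have hg1: "tw_h P' (i - 1) \<cdot> \<gamma> (i - 1) = u \<cdot> tw_h P (i - 2)" using hg[of "i - 1"] by simp
    have m: "tw_h P' i \<cdot> (tw_j P' (i - 1) \<cdot> \<gamma> (i - 1)) = tw_h P' (i - 1) \<cdot> \<gamma> (i - 1)"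
      by (rule ra) simp_all
    show "tw_h P' i \<cdot> (\<gamma> i \<cdot> tw_j P (i - 2)) = tw_h P' i \<cdot> (tw_j P' (i - 1) \<cdot> \<gamma> (i - 1))"
      unfolding m hg1 by (simp add: hg[THEN ra])
  qed (simp_all add: ar_iff)
  \<comment> \<open>From \<open>k + 1\<close> on the lift is \<open>u\<close> itself and the given
    triangle is used as it stands; this anchors the later arrows to \<open>A''\<close>.\<close>
  have "\<forall>i. \<exists>Z \<alpha> \<beta>. dist C (tw_ob P (i - 1)) (tw_ob P' i) Z (\<gamma> i) \<alpha> \<beta> \<and>
      (k + 1 \<le> i \<longrightarrow> Z = A'' \<and> \<alpha> = v \<and> \<beta> = q)"
  proof
    fix i
    show "\<exists>Z \<alpha> \<beta>. dist C (tw_ob P (i - 1)) (tw_ob P' i) Z (\<gamma> i) \<alpha> \<beta> \<and>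
      (k + 1 \<le> i \<longrightarrow> Z = A'' \<and> \<alpha> = v \<and> \<beta> = q)"
    proof (cases "k + 1 \<le> i")
      case True
      then have "dist C (tw_ob P (i - 1)) (tw_ob P' i) A'' (\<gamma> i) v q" using d gu cP cP' by simp
      then show ?thesis by blast
    next
      case False
      then show ?thesis using dist_ex[of "tw_ob P (i - 1)" "tw_ob P' i" "\<gamma> i"] g by (auto simp: Hom_ar)
    qed
  qed
  then obtain Z \<alpha> \<beta> where Z: "\<And>i. dist C (tw_ob P (i - 1)) (tw_ob P' i) (Z i) (\<gamma> i) (\<alpha> i) (\<beta> i)"
    and cZ: "\<And>i. k + 1 \<le> i \<Longrightarrow> Z i = A'' \<and> \<alpha> i = v \<and> \<beta> i = q" by metis
  note [simp] = distD[OF Z, unfolded ar_iff]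
  have wZ: "Z i \<in> wle C w i" for i using wle_cone[OF Z towerD(19)[OF P] towerD(19)[OF P']] .
  define S where "S i jz G cz ez u3 v3 s p \<longleftrightarrow> dist C (Z (i - 1)) (Z i) G jz cz ez \<and>
    biproduct C (shO C 1 (tw_gr P (i - 1))) (tw_gr P' i) G s u3 v3 p \<and>
    jz \<cdot> \<alpha> (i - 1) = \<alpha> i \<cdot> tw_j P' (i - 1) \<and> cz \<cdot> \<alpha> i = u3 \<cdot> tw_c P' i \<and>
    ez \<cdot> u3 = shA C 1 (\<alpha> (i - 1)) \<cdot> tw_e P' (i - 1) \<and>
    v3 \<cdot> cz = neg (shA C 1 (tw_c P (i - 1)) \<cdot> \<beta> i) \<and>
    shA C 1 (\<beta> (i - 1)) \<cdot> ez = shA C 1 (tw_e P (i - 2)) \<cdot> v3 \<and>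
    (zero_object C (tw_gr P' i) \<longrightarrow> (\<forall>g. ar g (tw_ob P (i - 1)) (tw_ob P' (i - 1)) \<and> tw_j P' (i - 1) \<cdot> g = \<gamma> i \<longrightarrow>
       ez \<cdot> (s \<cdot> shA C 1 (tw_c P (i - 1))) = shA C 1 (\<alpha> (i - 1) \<cdot> g))) \<and>
    (k + 2 \<le> i \<longrightarrow> jz = idm C A'')" for i jz G cz ez u3 v3 s p
  have "\<forall>i. \<exists>jz G cz ez u3 v3 s p. S i jz G cz ez u3 v3 s p"
  proof
    fix i
    show "\<exists>jz G cz ez u3 v3 s p. S i jz G cz ez u3 v3 s p"
    proof (cases "k + 2 \<le> i")
      case False
      have Z1: "dist C (tw_ob P (i - 2)) (tw_ob P' (i - 1)) (Z (i - 1)) (\<gamma> (i - 1)) (\<alpha> (i - 1)) (\<beta> (i - 1))"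
        using Z[of "i - 1"] by simp
      from tower_cone_step[OF P P' Z1 Z sq] obtain jz G cz ez u3 v3 s p where
        "dist C (Z (i - 1)) (Z i) G jz cz ez"
        "biproduct C (shO C 1 (tw_gr P (i - 1))) (tw_gr P' i) G s u3 v3 p"
        "jz \<cdot> \<alpha> (i - 1) = \<alpha> i \<cdot> tw_j P' (i - 1)" "cz \<cdot> \<alpha> i = u3 \<cdot> tw_c P' i"
        "ez \<cdot> u3 = shA C 1 (\<alpha> (i - 1)) \<cdot> tw_e P' (i - 1)"
        "v3 \<cdot> cz = neg (shA C 1 (tw_c P (i - 1)) \<cdot> \<beta> i)"
        "shA C 1 (\<beta> (i - 1)) \<cdot> ez = shA C 1 (tw_e P (i - 2)) \<cdot> v3"
        "zero_object C (tw_gr P' i) \<longrightarrow> (\<forall>g. ar g (tw_ob P (i - 1)) (tw_ob P' (i - 1)) \<and> tw_j P' (i - 1) \<cdot> g = \<gamma> i \<longrightarrow>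
           ez \<cdot> (s \<cdot> shA C 1 (tw_c P (i - 1))) = shA C 1 (\<alpha> (i - 1) \<cdot> g))" .
      then have "S i jz G cz ez u3 v3 s p" using False unfolding S_def by blast
      then show ?thesis by blast
    next
      case True
      have c: "Z (i - 1) = A''" "Z i = A''" "\<alpha> i = v" "\<alpha> (i - 1) = v" "\<beta> i = q" "\<beta> (i - 1) = q"
        "\<gamma> i = u" "tw_ob P (i - 1) = A" "tw_ob P' (i - 1) = A'" "tw_ob P' i = A'" "tw_ob P (i - 2) = A"
        using True cZ gu cP cP' by auto
      have j: "tw_j P' (i - 1) = idm C A'"
        using True cP' by (intro tower_of_constant(1)[OF P', of k]) auto
      have z: "zero_object C (tw_gr P (i - 1))" "zero_object C (tw_gr P' i)"
        using True cP cP' by (auto intro: tower_of_constant(2)[OF P, of k] tower_of_constant(2)[OF P', of k])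
      have z1: "zero_object C (shO C 1 (tw_gr P (i - 1)))" using z(1) by (rule zero_object_shO)
      note [simp] = zero_object_Obj[OF z(1)] zero_object_Obj[OF z(2)]
      have t: "tgt (tw_e P (i - 2)) = shO C 1 A" "src (tw_e P (i - 2)) = tw_gr P (i - 1)"
        "src (tw_c P (i - 1)) = A" "tgt (tw_e P' (i - 1)) = shO C 1 A'" "src (tw_c P' i) = A'"
        using towerD(13,14)[OF P, of "i - 2"] towerD(10)[OF P, of "i - 1"] towerD(14)[OF P', of "i - 1"]
          towerD(10)[OF P', of i] c by simp_all
      \<comment> \<open>In the constant range both graded pieces vanish and zero data satisfy every
        clause. They are preferred to the output of the octahedra because \<open>jz\<close> is then
        the identity.\<close>
      have "S i (idm C A'') zob (zr A'' zob) (zr zob (shO C 1 A'')) (zr (tw_gr P' i) zob)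
          (zr zob (shO C 1 (tw_gr P (i - 1)))) (zr (shO C 1 (tw_gr P (i - 1))) zob) (zr zob (tw_gr P' i))"
        unfolding S_def c j
      proof (intro conjI impI allI dist_idm biproduct_zero_objects[OF z1 z(2) zob(1)])
        show "zr zob (shO C 1 A'') \<cdot> zr (tw_gr P' i) zob = shA C 1 v \<cdot> tw_e P' (i - 1)"
          by (rule eq_from_zero) (simp_all add: z t c)
        show "zr zob (shO C 1 (tw_gr P (i - 1))) \<cdot> zr A'' zob = neg (shA C 1 (tw_c P (i - 1)) \<cdot> q)"
          by (rule eq_to_zero) (simp_all add: z1 t c)
        fix g assume "ar g A A' \<and> idm C A' \<cdot> g = u"
        then have "g = u" by (auto simp: ar_iff)
        then show "zr zob (shO C 1 A'') \<cdot> (zr (shO C 1 (tw_gr P (i - 1))) zob \<cdot> shA C 1 (tw_c P (i - 1))) = shA C 1 (v \<cdot> g)"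
          by (simp add: dist_cmp_zero(1)[OF d] t c)
      qed (simp_all add: t c)
      then show ?thesis by blast
    qed
  qed
  then obtain jz G cz ez u3 v3 s p where S: "\<And>i. S i (jz i) (G i) (cz i) (ez i) (u3 i) (v3 i) (s i) (p i)"
    by metis
  note S' = S[unfolded S_def]
  have dG: "dist C (Z (i - 1)) (Z i) (G i) (jz i) (cz i) (ez i)" and
    bG: "biproduct C (shO C 1 (tw_gr P (i - 1))) (tw_gr P' i) (G i) (s i) (u3 i) (v3 i) (p i)" and
    jza: "jz i \<cdot> \<alpha> (i - 1) = \<alpha> i \<cdot> tw_j P' (i - 1)" and cza: "cz i \<cdot> \<alpha> i = u3 i \<cdot> tw_c P' i" and
    ezu: "ez i \<cdot> u3 i = shA C 1 (\<alpha> (i - 1)) \<cdot> tw_e P' (i - 1)" and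
    vcz: "v3 i \<cdot> cz i = neg (shA C 1 (tw_c P (i - 1)) \<cdot> \<beta> i)" and
    bez: "shA C 1 (\<beta> (i - 1)) \<cdot> ez i = shA C 1 (tw_e P (i - 2)) \<cdot> v3 i" and
    spec: "zero_object C (tw_gr P' i) \<Longrightarrow> ar g (tw_ob P (i - 1)) (tw_ob P' (i - 1)) \<Longrightarrow> tw_j P' (i - 1) \<cdot> g = \<gamma> i \<Longrightarrow>
       ez i \<cdot> (s i \<cdot> shA C 1 (tw_c P (i - 1))) = shA C 1 (\<alpha> (i - 1) \<cdot> g)" and
    jid: "k + 2 \<le> i \<Longrightarrow> jz i = idm C A''" for i g
    using S'[of i] by blast+
  note [simp] = distD[OF dG, unfolded ar_iff] bG[unfolded biproduct_ar ar_iff]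
  have wG: "G i \<in> wge C w i" for i
    using biproduct_wge[OF bG] towerD(21)[OF P, of "i - 1"] towerD(21)[OF P', of i] by simp
  \<comment> \<open>The cones are chosen without functoriality, so no arrow from \<open>Z i\<close>
    to \<open>A''\<close> is available. It is defined as the composite of the \<open>jz\<close> up
    to \<open>k + 1\<close>, where \<open>Z\<close> is \<open>A''\<close>; \<open>Hd d\<close>
    belongs to index \<open>k + 1 - d\<close>.\<close>
  define Hd where "Hd = rec_nat (idm C A'') (\<lambda>d h. h \<cdot> jz (k + 1 - int d))"
  have Hd0: "Hd 0 = idm C A''" and HdS: "Hd (Suc d) = Hd d \<cdot> jz (k + 1 - int d)" for d
    by (simp_all add: Hd_def)
  have Hd: "gives_decomposition C w (k + 1 - int d) (Z (k + 1 - int d)) A'' (Hd d) \<and>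
      Hd d \<cdot> \<alpha> (k + 1 - int d) = v \<cdot> tw_h P' (k + 1 - int d)" for d
  proof (induction d)
    case 0
    have "A'' \<in> wle C w (k + 1)" using wZ[of "k + 1"] cZ[of "k + 1"] by simp
    then show ?case using cZ[of "k + 1"] cP' by (simp add: Hd0 gives_decomposition_id)
  next
    case (Suc d)
    define i where "i = k + 1 - int d"
    have i: "k + 1 - int (Suc d) = i - 1" by (simp add: i_def)
    have IH: "gives_decomposition C w i (Z i) A'' (Hd d)" "Hd d \<cdot> \<alpha> i = v \<cdot> tw_h P' i"
      using Suc by (simp_all add: i_def)
    obtain R a b where R: "dist C (Z i) A'' R (Hd d) a b" "R \<in> wge C w (i + 1)"
      using IH(1) by (rule gives_decompositionE)
    note [simp] = distD[OF R(1), unfolded ar_iff]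
    obtain Y c c' where Y: "dist C (Z (i - 1)) A'' Y (Hd d \<cdot> jz i) c c'"
      using dist_ex[of "Z (i - 1)" A'' "Hd d \<cdot> jz i"] by (auto simp: Hom_ar ar_iff)
    \<comment> \<open>One step down, the new quotient of \<open>A''\<close> is an extension of the
      old one by \<open>G i\<close>, which has weight at least \<open>i\<close>.\<close>
    obtain x y z where o: "dist C (G i) Y R x y z"
      using octahedron_obtain[OF dG R(1) Y] .
    have "Y \<in> wge C w i" using wge_extension[OF o wG wge_mono[OF R(2)]] by simp
    then have 1: "gives_decomposition C w (i - 1) (Z (i - 1)) A'' (Hd (Suc d))"
      using gives_decompositionI[OF Y wZ[of "i - 1"]] HdS[of d] unfolding i_def[symmetric] by simp
    have "(Hd d \<cdot> jz i) \<cdot> \<alpha> (i - 1) = Hd d \<cdot> (jz i \<cdot> \<alpha> (i - 1))" by simp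
    also have "\<dots> = v \<cdot> (tw_h P' i \<cdot> tw_j P' (i - 1))" by (simp add: jza IH(2)[THEN ra])
    also have "tw_h P' i \<cdot> tw_j P' (i - 1) = tw_h P' (i - 1)" using towerD(17)[OF P', of "i - 1"] by simp
    finally have 2: "Hd (Suc d) \<cdot> \<alpha> (i - 1) = v \<cdot> tw_h P' (i - 1)" by (simp add: HdS i_def)
    show ?case unfolding i using 1 2 by blast
  qed
  define hh where "hh i = Hd (nat (k + 1 - i))" for i
  have hh1: "hh i = idm C A''" if "k + 1 \<le> i" for i using that by (simp add: hh_def Hd0)
  have hdec: "gives_decomposition C w i (Z i) A'' (hh i)" for i
  proof (cases "k + 1 \<le> i")
    case True
    then have "A'' \<in> wle C w i" using wZ[of i] cZ[of i] by simp
    then show ?thesis using True cZ by (simp add: hh1 gives_decomposition_id)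
  next
    case False
    then have "k + 1 - int (nat (k + 1 - i)) = i" by simp
    then show ?thesis using Hd[of "nat (k + 1 - i)"] by (simp add: hh_def)
  qed
  have hha: "hh i \<cdot> \<alpha> i = v \<cdot> tw_h P' i" for i
  proof (cases "k + 1 \<le> i")
    case True
    then show ?thesis using cZ cP' by (simp add: hh1)
  next
    case False
    then have "k + 1 - int (nat (k + 1 - i)) = i" by simp
    then show ?thesis using Hd[of "nat (k + 1 - i)"] by (simp add: hh_def)
  qed
  have hhj: "hh (i + 1) \<cdot> jz (i + 1) = hh i" for i
  proof (cases "k + 1 \<le> i")
    case True
    then show ?thesis by (simp add: hh1 jid)
  next
    case False
    define d where "d = nat (k - i)"
    have e: "nat (k + 1 - i) = Suc d" "nat (k + 1 - (i + 1)) = d" "k + 1 - int d = i + 1"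
      using False by (simp_all add: d_def nat_eq_iff)
    show ?thesis unfolding hh_def e(1,2) HdS e(3) ..
  qed
  note [simp] = gives_decompositionD(1)[OF hdec, unfolded ar_iff]
  define P'' where "P'' = \<lparr>tw_ob = Z, tw_gr = G, tw_h = hh, tw_j = (\<lambda>i. jz (i + 1)), tw_c = cz,
    tw_e = (\<lambda>i. ez (i + 1))\<rparr>"
  have P'': "is_tower C w A'' P''"
    unfolding is_tower_def P''_def using hdec dG hhj by (simp add: Hom_ar ar_iff)
  have m: "is_tower_mor C A' P' A'' P'' v \<alpha> u3"
    by (rule tower_morI) (use jza[of "_ + 1"] ezu[of "_ + 1"] in \<open>simp_all add: P''_def ar_iff hha cza\<close>)
  have tP: "tower_complex C P \<in> complexes (heart C w)" "tower_complex C P' \<in> complexes (heart C w)"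
    "tower_complex C P'' \<in> complexes (heart C w)"
    using P P' P'' tower_complex_complex by blast+
  have b: "biproduct (heart C w) (cob (tower_complex C P) (n + 1)) (cob (tower_complex C P') n) (cob (tower_complex C P'') n)
      (shA C n (s (- n))) (shA C n (u3 (- n))) (shA C n (v3 (- n))) (shA C n (p (- n)))" for n
    unfolding heart_biproduct using biproduct_shA[OF bG[of "- n"], of n] tower_gr_heart[OF P, of "n + 1"] tower_gr_heart[OF P', of n]
    by (simp add: P''_def int_norms)
  have d2: "cdf (tower_complex C P'') n \<cdot>\<^bsub>heart C w\<^esub> shA C n (u3 (- n)) =
      shA C (n + 1) (u3 (- (n + 1))) \<cdot>\<^bsub>heart C w\<^esub> cdf (tower_complex C P') n" for n
    using H_cmD(4)[OF tower_mor_cm[OF m P' P''], of n] by (simp del: tower_complex_simps)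
  have d1: "shA C (n + 1) (v3 (- (n + 1))) \<cdot>\<^bsub>heart C w\<^esub> cdf (tower_complex C P'') n =
      H.neg (cdf (tower_complex C P) (n + 1) \<cdot>\<^bsub>heart C w\<^esub> shA C n (v3 (- n)))" for n
  proof -
    have "H.ar (cdf (tower_complex C P) (n + 1) \<cdot> shA C n (v3 (- n))) (cob (tower_complex C P'') n) (cob (tower_complex C P) (n + 1 + 1))"
      using H_cplxD[OF tP(1), of "n + 1"] H_cplxD(1,2)[OF tP(3), of n] H_cplxD(1,2)[OF tP(1), of "n + 1 + 1"]
      unfolding H_ar ar_iff by (simp add: P''_def int_norms)
    then have ne: "H.neg (cdf (tower_complex C P) (n + 1) \<cdot> shA C n (v3 (- n))) = neg (cdf (tower_complex C P) (n + 1) \<cdot> shA C n (v3 (- n)))"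
      by (rule H_neg)
    have b1: "shA C (n + 1) (\<beta> (- n - 1)) \<cdot> shA C n (ez (- n)) = shA C (n + 1) (tw_e P (- n - 2)) \<cdot> shA C n (v3 (- n))"
      using arg_cong[OF bez[of "- n"], of "shA C n"] by (simp add: int_norms)
    have c1: "shA C (n + 1) (v3 (- n - 1)) \<cdot> shA C (n + 1) (cz (- n - 1)) =
        neg (shA C (n + 2) (tw_c P (- n - 2)) \<cdot> shA C (n + 1) (\<beta> (- n - 1)))"
      using arg_cong[OF vcz[of "- n - 1"], of "shA C (n + 1)"] by (simp add: int_norms)
    show ?thesis unfolding heart_simps ne
      by (simp add: P''_def int_norms c1[THEN ra] b1)
  qed
  let ?f = "\<lambda>n. shA C n (p (- n)) \<cdot> (cdf (tower_complex C P'') (n - 1) \<cdot> shA C (n - 1) (s (- (n - 1))))"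
  have cone: "H.cm (tower_complex C P) (tower_complex C P') ?f"
    "is_cone (heart C w) (tower_complex C P) (tower_complex C P') ?f (tower_complex C P'')
       (\<lambda>n. shA C n (s (- n))) (\<lambda>n. shA C n (u3 (- n))) (\<lambda>n. shA C n (v3 (- n))) (\<lambda>n. shA C n (p (- n)))"
    using H.cone_of_split[OF tP b d2 d1] by simp_all
  have "\<forall>n g. zero_object C (tw_gr P' (- n + 1)) \<and> ar g (tw_ob P (- n)) (tw_ob P' (- n)) \<and>
       tw_h P' (- n) \<cdot> g = u \<cdot> tw_h P (- n) \<longrightarrow> ?f n \<cdot> shA C n (tw_c P (- n)) = shA C n (tw_c P' (- n) \<cdot> g)"
  proof (intro allI impI, elim conjE)
    fix n g
    assume z: "zero_object C (tw_gr P' (- n + 1))" and g: "ar g (tw_ob P (- n)) (tw_ob P' (- n))"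
      and hgg: "tw_h P' (- n) \<cdot> g = u \<cdot> tw_h P (- n)"
    note [simp] = g[unfolded ar_iff]
    have r: "tw_h P' (- n + 1) \<cdot> (tw_j P' (- n) \<cdot> g) = tw_h P' (- n) \<cdot> g"
      by (rule ra[OF towerD(17)[OF P']]) simp_all
    \<comment> \<open>Any lift of \<open>u\<close> at equal indices becomes the chosen offset lift
      after one step in the target tower, by uniqueness.\<close>
    have "tw_j P' (- n) \<cdot> g = \<gamma> (- n + 1)"
    proof (rule decomposition_unique[OF towerD(2)[OF P', of "- n + 1"] _ _ towerD(19)[OF P, of "- n"]])
      show "tw_h P' (- n + 1) \<cdot> (tw_j P' (- n) \<cdot> g) = tw_h P' (- n + 1) \<cdot> \<gamma> (- n + 1)"
        unfolding r hgg using hg[of "- n + 1"] by simp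
    qed (simp_all add: ar_iff)
    then have "ez (- n + 1) \<cdot> (s (- n + 1) \<cdot> shA C 1 (tw_c P (- n))) = shA C 1 (\<alpha> (- n) \<cdot> g)"
      using spec[of "- n + 1" g] z g by simp
    from arg_cong[OF this, of "shA C (n - 1)"]
    have 1: "shA C (n - 1) (ez (- n + 1)) \<cdot> (shA C (n - 1) (s (- n + 1)) \<cdot> shA C n (tw_c P (- n))) =
       shA C n (\<alpha> (- n)) \<cdot> shA C n g" by simp
    have 2: "shA C n (cz (- n)) \<cdot> shA C n (\<alpha> (- n)) = shA C n (u3 (- n)) \<cdot> shA C n (tw_c P' (- n))"
      using arg_cong[OF cza[of "- n"], of "shA C n"] by simp
    have 3: "shA C n (p (- n)) \<cdot> shA C n (u3 (- n)) = idm C (shO C n (tw_gr P' (- n)))"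
      using arg_cong[of "p (- n) \<cdot> u3 (- n)" _ "shA C n"] bG[of "- n", unfolded biproduct_ar] by (simp del: shA_cmp' flip: shA_cmp')
    have [simp]: "- (n - 1) - 1 = - n" by simp
    have e: "- n + 1 = 1 - n" by simp
    show "?f n \<cdot> shA C n (tw_c P (- n)) = shA C n (tw_c P' (- n) \<cdot> g)"
      by (simp add: P''_def 1[unfolded e] 2[THEN ra] 3[THEN ra])
  qed
  moreover have "\<forall>i\<ge>k+1. tw_ob P'' i = A'' \<and> tw_h P'' i = idm C A''"
    using cZ hh1 by (simp add: P''_def)
  ultimately show thesis using that[OF P'' m _ cone] by blast
qed

end

section \<open>Realizing truncations\<close>

context triangulated_category begin

lemma dist_iso_of_zero:
  assumes "dist C X Y Z f g h" "zero_object C Z" shows "iso_arrow C X Y f"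
proof -
  note [simp] = distD[OF assms(1), unfolded ar_iff]
  have "g = zr Y Z" using to_zero[OF assms(2) distD(2)[OF assms(1)]] .
  then obtain y where y: "ar y Y X" "f \<cdot> y = idm C Y"
    using dist_lift[OF assms(1) ar_idm[of Y]] by auto
  note [simp] = y(1)[unfolded ar_iff]
  have "y \<cdot> f \<boxplus> neg (idm C X) = zr X X"
    by (rule dist_mono[OF assms]) (simp_all add: ar_iff y(2)[THEN ra])
  then have "y \<cdot> f = idm C X" using eq_of_diff[of "y \<cdot> f" "idm C X"] by simp
  then show ?thesis unfolding iso_arrow_ar using y distD(1)[OF assms(1)] by blast
qed

end

section \<open>Pure objects and maps to one-term complexes\<close>

context weight_structure begin

lemma pure_tower_exists:
  assumes "D \<in> wle C w k" "D \<in> wge C w k"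
  obtains P where "is_tower C w D P" "\<forall>i\<ge>k. tw_ob P i = D \<and> tw_h P i = idm C D"
    "\<forall>i<k. zero_object C (tw_ob P i)" "\<forall>i. i \<noteq> k \<longrightarrow> zero_object C (tw_gr P i)"
    "iso_arrow C D (tw_gr P k) (tw_c P k)"
proof -
  have D: "D \<in> Obj C" using wle_Obj[OF assms(1)] .
  \<comment> \<open>Unrotating the trivial triangle on \<open>D\<close> produces 0[-1] as its first
    vertex, so this object serves as the zero truncation.\<close>
  let ?O = "shO C (-1) zob"
  have O: "zero_object C ?O" by (simp add: zero_object_shO)
  have g: "gives_decomposition C w i (if k \<le> i then D else ?O) D (if k \<le> i then idm C D else zr ?O D)" for i
  proof (cases "k \<le> i")
    case True
    then show ?thesis using gives_decomposition_id[OF assms(1)] by simp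
  next
    case False
    then show ?thesis
      using gives_decompositionI[OF dist_zero_first[OF D] zero_wle[OF O] wge_mono[OF assms(2)], of i] by simp
  qed
  obtain P where P: "is_tower C w D P" "tw_ob P = (\<lambda>i. if k \<le> i then D else ?O)"
    "tw_h P = (\<lambda>i. if k \<le> i then idm C D else zr ?O D)"
    using tower_exists[OF g] .
  have 1: "\<forall>i\<ge>k. tw_ob P i = D \<and> tw_h P i = idm C D" and 2: "\<forall>i<k. zero_object C (tw_ob P i)"
    using O by (simp_all add: P(2,3))
  have 3: "zero_object C (tw_gr P i)" if "i \<noteq> k" for i
  proof (cases "k < i")
    case True
    then show ?thesis using 1 by (intro tower_of_constant(2)[OF P(1), of k]) auto
  next
    case False
    then show ?thesis using dist_zero_third[OF towerD(18)[OF P(1), of i]] 2 that by simp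
  qed
  have "iso_arrow C (tw_ob P k) (tw_gr P k) (tw_c P k)"
    using dist_iso_of_zero[OF dist_rot[OF towerD(18)[OF P(1), of k]]] 2 zero_object_shO by simp
  then show thesis using that[OF P(1) 1 2] 1 3 by simp
qed

text \<open>A difference killed by \<open>tw_c\<close> is t d by \<open>tower_gr_factor\<close>.
  With a target in a single degree, \<open>t\<close> alone is a homotopy, so agreement after
  \<open>tw_c\<close> already fixes the class in K(Hw).\<close>

lemma concentrated_homotopic:
  assumes Q: "is_tower C w N Q" and F: "H.cm (tower_complex C Q) E F" and G: "H.cm (tower_complex C Q) E G"
    and E: "\<And>n. n \<noteq> k \<Longrightarrow> zero_object C (cob E n)"
    and eq: "F k \<cdot> shA C k (tw_c Q (- k)) = G k \<cdot> shA C k (tw_c Q (- k))"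
  shows "homotopic (heart C w) (tower_complex C Q) E F G"
proof -
  note cE = H.cm_cplx(2)[OF F] and cQ = H.cm_cplx(1)[OF F]
  note [simp] = towerD(1,3-17)[OF Q] H_cplxD(1-5)[OF cE] int_norms
  have tF: "is_arr (F n)" "src (F n) = shO C n (tw_gr Q (- n))" "tgt (F n) = cob E n"
    "is_arr (G n)" "src (G n) = shO C n (tw_gr Q (- n))" "tgt (G n) = cob E n" for n
    using H_cmD(1-3)[OF F, of n] H_cmD(1-3)[OF G, of n] by simp_all
  note [simp] = tF
  let ?x = "shA C (- k) (F k \<boxplus> neg (G k))"
  have "cob E k \<in> wge C w 0" using H_cplxD(1)[OF cE, of k] by (simp add: heart_Obj)
  then have w: "shO C (- k) (cob E k) \<in> wge C w (- k)" by simp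
  have "?x \<cdot> tw_c Q (- k) = shA C (- k) ((F k \<boxplus> neg (G k)) \<cdot> shA C k (tw_c Q (- k)))" by simp
  also have "(F k \<boxplus> neg (G k)) \<cdot> shA C k (tw_c Q (- k)) = zr (shO C k (tw_ob Q (- k))) (cob E k)"
    by (simp add: eq)
  finally have "?x \<cdot> tw_c Q (- k) = zr (tw_ob Q (- k)) (shO C (- k) (cob E k))" by simp
  then obtain t where t: "ar t (shO C 1 (tw_gr Q (- k - 1))) (shO C (- k) (cob E k))"
    "?x = t \<cdot> (shA C 1 (tw_c Q (- k - 1)) \<cdot> tw_e Q (- k - 1))"
    using tower_gr_factor[OF Q _ w, of ?x] by (auto simp: ar_iff)
  note [simp] = t(1)[unfolded ar_iff]
  have Fk: "F k = G k \<boxplus> shA C k t \<cdot> cdf (tower_complex C Q) k"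
  proof -
    have "F k \<boxplus> neg (G k) = shA C k ?x" by simp
    then have "F k \<boxplus> neg (G k) = shA C k t \<cdot> cdf (tower_complex C Q) k" unfolding t(2) by simp
    moreover have "F k = G k \<boxplus> (F k \<boxplus> neg (G k))" by (simp add: madd_ac madd_cancel_apart)
    ultimately show ?thesis by simp
  qed
  show ?thesis
  proof (rule H_homotopicI[OF cQ cE, where s = "\<lambda>n. if n = k + 1 then shA C k t else zr (shO C n (tw_gr Q (- n))) (cob E (n - 1))"])
    show "ar (if n = k + 1 then shA C k t else zr (shO C n (tw_gr Q (- n))) (cob E (n - 1)))
        (cob (tower_complex C Q) n) (cob E (n - 1))" for n
      by (simp add: ar_iff)
    fix n
    show "F n = G n \<boxplus> (cdf E (n - 1) \<cdot> (if n = k + 1 then shA C k t else zr (shO C n (tw_gr Q (- n))) (cob E (n - 1))) \<boxplus>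
       (if n + 1 = k + 1 then shA C k t else zr (shO C (n + 1) (tw_gr Q (- (n + 1)))) (cob E (n + 1 - 1))) \<cdot> cdf (tower_complex C Q) n)"
    proof (cases "n = k")
      case True
      then show ?thesis using Fk by simp
    next
      case False
      show ?thesis by (rule eq_to_zero) (use False E[OF False] in auto)
    qed
  qed
qed

text \<open>If the lowest term of the weight complex is contractible, the top graded piece of \<open>A\<close>
  embeds into the next one, so the projection of \<open>A\<close> onto it vanishes.\<close>

lemma wle_of_weight_complex:
  assumes P: "is_tower C w A P" and "tw_ob P k = A" "zero_object C (tw_gr P (k + 1))"
    and "isomorphic (Kcat (heart C w)) (tower_complex C P) X" "zero_object C (cob X (- k))"
  shows "A \<in> wle C w (k - 1)"
proof -
  note [simp] = towerD(1,3-17)[OF P] int_norms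
  have z: "zero_object (heart C w) (cob X (- k))" "zero_object (heart C w) (cob (tower_complex C P) (- k - 1))"
    using assms(3,5) by (simp_all add: heart_zero_object zero_object_shO)
  obtain s where s: "H.ar s (cob (tower_complex C P) (- k + 1)) (cob (tower_complex C P) (- k))"
    "s \<cdot> cdf (tower_complex C P) (- k) = idm C (cob (tower_complex C P) (- k))"
    using H.split_lowest_differential[OF assms(4) z] by auto
  have [simp]: "is_arr s" "src s = shO C (- k + 1) (tw_gr P (k - 1))" "tgt s = shO C (- k) (tw_gr P k)"
    using s(1) by (simp_all add: H_ar ar_iff)
  \<comment> \<open>The differential factors through \<open>tw_e\<close>, which kills
    \<open>tw_c\<close>; the retraction \<open>s\<close> of the differential then forces
    \<open>tw_c\<close> itself to vanish.\<close>
  have "shA C (- k) (tw_e P (k - 1)) \<cdot> shA C (- k) (tw_c P k) = zr (shO C (- k) (tw_ob P k)) (shO C (- k + 1) (tw_ob P (k - 1)))"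
    using arg_cong[OF tower_cmp(2)[OF P, of k "k - 1"], of "shA C (- k)"] by simp
  then have "cdf (tower_complex C P) (- k) \<cdot> shA C (- k) (tw_c P k) = zr (shO C (- k) (tw_ob P k)) (shO C (- k + 1) (tw_gr P (k - 1)))"
    by simp
  then have "s \<cdot> (cdf (tower_complex C P) (- k) \<cdot> shA C (- k) (tw_c P k)) = zr (shO C (- k) (tw_ob P k)) (shO C (- k) (tw_gr P k))"
    by simp
  then have "shA C (- k) (tw_c P k) = zr (shO C (- k) (tw_ob P k)) (shO C (- k) (tw_gr P k))"
    using s(2)[THEN ra, of "shA C (- k) (tw_c P k)"] by simp
  then have "tw_c P k \<cdot> idm C (tw_ob P k) = zr (tw_ob P k) (tw_gr P k)" by (simp add: shA_eq_zr_iff)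
  then obtain y where y: "ar y (tw_ob P k) (tw_ob P (k - 1))" "tw_j P (k - 1) \<cdot> y = idm C (tw_ob P k)"
    using dist_lift[OF towerD(18)[OF P, of k] ar_idm] by auto
  have "ar (tw_j P (k - 1)) (tw_ob P (k - 1)) (tw_ob P k)" by (simp add: ar_iff)
  then have "retract_of C (tw_ob P k) (tw_ob P (k - 1))" unfolding retract_of_ar using y by blast
  then show ?thesis using wle_retract[OF towerD(19)[OF P]] assms(2) by simp
qed

text \<open>The arrow \<open>u\<close> is built so that on weight complexes it becomes
  \<open>r i2\<close>. Two chain maps have to be matched with it: the one induced by a tower
  morphism over \<open>u\<close>, and the one whose cone is the weight complex of the cone of
  \<open>u\<close>. \<open>concentrated_homotopic\<close> settles both.\<close>

lemma realize_truncation: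
  assumes kar: "karoubian (heart C w)" and N': "gives_decomposition C w (m + 1) N' M h'"
    and Q: "is_tower C w N' Q" and cQ: "\<forall>i\<ge>m+1. tw_ob Q i = N' \<and> tw_h Q i = idm C N'"
    and X1: "\<And>n. n < - m \<Longrightarrow> zero_object C (cob X1 n)"
    and f1: "H.cm X1 (tower_complex C Q) f1" and cone: "is_cone (heart C w) X1 (tower_complex C Q) f1 Z1 i1 i2 p1 p2"
    and p: "H.cm Z1 Z1 p" "homotopic (heart C w) Z1 Z1 p (\<lambda>n. idm C (cob Z1 n))"
      "\<And>n. - m - 1 < n \<Longrightarrow> p n = zr (cob Z1 n) (cob Z1 n)"
  obtains D' N PD PN u ule ugr v vle vgr n a b where "is_tower C w D' PD" "N \<in> Obj C"
    "is_tower C w (shO C 1 N) PN" "is_tower_mor C N' Q D' PD u ule ugr"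
    "is_tower_mor C D' PD (shO C 1 N) PN v vle vgr"
    "iso_arrow (Kcat (heart C w)) Z1 (tower_complex C PD) a"
    "iso_arrow (Kcat (heart C w)) (cshift (heart C w) 1 X1) (tower_complex C PN) b"
    "a \<cdot>\<^bsub>Kcat (heart C w)\<^esub> kmor (heart C w) (tower_complex C Q) Z1 i2 = tower_complex_mor C w Q PD ugr"
    "b \<cdot>\<^bsub>Kcat (heart C w)\<^esub> kmor (heart C w) Z1 (cshift (heart C w) 1 X1) p1 =
       tower_complex_mor C w PD PN vgr \<cdot>\<^bsub>Kcat (heart C w)\<^esub> a"
    "dist C N N' D' n u v" "gives_decomposition C w m N M (h' \<cdot> n)"
proof -
  let ?k = "- m - 1"
  let ?K = "Kcat (heart C w)"
  note [simp] = towerD(1,3-17)[OF Q] int_norms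
  note cX = H.cm_cplx(1)[OF f1] and tQ = H.cm_cplx(2)[OF f1]
  note Dc = H.coneD[OF cone f1]
  note [simp] = H_cplxD(1-5)[OF Dc(1)]
  have grQ: "zero_object C (tw_gr Q i)" if "m + 1 < i" for i
    by (rule tower_of_constant(2)[OF Q _ that]) (use cQ in auto)
  \<comment> \<open>Such a term is the sum of a term of \<open>X1\<close> in degree
    \<open>n + 1 < - m\<close> and a graded piece of index \<open>- n > m + 1\<close>; both
    vanish.\<close>
  have Zlow: "zero_object (heart C w) (cob Z1 n)" if "n < ?k" for n
    by (rule H.biproduct_is_zero[OF Dc(2)])
      (use X1[of "n + 1"] grQ[of "- n"] that in \<open>simp_all add: heart_zero_object zero_object_shO\<close>)
  have pz: "\<And>n. ?k < n \<Longrightarrow> p n = mzero (heart C w) (cob Z1 n) (cob Z1 n)" using p(3) by simp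
  have ph: "homotopic (heart C w) Z1 Z1 p (\<lambda>n. idm (heart C w) (cob Z1 n))" using p(2) by simp
  note idem = H.concentrated_idempotent[OF p(1) ph Zlow pz]
  have "p ?k \<in> Hom (heart C w) (cob Z1 ?k) (cob Z1 ?k)"
    using H_cmD[OF p(1), of ?k] by (simp add: Hom_ar ar_iff)
  then obtain Y r s where rs: "Y \<in> Obj (heart C w)" "r \<in> Hom (heart C w) (cob Z1 ?k) Y"
    "s \<in> Hom (heart C w) Y (cob Z1 ?k)" "r \<cdot> s = idm C Y" "s \<cdot> r = p ?k"
    using kar idem(1) H_cplxD(1)[OF Dc(1), of ?k] unfolding karoubian_def by (metis heart_simps(2,3))
  have YC[simp]: "Y \<in> Obj C" using heart_Obj_C[OF rs(1)] .
  have [simp]: "is_arr r" "src r = cob Z1 ?k" "tgt r = Y" "is_arr s" "src s = Y" "tgt s = cob Z1 ?k"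
    using rs(2,3) by (simp_all add: Hom_ar ar_iff)
  \<comment> \<open>\<open>Y\<close> sits in degree \<open>- m - 1\<close> of the complex, that is
    at tower index \<open>m + 1\<close>.\<close>
  define D' where "D' = shO C (m + 1) Y"
  have "Y \<in> wle C w 0" "Y \<in> wge C w 0" using rs(1) by (simp_all add: heart_Obj)
  then have wD: "D' \<in> wle C w (m + 1)" "D' \<in> wge C w (m + 1)" by (simp_all add: D'_def)
  obtain PD where PD: "is_tower C w D' PD" "\<forall>i\<ge>m+1. tw_ob PD i = D' \<and> tw_h PD i = idm C D'"
    "\<forall>i<m+1. zero_object C (tw_ob PD i)" "\<forall>i. i \<noteq> m + 1 \<longrightarrow> zero_object C (tw_gr PD i)"
    "iso_arrow C D' (tw_gr PD (m + 1)) (tw_c PD (m + 1))"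
    using wD by (rule pure_tower_exists)
  note [simp] = towerD(1,3-17)[OF PD(1)]
  obtain c' where c': "ar c' (tw_gr PD (m + 1)) D'" "c' \<cdot> tw_c PD (m + 1) = idm C D'"
    "tw_c PD (m + 1) \<cdot> c' = idm C (tw_gr PD (m + 1))"
    using PD(5) by (rule iso_arrowE)
  note [simp] = c'(1)[unfolded ar_iff]
  have obs[simp]: "tw_ob PD (m + 1) = D'" "tw_h PD (m + 1) = idm C D'" "tw_ob Q (m + 1) = N'" "tw_h Q (m + 1) = idm C N'"
    using PD(2) cQ by auto
  have D'k[simp]: "shO C ?k D' = Y" by (simp add: D'_def)
  have D'O[simp]: "D' \<in> Obj C" by (simp add: D'_def)
  let ?E = "tower_complex C PD"
  have tE: "?E \<in> complexes (heart C w)" using tower_complex_complex[OF PD(1)] .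
  have Ez: "zero_object C (cob ?E n)" if "n \<noteq> ?k" for n
    using PD(4)[rule_format, of "- n"] that by (simp add: zero_object_shO)
  have Ez': "zero_object (heart C w) (cob ?E n)" if "n \<noteq> ?k" for n
    using Ez[OF that] by (simp add: heart_zero_object del: tower_complex_simps)
  define r' where "r' = shA C ?k (tw_c PD (m + 1)) \<cdot> r"
  define s' where "s' = s \<cdot> shA C ?k c'"
  have r's'[simp]: "is_arr r'" "src r' = cob Z1 ?k" "tgt r' = shO C ?k (tw_gr PD (m + 1))"
    "is_arr s'" "tgt s' = cob Z1 ?k" "src s' = shO C ?k (tw_gr PD (m + 1))"
    by (simp_all add: r'_def s'_def)
  have cc: "shA C ?k c' \<cdot> shA C ?k (tw_c PD (m + 1)) = idm C Y"
    "shA C ?k (tw_c PD (m + 1)) \<cdot> shA C ?k c' = idm C (shO C ?k (tw_gr PD (m + 1)))"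
    using arg_cong[OF c'(2), of "shA C ?k"] arg_cong[OF c'(3), of "shA C ?k"] by simp_all
  have rs': "r' \<cdot> s' = idm C (cob ?E ?k)" "s' \<cdot> r' = p ?k"
    by (simp_all add: r'_def s'_def rs(4)[THEN ra] cc cc[THEN ra] rs(5))
  define rr where "rr = (\<lambda>n. if n = ?k then r' else zr (cob Z1 n) (cob ?E n))"
  have "H.heq Z1 ?E rr (\<lambda>n. if n = ?k then s' else zr (cob ?E n) (cob Z1 n))"
  proof -
    have h: "H.ar r' (cob Z1 ?k) (cob ?E ?k)" "H.ar s' (cob ?E ?k) (cob Z1 ?k)"
      using H_cplxD(1)[OF tE, of ?k] by (simp_all add: H_ar ar_iff)
    show ?thesis
      using H.concentrated_heq[OF p(1) ph Zlow pz tE Ez' h] rs' unfolding rr_def heart_simps by simp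
  qed
  then have a: "iso_arrow ?K Z1 ?E (kmor (heart C w) Z1 ?E rr)" and crr: "H.cm Z1 ?E rr"
    using H.heq_iso by (auto simp: H.heq_def)
  define a where "a = kmor (heart C w) Z1 ?E rr"
  note ci2 = H.cone_cm(1)[OF cone f1] and cp1 = H.cone_cm(2)[OF cone f1]
  have ti2[simp]: "is_arr (i2 n)" "src (i2 n) = shO C n (tw_gr Q (- n))" "tgt (i2 n) = cob Z1 n" for n
    using H_cmD[OF ci2, of n] by simp_all
  define \<rho> where "\<rho> = shA C (m + 1) (r' \<cdot> i2 ?k)"
  have [simp]: "is_arr \<rho>" "src \<rho> = tw_gr Q (m + 1)" "tgt \<rho> = tw_gr PD (m + 1)" by (simp_all add: \<rho>_def)
  \<comment> \<open>\<open>\<rho>\<close> is \<open>r' i2\<close> in degree \<open>- m - 1\<close>,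
    moved to tower index \<open>m + 1\<close>. There both towers have reached their objects, so
    \<open>tw_c\<close> of \<open>Q\<close> and the inverse \<open>c'\<close> turn it into an arrow
    of \<open>C\<close>.\<close>
  define u where "u = c' \<cdot> (\<rho> \<cdot> tw_c Q (m + 1))"
  have u: "ar u N' D'" by (simp add: u_def ar_iff)
  note [simp] = u[unfolded ar_iff]
  have cu: "tw_c PD (m + 1) \<cdot> u = \<rho> \<cdot> tw_c Q (m + 1)" by (simp add: u_def c'(3)[THEN ra])
  have cuk: "shA C ?k (tw_c PD (m + 1)) \<cdot> shA C ?k u = (r' \<cdot> i2 ?k) \<cdot> shA C ?k (tw_c Q (m + 1))"
    using arg_cong[OF cu, of "shA C ?k"] by (simp add: \<rho>_def)
  obtain ule ugr where m1: "is_tower_mor C N' Q D' PD u ule ugr" using tower_mor_exists[OF Q PD(1) u] .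
  note M1 = tower_morD[OF m1 Q PD(1)]
  note cu1 = tower_mor_cm[OF m1 Q PD(1)]
  have ule: "ule (m + 1) = u"
    using M1(8)[of "m + 1"] M1(2-4)[of "m + 1"] by simp
  have ci2r: "H.cm (tower_complex C Q) ?E (\<lambda>n. rr n \<cdot> i2 n)"
    using H.cm_cmp[OF ci2 crr] by simp
  have h1: "homotopic (heart C w) (tower_complex C Q) ?E (\<lambda>n. shA C n (ugr (- n))) (\<lambda>n. rr n \<cdot> i2 n)"
  proof (rule concentrated_homotopic[OF Q cu1 ci2r Ez])
    show "shA C ?k (ugr (- ?k)) \<cdot> shA C ?k (tw_c Q (- ?k)) = (rr ?k \<cdot> i2 ?k) \<cdot> shA C ?k (tw_c Q (- ?k))"
      using arg_cong[OF M1(10)[of "m + 1"], of "shA C ?k"] M1(5-7)[of "m + 1"] cuk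
      by (simp add: ule rr_def)
  qed
  have eq1: "a \<cdot>\<^bsub>?K\<^esub> kmor (heart C w) (tower_complex C Q) Z1 i2 = tower_complex_mor C w Q PD ugr"
    unfolding a_def H.kmor_cmp[OF ci2 crr] tower_complex_mor_def
    using H.kmor_eq_iff[OF cu1 ci2r] h1 by simp
  obtain Y' v q where d: "dist C N' D' Y' u v q"
    using dist_ex[of N' D' u] u unfolding ar_def by blast
  obtain PY vle vgr f j1 r1 r2 where PY: "is_tower C w Y' PY" "is_tower_mor C D' PD Y' PY v vle vgr"
    "\<forall>i\<ge>m+1+1. tw_ob PY i = Y' \<and> tw_h PY i = idm C Y'"
    "H.cm (tower_complex C Q) ?E f"
    "is_cone (heart C w) (tower_complex C Q) ?E f (tower_complex C PY) j1 (\<lambda>n. shA C n (vgr (- n))) r1 r2"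
    "\<forall>n g. zero_object C (tw_gr PD (- n + 1)) \<and> ar g (tw_ob Q (- n)) (tw_ob PD (- n)) \<and>
       tw_h PD (- n) \<cdot> g = u \<cdot> tw_h Q (- n) \<longrightarrow> f n \<cdot> shA C n (tw_c Q (- n)) = shA C n (tw_c PD (- n) \<cdot> g)"
    using tower_cone[OF d Q PD(1) cQ PD(2)] .
  \<comment> \<open>The last clause of \<open>tower_cone\<close> applies because the tower of
    \<open>D'\<close> has zero graded piece at index \<open>m + 2\<close>.\<close>
  have "f ?k \<cdot> shA C ?k (tw_c Q (- ?k)) = shA C ?k (tw_c PD (- ?k) \<cdot> u)"
    using PY(6)[rule_format, of ?k u] PD(4) u by simp
  then have h2: "homotopic (heart C w) (tower_complex C Q) ?E (\<lambda>n. rr n \<cdot> i2 n) f"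
    using H.homotopic_sym[OF ci2r concentrated_homotopic[OF Q PY(4) ci2r Ez]] cuk by (simp add: rr_def)
  \<comment> \<open>The cone of \<open>i2\<close> is X1[1] by rotation, and also the weight complex
    of \<open>Y'\<close>, since \<open>i2\<close> and \<open>f\<close> agree up to the isomorphism
    \<open>a\<close>. This makes \<open>Y'\<close> the candidate for N[1].\<close>
  obtain W k1 k2 s1 s2 where W: "is_cone (heart C w) (tower_complex C Q) Z1 i2 W k1 k2 s1 s2"
    using H.cone_exists[OF ci2] by blast
  define \<chi> where "\<chi> = kmor (heart C w) W (cshift (heart C w) 1 X1) (\<lambda>n. p1 n \<cdot> s2 n)"
  have \<chi>: "iso_arrow ?K W (cshift (heart C w) 1 X1) \<chi>"
    "\<chi> \<cdot>\<^bsub>?K\<^esub> kmor (heart C w) Z1 W k2 = kmor (heart C w) Z1 (cshift (heart C w) 1 X1) p1"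
    using H.cone_rotate[OF f1 cone W] by (simp_all add: \<chi>_def)
  have sq: "a \<cdot>\<^bsub>?K\<^esub> kmor (heart C w) (tower_complex C Q) Z1 i2 =
      kmor (heart C w) (tower_complex C Q) ?E f \<cdot>\<^bsub>?K\<^esub> idm ?K (tower_complex C Q)"
  proof -
    have "a \<cdot>\<^bsub>?K\<^esub> kmor (heart C w) (tower_complex C Q) Z1 i2 = kmor (heart C w) (tower_complex C Q) ?E f"
      unfolding a_def H.kmor_cmp[OF ci2 crr] using H.kmor_eq_iff[OF ci2r PY(4)] h2 by simp
    moreover have "kmor (heart C w) (tower_complex C Q) ?E f \<cdot>\<^bsub>?K\<^esub> idm ?K (tower_complex C Q) =
       kmor (heart C w) (tower_complex C Q) ?E f"
      using H.K_ar_kmor[OF PY(4)] unfolding H.K.ar_iff by simp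
    ultimately show ?thesis by simp
  qed
  have aiso: "iso_arrow ?K Z1 ?E a" using a by (simp add: a_def)
  have idQ: "iso_arrow ?K (tower_complex C Q) (tower_complex C Q) (idm ?K (tower_complex C Q))"
    using H.K.iso_arrow_idm tQ by simp
  obtain \<gamma> where \<gamma>: "iso_arrow ?K W (tower_complex C PY) \<gamma>"
    "\<gamma> \<cdot>\<^bsub>?K\<^esub> kmor (heart C w) Z1 W k2 =
     kmor (heart C w) ?E (tower_complex C PY) (\<lambda>n. shA C n (vgr (- n))) \<cdot>\<^bsub>?K\<^esub> a"
    using H.cone_iso[OF ci2 W PY(4,5) idQ aiso sq] .
  obtain \<chi>' where \<chi>': "H.K.ar \<chi>' (cshift (heart C w) 1 X1) W" "\<chi>' \<cdot>\<^bsub>?K\<^esub> \<chi> = idm ?K W"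
    "iso_arrow ?K (cshift (heart C w) 1 X1) W \<chi>'"
    using \<chi>(1) by (rule H.K.iso_arrowE)
  define b where "b = \<gamma> \<cdot>\<^bsub>?K\<^esub> \<chi>'"
  have b: "iso_arrow ?K (cshift (heart C w) 1 X1) (tower_complex C PY) b"
    unfolding b_def using H.K.iso_arrow_cmp[OF \<chi>'(3) \<gamma>(1)] .
  have kk: "H.K.ar (kmor (heart C w) Z1 W k2) Z1 W"
    using H.K_ar_kmor[OF H.cone_cm(1)[OF W ci2]] .
  note [simp] = H.K.cong_iso[OF \<gamma>(1)] \<chi>'(1)[unfolded H.K.ar_iff] H.K.cong_iso[OF \<chi>(1)] kk[unfolded H.K.ar_iff]
  have eq2: "b \<cdot>\<^bsub>?K\<^esub> kmor (heart C w) Z1 (cshift (heart C w) 1 X1) p1 =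
       tower_complex_mor C w PD PY vgr \<cdot>\<^bsub>?K\<^esub> a"
    unfolding b_def \<chi>(2)[symmetric] tower_complex_mor_def \<gamma>(2)[symmetric]
    by (simp add: \<chi>'(2)[THEN H.K.ra])
  define N where "N = shO C (-1) Y'"
  have Y'O[simp]: "Y' \<in> Obj C" using distD[OF d] by (simp add: ar_iff)
  have N1: "shO C 1 N = Y'" by (simp add: N_def)
  have dN: "dist C N N' D' (neg (shA C (-1) q)) u v" unfolding N_def using dist_unrot[OF d] .
  \<comment> \<open>The cone tower only shows weight at most \<open>m + 2\<close>. The isomorphic
    complex X1[1] vanishes in degree \<open>- m - 2\<close>, which improves the bound by
    one.\<close>
  have "Y' \<in> wle C w (m + 2 - 1)"
  proof (rule wle_of_weight_complex[OF PY(1)])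
    show "tw_ob PY (m + 2) = Y'" using PY(3) by simp
    show "zero_object C (tw_gr PY (m + 2 + 1))"
      by (rule tower_of_constant(2)[OF PY(1), of "m + 2"]) (use PY(3) in auto)
    show "isomorphic ?K (tower_complex C PY) (cshift (heart C w) 1 X1)"
      using b H.K.isomorphic_sym unfolding isomorphic_def by blast
    show "zero_object C (cob (cshift (heart C w) 1 X1) (- (m + 2)))" using X1[of "- m - 1"] by simp
  qed
  then have wN: "N \<in> wle C w m" by (simp add: N_def)
  obtain R g k where R: "dist C N' M R h' g k" "R \<in> wge C w (m + 1 + 1)"
    using N' by (rule gives_decompositionE)
  note [simp] = distD[OF dN, unfolded ar_iff] distD[OF R(1), unfolded ar_iff]
  obtain V g' k' where V: "dist C N M V (h' \<cdot> neg (shA C (-1) q)) g' k'"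
    using dist_ex[of N M "h' \<cdot> neg (shA C (-1) q)"] by (auto simp: Hom_ar ar_iff simp del: neg_cmp)
  \<comment> \<open>The cone of N -> N' -> M is an extension of the quotient of \<open>M\<close> by
    \<open>N'\<close> and of \<open>D'\<close>, both of weight at least
    \<open>m + 1\<close>.\<close>
  obtain x y z where o: "dist C D' V R x y z"
    using octahedron_obtain[OF dN R(1) V] .
  have "V \<in> wge C w (m + 1)" using wge_extension[OF o wD(2) wge_mono[OF R(2)]] by simp
  then have gN: "gives_decomposition C w m N M (h' \<cdot> neg (shA C (-1) q))"
    using gives_decompositionI[OF V wN] by simp
  show thesis
  proof (rule that[OF PD(1) _ _ m1 _ aiso b eq1 eq2 dN gN])
    show "N \<in> Obj C" by simp
    show "is_tower C w (shO C 1 N) PY" "is_tower_mor C D' PD (shO C 1 N) PY v vle vgr"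
      unfolding N1 using PY(1,2) by blast+
  qed
qed

end

section \<open>Restricting a decomposition to a stupid truncation\<close>

context additive_category begin

text \<open>As \<open>X\<close> lives above degree \<open>k\<close>, its map to \<open>T\<close>
  already lands in the truncation \<open>Q\<close>, and the cone over \<open>Q\<close> is the part
  of \<open>Z\<close> in degrees at least \<open>k\<close>. This replaces t(M) by t(w_{<=m+1} M)
  without changing the truncation \<open>X\<close>.\<close>

lemma truncated_cone:
  assumes f: "cm X T f" and cone: "is_cone C X T f Z j1 j2 q1 q2"
    and R: "isomorphic (Kcat C) Z R" "\<And>n. k < n \<Longrightarrow> zero_object C (cob R n)"
    and X: "\<And>n. n \<le> k \<Longrightarrow> zero_object C (cob X n)"
    and Q: "Q \<in> complexes C" "\<And>n. k \<le> n \<Longrightarrow> cob Q n = cob T n" "\<And>n. k \<le> n \<Longrightarrow> cdf Q n = cdf T n"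
      "\<And>n. n < k \<Longrightarrow> zero_object C (cob Q n)"
  obtains f1 Z1 i1 i2 p1 p2 p where "cm X Q f1" "is_cone C X Q f1 Z1 i1 i2 p1 p2"
    "cm Z1 Z1 p" "homotopic C Z1 Z1 p (\<lambda>n. idm C (cob Z1 n))" "\<forall>n>k. p n = zr (cob Z1 n) (cob Z1 n)"
proof -
  note D = coneD[OF cone f] and cX = cm_cplx(1)[OF f] and cT = cm_cplx(2)[OF f]
  define f1 where "f1 = (\<lambda>n. if k < n then f n else zr (cob X n) (cob Q n))"
  note [simp] = cmD[OF f] cplxD[OF cX] cplxD[OF cT] cplxD[OF Q(1)] cplxD[OF D(1)] D(3-14) Q(2,3)
  have f1: "cm X Q f1" unfolding cm_ar ar_iff
  proof (intro conjI allI cX Q(1))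
    show "cdf Q n \<cdot> f1 n = f1 (n + 1) \<cdot> cdf X n" for n
    proof (cases "k < n")
      case False
      show ?thesis by (rule eq_from_zero) (use False X in \<open>auto simp: f1_def\<close>)
    qed (simp add: f1_def)
  qed (simp_all add: f1_def)
  define Z1 where "Z1 = trunc_ge k Z"
  have Z1: "Z1 \<in> complexes C" unfolding Z1_def using trunc_ge_complex[OF D(1)] .
  have Z1ge: "cob Z1 n = cob Z n" "cdf Z1 n = cdf Z n" if "k \<le> n" for n
    using that by (simp_all add: Z1_def trunc_ge_def)
  have Z1lt: "cob Z1 n = zob" if "n < k" for n using that by (simp add: Z1_def trunc_ge_def)
  note [simp] = cplxD[OF Z1]
  define i1 where "i1 = (\<lambda>n. if k \<le> n then j1 n else zr (cob X (n + 1)) (cob Z1 n))"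
  define i2 where "i2 = (\<lambda>n. if k \<le> n then j2 n else zr (cob Q n) (cob Z1 n))"
  define p1 where "p1 = (\<lambda>n. if k \<le> n then q1 n else zr (cob Z1 n) (cob X (n + 1)))"
  define p2 where "p2 = (\<lambda>n. if k \<le> n then q2 n else zr (cob Z1 n) (cob Q n))"
  have b: "biproduct C (cob X (n + 1)) (cob Q n) (cob Z1 n) (i1 n) (i2 n) (p1 n) (p2 n)" for n
  proof (cases "k \<le> n")
    case True
    then show ?thesis using D(2)[of n] by (simp add: i1_def i2_def p1_def p2_def Z1ge)
  next
    case False
    then show ?thesis using biproduct_zero_objects[of "cob X (n + 1)" "cob Q n" "cob Z1 n"] X[of "n + 1"] Q(4)[of n] Z1lt[of n]
      by (simp add: i1_def i2_def p1_def p2_def)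
  qed
  have cone1: "is_cone C X Q f1 Z1 i1 i2 p1 p2"
    unfolding is_cone_def
  proof (intro conjI allI Z1 b)
    fix n
    note [simp] = b[unfolded biproduct_ar ar_iff] cmD(1-3)[OF f1] cshift_cdf[OF cX]
    show "cdf Z1 n = i1 (n + 1) \<cdot> (cdf (cshift C 1 X) n \<cdot> p1 n) \<boxplus>
       (i2 (n + 1) \<cdot> (f1 (n + 1) \<cdot> p1 n) \<boxplus> i2 (n + 1) \<cdot> (cdf Q n \<cdot> p2 n))"
    proof (cases "k \<le> n")
      case True
      have "cdf Z n = j1 (n + 1) \<cdot> (cdf (cshift C 1 X) n \<cdot> q1 n) \<boxplus>
         (j2 (n + 1) \<cdot> (f (n + 1) \<cdot> q1 n) \<boxplus> j2 (n + 1) \<cdot> (cdf T n \<cdot> q2 n))"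
        using cone unfolding is_cone_def by blast
      then show ?thesis using True by (simp add: Z1ge i1_def i2_def p1_def p2_def f1_def)
    next
      case False
      show ?thesis by (rule eq_from_zero) (use False Z1lt[of n] zob in simp_all)
    qed
  qed
  obtain \<phi> \<chi> where h: "heq Z R \<phi> \<chi>" using R(1) unfolding isomorphic_def using iso_heqE by metis
  then have ph: "cm Z R \<phi>" "cm R Z \<chi>" "homotopic C Z Z (\<lambda>n. \<chi> n \<cdot> \<phi> n) (\<lambda>n. idm C (cob Z n))"
    by (auto simp: heq_def)
  note [simp] = cmD[OF ph(1)] cmD[OF ph(2)] cplxD(4)[OF cm_cplx(2)[OF ph(1)]]
  obtain s where s[rule_format, simp]: "\<forall>n. is_arr (s n) \<and> src (s n) = cob Z n \<and> tgt (s n) = cob Z (n - 1)"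
    and hs[rule_format]: "\<forall>n. \<chi> n \<cdot> \<phi> n = idm C (cob Z n) \<boxplus> (cdf Z (n - 1) \<cdot> s n \<boxplus> s (n + 1) \<cdot> cdf Z n)"
    using ph(3) D(1) D(1) by (rule homotopicE)
  \<comment> \<open>The component starting in degree \<open>k\<close> would leave the truncated
    complex and is dropped. For \<open>n > k\<close> the map \<open>p n\<close> involves only
    \<open>t n\<close> and \<open>t (n + 1)\<close>, which are unchanged.\<close>
  define t where "t = (\<lambda>n. if k < n then s n else zr (cob Z1 n) (cob Z1 (n - 1)))"
  have t: "ar (t n) (cob Z1 n) (cob Z1 (n - 1))" for n
    by (simp add: t_def ar_iff Z1ge)
  define p where "p = (\<lambda>n. idm C (cob Z1 n) \<boxplus> (cdf Z1 (n - 1) \<cdot> t n \<boxplus> t (n + 1) \<cdot> cdf Z1 n))"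
  have "cm Z1 Z1 p" unfolding p_def by (rule cm_cong_homotopic[OF cm_id[OF Z1] t])
  moreover have "homotopic C Z1 Z1 p (\<lambda>n. idm C (cob Z1 n))"
    by (rule homotopicI[OF t]) (simp add: p_def)
  moreover have "p n = zr (cob Z1 n) (cob Z1 n)" if n: "k < n" for n
  proof -
    have "\<phi> n = zr (cob Z n) (cob R n)" by (rule eq_to_zero) (simp_all add: R(2)[OF n])
    then have "\<chi> n \<cdot> \<phi> n = zr (cob Z n) (cob Z n)" by simp
    then show ?thesis using n unfolding hs by (simp add: p_def t_def Z1ge)
  qed
  ultimately show thesis using that[OF f1 cone1] by blast
qed

end

section \<open>Truncations of objects and of weight complexes\<close>

context weight_structure begin

text \<open>For a tower of \<open>M\<close> passing through \<open>L\<close> and its truncation at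
  \<open>m\<close>, the weight complex of \<open>L\<close> is literally a stupid truncation. All
  other choices differ by isomorphisms.\<close>

lemma truncation_of_weight_complex:
  assumes "gives_decomposition C w m L M h" "is_weight_complex C w M T" "is_weight_complex C w L T'"
  shows "truncation_choice (Kcat (heart C w)) (w_st (heart C w)) m T T'"
proof -
  obtain P where P: "is_tower C w M P" "tw_ob P m = L" using tower_exists_with[OF assms(1)] by blast
  obtain Q where Q: "is_tower C w (tw_ob P m) Q"
    "\<forall>i\<ge>m. tw_ob Q i = tw_ob P m \<and> tw_h Q i = idm C (tw_ob P m)"
    "\<forall>i\<le>m. tw_gr Q i = tw_gr P i" "\<forall>i>m. zero_object C (tw_gr Q i)"
    "\<forall>n\<ge>- m. cdf (tower_complex C Q) n = cdf (tower_complex C P) n"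
    using truncated_tower[OF P(1), of m] .
  have "truncation_choice (Kcat (heart C w)) (w_st (heart C w)) (- (- m)) (tower_complex C P) (tower_complex C Q)"
  proof (rule H.stupid_truncation)
    show "tower_complex C P \<in> complexes (heart C w)" "tower_complex C Q \<in> complexes (heart C w)"
      using tower_complex_complex P(1) Q(1) by blast+
    show "cob (tower_complex C Q) n = cob (tower_complex C P) n" if "- m \<le> n" for n
      using Q(3)[rule_format, of "- n"] that by simp
    show "cdf (tower_complex C Q) n = cdf (tower_complex C P) n" if "- m \<le> n" for n
      using Q(5) that by blast
    show "zero_object (heart C w) (cob (tower_complex C Q) n)" if "n < - m" for n
      using Q(4)[rule_format, of "- n"] that by (simp add: heart_zero_object zero_object_shO)
  qed
  moreover have "isomorphic (Kcat (heart C w)) (tower_complex C P) T"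
    "isomorphic (Kcat (heart C w)) (tower_complex C Q) T'"
    using assms(2,3) tower_complex_unique P Q(1) unfolding is_weight_complex_def by auto
  ultimately show ?thesis using H.truncation_choice_iso by simp
qed

lemma weight_complex_unique:
  "is_weight_complex C w M T \<Longrightarrow> is_weight_complex C w M T' \<Longrightarrow> isomorphic (Kcat (heart C w)) T T'"
  unfolding is_weight_complex_def using tower_complex_unique by blast

lemma weight_complex_exists: "M \<in> Obj C \<Longrightarrow> \<exists>T. is_weight_complex C w M T"
  using gives_decomposition_ex[of M 0] tower_exists_with[of 0 _ M] unfolding is_weight_complex_def by metis

text \<open>The truncation is taken in two steps. Passing to w_{<=m+1} M makes the complex start in
  degree \<open>- m - 1\<close>, one below the cut, so that what remains to be removed sits in a
  single degree.\<close>

lemma realize_weight_complex_truncation: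
  assumes kar: "karoubian (heart C w)" and T: "is_weight_complex C w M T"
    and X: "truncation_choice (Kcat (heart C w)) (w_st (heart C w)) m T X"
  shows "\<exists>L T'. truncation_choice C w m M L \<and> is_weight_complex C w L T' \<and>
    isomorphic (Kcat (heart C w)) T' X"
proof -
  let ?K = "Kcat (heart C w)"
  obtain P where P: "is_tower C w M P" "T = tower_complex C P" using T unfolding is_weight_complex_def by blast
  obtain h R g k X1 R1 where 1: "kdist (heart C w) X T R h g k" "isomorphic ?K X X1"
    "\<forall>n < - m. zero_object (heart C w) (cob X1 n)" "isomorphic ?K R R1" "\<forall>n \<ge> - m. zero_object (heart C w) (cob R1 n)"
    using X unfolding H.truncation_choice_K by blast
  obtain \<xi> where \<xi>: "iso_arrow ?K X X1 \<xi>" using 1(2) unfolding isomorphic_def by blast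
  have tP: "tower_complex C P \<in> complexes (heart C w)" using tower_complex_complex[OF P(1)] .
  then have "iso_arrow ?K T T (idm ?K T)" using H.K.iso_arrow_idm P(2) by simp
  with 1(1) \<xi> obtain f Zt j1 j2 q1 q2 \<gamma> where 2: "H.cm X1 T f" "is_cone (heart C w) X1 T f Zt j1 j2 q1 q2"
    "iso_arrow ?K R Zt \<gamma>" by (rule H.kdist_normal)
  have ZR: "isomorphic ?K Zt R1" using 2(3) 1(4) H.K.isomorphic_sym H.K.isomorphic_trans unfolding isomorphic_def by blast
  obtain Q where Q: "is_tower C w (tw_ob P (m + 1)) Q"
    "\<forall>i\<ge>m+1. tw_ob Q i = tw_ob P (m + 1) \<and> tw_h Q i = idm C (tw_ob P (m + 1))"
    "\<forall>i\<le>m+1. tw_gr Q i = tw_gr P i" "\<forall>i>m+1. zero_object C (tw_gr Q i)"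
    "\<forall>n\<ge>- (m + 1). cdf (tower_complex C Q) n = cdf (tower_complex C P) n"
    using truncated_tower[OF P(1), of "m + 1"] .
  obtain f1 Z1 i1 i2 p1 p2 p where 3: "H.cm X1 (tower_complex C Q) f1"
    "is_cone (heart C w) X1 (tower_complex C Q) f1 Z1 i1 i2 p1 p2"
    "H.cm Z1 Z1 p" "homotopic (heart C w) Z1 Z1 p (\<lambda>n. idm (heart C w) (cob Z1 n))"
    "\<forall>n>- m - 1. p n = mzero (heart C w) (cob Z1 n) (cob Z1 n)"
  proof (rule H.truncated_cone[OF 2(1,2) ZR, of "- m - 1" "tower_complex C Q"])
    show "zero_object (heart C w) (cob R1 n)" if "- m - 1 < n" for n using 1(5) that by simp
    show "zero_object (heart C w) (cob X1 n)" if "n \<le> - m - 1" for n using 1(3) that by simp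
    show "tower_complex C Q \<in> complexes (heart C w)" using tower_complex_complex[OF Q(1)] .
    show "cob (tower_complex C Q) n = cob T n" if "- m - 1 \<le> n" for n
      using Q(3)[rule_format, of "- n"] that P(2) by simp
    show "cdf (tower_complex C Q) n = cdf T n" if "- m - 1 \<le> n" for n
      using Q(5)[rule_format, of n] that P(2) by simp
    show "zero_object (heart C w) (cob (tower_complex C Q) n)" if "n < - m - 1" for n
      using Q(4)[rule_format, of "- n"] that by (simp add: heart_zero_object zero_object_shO)
  qed blast
  have X1z: "zero_object C (cob X1 n)" if "n < - m" for n using 1(3) that by (simp add: heart_zero_object)
  have 4: "homotopic (heart C w) Z1 Z1 p (\<lambda>n. idm C (cob Z1 n))" using 3(4) by simp
  have 5: "p n = zr (cob Z1 n) (cob Z1 n)" if "- m - 1 < n" for n using 3(5) that by simp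
  obtain D' N PD PN u ule ugr v vle vgr n a b where 6: "N \<in> Obj C"
    "is_tower C w (shO C 1 N) PN" "iso_arrow ?K (cshift (heart C w) 1 X1) (tower_complex C PN) b"
    "gives_decomposition C w m N M (tw_h P (m + 1) \<cdot> n)"
    using realize_truncation[OF kar towerD(2)[OF P(1), of "m + 1"] Q(1,2) X1z 3(1,2,3) 4 5] by metis
  obtain T' where T': "is_weight_complex C w N T'" using weight_complex_exists[OF 6(1)] by blast
  then obtain PP where PP: "is_tower C w N PP" "T' = tower_complex C PP" unfolding is_weight_complex_def by blast
  obtain PS where PS: "is_tower C w (shO C 1 N) PS" "tower_complex C PS = cshift (heart C w) 1 (tower_complex C PP)"
    using shifted_tower[OF PP(1)] .
  \<comment> \<open>The realization describes the weight complex of N[1]; undoing the shift gives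
    that of \<open>N\<close>.\<close>
  have "isomorphic ?K (cshift (heart C w) 1 T') (cshift (heart C w) 1 X1)"
    using tower_complex_unique[OF PS(1) 6(2)] 6(3) H.K.isomorphic_sym H.K.isomorphic_trans
    unfolding PS(2) PP(2) isomorphic_def by blast
  from H.isomorphic_cshift[OF this, of "- 1"]
  have "isomorphic ?K T' X1"
    using H.cm_cplx(1)[OF 3(1)] tower_complex_complex[OF PP(1)] by (simp add: H.cshift_add H.cshift_0 PP(2))
  then have "isomorphic ?K T' X" using 1(2) H.K.isomorphic_sym H.K.isomorphic_trans by blast
  then show ?thesis using T' 6(4) unfolding truncation_choice_def by blast
qed

text \<open>The arbitrary tower \<open>P'\<close> is linked by a tower morphism over the identity to
  one that is constant from \<open>m + 1\<close> on. Precomposing with this morphism keeps the first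
  component of the isomorphism of couples equal to the identity.\<close>

lemma realize_decomposition:
  assumes kar: "karoubian (heart C w)" and N': "gives_decomposition C w (m + 1) N' M h'"
    and P': "is_tower C w N' P'"
    and d: "weight_decomposition (Kcat (heart C w)) (w_st (heart C w)) m X (tower_complex C P') D e f g"
  shows "\<exists>D' N PD PN u ule ugr v vle vgr n a b.
           is_tower C w D' PD \<and> N \<in> Obj C \<and> is_tower C w (shO C 1 N) PN \<and>
           is_tower_mor C N' P' D' PD u ule ugr \<and>
           is_tower_mor C D' PD (shO C 1 N) PN v vle vgr \<and>
           iso_arrow (Kcat (heart C w)) D (tower_complex C PD) a \<and>
           iso_arrow (Kcat (heart C w)) (shO (Kcat (heart C w)) 1 X) (tower_complex C PN) b \<and>
           a \<cdot>\<^bsub>Kcat (heart C w)\<^esub> f = tower_complex_mor C w P' PD ugr \<and>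
           b \<cdot>\<^bsub>Kcat (heart C w)\<^esub> g = tower_complex_mor C w PD PN vgr \<cdot>\<^bsub>Kcat (heart C w)\<^esub> a \<and>
           dist C N N' D' n u v \<and>
           gives_decomposition C w m N M (h' \<cdot> n)"
proof -
  let ?K = "Kcat (heart C w)"
  have N'O: "N' \<in> Obj C" using towerD(1)[OF P'] .
  have 0: "kdist (heart C w) X (tower_complex C P') D e f g" using d unfolding weight_decomposition_def Kcat_simps(9) by blast
  obtain X1 where X1: "isomorphic ?K X X1" "\<forall>n < - m. zero_object (heart C w) (cob X1 n)"
    using d unfolding weight_decomposition_def H.wle_w_st by blast
  obtain D1 where D1: "isomorphic ?K D D1" "\<forall>n > - (m + 1). zero_object (heart C w) (cob D1 n)"
    using d unfolding weight_decomposition_def H.wge_w_st by blast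
  obtain \<xi> where \<xi>: "iso_arrow ?K X X1 \<xi>" using X1(1) unfolding isomorphic_def by blast
  obtain Q where Q: "is_tower C w N' Q" "\<forall>i\<ge>m+1. tw_ob Q i = N' \<and> tw_h Q i = idm C N'"
    using bounded_tower_exists[OF gives_decompositionD(2)[OF N']] .
  obtain le gr where m0: "is_tower_mor C N' P' N' Q (idm C N') le gr"
    using tower_mor_exists[OF P' Q(1) ar_idm[OF N'O]] .
  define \<phi> where "\<phi> = tower_complex_mor C w P' Q gr"
  have \<phi>: "iso_arrow ?K (tower_complex C P') (tower_complex C Q) \<phi>"
    unfolding \<phi>_def using tower_iso[OF P' Q(1) m0] .
  obtain f1 Z1 i1 i2 p1 p2 \<gamma> where c: "H.cm X1 (tower_complex C Q) f1"
    "is_cone (heart C w) X1 (tower_complex C Q) f1 Z1 i1 i2 p1 p2" "iso_arrow ?K D Z1 \<gamma>"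
    "\<gamma> \<cdot>\<^bsub>?K\<^esub> f = kmor (heart C w) (tower_complex C Q) Z1 i2 \<cdot>\<^bsub>?K\<^esub> \<phi>"
    "kmor (heart C w) Z1 (cshift (heart C w) 1 X1) p1 \<cdot>\<^bsub>?K\<^esub> \<gamma> = kshift (heart C w) 1 \<xi> \<cdot>\<^bsub>?K\<^esub> g"
    using 0 \<xi> \<phi> by (rule H.kdist_normal)
  have "isomorphic ?K Z1 D1" using c(3) D1(1) H.K.isomorphic_sym H.K.isomorphic_trans unfolding isomorphic_def by blast
  then obtain \<alpha> \<beta> where "H.heq Z1 D1 \<alpha> \<beta>" unfolding isomorphic_def using H.iso_heqE by metis
  then have ab: "H.cm Z1 D1 \<alpha>" "H.cm D1 Z1 \<beta>" "homotopic (heart C w) Z1 Z1 (\<lambda>n. \<beta> n \<cdot> \<alpha> n) (\<lambda>n. idm C (cob Z1 n))"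
    by (auto simp: H.heq_def)
  \<comment> \<open>The identity of \<open>Z1\<close> is homotopic to a map through
    \<open>D1\<close>, which vanishes above degree \<open>- m - 1\<close>.\<close>
  define p where "p = (\<lambda>n. \<beta> n \<cdot> \<alpha> n)"
  have p1: "H.cm Z1 Z1 p" using H.cm_cmp[OF ab(1,2)] by (simp add: p_def)
  have p2: "homotopic (heart C w) Z1 Z1 p (\<lambda>n. idm C (cob Z1 n))" using ab(3) by (simp add: p_def)
  have p3: "p n = zr (cob Z1 n) (cob Z1 n)" if "- m - 1 < n" for n
  proof -
    note [simp] = H_cmD(1-3)[OF ab(1)] H_cmD(1-3)[OF ab(2)] H_cplxD(2)[OF H.cm_cplx(1)[OF ab(1)]]
      H_cplxD(2)[OF H.cm_cplx(2)[OF ab(1)]]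
    have "\<alpha> n = zr (cob Z1 n) (cob D1 n)"
      by (rule eq_to_zero) (use D1(2)[rule_format, of n] that in \<open>simp_all add: heart_zero_object\<close>)
    then show ?thesis by (simp add: p_def)
  qed
  have X1z: "zero_object C (cob X1 n)" if "n < - m" for n using X1(2) that by (simp add: heart_zero_object)
  obtain D' N PD PN u ule ugr v vle vgr n a b where r: "is_tower C w D' PD" "N \<in> Obj C"
    "is_tower C w (shO C 1 N) PN" "is_tower_mor C N' Q D' PD u ule ugr"
    "is_tower_mor C D' PD (shO C 1 N) PN v vle vgr"
    "iso_arrow ?K Z1 (tower_complex C PD) a"
    "iso_arrow ?K (cshift (heart C w) 1 X1) (tower_complex C PN) b"
    "a \<cdot>\<^bsub>?K\<^esub> kmor (heart C w) (tower_complex C Q) Z1 i2 = tower_complex_mor C w Q PD ugr"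
    "b \<cdot>\<^bsub>?K\<^esub> kmor (heart C w) Z1 (cshift (heart C w) 1 X1) p1 =
       tower_complex_mor C w PD PN vgr \<cdot>\<^bsub>?K\<^esub> a"
    "dist C N N' D' n u v" "gives_decomposition C w m N M (h' \<cdot> n)"
    using realize_truncation[OF kar N' Q X1z c(1,2) p1 p2 p3] .
  note ci = H.K_ar_kmor[OF H.cone_cm(1)[OF c(2,1)]] H.K_ar_kmor[OF H.cone_cm(2)[OF c(2,1)]]
  have tfg: "H.K.ar f (tower_complex C P') D" "H.K.ar g D (cshift (heart C w) 1 X)"
    using 0 unfolding H.kdist_K by blast+
  note tv = tower_mor_K_ar[OF r(5,1,3)]
  note [simp] = H.K.cong_iso[OF c(3)] H.K.cong_iso[OF r(6)] H.K.cong_iso[OF r(7)] H.K.cong_iso[OF \<phi>]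
    H.K.cong_iso[OF H.kshift_iso[OF \<xi>, of 1]] ci[unfolded H.K.ar_iff] tfg[unfolded H.K.ar_iff] tv[unfolded H.K.ar_iff]
  have "u \<cdot> idm C N' = u" using distD(2)[OF r(10)] by (simp add: ar_iff)
  then have mor: "is_tower_mor C N' P' D' PD u (\<lambda>i. ule i \<cdot> le i) (\<lambda>i. ugr i \<cdot> gr i)"
    using tower_mor_cmp[OF m0 r(4) P' Q(1) r(1)] by simp
  have e1: "(a \<cdot>\<^bsub>?K\<^esub> \<gamma>) \<cdot>\<^bsub>?K\<^esub> f = tower_complex_mor C w P' PD (\<lambda>i. ugr i \<cdot> gr i)"
    using tower_mor_K_cmp[OF m0 r(4) P' Q(1) r(1), folded \<phi>_def] r(8)[THEN H.K.ra, of \<phi>] by (simp add: c(4))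
  have e2: "(b \<cdot>\<^bsub>?K\<^esub> kshift (heart C w) 1 \<xi>) \<cdot>\<^bsub>?K\<^esub> g =
      tower_complex_mor C w PD PN vgr \<cdot>\<^bsub>?K\<^esub> (a \<cdot>\<^bsub>?K\<^esub> \<gamma>)"
    using r(9)[THEN H.K.ra, of \<gamma>] by (simp add: c(5))
  have i1: "iso_arrow ?K D (tower_complex C PD) (a \<cdot>\<^bsub>?K\<^esub> \<gamma>)" using H.K.iso_arrow_cmp[OF c(3) r(6)] .
  have i2: "iso_arrow ?K (shO ?K 1 X) (tower_complex C PN) (b \<cdot>\<^bsub>?K\<^esub> kshift (heart C w) 1 \<xi>)"
    unfolding Kcat_simps(7) using H.K.iso_arrow_cmp[OF H.kshift_iso[OF \<xi>] r(7)] .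
  show ?thesis using r(1,2,3) mor r(5) i1 i2 e1 e2 r(10,11) by blast
qed

end

section \<open>Objects with weight complex over a subcategory\<close>

context additive_category begin

lemma retract_biproduct:
  assumes b: "biproduct C X Y S i1 i2 p1 p2" and c: "biproduct C X' Y' S' j1 j2 q1 q2"
    and "retract_of C X X'" "retract_of C Y Y'"
  shows "retract_of C S S'"
proof -
  obtain s1 r1 where 1: "ar s1 X X'" "ar r1 X' X" "r1 \<cdot> s1 = idm C X" using assms(3) unfolding retract_of_ar by blast
  obtain s2 r2 where 2: "ar s2 Y Y'" "ar r2 Y' Y" "r2 \<cdot> s2 = idm C Y" using assms(4) unfolding retract_of_ar by blast
  note b' = b[unfolded biproduct_ar] and c' = c[unfolded biproduct_ar]
  note [simp] = b'[unfolded ar_iff] c'[unfolded ar_iff] 1(1,2)[unfolded ar_iff] 2(1,2)[unfolded ar_iff]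
  have e: "q1 \<cdot> j1 = idm C X'" "q2 \<cdot> j2 = idm C Y'" "q2 \<cdot> j1 = zr X' Y'" "q1 \<cdot> j2 = zr Y' X'" by simp_all
  let ?s = "j1 \<cdot> (s1 \<cdot> p1) \<boxplus> j2 \<cdot> (s2 \<cdot> p2)" and ?r = "i1 \<cdot> (r1 \<cdot> q1) \<boxplus> i2 \<cdot> (r2 \<cdot> q2)"
  have "?r \<cdot> ?s = idm C S" by (simp add: e[THEN ra] 1(3)[THEN ra] 2(3)[THEN ra])
  moreover have "ar ?s S S'" "ar ?r S' S" by (simp_all add: ar_iff)
  ultimately show ?thesis unfolding retract_of_ar by blast
qed

text \<open>Adding up the objects of the family inside \<open>B\<close> gives one object through
  which the whole sum factors. When the sum is the identity, \<open>S\<close> becomes a retract of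
  an object of \<open>B\<close>, even if \<open>S\<close> lies outside \<open>B\<close>.\<close>

lemma finite_sum_factors:
  assumes B: "\<exists>Z\<in>B. zero_object C Z"
    "\<And>X Y. X \<in> B \<Longrightarrow> Y \<in> B \<Longrightarrow> \<exists>S\<in>B. \<exists>i1 i2 p1 p2. biproduct C X Y S i1 i2 p1 p2"
    and "finite I" "S \<in> Obj C" "\<forall>i\<in>I. Y i \<in> B \<and> ar (\<iota> i) (Y i) S \<and> ar (\<pi> i) S (Y i)"
  shows "\<exists>T\<in>B. \<exists>a b. ar a S T \<and> ar b T S \<and> b \<cdot> a = finprod (hom_group C S S) (\<lambda>i. \<iota> i \<cdot> \<pi> i) I"
  using assms(3,5)
proof (induction I rule: finite_induct)
  case empty
  obtain Z where "Z \<in> B" "zero_object C Z" using B(1) by blast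
  interpret G: comm_group "hom_group C S S" using hom_comm_group assms(4) by blast
  have ZO: "Z \<in> Obj C" using \<open>zero_object C Z\<close> by (simp add: zero_object_def)
  have "zr Z S \<cdot> zr S Z = finprod (hom_group C S S) (\<lambda>i. \<iota> i \<cdot> \<pi> i) {}"
    using assms(4) ZO by simp
  moreover have "ar (zr S Z) S Z" "ar (zr Z S) Z S" using assms(4) ZO by (simp_all add: ar_iff)
  ultimately show ?case using \<open>Z \<in> B\<close> by blast
next
  case (insert k F)
  interpret G: comm_group "hom_group C S S" using hom_comm_group assms(4) by blast
  obtain T a b where T: "T \<in> B" "ar a S T" "ar b T S" "b \<cdot> a = finprod (hom_group C S S) (\<lambda>i. \<iota> i \<cdot> \<pi> i) F"
    using insert by blast
  have k: "Y k \<in> B" "ar (\<iota> k) (Y k) S" "ar (\<pi> k) S (Y k)" using insert.prems by auto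
  obtain U i1 i2 p1 p2 where U: "U \<in> B" "biproduct C T (Y k) U i1 i2 p1 p2" using B(2)[OF T(1) k(1)] by blast
  note b' = U(2)[unfolded biproduct_ar]
  note [simp] = b'[unfolded ar_iff] T(2,3)[unfolded ar_iff] k(2,3)[unfolded ar_iff]
  have e: "p1 \<cdot> i1 = idm C T" "p2 \<cdot> i2 = idm C (Y k)" "p2 \<cdot> i1 = zr T (Y k)" "p1 \<cdot> i2 = zr (Y k) T" by simp_all
  have f: "(\<lambda>i. \<iota> i \<cdot> \<pi> i) \<in> F \<rightarrow> carrier (hom_group C S S)"
    using insert.prems by (auto simp: Hom_ar assms(4) ar_iff)
  have "\<iota> k \<cdot> \<pi> k \<in> carrier (hom_group C S S)" by (simp add: Hom_ar ar_iff)
  from G.finprod_insert[OF insert.hyps f this]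
  have "finprod (hom_group C S S) (\<lambda>i. \<iota> i \<cdot> \<pi> i) (Set.insert k F) = \<iota> k \<cdot> \<pi> k \<boxplus> b \<cdot> a"
    by (simp add: T(4))
  moreover have "(b \<cdot> p1 \<boxplus> \<iota> k \<cdot> p2) \<cdot> (i1 \<cdot> a \<boxplus> i2 \<cdot> \<pi> k) = \<iota> k \<cdot> \<pi> k \<boxplus> b \<cdot> a"
    by (simp add: e[THEN ra] madd_ac)
  ultimately show ?case using U(1)
    by (intro bexI[of _ U] exI[of _ "i1 \<cdot> a \<boxplus> i2 \<cdot> \<pi> k"] exI[of _ "b \<cdot> p1 \<boxplus> \<iota> k \<cdot> p2"]) (simp_all add: ar_iff)
qed

lemma Kar_in_obj_iff:
  assumes "B \<subseteq> Obj C" "\<exists>Z\<in>B. zero_object C Z"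
    "\<And>X Y. X \<in> B \<Longrightarrow> Y \<in> B \<Longrightarrow> \<exists>S\<in>B. \<exists>i1 i2 p1 p2. biproduct C X Y S i1 i2 p1 p2"
  shows "X \<in> Kar_in_obj C B \<longleftrightarrow> (\<exists>S\<in>B. retract_of C X S)"
proof
  assume "X \<in> Kar_in_obj C B"
  then obtain S where S: "finite_direct_sum C B S" "retract_of C X S" by (auto simp: Kar_in_obj_def)
  then obtain I :: "nat set" and Y \<iota> \<pi> where "finite I" and SO: "S \<in> Obj C"
    and "\<forall>i\<in>I. Y i \<in> B \<and> \<iota> i \<in> Hom C (Y i) S \<and> \<pi> i \<in> Hom C S (Y i)"
    and "finprod (hom_group C S S) (\<lambda>i. \<iota> i \<cdot> \<pi> i) I = idm C S"
    unfolding finite_direct_sum_def by blast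
  moreover from this have "\<forall>i\<in>I. Y i \<in> B \<and> ar (\<iota> i) (Y i) S \<and> ar (\<pi> i) S (Y i)"
    using assms(1) unfolding ar_def by blast
  ultimately obtain T a b where "T \<in> B" "ar a S T" "ar b T S" "b \<cdot> a = idm C S"
    using finite_sum_factors[OF assms(2,3), of I S Y \<iota> \<pi>] by auto
  then show "\<exists>S\<in>B. retract_of C X S" using retract_trans[OF S(2)] unfolding retract_of_ar by blast
next
  assume "\<exists>S\<in>B. retract_of C X S"
  then obtain S where S: "S \<in> B" "retract_of C X S" by blast
  then have SO: "S \<in> Obj C" using assms(1) by blast
  interpret G: comm_group "hom_group C S S" using hom_comm_group SO by blast
  have "finprod (hom_group C S S) (\<lambda>i. idm C S \<cdot> idm C S) {0::nat} = idm C S"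
    using G.finprod_insert[of "{}" 0 "\<lambda>i. idm C S \<cdot> idm C S"] idm_closed[OF SO] G.r_one SO by simp
  then have "finite_direct_sum C B S"
    unfolding finite_direct_sum_def using S(1) SO idm_closed[OF SO]
    by (intro conjI exI[of _ "{0::nat}"] exI[of _ "\<lambda>_. S"] exI[of _ "\<lambda>_. idm C S"]) auto
  then show "X \<in> Kar_in_obj C B" using S(2) by (auto simp: Kar_in_obj_def retract_of_def)
qed

definition triple_biproduct :: "'o \<Rightarrow> 'o \<Rightarrow> 'o \<Rightarrow> 'o \<Rightarrow> 'a \<Rightarrow> 'a \<Rightarrow> 'a \<Rightarrow> 'a \<Rightarrow> 'a \<Rightarrow> 'a \<Rightarrow> bool" where
  "triple_biproduct X Y Z S i1 p1 i2 p2 i3 p3 \<longleftrightarrow>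
     ar i1 X S \<and> ar p1 S X \<and> ar i2 Y S \<and> ar p2 S Y \<and> ar i3 Z S \<and> ar p3 S Z \<and>
     p1 \<cdot> i1 = idm C X \<and> p2 \<cdot> i2 = idm C Y \<and> p3 \<cdot> i3 = idm C Z \<and>
     p1 \<cdot> i2 = zr Y X \<and> p1 \<cdot> i3 = zr Z X \<and> p2 \<cdot> i1 = zr X Y \<and>
     p2 \<cdot> i3 = zr Z Y \<and> p3 \<cdot> i1 = zr X Z \<and> p3 \<cdot> i2 = zr Y Z \<and>
     i1 \<cdot> p1 \<boxplus> (i2 \<cdot> p2 \<boxplus> i3 \<cdot> p3) = idm C S"

lemma triple_biproduct_swap:
  "triple_biproduct X Y Z S i1 p1 i2 p2 i3 p3 \<Longrightarrow> triple_biproduct X Z Y S i1 p1 i3 p3 i2 p2"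
  unfolding triple_biproduct_def by (auto simp: ar_iff madd_comm)

end

lemma (in weight_structure) weight_complex_of_cone:
  assumes "dist C A A' A'' u v q" "is_tower C w A P" "is_tower C w A' P'"
    "\<forall>i\<ge>k. tw_ob P i = A \<and> tw_h P i = idm C A" "\<forall>i\<ge>k. tw_ob P' i = A' \<and> tw_h P' i = idm C A'"
  shows "\<exists>P'' f i1 i2 p1 p2. is_tower C w A'' P'' \<and> (\<forall>i\<ge>k+1. tw_ob P'' i = A'' \<and> tw_h P'' i = idm C A'') \<and>
    H.cm (tower_complex C P) (tower_complex C P') f \<and>
    is_cone (heart C w) (tower_complex C P) (tower_complex C P') f (tower_complex C P'') i1 i2 p1 p2"
  by (rule tower_cone[OF assms]) blast

section \<open>Retracts of B, the class C^B and its towers\<close>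

locale karoubian_weight_structure = weight_structure C w
  for C :: "('o, 'a) tricat" (structure) and w :: "'o weights" +
  fixes B :: "'o set"
  assumes karoubian_heart: "karoubian (heart C w)"
    and B_heart: "B \<subseteq> Obj (heart C w)"
    and B_additive: "additive_category (full_sub (heart C w) B)"
begin

abbreviation KB :: "'o set" where "KB \<equiv> Kar_in_obj C B"
abbreviation CB :: "'o set" where "CB \<equiv> weight_complex_sub C w B"

lemma B_Obj: "B \<subseteq> Obj C" using B_heart heart_Obj_C by blast

lemma B_zero: "\<exists>Z\<in>B. zero_object C Z"
proof -
  interpret A: additive_category "full_sub (heart C w) B" by (rule B_additive)
  obtain Z where "zero_object (full_sub (heart C w) B) Z" using A.ex_zero_object by blast
  then have Z: "Z \<in> B" "\<exists>!f. f \<in> Hom C Z Z" by (auto simp: zero_object_def)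
  then have "Z \<in> Obj C" using B_Obj by blast
  then have "idm C Z = zr Z Z" using Z(2) ar_idm[of Z] ar_zr[of Z Z] by (auto simp: Hom_ar)
  then show ?thesis using Z(1) \<open>Z \<in> Obj C\<close> by (auto simp: zero_object_idm)
qed

lemma B_biproduct:
  assumes "X \<in> B" "Y \<in> B" shows "\<exists>S\<in>B. \<exists>i1 i2 p1 p2. biproduct C X Y S i1 i2 p1 p2"
proof -
  interpret A: additive_category "full_sub (heart C w) B" by (rule B_additive)
  obtain S i1 i2 p1 p2 where b: "biproduct (full_sub (heart C w) B) X Y S i1 i2 p1 p2"
    using A.ex_biproduct[of X Y] assms by auto
  then have "S \<in> B" by (simp add: biproduct_def)
  moreover have "biproduct C X Y S i1 i2 p1 p2"
    using b B_Obj assms \<open>S \<in> B\<close> unfolding biproduct_def by auto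
  ultimately show ?thesis by blast
qed

lemma KB_iff: "X \<in> KB \<longleftrightarrow> (\<exists>S\<in>B. retract_of C X S)"
  using Kar_in_obj_iff[OF B_Obj B_zero B_biproduct] .

lemma B_KB: "B \<subseteq> KB"
proof
  fix X assume X: "X \<in> B"
  then have "retract_of C X X" using B_Obj isomorphic_retract[OF isomorphic_refl] by blast
  then show "X \<in> KB" using X KB_iff by blast
qed

lemma KB_retract: "X \<in> KB \<Longrightarrow> retract_of C Y X \<Longrightarrow> Y \<in> KB"
  using KB_iff retract_trans by blast

lemma KB_heart: "KB \<subseteq> Obj (heart C w)"
  using KB_iff B_heart wle_retract[of _ 0] wge_retract[of _ 0] unfolding heart_Obj by blast

lemma KB_zero: assumes "zero_object C Z" shows "Z \<in> KB"
proof -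
  obtain Z' where Z': "Z' \<in> B" "zero_object C Z'" using B_zero by blast
  have "isomorphic C Z Z'" using zero_objects_iso[OF assms Z'(2)] unfolding isomorphic_def by blast
  then show ?thesis using KB_iff Z'(1) isomorphic_retract by blast
qed

lemma KB_biproduct:
  assumes "biproduct C X Y S i1 i2 p1 p2" "X \<in> KB" "Y \<in> KB" shows "S \<in> KB"
proof -
  obtain X' Y' where 1: "X' \<in> B" "retract_of C X X'" "Y' \<in> B" "retract_of C Y Y'" using assms(2,3) KB_iff by blast
  obtain S' j1 j2 q1 q2 where 2: "S' \<in> B" "biproduct C X' Y' S' j1 j2 q1 q2" using B_biproduct[OF 1(1,3)] by blast
  show ?thesis using retract_biproduct[OF assms(1) 2(2) 1(2,4)] 2(1) KB_iff by blast
qed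

text \<open>U + V is a retract of some \<open>S\<close> in \<open>B\<close>. The complementary
  idempotent splits in the Karoubian heart, so a complement exists and is again a retract of
  \<open>S\<close>.\<close>

lemma KB_complement:
  assumes "U \<in> KB" "V \<in> KB"
  shows "\<exists>W. W \<in> KB \<and> (\<exists>S\<in>B. \<exists>i1 p1 i2 p2 i3 p3. triple_biproduct U V W S i1 p1 i2 p2 i3 p3)"
proof -
  have UV: "U \<in> Obj C" "V \<in> Obj C" using assms KB_heart heart_Obj_C by blast+
  obtain Q i1 i2 p1 p2 where Q: "biproduct C U V Q i1 i2 p1 p2" using ex_biproduct[OF UV] by blast
  obtain S where S: "S \<in> B" "retract_of C Q S" using KB_biproduct[OF Q assms] KB_iff by blast
  obtain s r where sr: "ar s Q S" "ar r S Q" "r \<cdot> s = idm C Q" using S(2) unfolding retract_of_ar by blast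
  note b' = Q[unfolded biproduct_ar]
  note [simp] = b'[unfolded ar_iff] sr(1,2)[unfolded ar_iff]
  let ?e = "idm C S \<boxplus> neg (s \<cdot> r)"
  have "?e \<cdot> ?e = ?e" by (simp add: sr(3)[THEN ra] madd_assoc)
  moreover have "?e \<in> Hom (heart C w) S S" by (simp add: Hom_ar ar_iff)
  moreover have "S \<in> Obj (heart C w)" using S(1) B_heart by blast
  ultimately obtain W r' s' where W: "W \<in> Obj (heart C w)" "r' \<in> Hom C S W" "s' \<in> Hom C W S" "r' \<cdot> s' = idm C W" "s' \<cdot> r' = ?e"
    using karoubian_heart unfolding karoubian_def by (metis heart_simps(1,2,3))
  have WO: "W \<in> Obj C" using W(1) heart_Obj_C by blast
  have t: "ar r' S W" "ar s' W S" using W(2,3) WO by (simp_all add: Hom_ar)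
  note [simp] = t[unfolded ar_iff]
  have rs': "r \<cdot> s' = zr W Q"
  proof -
    have "r \<cdot> s' = r \<cdot> (s' \<cdot> (r' \<cdot> s'))" by (simp add: W(4))
    also have "\<dots> = (r \<cdot> (s' \<cdot> r')) \<cdot> s'" by simp
    also have "\<dots> = zr W Q" unfolding W(5) by (simp add: sr(3)[THEN ra])
    finally show ?thesis .
  qed
  have r's: "r' \<cdot> s = zr Q W"
  proof -
    have "r' \<cdot> s = (r' \<cdot> s') \<cdot> (r' \<cdot> s)" by (simp add: W(4))
    also have "\<dots> = r' \<cdot> ((s' \<cdot> r') \<cdot> s)" by simp
    also have "\<dots> = zr Q W" unfolding W(5) by (simp add: sr(3))
    finally show ?thesis .
  qed
  have "retract_of C W S" unfolding retract_of_ar using t W(4) by blast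
  then have "W \<in> KB" using S(1) KB_iff by blast
  moreover have e: "p1 \<cdot> i1 = idm C U" "p2 \<cdot> i2 = idm C V" "p2 \<cdot> i1 = zr U V" "p1 \<cdot> i2 = zr V U" by simp_all
  have sum: "(s \<cdot> i1) \<cdot> (p1 \<cdot> r) \<boxplus> ((s \<cdot> i2) \<cdot> (p2 \<cdot> r) \<boxplus> s' \<cdot> r') = idm C S"
  proof -
    have be: "i1 \<cdot> p1 \<boxplus> i2 \<cdot> p2 = idm C Q" by simp
    have "s \<cdot> r = s \<cdot> ((i1 \<cdot> p1 \<boxplus> i2 \<cdot> p2) \<cdot> r)" by simp
    also have "\<dots> = (s \<cdot> i1) \<cdot> (p1 \<cdot> r) \<boxplus> (s \<cdot> i2) \<cdot> (p2 \<cdot> r)" by (simp del: be)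
    finally have "(s \<cdot> i1) \<cdot> (p1 \<cdot> r) \<boxplus> ((s \<cdot> i2) \<cdot> (p2 \<cdot> r) \<boxplus> s' \<cdot> r') = s \<cdot> r \<boxplus> s' \<cdot> r'"
      by (simp add: madd_assoc)
    also have "\<dots> = s \<cdot> r \<boxplus> ?e" by (simp add: W(5))
    also have "\<dots> = idm C S" by (simp add: madd_ac madd_cancel_apart)
    finally show ?thesis .
  qed
  have "triple_biproduct U V W S (s \<cdot> i1) (p1 \<cdot> r) (s \<cdot> i2) (p2 \<cdot> r) s' r'"
    unfolding triple_biproduct_def
    by (intro conjI sum) (simp_all add: ar_iff sr(3)[THEN ra] e W(4) rs' r's[THEN ra])
  ultimately show ?thesis using S(1) by blast
qed

text \<open>The swindle is spread over the degrees: starting from zero at 0, each new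
  \<open>A\<close> complements the term of \<open>T\<close> plus the previous \<open>A\<close>,
  going upward and downward separately. Every degree then needs only one finite sum to land in
  \<open>B\<close>.\<close>

lemma complex_over_KB:
  assumes T: "T \<in> complexes (heart C w)" "\<And>n. cob T n \<in> KB"
  shows "\<exists>X\<in>complexes (full_sub (heart C w) B). isomorphic (Kcat (heart C w)) T X"
proof -
  define F where "F U V = (SOME W. W \<in> KB \<and> (\<exists>S\<in>B. \<exists>i1 p1 i2 p2 i3 p3. triple_biproduct U V W S i1 p1 i2 p2 i3 p3))" for U V
  have F: "F U V \<in> KB" "\<exists>S\<in>B. \<exists>i1 p1 i2 p2 i3 p3. triple_biproduct U V (F U V) S i1 p1 i2 p2 i3 p3"
    if "U \<in> KB" "V \<in> KB" for U V
    using someI_ex[OF KB_complement[OF that]] unfolding F_def by blast+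
  define Ap where "Ap = rec_nat zob (\<lambda>n V. F (cob T (int n)) V)"
  define Am where "Am = rec_nat zob (\<lambda>n V. F (cob T (- int n - 1)) V)"
  have Ap: "Ap 0 = zob" "Ap (Suc n) = F (cob T (int n)) (Ap n)" and
    Am: "Am 0 = zob" "Am (Suc n) = F (cob T (- int n - 1)) (Am n)" for n
    by (simp_all add: Ap_def Am_def)
  have ApK: "Ap n \<in> KB" for n by (induction n) (auto simp: Ap KB_zero F assms)
  have AmK: "Am n \<in> KB" for n by (induction n) (auto simp: Am KB_zero F assms)
  \<comment> \<open>\<open>Am k\<close> is the term at \<open>- k\<close>. Going down,
    \<open>A n\<close> is the complement and \<open>A (n + 1)\<close> the earlier choice, so two
    summands have to be swapped for negative \<open>n\<close>.\<close>
  define A where "A n = (if 0 \<le> n then Ap (nat n) else Am (nat (- n)))" for n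
  have "\<exists>S\<in>B. \<exists>i1 p1 i2 p2 i3 p3. triple_biproduct (cob T n) (A n) (A (n + 1)) S i1 p1 i2 p2 i3 p3" for n
  proof (cases "0 \<le> n")
    case True
    then obtain k where n: "n = int k" using nonneg_int_cases by blast
    have "A n = Ap k" "A (n + 1) = F (cob T n) (Ap k)"
      unfolding A_def n Ap(2)[symmetric] by (simp_all add: nat_add_distrib)
    then show ?thesis using F(2)[OF assms(2) ApK] by simp
  next
    case False
    define k where "k = nat (- n - 1)"
    have n: "n = - int k - 1" using False by (simp add: k_def)
    have n': "n + 1 = - int k" "nat (- n) = Suc k" "- int k - 1 = n" using n by linarith+
    have "A n = Am (Suc k)" using False n'(2) by (simp only: A_def if_False)
    then have "A n = F (cob T n) (Am k)" by (simp only: Am(2) n'(3))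
    moreover have "A (n + 1) = Am k" unfolding n'(1) A_def by (cases "k = 0") (simp_all add: Ap(1) Am(1))
    ultimately obtain S i1 p1 i2 p2 i3 p3 where "S \<in> B" "triple_biproduct (cob T n) (A (n + 1)) (A n) S i1 p1 i2 p2 i3 p3"
      using F(2)[OF assms(2)[of n] AmK[of k]] by auto
    then show ?thesis using triple_biproduct_swap by blast
  qed
  then obtain S i1 p1 i2 p2 i3 p3 where S: "\<And>n. S n \<in> B"
    "\<And>n. triple_biproduct (cob T n) (A n) (A (n + 1)) (S n) (i1 n) (p1 n) (i2 n) (p2 n) (i3 n) (p3 n)"
    by metis
  note t = S(2)[unfolded triple_biproduct_def]
  have AH: "A n \<in> Obj (heart C w)" "S n \<in> Obj (heart C w)" "cob T n \<in> Obj (heart C w)" for n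
    using ApK AmK KB_heart S(1) B_heart assms(2) by (auto simp: A_def)
  have "\<exists>X\<in>complexes (heart C w). cob X = S \<and> isomorphic (Kcat (heart C w)) T X"
    by (rule H.isomorphic_of_complements[OF T(1), of i1 S p1 i2 A p2 i3 p3])
      (use t AH in \<open>simp_all add: H_ar\<close>)
  then obtain X where X: "X \<in> complexes (heart C w)" "cob X = S" "isomorphic (Kcat (heart C w)) T X" by blast
  then have "X \<in> complexes (full_sub (heart C w) B)" using S(1) by (simp add: H.complexes_full_sub[OF B_heart])
  then show ?thesis using X(3) by blast
qed

lemma CB_Obj: "CB \<subseteq> Obj C"
  by (auto simp: weight_complex_sub_def)

lemma CB_I:
  assumes "is_tower C w N P" "\<And>n. cob (tower_complex C P) n \<in> KB" shows "N \<in> CB"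
  using complex_over_KB[OF tower_complex_complex[OF assms(1)] assms(2)] assms(1) towerD(1)[OF assms(1)]
  unfolding weight_complex_sub_def is_weight_complex_def by (auto simp: Kcat_simps(1))

text \<open>A pure object has a weight complex concentrated in one degree, and that term is a
  retract of the corresponding term of every isomorphic complex.\<close>

lemma pure_in_KB:
  assumes "G \<in> wle C w k" "G \<in> wge C w k" "is_weight_complex C w G T"
    "isomorphic (Kcat (heart C w)) T Z" "cob Z (- k) \<in> KB"
  shows "shO C (- k) G \<in> KB"
proof -
  obtain P where P: "is_tower C w G P" "\<forall>i. i \<noteq> k \<longrightarrow> zero_object C (tw_gr P i)"
    "iso_arrow C G (tw_gr P k) (tw_c P k)"
    using pure_tower_exists[OF assms(1,2)] by metis
  have "isomorphic (Kcat (heart C w)) (tower_complex C P) Z"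
    using weight_complex_unique[OF _ assms(3)] P(1) assms(4) H.K.isomorphic_trans unfolding is_weight_complex_def by blast
  moreover have "zero_object (heart C w) (cob (tower_complex C P) n)" if "n \<noteq> - k" for n
    using P(2)[rule_format, of "- n"] that by (simp add: heart_zero_object zero_object_shO)
  ultimately have "retract_of (heart C w) (cob (tower_complex C P) (- k)) (cob Z (- k))"
    by (rule H.retract_of_concentrated)
  then have 1: "retract_of C (shO C (- k) (tw_gr P k)) (cob Z (- k))"
    using heart_Obj_C by (auto simp: retract_of_def)
  have "retract_of C (shO C (- k) G) (shO C (- k) (tw_gr P k))"
    using isomorphic_retract iso_arrow_shA[OF P(3)] unfolding isomorphic_def by blast
  then show ?thesis using retract_trans 1 KB_retract[OF assms(5)] by blast
qed

lemma cone_over_KB: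
  assumes "H.cm X Y f" "is_cone (heart C w) X Y f Z i1 i2 p1 p2" "\<And>n. cob X n \<in> KB" "\<And>n. cob Y n \<in> KB"
  shows "cob Z n \<in> KB"
  using H.coneD(2)[OF assms(2,1), of n] KB_biproduct assms(3,4) unfolding heart_biproduct by blast

text \<open>Membership only provides a homotopy equivalence with a complex \<open>X\<close> over
  \<open>B\<close>. Each stupid truncation of \<open>X\<close> is realized by a choice of w_{<=m} N;
  in the tower built from these choices every graded piece is pure with weight complex isomorphic to
  a complex over retracts of \<open>B\<close>.\<close>

lemma CB_E:
  assumes "N \<in> CB"
  obtains P where "is_tower C w N P" "\<forall>n. cob (tower_complex C P) n \<in> KB"
proof -
  let ?K = "Kcat (heart C w)"
  obtain T X where TX: "is_weight_complex C w N T" "X \<in> complexes (full_sub (heart C w) B)" "isomorphic ?K T X"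
    using assms unfolding weight_complex_sub_def Kcat_simps(1) by blast
  have X: "X \<in> complexes (heart C w)" "\<And>n. cob X n \<in> B" using TX(2) unfolding H.complexes_full_sub[OF B_heart] by auto
  define \<sigma> where "\<sigma> m = H.trunc_ge (- m) X" for m
  have \<sigma>: "\<sigma> m \<in> complexes (heart C w)" "cob (\<sigma> m) n \<in> KB" for m n
    using H.trunc_ge_complex[OF X(1)] X(2) B_KB KB_zero H.zob(1)
    by (auto simp: \<sigma>_def H.trunc_ge_def heart_zero_object)
  have tr: "truncation_choice ?K (w_st (heart C w)) m T (\<sigma> m)" for m
  proof -
    have "truncation_choice ?K (w_st (heart C w)) (- (- m)) X (\<sigma> m)"
      by (rule H.stupid_truncation[OF X(1) \<sigma>(1)])
        (use H.zob(1) in \<open>simp_all add: \<sigma>_def H.trunc_ge_def\<close>)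
    then show ?thesis
      using H.truncation_choice_iso[OF _ H.K.isomorphic_refl H.K.isomorphic_sym[OF TX(3)], of m "\<sigma> m"] \<sigma>(1) by simp
  qed
  have "\<forall>m. \<exists>L h T'. gives_decomposition C w m L N h \<and> is_weight_complex C w L T' \<and> isomorphic ?K T' (\<sigma> m)"
    using realize_weight_complex_truncation[OF karoubian_heart TX(1) tr] unfolding truncation_choice_def by blast
  then obtain L h T' where L: "\<And>m. gives_decomposition C w m (L m) N (h m)" "\<And>m. is_weight_complex C w (L m) (T' m)"
    "\<And>m. isomorphic ?K (T' m) (\<sigma> m)" by metis
  obtain P where P: "is_tower C w N P" "tw_ob P = L" "tw_h P = h" using tower_exists[OF L(1)] .
  have "shO C (- i) (tw_gr P i) \<in> KB" for i
  proof -
    obtain P1 where P1: "is_tower C w (L (i - 1)) P1" "\<forall>k\<ge>i-1. tw_ob P1 k = L (i - 1) \<and> tw_h P1 k = idm C (L (i - 1))"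
      using bounded_tower_exists[OF gives_decompositionD(2)[OF L(1)]] .
    obtain P2 where P2: "is_tower C w (L i) P2" "\<forall>k\<ge>i. tw_ob P2 k = L i \<and> tw_h P2 k = idm C (L i)"
      using bounded_tower_exists[OF gives_decompositionD(2)[OF L(1)]] .
    have P1': "\<forall>k\<ge>i. tw_ob P1 k = L (i - 1) \<and> tw_h P1 k = idm C (L (i - 1))" using P1(2) by simp
    have d: "dist C (L (i - 1)) (L i) (tw_gr P i) (tw_j P (i - 1)) (tw_c P i) (tw_e P (i - 1))"
      using towerD(18)[OF P(1), of i] P(2) by simp
    obtain P'' f i1 i2 p1 p2 where c: "is_tower C w (tw_gr P i) P''" "H.cm (tower_complex C P1) (tower_complex C P2) f"
      "is_cone (heart C w) (tower_complex C P1) (tower_complex C P2) f (tower_complex C P'') i1 i2 p1 p2"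
      using weight_complex_of_cone[OF d P1(1) P2(1) P1' P2(2)] by blast
    obtain \<alpha> \<beta> where ab: "iso_arrow ?K (tower_complex C P1) (\<sigma> (i - 1)) \<alpha>" "iso_arrow ?K (tower_complex C P2) (\<sigma> i) \<beta>"
    proof -
      have "is_weight_complex C w (L (i - 1)) (tower_complex C P1)" "is_weight_complex C w (L i) (tower_complex C P2)"
        using P1(1) P2(1) unfolding is_weight_complex_def by blast+
      then have "isomorphic ?K (tower_complex C P1) (\<sigma> (i - 1))" "isomorphic ?K (tower_complex C P2) (\<sigma> i)"
        using H.K.isomorphic_trans[OF weight_complex_unique[OF _ L(2)] L(3)] by blast+
      then show thesis using that unfolding isomorphic_def by blast
    qed
    \<comment> \<open>The cone is moved from the weight complexes of the truncations to the
      complexes \<open>\<sigma>\<close>, whose terms are known; only the terms of the new cone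
      matter.\<close>
    obtain f1 Z1 j1 j2 q1 q2 \<gamma> where z: "H.cm (\<sigma> (i - 1)) (\<sigma> i) f1" "is_cone (heart C w) (\<sigma> (i - 1)) (\<sigma> i) f1 Z1 j1 j2 q1 q2"
      "iso_arrow ?K (tower_complex C P'') Z1 \<gamma>"
      using H.kdist_cone[OF c(2,3)] ab by (rule H.kdist_normal)
    show ?thesis
    proof (rule pure_in_KB[OF towerD(20,21)[OF P(1)]])
      show "is_weight_complex C w (tw_gr P i) (tower_complex C P'')" using c(1) unfolding is_weight_complex_def by blast
      show "isomorphic ?K (tower_complex C P'') Z1" using z(3) unfolding isomorphic_def by blast
      show "cob Z1 (- i) \<in> KB" by (rule cone_over_KB[OF z(1,2) \<sigma>(2) \<sigma>(2)])
    qed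
  qed
  from this[of "- n" for n] have "\<forall>n. cob (tower_complex C P) n \<in> KB" by simp
  then show thesis using that P(1) by blast
qed

text \<open>Constancy from \<open>k\<close> on is what the construction of cone towers
  requires.\<close>

definition bounded_KB_tower :: "int \<Rightarrow> 'o \<Rightarrow> ('o, 'a) tower \<Rightarrow> bool" where
  "bounded_KB_tower k N P \<longleftrightarrow> is_tower C w N P \<and> (\<forall>n. cob (tower_complex C P) n \<in> KB) \<and>
     (\<forall>i\<ge>k. tw_ob P i = N \<and> tw_h P i = idm C N)"

lemma bounded_KB_tower_mono: "bounded_KB_tower k N P \<Longrightarrow> k \<le> l \<Longrightarrow> bounded_KB_tower l N P"
  by (auto simp: bounded_KB_tower_def)

lemma bounded_KB_cone:
  assumes d: "dist C A A' A'' u v q" and "bounded_KB_tower k A P" "bounded_KB_tower k A' P'"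
  obtains P'' where "bounded_KB_tower (k + 1) A'' P''"
proof -
  note 1 = assms(2,3)[unfolded bounded_KB_tower_def]
  obtain P'' f i1 i2 p1 p2 where c: "is_tower C w A'' P''" "\<forall>i\<ge>k+1. tw_ob P'' i = A'' \<and> tw_h P'' i = idm C A''"
    "H.cm (tower_complex C P) (tower_complex C P') f"
    "is_cone (heart C w) (tower_complex C P) (tower_complex C P') f (tower_complex C P'') i1 i2 p1 p2"
    using weight_complex_of_cone[OF d, of P P' k] 1 by blast
  have "cob (tower_complex C P'') n \<in> KB" for n
    by (rule cone_over_KB[OF c(3,4)]) (use 1 in auto)
  then show thesis using that c(1,2) unfolding bounded_KB_tower_def by blast
qed

lemma truncated_KB_tower:
  assumes "is_tower C w N P" "\<forall>n. cob (tower_complex C P) n \<in> KB"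
  obtains Q where "bounded_KB_tower k (tw_ob P k) Q"
proof -
  obtain Q where Q: "is_tower C w (tw_ob P k) Q"
    "\<forall>i\<ge>k. tw_ob Q i = tw_ob P k \<and> tw_h Q i = idm C (tw_ob P k)"
    "\<forall>i\<le>k. tw_gr Q i = tw_gr P i" "\<forall>i>k. zero_object C (tw_gr Q i)"
    "\<forall>n\<ge>- k. cdf (tower_complex C Q) n = cdf (tower_complex C P) n"
    using truncated_tower[OF assms(1)] .
  have "cob (tower_complex C Q) n \<in> KB" for n
  proof (cases "- n \<le> k")
    case True
    then show ?thesis using Q(3) assms(2)[rule_format, of n] by simp
  next
    case False
    then show ?thesis using Q(4) by (simp add: KB_zero zero_object_shO)
  qed
  then show thesis using that Q(1,2) unfolding bounded_KB_tower_def by blast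
qed

text \<open>The towers of \<open>N\<close> and \<open>N'\<close> need not become constant, so the
  cone is treated weight by weight: the cone of w_{<=k-1} N -> w_{<=k} N' is a truncation of
  \<open>N''\<close> and does have a bounded tower. Graded pieces are cones between such truncations
  and, being pure, are controlled by one term of their weight complex.\<close>

lemma CB_cone:
  assumes d: "dist C N N' N'' u v q" and "N \<in> CB" "N' \<in> CB" shows "N'' \<in> CB"
proof -
  obtain P where P: "is_tower C w N P" "\<forall>n. cob (tower_complex C P) n \<in> KB" using assms(2) by (rule CB_E)
  obtain P' where P': "is_tower C w N' P'" "\<forall>n. cob (tower_complex C P') n \<in> KB" using assms(3) by (rule CB_E)
  note [simp] = towerD(1,3-17)[OF P(1)] towerD(1,3-17)[OF P'(1)] distD[OF d, unfolded ar_iff]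
  have "\<exists>Z j Q. gives_decomposition C w k Z N'' j \<and> bounded_KB_tower (k + 1) Z Q" for k
  proof -
    have "ar (u \<cdot> tw_h P (k - 1)) (tw_ob P (k - 1)) N'" by (simp add: ar_iff)
    then obtain g where g: "ar g (tw_ob P (k - 1)) (tw_ob P' k)" "tw_h P' k \<cdot> g = u \<cdot> tw_h P (k - 1)"
      using decomposition_lift[OF towerD(2)[OF P'(1), of k] _ towerD(19)[OF P(1)]] by force
    obtain Z a b where Z: "dist C (tw_ob P (k - 1)) (tw_ob P' k) Z g a b"
      using dist_ex[of "tw_ob P (k - 1)" "tw_ob P' k" g] g(1) by (auto simp: ar_def)
    obtain R r e where R: "dist C (tw_ob P (k - 1)) N R (tw_h P (k - 1)) r e" "R \<in> wge C w (k - 1 + 1)"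
      using towerD(2)[OF P(1), of "k - 1"] by (rule gives_decompositionE)
    obtain R' r' e' where R': "dist C (tw_ob P' k) N' R' (tw_h P' k) r' e'" "R' \<in> wge C w (k + 1)"
      using towerD(2)[OF P'(1), of k] by (rule gives_decompositionE)
    \<comment> \<open>The quotient of \<open>N''\<close> is an extension of R[1] by
      \<open>R'\<close>. As the source was cut at \<open>k - 1\<close>, R[1] also has weight at
      least \<open>k + 1\<close>.\<close>
    obtain jz G cz ez x y z where G: "dist C Z N'' G jz cz ez" "dist C R' G (shO C 1 R) x y z"
      using cone_of_filtered_morphism[OF R(1) R'(1) Z d g(2)[symmetric]] by metis
    have "G \<in> wge C w (k + 1)" using wge_extension[OF G(2) R'(2)] R(2) wge_Obj[OF R(2)] by simp
    moreover have "Z \<in> wle C w k" using wle_cone[OF Z towerD(19)[OF P(1)] towerD(19)[OF P'(1)]] .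
    ultimately have 1: "gives_decomposition C w k Z N'' jz" using gives_decompositionI[OF G(1)] by blast
    obtain Q1 where "bounded_KB_tower (k - 1) (tw_ob P (k - 1)) Q1" using truncated_KB_tower[OF P] .
    then have Q1: "bounded_KB_tower k (tw_ob P (k - 1)) Q1" by (rule bounded_KB_tower_mono) simp
    obtain Q2 where Q2: "bounded_KB_tower k (tw_ob P' k) Q2" using truncated_KB_tower[OF P'] .
    obtain Q where "bounded_KB_tower (k + 1) Z Q" using bounded_KB_cone[OF Z Q1 Q2] .
    then show ?thesis using 1 by blast
  qed
  then obtain Z j Q where Z: "\<And>k. gives_decomposition C w k (Z k) N'' (j k)" "\<And>k. bounded_KB_tower (k + 1) (Z k) (Q k)"
    by metis
  obtain P'' where P'': "is_tower C w N'' P''" "tw_ob P'' = Z" "tw_h P'' = j" using tower_exists[OF Z(1)] .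
  have "shO C (- k) (tw_gr P'' k) \<in> KB" for k
  proof -
    have d: "dist C (Z (k - 1)) (Z k) (tw_gr P'' k) (tw_j P'' (k - 1)) (tw_c P'' k) (tw_e P'' (k - 1))"
      using towerD(18)[OF P''(1), of k] P''(2) by simp
    have 1: "bounded_KB_tower (k + 1) (Z (k - 1)) (Q (k - 1))" using Z(2)[of "k - 1"] by (rule bounded_KB_tower_mono) simp
    obtain S where S: "bounded_KB_tower (k + 1 + 1) (tw_gr P'' k) S" using bounded_KB_cone[OF d 1 Z(2)] .
    then have "is_tower C w (tw_gr P'' k) S" "cob (tower_complex C S) (- k) \<in> KB"
      unfolding bounded_KB_tower_def by blast+
    then show ?thesis
      using pure_in_KB[OF towerD(20,21)[OF P''(1), of k] _ H.K.isomorphic_refl] tower_complex_complex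
      unfolding is_weight_complex_def by (metis H.K_Obj)
  qed
  from this[of "- n" for n] show ?thesis by (intro CB_I[OF P''(1)]) simp
qed

lemma CB_shift: assumes "N \<in> CB" shows "shO C k N \<in> CB"
proof -
  obtain P where P: "is_tower C w N P" "\<forall>n. cob (tower_complex C P) n \<in> KB" using assms by (rule CB_E)
  obtain Q where Q: "is_tower C w (shO C k N) Q" "tower_complex C Q = cshift (heart C w) k (tower_complex C P)"
    using shifted_tower[OF P(1)] .
  show ?thesis by (rule CB_I[OF Q(1)]) (use P(2) in \<open>simp add: Q(2) del: tower_complex_simps\<close>)
qed

lemma KB_CB: assumes "X \<in> KB" shows "X \<in> CB"
proof -
  have "X \<in> wle C w 0" "X \<in> wge C w 0" using assms KB_heart by (auto simp: heart_Obj)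
  then obtain P where P: "is_tower C w X P" "\<forall>i. i \<noteq> 0 \<longrightarrow> zero_object C (tw_gr P i)"
    "iso_arrow C X (tw_gr P 0) (tw_c P 0)"
    using pure_tower_exists by metis
  show ?thesis
  proof (rule CB_I[OF P(1)])
    fix n
    show "cob (tower_complex C P) n \<in> KB"
    proof (cases "n = 0")
      case True
      have "isomorphic C (tw_gr P 0) X" using P(3) isomorphic_sym unfolding isomorphic_def by blast
      then show ?thesis using True KB_retract[OF assms isomorphic_retract] towerD(16)[OF P(1), of 0] by simp
    next
      case False
      then show ?thesis using P(2) by (simp add: KB_zero zero_object_shO)
    qed
  qed
qed

text \<open>The sum is the cone of the zero arrow X[-1] -> Y.\<close>

lemma CB_biproduct:
  assumes "X \<in> CB" "Y \<in> CB" shows "\<exists>S i1 i2 p1 p2. S \<in> CB \<and> biproduct C X Y S i1 i2 p1 p2"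
proof -
  have XY: "X \<in> Obj C" "Y \<in> Obj C" using assms CB_Obj by blast+
  obtain S g h where S: "dist C (shO C (-1) X) Y S (zr (shO C (-1) X) Y) g h"
    using dist_ex[of "shO C (-1) X" Y "zr (shO C (-1) X) Y"] XY by (auto simp: Hom_ar ar_iff)
  obtain s p where "biproduct C (shO C 1 (shO C (-1) X)) Y S s g h p" using cone_of_zero[OF S] .
  then have "biproduct C X Y S s g h p" using XY by simp
  then show ?thesis using CB_cone[OF S CB_shift[OF assms(1)] assms(2)] by blast
qed

lemma CB_decomposition:
  assumes "N \<in> CB"
  shows "\<exists>L R h g k. dist C L N R h g k \<and> L \<in> CB \<and> L \<in> wle C w 0 \<and> R \<in> CB \<and> R \<in> wge C w 1"
proof -
  obtain P where P: "is_tower C w N P" "\<forall>n. cob (tower_complex C P) n \<in> KB" using assms by (rule CB_E)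
  obtain Q where "bounded_KB_tower 0 (tw_ob P 0) Q" using truncated_KB_tower[OF P] .
  then have L: "tw_ob P 0 \<in> CB" using CB_I unfolding bounded_KB_tower_def by blast
  obtain R g k where R: "dist C (tw_ob P 0) N R (tw_h P 0) g k" "R \<in> wge C w (0 + 1)"
    using towerD(2)[OF P(1), of 0] by (rule gives_decompositionE)
  have "R \<in> wge C w 1" using R(2) by simp
  then show ?thesis using R(1) L CB_cone[OF R(1) L assms] towerD(19)[OF P(1), of 0] by blast
qed

lemma CB_heart: "CB \<inter> Obj (heart C w) = KB"
proof
  show "KB \<subseteq> CB \<inter> Obj (heart C w)" using KB_CB KB_heart by blast
  show "CB \<inter> Obj (heart C w) \<subseteq> KB"
  proof
    fix N assume N: "N \<in> CB \<inter> Obj (heart C w)"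
    then obtain P where P: "is_tower C w N P" "\<forall>n. cob (tower_complex C P) n \<in> KB" using CB_E by blast
    note [simp] = towerD(1,3-17)[OF P(1)]
    have Nw: "N \<in> wle C w 0" "N \<in> wge C w 0" using N by (auto simp: heart_Obj)
    \<comment> \<open>Weight at most 0 lets the identity of \<open>N\<close> lift to w_{<=0} N;
      weight at least 0 makes w_{<=-1} N map to zero, so \<open>tw_h P 0\<close> factors through the
      graded piece. Hence \<open>N\<close> is a retract of that piece.\<close>
    obtain s where s: "ar s N (tw_ob P 0)" "tw_h P 0 \<cdot> s = idm C N"
      using decomposition_lift[OF towerD(2)[OF P(1), of 0] ar_idm[of N] Nw(1)] by auto
    have "ar (tw_h P (-1)) (tw_ob P (-1)) N" by (simp add: ar_iff)
    then have "tw_h P (-1) = zr (tw_ob P (-1)) N" using weight_orth[OF _ towerD(19)[OF P(1)] Nw(2), of _ "-1"] by simp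
    then have "tw_h P 0 \<cdot> tw_j P (-1) = zr (tw_ob P (-1)) N" using towerD(17)[OF P(1), of "-1"] by simp
    then obtain x where x: "ar x (tw_gr P 0) N" "x \<cdot> tw_c P 0 = tw_h P 0"
      using dist_extend[OF towerD(18)[OF P(1), of 0], of "tw_h P 0" N] by (auto simp: ar_iff)
    note [simp] = s(1)[unfolded ar_iff] x(1)[unfolded ar_iff]
    have "x \<cdot> (tw_c P 0 \<cdot> s) = idm C N" using s(2) by (simp add: x(2)[THEN ra])
    moreover have "ar (tw_c P 0 \<cdot> s) N (tw_gr P 0)" by (simp add: ar_iff)
    ultimately have "retract_of C N (tw_gr P 0)" unfolding retract_of_ar using x(1) by blast
    then show "N \<in> KB" using KB_retract P(2)[rule_format, of 0] by simp
  qed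
qed

end

section \<open>Full triangulated subcategories\<close>

lemma full_trisub_simps [simp]:
  "Obj (full_trisub C D) = D" "Hom (full_trisub C D) = Hom C" "idm (full_trisub C D) = idm C"
  "cmp (full_trisub C D) = cmp C" "madd (full_trisub C D) = madd C" "mzero (full_trisub C D) = mzero C"
  "shO (full_trisub C D) = shO C" "shA (full_trisub C D) = shA C"
  "hom_group (full_trisub C D) = hom_group C" "mneg (full_trisub C D) = mneg C"
  "dist (full_trisub C D) X Y Z f g h \<longleftrightarrow> X \<in> D \<and> Y \<in> D \<and> Z \<in> D \<and> dist C X Y Z f g h"
  by (simp_all add: full_trisub_def full_sub_def hom_group_def mneg_def fun_eq_iff)

text \<open>Fullness passes on the equations and the axioms that assert arrows; shifts, biproducts
  and third vertices are the objects that have to stay inside \<open>D\<close>.\<close>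

lemma full_trisub_triangulated:
  fixes C :: "('o, 'a) tricat"
  assumes C: "triangulated_category C" and D: "D \<subseteq> Obj C"
    and Z: "Z \<in> D" "zero_object C Z"
    and b: "\<And>X Y. X \<in> D \<Longrightarrow> Y \<in> D \<Longrightarrow> \<exists>S i1 i2 p1 p2. S \<in> D \<and> biproduct C X Y S i1 i2 p1 p2"
    and shift: "\<And>X n. X \<in> D \<Longrightarrow> shO C n X \<in> D"
    and cone: "\<And>X Y Z f g h. dist C X Y Z f g h \<Longrightarrow> X \<in> D \<Longrightarrow> Y \<in> D \<Longrightarrow> Z \<in> D"
  shows "triangulated_category (full_trisub C D)"
proof -
  interpret triangulated_category C by (rule C)
  let ?E = "full_trisub C D"
  note O = subsetD[OF D]
  have iso: "iso_arrow ?E X Y f \<longleftrightarrow> X \<in> D \<and> Y \<in> D \<and> iso_arrow C X Y f" for X Y f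
    using O unfolding iso_arrow_def by auto
  have zero: "zero_object C Y" if "zero_object ?E Y" for Y
  proof -
    have Y: "Y \<in> D" "\<exists>!f. f \<in> Hom C Y Y" using that by (auto simp: zero_object_def)
    then have "idm C Y = zr Y Y" using O ar_idm[of Y] ar_zr[of Y Y] by (auto simp: Hom_ar)
    then show ?thesis using Y(1) O by (simp add: zero_object_idm)
  qed
  show ?thesis
  proof (intro triangulated_category.intro triangulated_category_axioms.intro)
    show "additive_category ?E"
      by (rule full_subcategory_additive[of _ Z]) (use D Z b in simp_all)
  next
    fix X Y Z f g h X' Y' Z' a b c f' g' h'
    assume "dist ?E X Y Z f g h" "iso_arrow ?E X X' a" "iso_arrow ?E Y Y' b" "iso_arrow ?E Z Z' c"
      "f' \<in> Hom ?E X' Y'" "g' \<in> Hom ?E Y' Z'" "h' \<in> Hom ?E Z' (shO ?E 1 X')"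
      "f' \<cdot>\<^bsub>?E\<^esub> a = b \<cdot>\<^bsub>?E\<^esub> f" "g' \<cdot>\<^bsub>?E\<^esub> b = c \<cdot>\<^bsub>?E\<^esub> g" "h' \<cdot>\<^bsub>?E\<^esub> c = shA ?E 1 a \<cdot>\<^bsub>?E\<^esub> h"
    then show "dist ?E X' Y' Z' f' g' h'"
      unfolding iso using dist_iso[of X Y Z f g h X' a Y' b Z' c f' g' h'] by simp
  next
    fix X Z assume "X \<in> Obj ?E" "zero_object ?E Z"
    then show "dist ?E X X Z (idm ?E X) (mzero ?E X Z) (mzero ?E Z (shO ?E 1 X))"
      using dist_idm[of X Z] zero[of Z] O by (auto simp: zero_object_def)
  next
    fix X Y f assume "X \<in> Obj ?E" "Y \<in> Obj ?E" "f \<in> Hom ?E X Y"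
    then have "X \<in> D" "Y \<in> D" "f \<in> Hom C X Y" by simp_all
    moreover from this obtain Z g h where "dist C X Y Z f g h" using dist_ex O by blast
    ultimately have "dist ?E X Y Z f g h" using cone[of X Y Z f g h] by simp
    then show "\<exists>Z g h. dist ?E X Y Z f g h" by blast
  next
    fix X Y Z f g h assume "dist ?E X Y Z f g h"
    then show "dist ?E Y Z (shO ?E 1 X) g h (mneg ?E (shO ?E 1 X) (shO ?E 1 Y) (shA ?E 1 f))"
      using dist_rotate[of X Y Z f g h] shift by simp
  next
    fix X Y Z f g h
    assume "X \<in> Obj ?E" "Y \<in> Obj ?E" "Z \<in> Obj ?E"
      "f \<in> Hom ?E X Y" "g \<in> Hom ?E Y Z" "h \<in> Hom ?E Z (shO ?E 1 X)"
      "dist ?E Y Z (shO ?E 1 X) g h (mneg ?E (shO ?E 1 X) (shO ?E 1 Y) (shA ?E 1 f))"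
    then show "dist ?E X Y Z f g h" using dist_rotate_back[of X Y Z f g h] O by simp
  next
    fix X Y Z f g h X' Y' Z' f' g' h' a b
    assume "dist ?E X Y Z f g h" "dist ?E X' Y' Z' f' g' h'" "a \<in> Hom ?E X X'" "b \<in> Hom ?E Y Y'"
      "f' \<cdot>\<^bsub>?E\<^esub> a = b \<cdot>\<^bsub>?E\<^esub> f"
    then show "\<exists>c\<in>Hom ?E Z Z'. g' \<cdot>\<^bsub>?E\<^esub> b = c \<cdot>\<^bsub>?E\<^esub> g \<and> h' \<cdot>\<^bsub>?E\<^esub> c = shA ?E 1 a \<cdot>\<^bsub>?E\<^esub> h"
      using dist_mor[of X Y Z f g h X' Y' Z' f' g' h' a b] by simp
  next
    fix X Y Z' f a a' Z X' g b b' Y' c c'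
    assume "dist ?E X Y Z' f a a'" "dist ?E Y Z X' g b b'" "dist ?E X Z Y' (g \<cdot>\<^bsub>?E\<^esub> f) c c'"
    then show "\<exists>u v. dist ?E Z' Y' X' u v (shA ?E 1 a \<cdot>\<^bsub>?E\<^esub> b') \<and> u \<cdot>\<^bsub>?E\<^esub> a = c \<cdot>\<^bsub>?E\<^esub> g \<and>
      c' \<cdot>\<^bsub>?E\<^esub> u = a' \<and> v \<cdot>\<^bsub>?E\<^esub> c = b \<and> b' \<cdot>\<^bsub>?E\<^esub> v = shA ?E 1 f \<cdot>\<^bsub>?E\<^esub> c'"
      using octahedron[of X Y Z' f a a' Z X' g b b' Y' c c'] by simp
  next
    fix X Y Z f g h assume "dist ?E X Y Z f g h"
    then show "X \<in> Obj ?E \<and> Y \<in> Obj ?E \<and> Z \<in> Obj ?E \<and>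
        f \<in> Hom ?E X Y \<and> g \<in> Hom ?E Y Z \<and> h \<in> Hom ?E Z (shO ?E 1 X)"
      using dist_typed[of X Y Z f g h] by simp
  next
    fix X Y Z f g n assume "X \<in> Obj ?E" "Y \<in> Obj ?E" "Z \<in> Obj ?E" "f \<in> Hom ?E X Y" "g \<in> Hom ?E Y Z"
    then show "shA ?E n (g \<cdot>\<^bsub>?E\<^esub> f) = shA ?E n g \<cdot>\<^bsub>?E\<^esub> shA ?E n f"
      using shA_cmp[of X Y Z f g n] O by simp
  next
    fix X Y f n assume "X \<in> Obj ?E" "Y \<in> Obj ?E" "f \<in> Hom ?E X Y"
    then show "shA ?E n f \<in> Hom ?E (shO ?E n X) (shO ?E n Y)" using shA_closed[of X Y f n] O by simp
  next
    fix X Y f assume "X \<in> Obj ?E" "Y \<in> Obj ?E" "f \<in> Hom ?E X Y"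
    then show "shA ?E 0 f = f" using shA_0[of X Y f] O by simp
  next
    fix X Y f k n assume "X \<in> Obj ?E" "Y \<in> Obj ?E" "f \<in> Hom ?E X Y"
    then show "shA ?E k (shA ?E n f) = shA ?E (k + n) f" using shA_add[of X Y f k n] O by simp
  next
    fix X Y f g n assume "X \<in> Obj ?E" "Y \<in> Obj ?E" "f \<in> Hom ?E X Y" "g \<in> Hom ?E X Y"
    then show "shA ?E n (madd ?E f g) = madd ?E (shA ?E n f) (shA ?E n g)"
      using shA_madd[of X Y f g n] O by simp
  qed (use O shift in simp_all)
qed

section \<open>Retracts of B and the Karoubi envelope\<close>

context additive_category begin

text \<open>A retract \<open>X\<close> of \<open>S\<close> goes to the pair of \<open>S\<close> and
  the idempotent \<open>s r\<close>; a pair goes back to a splitting of its idempotent. Composites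
  of sections and retractions provide \<open>\<eta>\<close> and \<open>\<epsilon>\<close>.\<close>

lemma equivalent_Kar:
  assumes B: "B \<subseteq> Obj C" and K: "K \<subseteq> Obj C"
    and retract: "\<And>X. X \<in> K \<Longrightarrow> \<exists>S\<in>B. retract_of C X S"
    and split: "\<And>T p. T \<in> B \<Longrightarrow> ar p T T \<Longrightarrow> p \<cdot> p = p \<Longrightarrow>
      \<exists>Y\<in>K. \<exists>r s. ar r T Y \<and> ar s Y T \<and> r \<cdot> s = idm C Y \<and> s \<cdot> r = p"
  shows "equivalent_cats (full_sub C K) (Kar (full_sub C B))"
proof -
  let ?L = "Kar (full_sub C B)"
  note BO = subsetD[OF B] and KO = subsetD[OF K]
  have "\<forall>X\<in>K. \<exists>S s r. S \<in> B \<and> ar s X S \<and> ar r S X \<and> r \<cdot> s = idm C X"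
    using retract unfolding retract_of_ar by blast
  then obtain S s r where S: "\<And>X. X \<in> K \<Longrightarrow> S X \<in> B" "\<And>X. X \<in> K \<Longrightarrow> ar (s X) X (S X)"
    "\<And>X. X \<in> K \<Longrightarrow> ar (r X) (S X) X" "\<And>X. X \<in> K \<Longrightarrow> r X \<cdot> s X = idm C X"
    by metis
  have LO: "Q \<in> Obj ?L \<longleftrightarrow> fst Q \<in> B \<and> ar (snd Q) (fst Q) (fst Q) \<and> snd Q \<cdot> snd Q = snd Q" for Q
    using BO by (auto simp: Kar_def Hom_ar)
  have LH: "a \<in> Hom ?L P Q \<longleftrightarrow> (\<exists>f. a = (P, Q, f) \<and> ar f (fst P) (fst Q) \<and> snd Q \<cdot> (f \<cdot> snd P) = f)"
    if "P \<in> Obj ?L" "Q \<in> Obj ?L" for a P Q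
  proof -
    obtain S p T q where "P = (S, p)" "Q = (T, q)" by fastforce
    moreover from this have "S \<in> Obj C" "T \<in> Obj C" using that BO by (auto simp: LO)
    ultimately show ?thesis by (auto simp: Kar_def Hom_ar)
  qed
  have Li: "idm ?L Q = (Q, Q, snd Q)" for Q by (simp add: Kar_def split: prod.splits)
  have Lc: "cmp ?L (R', R, g) (P, P', f) = (P, R, g \<cdot> f)" for R' R g P P' f by (simp add: Kar_def)
  have "\<forall>Q\<in>Obj ?L. \<exists>Y r s. Y \<in> K \<and> ar r (fst Q) Y \<and> ar s Y (fst Q) \<and> r \<cdot> s = idm C Y \<and> s \<cdot> r = snd Q"
  proof
    fix Q assume "Q \<in> Obj ?L"
    then have "fst Q \<in> B" "ar (snd Q) (fst Q) (fst Q)" "snd Q \<cdot> snd Q = snd Q" by (simp_all add: LO)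
    from split[OF this] show "\<exists>Y r s. Y \<in> K \<and> ar r (fst Q) Y \<and> ar s Y (fst Q) \<and> r \<cdot> s = idm C Y \<and> s \<cdot> r = snd Q"
      by blast
  qed
  then obtain G u v where "\<forall>Q\<in>Obj ?L. G Q \<in> K \<and> ar (u Q) (fst Q) (G Q) \<and> ar (v Q) (G Q) (fst Q) \<and>
      u Q \<cdot> v Q = idm C (G Q) \<and> v Q \<cdot> u Q = snd Q"
    unfolding bchoice_iff by blast
  then have G: "\<And>Q. Q \<in> Obj ?L \<Longrightarrow> G Q \<in> K" "\<And>Q. Q \<in> Obj ?L \<Longrightarrow> ar (u Q) (fst Q) (G Q)"
    "\<And>Q. Q \<in> Obj ?L \<Longrightarrow> ar (v Q) (G Q) (fst Q)"
    "\<And>Q. Q \<in> Obj ?L \<Longrightarrow> u Q \<cdot> v Q = idm C (G Q)" "\<And>Q. Q \<in> Obj ?L \<Longrightarrow> v Q \<cdot> u Q = snd Q"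
    by blast+
  define F where "F X = (S X, s X \<cdot> r X)" for X
  have Ssimp: "is_arr (s X)" "src (s X) = X" "tgt (s X) = S X" "is_arr (r X)" "src (r X) = S X"
    "tgt (r X) = X" "S X \<in> Obj C" "X \<in> Obj C" "S X \<in> B" if "X \<in> K" for X
    using S(1-3)[OF that] by (simp_all add: ar_iff)
  have Gsimp: "is_arr (u Q)" "src (u Q) = fst Q" "tgt (u Q) = G Q" "is_arr (v Q)" "src (v Q) = G Q"
    "tgt (v Q) = fst Q" "G Q \<in> Obj C" "is_arr (snd Q)" "src (snd Q) = fst Q" "tgt (snd Q) = fst Q"
    "snd Q \<cdot> snd Q = snd Q" "fst Q \<in> Obj C" if "Q \<in> Obj ?L" for Q
    using G(1-3)[OF that] that by (simp_all add: ar_iff LO)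
  have FL: "F X \<in> Obj ?L" if "X \<in> K" for X
    using that by (simp add: LO F_def Ssimp ar_iff S(4)[THEN ra])
  have Fsimp: "fst (F X) = S X" "snd (F X) = s X \<cdot> r X" for X by (simp_all add: F_def)
  have pv: "snd Q \<cdot> v Q = v Q" "u Q \<cdot> snd Q = u Q" if "Q \<in> Obj ?L" for Q
    using that by (simp_all add: G(5)[symmetric] Gsimp G(4)[THEN ra] G(4) del: Gsimp(8-11))
  \<comment> \<open>The condition on arrows of the envelope is equivalent to absorbing each
    idempotent separately; this form makes \<open>GA\<close> compatible with composition.\<close>
  have absorb: "snd Q \<cdot> f = f" "f \<cdot> snd P = f"
    if "P \<in> Obj ?L" "Q \<in> Obj ?L" "ar f (fst P) (fst Q)" "snd Q \<cdot> (f \<cdot> snd P) = f" for P Q f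
  proof -
    note [simp] = Gsimp[OF that(1)] Gsimp[OF that(2)] that(3)[unfolded ar_iff]
    have "snd Q \<cdot> (snd Q \<cdot> (f \<cdot> snd P)) = snd Q \<cdot> (f \<cdot> snd P)" by (simp add: Gsimp(11)[OF that(2), THEN ra])
    then show "snd Q \<cdot> f = f" unfolding that(4) .
    have "(snd Q \<cdot> (f \<cdot> snd P)) \<cdot> snd P = snd Q \<cdot> (f \<cdot> snd P)" by simp
    then show "f \<cdot> snd P = f" unfolding that(4) .
  qed
  define FA where "FA f = (F (src f), F (tgt f), s (tgt f) \<cdot> (f \<cdot> r (src f)))" for f
  define GA where "GA a = (case a of (P, Q, f) \<Rightarrow> u Q \<cdot> (f \<cdot> v P))" for a
  define \<eta> where "\<eta> X = u (F X) \<cdot> s X" for X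
  define \<epsilon> where "\<epsilon> Q = (F (G Q), Q, v Q \<cdot> r (G Q))" for Q
  have vu: "v (F X) \<cdot> u (F X) = s X \<cdot> r X" if "X \<in> K" for X using G(5)[OF FL[OF that]] by (simp add: Fsimp)
  have uvF: "is_arr (u (F X))" "src (u (F X)) = S X" "tgt (u (F X)) = G (F X)"
    "is_arr (v (F X))" "src (v (F X)) = G (F X)" "tgt (v (F X)) = S X" "G (F X) \<in> Obj C" if "X \<in> K" for X
    using Gsimp[OF FL[OF that]] by (simp_all add: Fsimp)
  have F_functor: "is_functor (full_sub C K) ?L F FA"
    unfolding is_functor_def
  proof (intro conjI ballI)
    fix X assume "X \<in> Obj (full_sub C K)"
    then have X: "X \<in> K" by simp
    show "F X \<in> Obj ?L" using FL X .
    show "FA (idm (full_sub C K) X) = idm ?L (F X)"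
      using X by (simp add: FA_def Li Ssimp Fsimp)
  next
    fix X Y f assume "X \<in> Obj (full_sub C K)" "Y \<in> Obj (full_sub C K)" "f \<in> Hom (full_sub C K) X Y"
    then have X: "X \<in> K" "Y \<in> K" and f: "ar f X Y" using KO by (simp_all add: Hom_ar)
    note [simp] = Ssimp[OF X(1)] Ssimp[OF X(2)] f[unfolded ar_iff]
    show "FA f \<in> Hom ?L (F X) (F Y)" unfolding LH[OF FL[OF X(1)] FL[OF X(2)]]
      by (simp add: FA_def Fsimp ar_iff S(4)[OF X(1), THEN ra] S(4)[OF X(2), THEN ra])
  next
    fix X Y Z f g assume "X \<in> Obj (full_sub C K)" "Y \<in> Obj (full_sub C K)" "Z \<in> Obj (full_sub C K)"
      "f \<in> Hom (full_sub C K) X Y" "g \<in> Hom (full_sub C K) Y Z"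
    then have X: "X \<in> K" "Y \<in> K" "Z \<in> K" and f: "ar f X Y" and g: "ar g Y Z" using KO by (simp_all add: Hom_ar)
    note [simp] = Ssimp[OF X(1)] Ssimp[OF X(2)] Ssimp[OF X(3)] f[unfolded ar_iff] g[unfolded ar_iff]
    show "FA (g \<cdot>\<^bsub>full_sub C K\<^esub> f) = FA g \<cdot>\<^bsub>?L\<^esub> FA f"
      by (simp add: FA_def Lc S(4)[OF X(2), THEN ra])
  qed
  have G_functor: "is_functor ?L (full_sub C K) G GA"
    unfolding is_functor_def
  proof (intro conjI ballI)
    fix Q assume Q: "Q \<in> Obj ?L"
    show "G Q \<in> Obj (full_sub C K)" using G(1)[OF Q] by simp
    show "GA (idm ?L Q) = idm (full_sub C K) (G Q)"
      by (simp add: GA_def Li pv[OF Q] G(4)[OF Q])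
  next
    fix P Q a assume Q: "P \<in> Obj ?L" "Q \<in> Obj ?L" and a: "a \<in> Hom ?L P Q"
    obtain f where f: "a = (P, Q, f)" "ar f (fst P) (fst Q)" using a unfolding LH[OF Q] by blast
    note [simp] = Gsimp[OF Q(1)] Gsimp[OF Q(2)] f(2)[unfolded ar_iff]
    show "GA a \<in> Hom (full_sub C K) (G P) (G Q)"
      by (simp add: GA_def f(1) Hom_ar ar_iff)
  next
    fix P Q R a c assume Q: "P \<in> Obj ?L" "Q \<in> Obj ?L" "R \<in> Obj ?L" and a: "a \<in> Hom ?L P Q" and c: "c \<in> Hom ?L Q R"
    obtain f where f: "a = (P, Q, f)" "ar f (fst P) (fst Q)" "snd Q \<cdot> (f \<cdot> snd P) = f"
      using a unfolding LH[OF Q(1,2)] by blast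
    obtain g where g: "c = (Q, R, g)" "ar g (fst Q) (fst R)"
      using c unfolding LH[OF Q(2,3)] by blast
    note [simp] = Gsimp[OF Q(1)] Gsimp[OF Q(2)] Gsimp[OF Q(3)] f(2)[unfolded ar_iff] g(2)[unfolded ar_iff]
    show "GA (c \<cdot>\<^bsub>?L\<^esub> a) = GA c \<cdot>\<^bsub>full_sub C K\<^esub> GA a"
      by (simp add: GA_def f(1) g(1) Lc G(5)[OF Q(2), THEN ra] absorb(1)[OF Q(1,2) f(2,3), THEN ra])
  qed
  have eta: "natural_iso (full_sub C K) (full_sub C K) (\<lambda>X. X) (\<lambda>f. f) (G \<circ> F) (GA \<circ> FA) \<eta>"
    unfolding natural_iso_def
  proof (intro conjI ballI)
    fix X assume "X \<in> Obj (full_sub C K)"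
    then have X: "X \<in> K" by simp
    note [simp] = Ssimp[OF X] uvF[OF X]
    note [simp] = S(4)[OF X] S(4)[OF X, THEN ra] vu[OF X, THEN ra]
    have uv: "u (F X) \<cdot> v (F X) = idm C (G (F X))" by (rule G(4)[OF FL[OF X]])
    have "u (F X) \<cdot> (s X \<cdot> (r X \<cdot> v (F X))) = u (F X) \<cdot> ((v (F X) \<cdot> u (F X)) \<cdot> v (F X))"
      by (simp add: vu[OF X] del: assoc) simp
    also have "\<dots> = idm C (G (F X))" by (simp add: uv uv[THEN ra] del: vu[OF X, THEN ra])
    finally have 1: "\<eta> X \<cdot> (r X \<cdot> v (F X)) = idm C (G (F X))" by (simp add: \<eta>_def)
    have 2: "(r X \<cdot> v (F X)) \<cdot> \<eta> X = idm C X" by (simp add: \<eta>_def)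
    show "iso_arrow (full_sub C K) X ((G \<circ> F) X) (\<eta> X)"
      unfolding iso_arrow_def using 1 2 X G(1)[OF FL[OF X]]
      by (intro conjI bexI[of _ "r X \<cdot> v (F X)"]) (simp_all add: Hom_ar ar_iff \<eta>_def)
  next
    fix X Y f assume "X \<in> Obj (full_sub C K)" "Y \<in> Obj (full_sub C K)" "f \<in> Hom (full_sub C K) X Y"
    then have X: "X \<in> K" "Y \<in> K" and f: "ar f X Y" using KO by (simp_all add: Hom_ar)
    note [simp] = Ssimp[OF X(1)] Ssimp[OF X(2)] uvF[OF X(1)] uvF[OF X(2)] f[unfolded ar_iff]
    show "\<eta> Y \<cdot>\<^bsub>full_sub C K\<^esub> f = (GA \<circ> FA) f \<cdot>\<^bsub>full_sub C K\<^esub> \<eta> X"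
      by (simp add: \<eta>_def GA_def FA_def vu[OF X(1), THEN ra] S(4)[OF X(1)] S(4)[OF X(1), THEN ra])
  qed
  have eps: "natural_iso ?L ?L (F \<circ> G) (FA \<circ> GA) (\<lambda>X. X) (\<lambda>f. f) \<epsilon>"
    unfolding natural_iso_def
  proof (intro conjI ballI)
    fix Q assume Q: "Q \<in> Obj ?L"
    note X = G(1)[OF Q] and FQ = FL[OF G(1)[OF Q]]
    note [simp] = Ssimp[OF X] Gsimp[OF Q] S(4)[OF X] S(4)[OF X, THEN ra] G(4)[OF Q] G(4)[OF Q, THEN ra]
      pv[OF Q] pv(1)[OF Q, THEN ra] pv(2)[OF Q, THEN ra]
    let ?i = "(Q, F (G Q), s (G Q) \<cdot> u Q)"
    have "\<epsilon> Q \<in> Hom ?L (F (G Q)) Q" "?i \<in> Hom ?L Q (F (G Q))"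
      unfolding LH[OF FQ Q] LH[OF Q FQ] by (simp_all add: \<epsilon>_def Fsimp ar_iff)
    moreover have "?i \<cdot>\<^bsub>?L\<^esub> \<epsilon> Q = idm ?L (F (G Q))" "\<epsilon> Q \<cdot>\<^bsub>?L\<^esub> ?i = idm ?L Q"
      by (simp_all add: \<epsilon>_def Lc Li Fsimp G(5)[OF Q])
    ultimately show "iso_arrow ?L ((F \<circ> G) Q) Q (\<epsilon> Q)"
      unfolding iso_arrow_def comp_def using Q FQ by blast
  next
    fix P Q a assume Q: "P \<in> Obj ?L" "Q \<in> Obj ?L" and a: "a \<in> Hom ?L P Q"
    obtain f where f: "a = (P, Q, f)" "ar f (fst P) (fst Q)" "snd Q \<cdot> (f \<cdot> snd P) = f"
      using a unfolding LH[OF Q] by blast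
    note X = G(1)[OF Q(1)] G(1)[OF Q(2)]
    note [simp] = Ssimp[OF X(1)] Ssimp[OF X(2)] Gsimp[OF Q(1)] Gsimp[OF Q(2)] f(2)[unfolded ar_iff]
    show "\<epsilon> Q \<cdot>\<^bsub>?L\<^esub> (FA \<circ> GA) a = a \<cdot>\<^bsub>?L\<^esub> \<epsilon> P"
      by (simp add: \<epsilon>_def FA_def GA_def f(1) Lc S(4)[OF X(2), THEN ra] G(5)[OF Q(2), THEN ra]
          absorb(1)[OF Q f(2,3), THEN ra])
  qed
  show ?thesis unfolding equivalent_cats_def using F_functor G_functor eta eps by blast
qed

end

section \<open>The restricted weight structure and its heart\<close>

context karoubian_weight_structure begin

abbreviation E :: "('o, 'a) tricat" where "E \<equiv> full_trisub C CB"

lemma CB_triangulated: "triangulated_category E"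
proof -
  obtain Z where Z: "zero_object C Z" using ex_zero_object by blast
  show ?thesis
    by (rule full_trisub_triangulated[OF triangulated_category_axioms CB_Obj KB_CB[OF KB_zero[OF Z]] Z])
      (use CB_biproduct CB_shift CB_cone in blast)+
qed

lemma CB_unshift: assumes "X \<in> Obj C" "shO C 1 X \<in> CB" shows "X \<in> CB"
  using CB_shift[OF assms(2), of "-1"] assms(1) by simp

lemma CB_weight_structure: "weight_structure E (restrict_weights w CB)"
proof (intro weight_structure.intro weight_structure_axioms.intro CB_triangulated)
  have R: "wle0 (restrict_weights w CB) = wle0 w \<inter> CB" "wge0 (restrict_weights w CB) = wge0 w \<inter> CB"
    by (simp_all add: restrict_weights_def)
  have ret: "retract_of C Y X \<and> Y \<in> CB" if "retract_of E Y X" for X Y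
    using that CB_Obj unfolding retract_of_def by auto
  show "wle0 (restrict_weights w CB) \<subseteq> Obj E" "wge0 (restrict_weights w CB) \<subseteq> Obj E" by (simp_all add: R)
  show "Y \<in> wle0 (restrict_weights w CB)" if "X \<in> wle0 (restrict_weights w CB)" "retract_of E Y X" for X Y
    using that ret wle0_retract unfolding R by blast
  show "Y \<in> wge0 (restrict_weights w CB)" if "X \<in> wge0 (restrict_weights w CB)" "retract_of E Y X" for X Y
    using that ret wge0_retract unfolding R by blast
  \<comment> \<open>The preimage under the shift stays in C^B because this class is also stable
    under [-1].\<close>
  show "wle0 (restrict_weights w CB) \<subseteq> shO E 1 ` wle0 (restrict_weights w CB)"
    using wle0_shift wle0_Obj CB_unshift unfolding R full_trisub_simps by blast
  show "shO E 1 ` wge0 (restrict_weights w CB) \<subseteq> wge0 (restrict_weights w CB)"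
    using wge0_shift CB_shift unfolding R full_trisub_simps by blast
  show "Hom E X Y = {mzero E X Y}"
    if "X \<in> wle0 (restrict_weights w CB)" "Y \<in> shO E 1 ` wge0 (restrict_weights w CB)" for X Y
    using that orthogonal[of X Y] unfolding R full_trisub_simps by blast
  show "\<exists>L T h g k. dist E L N T h g k \<and> L \<in> wle0 (restrict_weights w CB) \<and>
      T \<in> shO E 1 ` wge0 (restrict_weights w CB)" if N: "N \<in> Obj E" for N
  proof -
    obtain L T h g k where d: "dist C L N T h g k" "L \<in> CB" "L \<in> wle C w 0" "T \<in> CB" "T \<in> wge C w 1"
      using CB_decomposition[of N] N unfolding full_trisub_simps by blast
    obtain T' where T': "T' \<in> wge0 w" "T = shO C 1 T'" using d(5) unfolding wge_def by blast
    have "T' \<in> CB" using CB_unshift T' d(4) wge0_Obj by blast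
    moreover have "L \<in> wle0 w" using d(3) wle0_Obj shO_0 by (auto simp: wle_def)
    ultimately show ?thesis using d(1,2,4) N T' unfolding R full_trisub_simps by blast
  qed
qed

lemma CB_heart_Obj: "Obj (heart E (restrict_weights w CB)) = KB"
proof -
  have "Obj (heart E (restrict_weights w CB)) = CB \<inter> Obj (heart C w)"
    by (auto simp: heart_def full_sub_def restrict_weights_def)
  then show ?thesis using CB_heart by simp
qed

lemma KB_equivalent_Kar: "equivalent_cats (full_sub C KB) (Kar (full_sub C B))"
proof (rule equivalent_Kar[OF B_Obj])
  show "KB \<subseteq> Obj C" using KB_heart heart_Obj_C by blast
  show "\<exists>S\<in>B. retract_of C X S" if "X \<in> KB" for X using that KB_iff by blast
  fix T p assume T: "T \<in> B" "ar p T T" "p \<cdot> p = p"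
  then have "T \<in> Obj (heart C w)" "p \<in> Hom (heart C w) T T" using B_heart by (auto simp: ar_def)
  then obtain Y r s where Y: "Y \<in> Obj (heart C w)" "r \<in> Hom C T Y" "s \<in> Hom C Y T" "r \<cdot> s = idm C Y" "s \<cdot> r = p"
    using karoubian_heart T(3) unfolding karoubian_def by (metis heart_simps(1,2,3))
  have rs: "ar r T Y" "ar s Y T" using Y(1-3) heart_Obj_C T(1) B_Obj by (auto simp: ar_def)
  then have "Y \<in> KB" using KB_iff T(1) Y(4) unfolding retract_of_ar by blast
  then show "\<exists>Y\<in>KB. \<exists>r s. ar r T Y \<and> ar s Y T \<and> r \<cdot> s = idm C Y \<and> s \<cdot> r = p" using rs Y(4,5) by blast
qed

end

theorem proposition3p3p1:
  fixes C :: "('o, 'a) tricat" and w :: "'o weights" and M :: 'o and m :: int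
  assumes "weight_structure C w"
    and "karoubian (heart C w)"
    and "M \<in> Obj C"
  shows
    "(\<forall>X\<in>Obj (Kcat (heart C w)).
        (\<forall>T. is_weight_complex C w M T \<longrightarrow>
          ((\<exists>L T'. truncation_choice C w m M L \<and> is_weight_complex C w L T' \<and>
              isomorphic (Kcat (heart C w)) T' X)
            \<longleftrightarrow> truncation_choice (Kcat (heart C w)) (w_st (heart C w)) m T X)) \<and>
        (\<forall>T T'. is_weight_complex C w M T \<and> is_weight_complex C w M T' \<longrightarrow>
          (truncation_choice (Kcat (heart C w)) (w_st (heart C w)) m T X
            \<longleftrightarrow> truncation_choice (Kcat (heart C w)) (w_st (heart C w)) m T' X)))
     \<and>
     (\<forall>N' h' P' X D e f g.
        gives_decomposition C w (m + 1) N' M h' \<and> is_tower C w N' P' \<and>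
        weight_decomposition (Kcat (heart C w)) (w_st (heart C w)) m X (tower_complex C P') D e f g
        \<longrightarrow>
        (\<exists>D' N PD PN u ule ugr v vle vgr n a b.
           is_tower C w D' PD \<and> N \<in> Obj C \<and> is_tower C w (shO C 1 N) PN \<and>
           is_tower_mor C N' P' D' PD u ule ugr \<and>
           is_tower_mor C D' PD (shO C 1 N) PN v vle vgr \<and>
           iso_arrow (Kcat (heart C w)) D (tower_complex C PD) a \<and>
           iso_arrow (Kcat (heart C w)) (shO (Kcat (heart C w)) 1 X) (tower_complex C PN) b \<and>
           a \<cdot>\<^bsub>Kcat (heart C w)\<^esub> f = tower_complex_mor C w P' PD ugr \<and>
           b \<cdot>\<^bsub>Kcat (heart C w)\<^esub> g = tower_complex_mor C w PD PN vgr \<cdot>\<^bsub>Kcat (heart C w)\<^esub> a \<and>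
           dist C N N' D' n u v \<and>
           gives_decomposition C w m N M (h' \<cdot>\<^bsub>C\<^esub> n)))
     \<and>
     (\<forall>B. B \<subseteq> Obj (heart C w) \<and> additive_category (full_sub (heart C w) B) \<longrightarrow>
        triangulated_category (full_trisub C (weight_complex_sub C w B)) \<and>
        weight_structure (full_trisub C (weight_complex_sub C w B))
          (restrict_weights w (weight_complex_sub C w B)) \<and>
        Obj (heart (full_trisub C (weight_complex_sub C w B))
              (restrict_weights w (weight_complex_sub C w B))) = Kar_in_obj C B \<and>
        equivalent_cats (full_sub C (Kar_in_obj C B)) (Kar (full_sub C B)))"
proof -
  interpret weight_structure C w by (rule assms(1))
  let ?K = "Kcat (heart C w)"
  have 1: "truncation_choice ?K (w_st (heart C w)) m T X"
    if A: "X \<in> Obj ?K" "is_weight_complex C w M T" "truncation_choice C w m M L" "is_weight_complex C w L T'"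
      "isomorphic ?K T' X" for X T L T'
  proof -
    have T: "isomorphic ?K T T" using weight_complex_unique[OF A(2,2)] .
    obtain h where "gives_decomposition C w m L M h" using A(3) unfolding truncation_choice_def by blast
    then show ?thesis using H.truncation_choice_iso[OF truncation_of_weight_complex[OF _ A(2,4)] A(5) T] by blast
  qed
  have 2: "truncation_choice ?K (w_st (heart C w)) m T' X"
    if "X \<in> Obj ?K" "is_weight_complex C w M T" "is_weight_complex C w M T'"
      "truncation_choice ?K (w_st (heart C w)) m T X" for X T T'
    using H.truncation_choice_iso[OF that(4) H.K.isomorphic_refl[OF that(1)] weight_complex_unique[OF that(2,3)]] .
  have 3: "triangulated_category (full_trisub C (weight_complex_sub C w B)) \<and>
        weight_structure (full_trisub C (weight_complex_sub C w B))
          (restrict_weights w (weight_complex_sub C w B)) \<and>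
        Obj (heart (full_trisub C (weight_complex_sub C w B))
              (restrict_weights w (weight_complex_sub C w B))) = Kar_in_obj C B \<and>
        equivalent_cats (full_sub C (Kar_in_obj C B)) (Kar (full_sub C B))"
    if "B \<subseteq> Obj (heart C w) \<and> additive_category (full_sub (heart C w) B)" for B
  proof -
    interpret karoubian_weight_structure C w B
      by (intro karoubian_weight_structure.intro karoubian_weight_structure_axioms.intro
          weight_structure_axioms assms(2)) (use that in blast)+
    show ?thesis using CB_triangulated CB_weight_structure CB_heart_Obj KB_equivalent_Kar by blast
  qed
  show ?thesis
  proof (intro conjI)
    show "\<forall>X\<in>Obj ?K.
        (\<forall>T. is_weight_complex C w M T \<longrightarrow>
          ((\<exists>L T'. truncation_choice C w m M L \<and> is_weight_complex C w L T' \<and> isomorphic ?K T' X)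
            \<longleftrightarrow> truncation_choice ?K (w_st (heart C w)) m T X)) \<and>
        (\<forall>T T'. is_weight_complex C w M T \<and> is_weight_complex C w M T' \<longrightarrow>
          (truncation_choice ?K (w_st (heart C w)) m T X \<longleftrightarrow> truncation_choice ?K (w_st (heart C w)) m T' X))"
      using 1 2 realize_weight_complex_truncation[OF assms(2)] by blast
  qed ((intro allI impI, elim conjE, rule realize_decomposition[OF assms(2)], assumption+),
      (intro allI impI, elim 3))
qed

end
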